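(* Let $f(t)\in\mathbb{Z}[t]$ be a polynomial whose distinct irreducible factors over $\mathbb{Z}[t]$ of positive degree are $g$ in number and have degrees $d_1,\ldots,d_g\geq 1$, and put $d=d_1+\cdots+d_g$. Assume $d\geq 2$. For $u\geq1$ put $$\gamma_f(u)=\frac12+\frac{2g+1}{16du}+\sqrt{\frac{2g+1}{16du}+\left(\frac{2g+1}{16du}\right)^2}.$$ Then there exist constants $C>0$ and $x_0>e$, depending only on $f$, such that for all $x\geq x_0$ and all real $u$ with $1\leq u\leq \sqrt{\log x}\,(\log\log x)^{-1}$, $$\Psi_f(x,x^{1/u})<\gamma_f(u)\,\frac{g^{[u]}}{d(d-1)^{[u]-1}u^{[u]}}\left(x+C\frac{x}{\log\log x}\right).$$
   Context: For an integer $m$, $P^+(m)$ denotes the largest prime factor of $m$, with the conventions $P^+(\pm1)=1$ and $P^+(0)=+\infty$. For $f\in\mathbb{Z}[t]$ and $x,y\geq1$, $\Psi_f(x,y)$ denotes the number of integers $n\in[1,x]$ with $P^+(f(n))\leq y$. $[u]$ denotes the largest integer not exceeding $u$. *)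

theory Defs
  imports Complex_Main "HOL-Library.Extended_Real" "HOL-Computational_Algebra.Computational_Algebra"
begin

text \<open>The value at \<open>0\<close> is \<open>\<infinity>\<close>, hence the extended reals as codomain.\<close>

definition P_plus :: "int \<Rightarrow> ereal" where
  "P_plus m =
     (if m = 0 then \<infinity>
      else if \<bar>m\<bar> = 1 then 1
      else ereal (real_of_int (Max (prime_factors m))))"

definition Psi :: "int poly \<Rightarrow> real \<Rightarrow> real \<Rightarrow> nat" where
  "Psi f x y = card {n :: int. 1 \<le> n \<and> real_of_int n \<le> x \<and> P_plus (poly f n) \<le> ereal y}"

text \<open>Irreducible factors that differ only by sign count once: \<open>normalize p = p\<close>
  selects the associate with positive leading coefficient. For \<open>f = 0\<close> the set is
  infinite, so that \<open>num_factors\<close> and \<open>total_degree\<close> are \<open>0\<close>; an assumption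
  \<open>total_degree f \<ge> 2\<close> thus excludes \<open>f = 0\<close>.\<close>

definition irred_factors :: "int poly \<Rightarrow> int poly set" where
  "irred_factors f = {p. irreducible p \<and> p dvd f \<and> degree p > 0 \<and> normalize p = p}"

definition num_factors :: "int poly \<Rightarrow> nat" where
  "num_factors f = card (irred_factors f)"

definition total_degree :: "int poly \<Rightarrow> nat" where
  "total_degree f = (\<Sum>p\<in>irred_factors f. degree p)"

definition gamma_f :: "int poly \<Rightarrow> real \<Rightarrow> real" where
  "gamma_f f u =
     (let a = (2 * real (num_factors f) + 1) / (16 * real (total_degree f) * u)
      in 1 / 2 + a + sqrt (a + a\<^sup>2))"

end

theory Submission
  imports Defs "Jordan_Normal_Form.Char_Poly" "HOL-Real_Asymp.Real_Asymp" "HOL-Number_Theory.Cong"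
begin

text \<open>
  Let \<open>h\<close> be the product of the distinct irreducible factors of \<open>f\<close>, \<open>y = x powr (1 / u)\<close>, \<open>Y = ln y\<close>
  and \<open>k = \<lfloor>u\<rfloor>\<close>. Apart from negligible exceptions, an \<open>n\<close> counted by \<open>\<Psi>\<close> has \<open>ln \<bar>h n\<bar>\<close> close to
  \<open>d * u * Y\<close>, and \<open>h n\<close> is built from prime powers of size at most \<open>y\<close>. Weight every such \<open>n\<close> by the sum \<open>W n\<close> of
  \<open>\<Prod> ln p\<^sub>i\<close> over the \<open>(k - 1)\<close>-tuples of prime powers of distinct primes that divide \<open>h n\<close>; choosing
  the powers one after the other gives \<open>W n \<ge> \<Prod>i<k-1. (d * u - i) * Y\<close>. Let \<open>V\<close> be the sum of the
  weights. A \<open>k\<close>-th prime power contributes at least \<open>(d * u - k + 1) * Y\<close> to each tuple. Its part above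
  \<open>sqrt y\<close> is counted directly, and its part below \<open>sqrt y\<close> is bounded by the Cauchy-Schwarz inequality, because
  two prime powers below \<open>sqrt y\<close> are still few enough to be counted. This is a quadratic inequality
  for \<open>V\<close> whose larger root yields \<open>\<gamma>\<close>.

  The counts need the number of roots \<open>\<rho> p\<close> of an irreducible polynomial modulo \<open>p\<close> on average:
  \<open>\<Sum>p\<le>y. \<rho> p * ln p / p\<close> is \<open>ln y\<close> up to an error of smaller order. For a monic irreducible \<open>F\<close> this follows
  without algebraic number theory by counting the integer polynomials \<open>A\<close> of degree below \<open>degree F\<close> with
  coefficients in a box that lie in an ideal of \<open>\<int>[t] / (F)\<close>. The upper bound double counts the pairs
  with \<open>p\<close> dividing \<open>A r\<close> at a root \<open>r\<close> of \<open>F\<close> modulo \<open>p\<close>. The lower bound factors the norm of \<open>A\<close>: for all but few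
  \<open>A\<close> its large prime factors are simple and come from such roots.
\<close>

hide_const (open) Module.smult

section \<open>Chebyshev's upper bound and Bezout identities\<close>

text \<open>Origin of the constant: put \<open>M = x * (g * Y) ^ k\<close>. The prime powers in
  \<open>(sqrt y, y]\<close> carry half of the mass \<open>g * Y\<close> and give
  \<open>M / 2\<close>. Those below \<open>sqrt y\<close> have second moment
  \<open>(g * Y / 2)\<^sup>2\<close> from different primes plus \<open>g * Y\<^sup>2 / 8\<close>
  from equal ones, together \<open>g * Y\<^sup>2 * (2 * g + 1) / 8\<close>. In units of
  \<open>M\<close> this reads \<open>t \<le> 1 / 2 + sqrt (2 * a * t)\<close> with \<open>a\<close>
  about \<open>(2 * g + 1) / (16 * d * u)\<close>. Both the half mass and the part from equal primes
  are differences of Mertens sums, and this is where the lower Mertens estimate is required. Range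
  of \<open>u\<close>: the base of \<open>(g * Y) ^ k\<close> needs a relative error well below
  \<open>1 / k\<close>, which the error \<open>ln (ln y)\<close> of the upper estimate provides; the
  larger error \<open>ln y / ln (ln y)\<close> of the lower one enters only once. Moreover the
  exceptional \<open>n\<close> have to be rarer than the main term, which may be nearly as small as
  \<open>x * exp (- sqrt (ln x))\<close>. Every residue class costs a rounding error of 1, which is
  affordable because \<open>y ^ k \<le> x\<close>; this fixes the number of prime powers.\<close>

definition primes_upto :: "real \<Rightarrow> nat set" where
  "primes_upto y = {p. prime p \<and> real p \<le> y}"

lemma finite_primes_upto [simp]: "finite (primes_upto y)"
proof -
  have "primes_upto y \<subseteq> {..nat \<lfloor>y\<rfloor>}"
    by (auto simp: primes_upto_def le_nat_iff le_floor_iff)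
  thus ?thesis by (rule finite_subset) auto
qed

lemma in_primes_upto: "p \<in> primes_upto y \<longleftrightarrow> prime p \<and> real p \<le> y"
  by (simp add: primes_upto_def)

definition theta :: "real \<Rightarrow> real" where
  "theta y = (\<Sum>p\<in>primes_upto y. ln (real p))"

lemma prod_coprime_dvd:
  fixes f :: "'b \<Rightarrow> 'a :: semiring_gcd"
  assumes "finite A" "\<And>a. a \<in> A \<Longrightarrow> f a dvd n"
    "\<And>a b. a \<in> A \<Longrightarrow> b \<in> A \<Longrightarrow> a \<noteq> b \<Longrightarrow> coprime (f a) (f b)"
  shows "prod f A dvd n"
  using assms
proof (induction A rule: finite_induct)
  case (insert a A)
  have "coprime (f a) (prod f A)" by (rule prod_coprime_right) (use insert in auto)
  thus ?case using insert by (simp add: divides_mult)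
qed simp

text \<open>Such a prime divides \<open>fact (2 * n)\<close> but neither of the two factors
  \<open>fact n\<close> in the denominator.\<close>

lemma primes_between_prod_dvd:
  "(\<Prod>p | prime p \<and> n < p \<and> p \<le> 2 * n. p) dvd ((2 * n) choose n)"
proof (rule prod_coprime_dvd)
  show "finite {p. prime p \<and> n < p \<and> p \<le> 2 * n}" by (rule finite_subset[of _ "{..2*n}"]) auto
next
  fix p assume "p \<in> {p. prime p \<and> n < p \<and> p \<le> 2 * n}"
  hence p: "prime p" "n < p" "p \<le> 2 * n" by auto
  have "p dvd fact (2 * n)" using p by (simp add: prime_dvd_fact_iff)
  also have "fact (2 * n) = fact n * fact n * ((2 * n) choose n)"
    using binomial_fact_lemma[of n "2 * n"] by simp
  finally show "p dvd ((2 * n) choose n)"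
    using p by (auto simp: prime_dvd_mult_iff prime_dvd_fact_iff)
next
  fix p q assume "p \<in> {p. prime p \<and> n < p \<and> p \<le> 2 * n}" "q \<in> {p. prime p \<and> n < p \<and> p \<le> 2 * n}" "p \<noteq> q"
  thus "coprime p q" by (auto intro: primes_coprime)
qed

lemma theta_double: "theta (2 * real n) \<le> theta (real n) + real n * ln 4"
proof (cases "n = 0")
  case False
  let ?B = "{p. prime p \<and> n < p \<and> p \<le> 2 * n}"
  have fin: "finite ?B" by (rule finite_subset[of _ "{..2*n}"]) auto
  have un: "primes_upto (2 * real n) = primes_upto (real n) \<union> ?B" "primes_upto (real n) \<inter> ?B = {}"
  proof -
    have "real p \<le> 2 * real n \<longleftrightarrow> p \<le> 2 * n" for p :: nat by linarith
    note iff = this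
    have "p \<in> primes_upto (2 * real n) \<longleftrightarrow> p \<in> primes_upto (real n) \<union> ?B" for p
      unfolding Un_iff in_primes_upto mem_Collect_eq iff of_nat_le_iff by linarith
    thus "primes_upto (2 * real n) = primes_upto (real n) \<union> ?B" by blast
    show "primes_upto (real n) \<inter> ?B = {}"
      by (auto simp: in_primes_upto)
  qed
  have "(\<Prod>p\<in>?B. p) \<le> ((2 * n) choose n)"
    by (rule dvd_imp_le[OF primes_between_prod_dvd]) simp
  also have "\<dots> \<le> 2 ^ (2 * n)" by (rule binomial_le_pow2)
  finally have "real (\<Prod>p\<in>?B. p) \<le> real (2 ^ (2 * n))" by (simp only: of_nat_le_iff)
  hence le: "(\<Prod>p\<in>?B. real p) \<le> 4 ^ n" by (simp add: power_mult)
  have pos: "(\<Prod>p\<in>?B. real p) > 0" by (rule prod_pos) (auto simp: prime_gt_0_nat)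
  have "(\<Sum>p\<in>?B. ln (real p)) = ln (\<Prod>p\<in>?B. real p)"
    by (rule ln_prod[symmetric]) (use fin in \<open>auto simp: prime_gt_0_nat\<close>)
  also have "\<dots> \<le> ln (4 ^ n)" using le pos by simp
  also have "\<dots> = real n * ln 4" by (simp add: ln_realpow)
  finally have "(\<Sum>p\<in>?B. ln (real p)) \<le> real n * ln 4" .
  thus ?thesis unfolding theta_def un(1) using un(2) fin by (subst sum.union_disjoint) auto
qed (simp add: theta_def)

lemma theta_mono: "y \<le> z \<Longrightarrow> theta y \<le> theta z"
  unfolding theta_def
  by (rule sum_mono2[OF finite_primes_upto]) (auto simp: in_primes_upto prime_gt_0_nat Suc_leI)

lemma theta_pow2: "theta (2 ^ m) \<le> 2 ^ m * ln 4"
proof (induction m)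
  case 0
  have "primes_upto 1 = {}" by (fastforce simp: in_primes_upto dest: prime_gt_1_nat)
  thus ?case by (simp add: theta_def)
next
  case (Suc m)
  thus ?case using theta_double[of "2 ^ m"] by simp
qed

text \<open>Rounding \<open>y\<close> up to a power of two costs a factor 2, and
  \<open>ln 4 = 2 * ln 2\<close> is rounded up to 2; hence the constant 4.\<close>

lemma theta_le: assumes "y \<ge> 0" shows "theta y \<le> 4 * y"
proof (cases "y < 1")
  case True
  have "primes_upto y = {}" using True by (fastforce simp: in_primes_upto dest: prime_gt_1_nat)
  thus ?thesis using assms by (simp add: theta_def)
next
  case False
  define m where "m = nat \<lfloor>log 2 y\<rfloor>"
  have l: "log 2 y \<ge> 0" using False by simp
  have "real m \<le> log 2 y" "log 2 y \<le> real (Suc m)" using l by (auto simp: m_def; linarith)+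
  hence "2 powr real m \<le> y" "y \<le> 2 powr real (Suc m)" using False by (auto simp: le_log_iff log_le_iff)
  hence m: "2 ^ m \<le> y" "y \<le> 2 ^ Suc m" by (simp_all only: powr_realpow)
  have "theta y \<le> theta (2 ^ Suc m)" using m by (intro theta_mono) auto
  also have "\<dots> \<le> 2 ^ Suc m * ln 4" by (rule theta_pow2)
  also have "ln (4::real) = 2 * ln 2" using ln_realpow[of 2 2] by simp
  also have "2 ^ Suc m * (2 * ln 2) \<le> 2 ^ Suc m * (2 * 1 :: real)"
    using ln_le_minus_one[of "2::real"] by (intro mult_left_mono) auto
  also have "\<dots> \<le> 4 * y" using m by simp
  finally show ?thesis .
qed

text \<open>Each doubling costs at most \<open>theta (2 * t) / t \<le> 8\<close>. In the lower
  Mertens estimate this disposes of the primes between \<open>y\<close> and \<open>y\<close> times a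
  power of \<open>ln y\<close>, which contribute only of order \<open>ln (ln y)\<close>.\<close>

lemma sum_primes_dyadic:
  assumes "a > 0"
  shows "(\<Sum>p\<in>primes_upto (2 ^ m * a) - primes_upto a. ln (real p) / real p) \<le> 8 * real m"
proof (induction m)
  case (Suc m)
  let ?t = "2 ^ m * a"
  have t: "?t > 0" using assms by simp
  have "(\<Sum>p\<in>primes_upto (2 * ?t) - primes_upto ?t. ln (real p) / real p)
        \<le> (\<Sum>p\<in>primes_upto (2 * ?t) - primes_upto ?t. ln (real p) / ?t)"
    using t assms by (intro sum_mono divide_left_mono mult_pos_pos)
       (auto simp: in_primes_upto prime_gt_0_nat Suc_leI)
  also have "\<dots> \<le> (\<Sum>p\<in>primes_upto (2 * ?t). ln (real p) / ?t)"
    using t by (intro sum_mono2) (auto simp: in_primes_upto prime_gt_0_nat Suc_leI)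
  also have "\<dots> = theta (2 * ?t) / ?t" by (simp add: theta_def sum_divide_distrib)
  also have "\<dots> \<le> (4 * (2 * ?t)) / ?t" using t by (intro divide_right_mono theta_le) auto
  also have "\<dots> = 8" using assms by simp
  finally have 1: "(\<Sum>p\<in>primes_upto (2 * ?t) - primes_upto ?t. ln (real p) / real p) \<le> 8" .
  have "primes_upto (2 ^ Suc m * a) - primes_upto a \<subseteq>
     (primes_upto (2 * ?t) - primes_upto ?t) \<union> (primes_upto ?t - primes_upto a)" by (auto simp: mult.assoc)
  hence "(\<Sum>p\<in>primes_upto (2 ^ Suc m * a) - primes_upto a. ln (real p) / real p) \<le>
    (\<Sum>p\<in>(primes_upto (2 * ?t) - primes_upto ?t) \<union> (primes_upto ?t - primes_upto a). ln (real p) / real p)"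
    by (intro sum_mono2) (auto simp: in_primes_upto prime_gt_0_nat Suc_leI)
  also have "\<dots> = (\<Sum>p\<in>primes_upto (2 * ?t) - primes_upto ?t. ln (real p) / real p) +
     (\<Sum>p\<in>primes_upto ?t - primes_upto a. ln (real p) / real p)"
    by (rule sum.union_disjoint) auto
  also have "\<dots> \<le> 8 * real (Suc m)" using 1 Suc by simp
  finally show ?case .
qed simp

section \<open>Bezout identities in Z[t]\<close>

lemma primitive_dvd_smultD:
  fixes p q :: "int poly"
  assumes "content p = 1" "a \<noteq> 0" "p dvd smult a q"
  shows "p dvd q"
proof -
  obtain k where k: "smult a q = p * k" using assms(3) by (auto elim: dvdE)
  have "content (smult a q) = content k" using assms(1) by (simp add: k content_mult)
  hence "content k = normalize a * content q" by simp
  hence "a dvd content k" by (metis dvd_mult2 dvd_normalize_iff dvd_refl)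
  hence "[:a:] dvd k" by (simp add: const_poly_dvd_iff_dvd_content)
  then obtain k' where "k = smult a k'" by (auto elim!: dvdE)
  hence "smult a q = smult a (p * k')" using k by simp
  hence "q = p * k'" using assms(2) by (metis smult_cancel)
  thus ?thesis by simp
qed

text \<open>In Z[t] the gcd itself need not be a combination of \<open>A\<close> and
  \<open>B\<close>, so only some nonzero constant is claimed. A nonzero \<open>h\<close> of least
  degree in the ideal leaves no remainder in pseudo-division; by Gauss's lemma the scalar introduced
  there can be cancelled, so \<open>primitive_part h\<close> divides both polynomials. Hence
  \<open>h\<close> is constant.\<close>

lemma int_poly_bezout:
  fixes A B :: "int poly"
  assumes "A \<noteq> 0" "degree (gcd A B) = 0"
  shows "\<exists>U V m. m \<noteq> 0 \<and> A * U + B * V = [:m:]"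
proof -
  define I where "I = {A * U + B * V | U V. True}"
  have I_diff: "x - y \<in> I" if "x \<in> I" "y \<in> I" for x y
  proof -
    from that obtain U V U' V' where "x = A * U + B * V" "y = A * U' + B * V'" by (auto simp: I_def)
    hence "x - y = A * (U - U') + B * (V - V')" by (simp add: algebra_simps)
    thus ?thesis by (auto simp: I_def)
  qed
  have I_mult: "x * q \<in> I" if "x \<in> I" for x q
  proof -
    from that obtain U V where "x = A * U + B * V" by (auto simp: I_def)
    hence "x * q = A * (U * q) + B * (V * q)" by (simp add: algebra_simps)
    thus ?thesis by (auto simp: I_def)
  qed
  have AI: "A \<in> I" "B \<in> I"
  proof -
    have "A = A * 1 + B * 0" "B = A * 0 + B * 1" by simp_all
    thus "A \<in> I" "B \<in> I" unfolding I_def by blast+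
  qed
  define P where "P h \<longleftrightarrow> h \<in> I \<and> h \<noteq> 0" for h
  have "P A" using AI assms by (auto simp: P_def)
  from ex_has_least_nat[of P A degree, OF this]
  obtain h where h: "P h" and least: "\<And>h'. P h' \<Longrightarrow> degree h \<le> degree h'" by blast
  have dvd: "primitive_part h dvd c" if "c \<in> I" for c
  proof -
    obtain a q where aq: "a \<noteq> 0" "smult a c = h * q + pseudo_mod c h"
      "pseudo_mod c h = 0 \<or> degree (pseudo_mod c h) < degree h"
      using pseudo_mod[of h c] h by (auto simp: P_def)
    have "pseudo_mod c h = c * [:a:] - h * q" using aq(2) by simp
    also have "\<dots> \<in> I" using that h by (intro I_diff I_mult) (auto simp: P_def)
    finally have "pseudo_mod c h = 0" using aq(3) least[of "pseudo_mod c h"] by (fastforce simp: P_def)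
    hence "h dvd smult a c" using aq by simp
    moreover have "primitive_part h dvd h" by (metis content_times_primitive_part dvd_refl dvd_smult)
    ultimately have "primitive_part h dvd smult a c" by (rule dvd_trans[rotated])
    moreover have "content (primitive_part h) = 1" using h by (intro content_primitive_part) (simp add: P_def)
    ultimately show ?thesis using aq(1) primitive_dvd_smultD by blast
  qed
  have "primitive_part h dvd gcd A B" by (intro gcd_greatest dvd AI)
  moreover have "gcd A B \<noteq> 0" using assms by simp
  ultimately have "degree (primitive_part h) \<le> degree (gcd A B)" by (intro dvd_imp_degree_le)
  hence "degree h = 0" using assms by simp
  then obtain m where "h = [:m:]" by (rule degree_eq_zeroE)
  moreover from h obtain U V where "h = A * U + B * V" "h \<noteq> 0" by (auto simp: I_def P_def)
  ultimately show ?thesis by (metis pCons_0_0)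
qed

section \<open>Ideals of integer polynomials and boxes\<close>

text \<open>Ideals of \<open>\<int>[t] / (F)\<close> are represented by ideals of \<open>\<int>[t]\<close> that contain \<open>F\<close>, which avoids a quotient ring.\<close>

definition pideal :: "int poly set \<Rightarrow> bool" where
  "pideal I \<longleftrightarrow> 0 \<in> I \<and> (\<forall>a\<in>I. \<forall>b\<in>I. a + b \<in> I) \<and> (\<forall>a\<in>I. \<forall>q. q * a \<in> I)"

lemma pidealD:
  assumes "pideal I"
  shows "0 \<in> I" "a \<in> I \<Longrightarrow> b \<in> I \<Longrightarrow> a + b \<in> I" "a \<in> I \<Longrightarrow> q * a \<in> I" "a \<in> I \<Longrightarrow> a * q \<in> I"
    "a \<in> I \<Longrightarrow> b \<in> I \<Longrightarrow> a - b \<in> I" "a - b \<in> I \<Longrightarrow> b - a \<in> I" "a - b \<in> I \<Longrightarrow> b - c \<in> I \<Longrightarrow> a - c \<in> I"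
proof -
  show 0: "0 \<in> I" and add: "\<And>a b. a \<in> I \<Longrightarrow> b \<in> I \<Longrightarrow> a + b \<in> I" and mul: "\<And>a q. a \<in> I \<Longrightarrow> q * a \<in> I"
    using assms by (auto simp: pideal_def)
  show "a \<in> I \<Longrightarrow> a * q \<in> I" using mul[of a q] by (simp add: mult.commute)
  show diff: "a \<in> I \<Longrightarrow> b \<in> I \<Longrightarrow> a - b \<in> I" for a b using add[of a "(-1) * b"] mul[of b "-1"] by simp
  show "a - b \<in> I \<Longrightarrow> b - a \<in> I" using mul[of "a - b" "-1"] by simp
  show "a - b \<in> I \<Longrightarrow> b - c \<in> I \<Longrightarrow> a - c \<in> I" using add[of "a - b" "b - c"] by simp
qed

lemma degree_less_iff_coeff: "d > 0 \<Longrightarrow> degree T < d \<longleftrightarrow> (\<forall>i\<ge>d. coeff T i = 0)"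
proof safe
  assume "d > 0" "\<forall>i\<ge>d. coeff T i = 0"
  thus "degree T < d"
    by (metis leading_coeff_0_iff not_less degree_0)
qed (simp add: coeff_eq_0)

text \<open>Irreducibility of \<open>F\<close> enters only through the identity \<open>bez\<close>.\<close>

locale monic_irr =
  fixes F :: "int poly" and d :: nat
  assumes monic: "coeff F d = 1" and deg: "degree F = d" and d_pos: "d > 0"
    and bez: "\<And>A. A \<noteq> 0 \<Longrightarrow> degree A < d \<Longrightarrow> \<exists>U V m. m \<noteq> 0 \<and> A * U + F * V = [:m:]"
begin

section \<open>Remainders modulo \<open>F\<close> and the size of their coefficients\<close>

definition Fb :: int where "Fb = (\<Sum>i\<le>d. \<bar>coeff F i\<bar>)"

lemma Fb: "\<bar>coeff F i\<bar> \<le> Fb"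
proof (cases "i \<le> d")
  case True
  thus ?thesis unfolding Fb_def by (intro member_le_sum) auto
next
  case False
  thus ?thesis unfolding Fb_def by (simp add: coeff_eq_0 deg sum_nonneg)
qed

lemma Fb_pos: "Fb \<ge> 1" using Fb[of d] monic by simp

text \<open>One Horner step: multiplying by \<open>t\<close> raises the degree to at most
  \<open>d\<close>, and as \<open>F\<close> is monic a multiple of it removes the top coefficient
  without division, at the price of a factor \<open>1 + Fb\<close>.\<close>

lemma red_step:
  assumes "degree T < d" "\<And>i. \<bar>coeff T i\<bar> \<le> K"
  shows "\<exists>T'. degree T' < d \<and> (\<forall>i. \<bar>coeff T' i\<bar> \<le> \<bar>b\<bar> + (1 + Fb) * K) \<and> F dvd (pCons b T - T')"
proof (intro exI conjI allI)
  let ?T = "pCons b T - smult (coeff T (d - 1)) F"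
  have z: "coeff T i = 0" if "i \<ge> d" for i using assms(1) that by (simp add: coeff_eq_0)
  have "coeff ?T i = 0" if "i \<ge> d" for i
  proof (cases "i = d")
    case True
    thus ?thesis using d_pos monic by (cases d) auto
  next
    case False
    hence "i > d" using that by simp
    thus ?thesis using z[of "i - 1"] deg by (cases i) (auto simp: coeff_eq_0)
  qed
  thus "degree ?T < d" using d_pos by (simp add: degree_less_iff_coeff)
  fix i
  have K: "K \<ge> 0" using assms(2)[of 0] by linarith
  have "\<bar>coeff (pCons b T) i\<bar> \<le> \<bar>b\<bar> + K" using assms(2) K by (cases i) (auto intro: order_trans add_increasing)
  moreover have "\<bar>coeff T (d - 1) * coeff F i\<bar> \<le> K * Fb"
    unfolding abs_mult using assms(2) Fb K by (intro mult_mono) auto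
  ultimately show "\<bar>coeff ?T i\<bar> \<le> \<bar>b\<bar> + (1 + Fb) * K" by (simp add: algebra_simps)
next
  show "F dvd pCons b T - (pCons b T - smult (coeff T (d - 1)) F)" by (simp add: dvd_smult)
qed

lemma red_exists: "\<exists>T. degree T < d \<and> F dvd (B - T)"
proof (induction B rule: pCons_induct)
  case 0
  show ?case using d_pos by (intro exI[of _ 0]) auto
next
  case (pCons b B)
  then obtain T where T: "degree T < d" "F dvd (B - T)" by auto
  define K where "K = (\<Sum>i\<le>degree T. \<bar>coeff T i\<bar>)"
  have "\<bar>coeff T i\<bar> \<le> K" for i
  proof (cases "i \<le> degree T")
    case True
    thus ?thesis unfolding K_def by (intro member_le_sum) auto
  next
    case False
    thus ?thesis by (simp add: coeff_eq_0 K_def sum_nonneg)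
  qed
  from red_step[OF T(1) this, of b] obtain T' where T': "degree T' < d" "F dvd (pCons b T - T')" by auto
  have "F dvd [:0, 1:] * (B - T)" using T(2) by (rule dvd_mult)
  hence "F dvd ([:0, 1:] * (B - T)) + (pCons b T - T')" using T'(2) by (rule dvd_add)
  moreover have e: "pCons 0 (B - T) + pCons b T = pCons b B" by simp
  have "[:0, 1:] * (B - T) + (pCons b T - T') = pCons b B - T'" unfolding e[symmetric] by simp
  ultimately have "F dvd pCons b B - T'" by (simp only:)
  thus ?case using T' by auto
qed

lemma red_unique: assumes "degree T < d" "degree T' < d" "F dvd (T - T')" shows "T = T'"
proof (rule ccontr)
  assume "T \<noteq> T'"
  hence "degree F \<le> degree (T - T')" using assms(3) by (intro dvd_imp_degree_le) auto
  moreover have "degree (T - T') < d" using assms by (simp add: degree_diff_less)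
  ultimately show False using deg by simp
qed

text \<open>The remainder modulo the monic \<open>F\<close>, used as the canonical representative of
  a class of Z[t] / (F).\<close>

definition red :: "int poly \<Rightarrow> int poly" where "red B = (SOME T. degree T < d \<and> F dvd (B - T))"

lemma red: "degree (red B) < d" "F dvd (B - red B)"
  using someI_ex[OF red_exists[of B]] unfolding red_def by auto

lemma red_eqI: "degree T < d \<Longrightarrow> F dvd (B - T) \<Longrightarrow> red B = T"
proof (rule red_unique[OF red(1)])
  assume "F dvd B - T"
  hence "F dvd (B - T) - (B - red B)" using red(2) by (rule dvd_diff)
  thus "F dvd red B - T" by simp
qed

lemma red_id: "degree T < d \<Longrightarrow> red T = T" by (rule red_eqI) auto

lemma red_cong: "F dvd (A - B) \<Longrightarrow> red A = red B"
proof (rule red_eqI[OF red(1)])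
  assume "F dvd A - B"
  hence "F dvd (A - B) + (B - red B)" using red(2) by (rule dvd_add)
  thus "F dvd A - red B" by simp
qed

lemma red_add: "red (A + B) = red A + red B"
proof (rule red_eqI)
  show "degree (red A + red B) < d" using red(1) by (simp add: degree_add_less)
  have "F dvd (A - red A) + (B - red B)" using red(2) by (intro dvd_add)
  thus "F dvd A + B - (red A + red B)" by (simp add: algebra_simps)
qed

lemma red_smult: "red (smult c A) = smult c (red A)"
proof (rule red_eqI)
  show "degree (smult c (red A)) < d" using red(1)[of A] by (meson degree_smult_le le_less_trans)
  have "F dvd smult c (A - red A)" using red(2) by (rule dvd_smult)
  thus "F dvd smult c A - smult c (red A)" by (simp add: smult_diff_right)
qed

lemma red_mult_right: "red (A * red B) = red (A * B)"
proof (rule red_cong[symmetric])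
  have "F dvd A * (B - red B)" using red(2) by (rule dvd_mult)
  thus "F dvd A * B - A * red B" by (simp add: algebra_simps)
qed

text \<open>Horner's scheme on the coefficients of \<open>A\<close>. The length \<open>n\<close>
  bounds the support instead of the degree, so that the induction can start from
  \<open>A = 0\<close>.\<close>

lemma red_mult_bound:
  assumes "degree R < d" "\<And>i. \<bar>coeff R i\<bar> \<le> K" "\<And>i. \<bar>coeff A i\<bar> \<le> H" "\<And>i. i \<ge> n \<Longrightarrow> coeff A i = 0"
  shows "\<bar>coeff (red (A * R)) i\<bar> \<le> int n * (1 + Fb) ^ n * H * K"
  using assms(3,4)
proof (induction n arbitrary: A i)
  case 0
  hence "A = 0" by (simp add: poly_eq_iff)
  thus ?case using red_id[of 0] d_pos by simp
next
  case (Suc n)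
  have K: "K \<ge> 0" using assms(2)[of 0] by linarith
  have H: "H \<ge> 0" using Suc.prems(1)[of 0] by linarith
  obtain a A' where A: "A = pCons a A'" by (cases A)
  have A': "\<bar>coeff A' i\<bar> \<le> H" "i \<ge> n \<Longrightarrow> coeff A' i = 0" for i
    using Suc.prems(1)[of "Suc i"] Suc.prems(2)[of "Suc i"] by (auto simp: A)
  let ?B = "int n * (1 + Fb) ^ n * H * K"
  have IH: "\<bar>coeff (red (A' * R)) i\<bar> \<le> ?B" for i by (rule Suc.IH) (use A' in auto)
  from red_step[OF red(1) IH, of 0] obtain T' where
    T': "degree T' < d" "\<And>i. \<bar>coeff T' i\<bar> \<le> (1 + Fb) * ?B" "F dvd pCons 0 (red (A' * R)) - T'" by auto
  have "red (A * R) = red (smult a R) + red (pCons 0 (A' * R))" by (simp add: A red_add)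
  also have "red (smult a R) = smult a R" using assms(1) by (simp add: red_smult red_id)
  also have "red (pCons 0 (A' * R)) = red ([:0,1:] * (A' * R))" by simp
  also have "\<dots> = red ([:0,1:] * red (A' * R))" by (rule red_mult_right[symmetric])
  also have "\<dots> = T'" by (rule red_eqI) (use T' in auto)
  finally have eq: "coeff (red (A * R)) i = a * coeff R i + coeff T' i" by simp
  have "\<bar>a\<bar> \<le> H" using Suc.prems(1)[of 0] by (simp add: A)
  hence "\<bar>a * coeff R i\<bar> \<le> H * K" unfolding abs_mult using assms(2) H by (intro mult_mono) auto
  also have "\<dots> \<le> (1 + Fb) ^ Suc n * (H * K)"
  proof -
    have "1 \<le> (1 + Fb) ^ Suc n" using Fb_pos by (intro one_le_power) auto
    thus ?thesis using H K mult_right_mono[of 1 "(1 + Fb) ^ Suc n" "H * K"] by simp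
  qed
  finally have "\<bar>coeff (red (A * R)) i\<bar> \<le> (1 + Fb) ^ Suc n * (H * K) + (1 + Fb) * ?B"
    unfolding eq using T'(2)[of i] by linarith
  also have "\<dots> = int (Suc n) * (1 + Fb) ^ Suc n * H * K" by (simp add: algebra_simps)
  finally show ?case .
qed

definition box :: "int \<Rightarrow> int poly set" where
  "box H = {A. degree A < d \<and> (\<forall>i. \<bar>coeff A i\<bar> \<le> H)}"

text \<open>The constant of \<open>red_mult_bound\<close> for polynomials with \<open>d\<close>
  coefficients.\<close>

definition C0 :: int where "C0 = int d * (1 + Fb) ^ d"

lemma C0_pos: "C0 \<ge> 1"
proof -
  have "1 \<le> (1 + Fb) ^ d" using Fb_pos by (intro one_le_power) auto
  thus ?thesis unfolding C0_def using d_pos mult_mono[of 1 "int d" 1 "(1 + Fb) ^ d"] by simp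
qed

text \<open>The substitute for dividing with small remainder: every class modulo \<open>(A, F)\<close> has a representative
  whose coefficients are bounded in terms of those of \<open>A\<close> alone.\<close>

lemma reduction:
  assumes A: "A \<in> box H" "A \<noteq> 0"
  shows "\<exists>B'\<in>box (C0 * H). \<exists>Q W. B - B' = A * Q + F * W"
proof -
  obtain U V m where m: "m \<noteq> 0" "A * U + F * V = [:m:]" using bez[of A] A by (auto simp: box_def)
  \<comment> \<open>Since \<open>A * U\<close> is \<open>m\<close> modulo \<open>F\<close>,
    \<open>m * B\<close> is congruent to \<open>A * C\<close>. Dividing the coefficients of
    \<open>C\<close> by \<open>m\<close> leaves \<open>m * B'\<close> congruent to
    \<open>A * R\<close> with \<open>R\<close> of size \<open>\<bar>m\<bar>\<close>. Cancelling
    \<open>m\<close> afterwards removes every dependence on \<open>m\<close>, over which there is no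
    control.\<close>
  define C where "C = red (B * U)"
  obtain W where W: "B * U - C = F * W" using red(2)[of "B * U"] by (auto simp: C_def elim: dvdE)
  define Q where "Q = map_poly (\<lambda>c. c div m) C"
  define R where "R = map_poly (\<lambda>c. c mod m) C"
  have C: "C = smult m Q + R" by (rule poly_eqI) (simp add: Q_def R_def coeff_map_poly)
  have dR: "degree R < d" using red(1)[of "B * U"] d_pos
    by (simp add: R_def C_def degree_less_iff_coeff coeff_map_poly)
  have Rb: "\<bar>coeff R i\<bar> \<le> \<bar>m\<bar>" for i using abs_mod_less[of m "coeff C i"] m by (simp add: R_def coeff_map_poly)
  define B' where "B' = red (B - A * Q)"
  have "smult m (B - A * Q) = [:m:] * B - A * smult m Q" by (simp add: smult_diff_right)
  also have "\<dots> = A * R + F * (A * W + V * B)"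
  proof -
    have e: "smult m Q = B * U - F * W - R" using C W by (simp add: algebra_simps)
    have "[:m:] * B - A * smult m Q = (A * U + F * V) * B - A * (B * U - F * W - R)"
      by (simp only: e m(2))
    thus ?thesis by (simp add: algebra_simps)
  qed
  finally have "F dvd smult m (B - A * Q) - A * R" by simp
  hence "red (smult m (B - A * Q)) = red (A * R)" by (rule red_cong)
  hence eq: "smult m B' = red (A * R)" by (simp add: red_smult B'_def)
  have "\<bar>coeff B' i\<bar> \<le> C0 * H" for i
  proof -
    have "\<bar>m\<bar> * \<bar>coeff B' i\<bar> = \<bar>coeff (red (A * R)) i\<bar>" using eq by (metis abs_mult coeff_smult)
    also have "\<dots> \<le> int d * (1 + Fb) ^ d * H * \<bar>m\<bar>"
      by (rule red_mult_bound) (use A dR Rb in \<open>auto simp: box_def coeff_eq_0\<close>)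
    finally have "\<bar>m\<bar> * \<bar>coeff B' i\<bar> \<le> \<bar>m\<bar> * (C0 * H)" by (simp add: C0_def mult_ac)
    thus ?thesis using m(1) by simp
  qed
  hence "B' \<in> box (C0 * H)" using red(1) by (simp add: box_def B'_def)
  moreover obtain W' where "B - A * Q - B' = F * W'" using red(2)[of "B - A * Q"] by (auto simp: B'_def elim: dvdE)
  hence "B - B' = A * Q + F * W'" by (simp add: algebra_simps)
  ultimately show ?thesis by blast
qed

section \<open>Counting the elements of an ideal in a box\<close>

lemma reduction_ideal:
  assumes "pideal I" "F \<in> I" "A \<in> I" "A \<in> box K" "A \<noteq> 0"
  shows "\<exists>B'\<in>box (C0 * K). B - B' \<in> I"
  using reduction[OF assms(4,5), of B] pidealD[OF assms(1)] assms(2,3) by metis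

text \<open>The condition on coefficients ranges over all \<open>i\<close>, and those from
  \<open>d\<close> on vanish; this is why \<open>0 \<in> X\<close> is required.\<close>

lemma card_coeff_in:
  assumes "finite X" "0 \<in> X"
  shows "finite {A. degree A < d \<and> (\<forall>i. coeff A i \<in> X)}" (is "finite ?S")
    and "card {A. degree A < d \<and> (\<forall>i. coeff A i \<in> X)} = card X ^ d"
proof -
  let ?L = "{xs. set xs \<subseteq> X \<and> length xs = d}"
  have "bij_betw Poly ?L ?S"
  proof (rule bij_betwI')
    fix xs ys assume xy: "xs \<in> ?L" "ys \<in> ?L"
    show "(Poly xs = Poly ys) = (xs = ys)"
    proof
      assume "Poly xs = Poly ys"
      hence "nth_default 0 xs i = nth_default 0 ys i" for i by (metis coeff_Poly_eq)
      note eq = this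
      show "xs = ys"
      proof (rule nth_equalityI)
        fix i assume "i < length xs"
        thus "xs ! i = ys ! i" using xy eq[of i] by (auto simp: nth_default_def)
      qed (use xy in auto)
    qed simp
  next
    fix xs assume xs: "xs \<in> ?L"
    have "\<forall>i\<ge>d. coeff (Poly xs) i = 0" using xs by (auto simp: nth_default_def)
    moreover have "coeff (Poly xs) i \<in> X" for i using xs assms(2) by (auto simp: nth_default_def)
    ultimately show "Poly xs \<in> ?S" using d_pos by (simp add: degree_less_iff_coeff)
  next
    fix A assume A: "A \<in> ?S"
    let ?xs = "map (coeff A) [0..<d]"
    have "A = Poly ?xs" using A by (intro poly_eqI) (auto simp: nth_default_def coeff_eq_0)
    moreover have "?xs \<in> ?L" using A by auto
    ultimately show "\<exists>xs\<in>?L. A = Poly xs" by blast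
  qed
  moreover have "finite ?L" "card ?L = card X ^ d" using assms by (auto simp: finite_lists_length_eq card_lists_length_eq)
  ultimately show "finite ?S" "card ?S = card X ^ d" by (auto simp: bij_betw_finite bij_betw_same_card)
qed

lemma card_box:
  assumes "H \<ge> 0"
  shows "finite (box H)" "card (box H) = nat (2 * H + 1) ^ d"
proof -
  have "\<bar>a\<bar> \<le> H \<longleftrightarrow> a \<in> {-H..H}" for a :: int by auto
  hence "box H = {A. degree A < d \<and> (\<forall>i. coeff A i \<in> {-H..H})}" by (simp only: box_def)
  thus "finite (box H)" "card (box H) = nat (2 * H + 1) ^ d"
    using card_coeff_in[of "{-H..H}"] assms by auto
qed

lemma box_add: "A \<in> box H \<Longrightarrow> B \<in> box K \<Longrightarrow> A + B \<in> box (H + K)"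
  unfolding box_def mem_Collect_eq coeff_add
  by (intro conjI allI degree_add_less order_trans[OF abs_triangle_ineq] add_mono) auto

lemma box_diff: "A \<in> box H \<Longrightarrow> B \<in> box K \<Longrightarrow> A - B \<in> box (H + K)"
  unfolding box_def mem_Collect_eq coeff_diff
  by (intro conjI allI degree_diff_less order_trans[OF abs_triangle_ineq4] add_mono) auto

text \<open>Adding to the elements of the ideal small representatives of the incongruent classes in
  \<open>S\<close> gives distinct polynomials in a slightly larger box. A nonzero
  \<open>A \<in> I\<close> of size \<open>K\<close> makes representatives of size
  \<open>C0 * K\<close> available.\<close>

lemma ideal_count_upper:
  assumes I: "pideal I" "F \<in> I" and A: "A \<in> I" "A \<in> box K" "A \<noteq> 0"
    and S: "finite S" "\<And>s s'. s \<in> S \<Longrightarrow> s' \<in> S \<Longrightarrow> s \<noteq> s' \<Longrightarrow> s - s' \<notin> I" and H: "H \<ge> 0"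
  shows "card (I \<inter> box H) * card S \<le> nat (2 * (H + C0 * K) + 1) ^ d"
proof -
  have K: "K \<ge> 0" using A(2) by (auto simp: box_def dest!: spec[of _ 0])
  hence K': "C0 * K \<ge> 0" using C0_pos by simp
  obtain r where r: "\<And>B. r B \<in> box (C0 * K)" "\<And>B. B - r B \<in> I"
    using reduction_ideal[OF I A] by metis
  let ?f = "\<lambda>(B, s). B + r s"
  have "inj_on ?f ((I \<inter> box H) \<times> S)"
  proof (rule inj_onI, clarify)
    fix B s B' s' assume *: "B \<in> I" "s \<in> S" "B' \<in> I" "s' \<in> S" "B + r s = B' + r s'"
    have e: "B' - B = r s - r s'" using *(5) by (simp add: algebra_simps)
    have "s - s' = (s - r s) - (s' - r s') + (B' - B)" unfolding e by simp
    also have "\<dots> \<in> I" by (intro pidealD(2,5)[OF I(1)] r(2) *)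
    finally have "s = s'" using S(2) * by blast
    thus "B = B' \<and> s = s'" using * by simp
  qed
  moreover have "?f ` ((I \<inter> box H) \<times> S) \<subseteq> box (H + C0 * K)" using r(1) box_add by auto
  ultimately have "card ((I \<inter> box H) \<times> S) \<le> card (box (H + C0 * K))"
    using card_box[of "H + C0 * K"] H K' by (intro card_inj_on_le) auto
  thus ?thesis using card_box[of "H + C0 * K"] H K' by (simp add: card_cartesian_product)
qed

text \<open>A polynomial in the box is determined by its class together with the ideal element that
  is left after subtracting the small representative of the class.\<close>

lemma ideal_count_lower:
  assumes I: "pideal I" "F \<in> I" and A: "A \<in> I" "A \<in> box K" "A \<noteq> 0"
    and S: "finite S" "\<And>B. \<exists>s\<in>S. B - s \<in> I" and H: "H \<ge> 0"
  shows "nat (2 * H + 1) ^ d \<le> card S * card (I \<inter> box (H + C0 * K))"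
proof -
  have K: "K \<ge> 0" using A(2) by (auto simp: box_def dest!: spec[of _ 0])
  hence K': "C0 * K \<ge> 0" using C0_pos by simp
  obtain r where r: "\<And>B. r B \<in> box (C0 * K)" "\<And>B. B - r B \<in> I"
    using reduction_ideal[OF I A] by metis
  obtain s where s: "\<And>B. s B \<in> S" "\<And>B. B - s B \<in> I" using S(2) by metis
  let ?f = "\<lambda>B. (s B, B - r (s B))"
  have "inj_on ?f (box H)" by (rule inj_onI) auto
  moreover have "?f ` box H \<subseteq> S \<times> (I \<inter> box (H + C0 * K))"
    using s(1) box_diff[OF _ r(1)] pidealD(7)[OF I(1) s(2) r(2)] by auto
  ultimately have "card (box H) \<le> card (S \<times> (I \<inter> box (H + C0 * K)))"
    using card_box[of "H + C0 * K"] H K' S(1) by (intro card_inj_on_le) auto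
  thus ?thesis using card_box[of H] H by (simp add: card_cartesian_product)
qed

text \<open>Pigeonhole principle: there are more polynomials with coefficients in
  \<open>{0..K}\<close> than classes, and the difference of two in one class has coefficients
  bounded by \<open>K\<close>.\<close>

lemma ideal_small_element:
  assumes I: "pideal I" and S: "finite S" "\<And>B. \<exists>s\<in>S. B - s \<in> I" and K: "card S < (K + 1) ^ d"
  shows "\<exists>A\<in>I. A \<in> box (int K) \<and> A \<noteq> 0"
proof -
  let ?P = "{A. degree A < d \<and> (\<forall>i. coeff A i \<in> {0..int K})}"
  have P: "finite ?P" "card ?P = (K + 1) ^ d" using card_coeff_in[of "{0..int K}"] by (auto simp: nat_add_distrib)
  obtain s where s: "\<And>B. s B \<in> S" "\<And>B. B - s B \<in> I" using S(2) by metis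
  have "\<not> inj_on s ?P"
  proof
    assume "inj_on s ?P"
    hence "card ?P \<le> card S" using s S(1) by (intro card_inj_on_le) auto
    thus False using P K by simp
  qed
  then obtain A B where AB: "A \<in> ?P" "B \<in> ?P" "s A = s B" "A \<noteq> B" by (auto simp: inj_on_def)
  have "A - B \<in> I" using s(2)[of A] s(2)[of B] pidealD[OF I] AB(3) by metis
  moreover have "\<bar>coeff (A - B) i\<bar> \<le> int K" for i
  proof -
    have "coeff A i \<in> {0..int K}" "coeff B i \<in> {0..int K}" using AB(1,2) by auto
    thus ?thesis by auto
  qed
  hence "A - B \<in> box (int K)" using AB(1,2) by (auto simp: box_def degree_diff_less)
  ultimately show ?thesis using AB(4) by (intro bexI[of _ "A - B"]) auto
qed

end

section \<open>The upper Mertens estimate\<close>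

definition roots_mod :: "int poly \<Rightarrow> nat \<Rightarrow> int set" where
  "roots_mod P m = {r. 0 \<le> r \<and> r < int m \<and> int m dvd poly P r}"

definition rho :: "int poly \<Rightarrow> nat \<Rightarrow> nat" where
  "rho P m = card (roots_mod P m)"

lemma roots_mod_subset: "roots_mod P m \<subseteq> {0..<int m}"
  by (auto simp: roots_mod_def)

lemma finite_roots_mod [simp]: "finite (roots_mod P m)"
  by (rule finite_subset[OF roots_mod_subset]) simp

lemma rho_le: "rho P m \<le> m"
  using card_mono[OF _ roots_mod_subset[of P m]] by (simp add: rho_def)

lemma poly_diff_dvd: "(a - b :: int) dvd poly P a - poly P b"
proof -
  have "poly P a = poly ([:-b, 1:] * synthetic_div P b + [:poly P b:]) a"
    by (subst synthetic_div_correct') simp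
  hence "poly P a - poly P b = (a - b) * poly (synthetic_div P b) a" by (simp add: algebra_simps)
  thus ?thesis by simp
qed

lemma poly_dvd_mod: "m dvd poly P (a mod m) \<longleftrightarrow> m dvd poly P (a :: int)"
proof -
  have "m dvd a mod m - a" by (simp add: mod_eq_dvd_iff[symmetric])
  hence "m dvd poly P (a mod m) - poly P a" using poly_diff_dvd dvd_trans by blast
  thus ?thesis by (metis diff_add_cancel dvd_add_right_iff dvd_add_left_iff)
qed

text \<open>Lagrange's argument, carried out over the integers with pairwise incongruent roots:
  splitting off a linear factor keeps the leading coefficient, which avoids passing to the residue
  field.\<close>

lemma card_incong_roots_le:
  fixes p :: int
  assumes "prime p" "finite X" "\<not> p dvd lead_coeff P" "\<And>r. r \<in> X \<Longrightarrow> p dvd poly P r"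
    "\<And>r s. r \<in> X \<Longrightarrow> s \<in> X \<Longrightarrow> r \<noteq> s \<Longrightarrow> \<not> p dvd r - s"
  shows "card X \<le> degree P"
  using assms(2-)
proof (induction "degree P" arbitrary: P X)
  case 0
  then obtain c where c: "P = [:c:]" by (metis degree_eq_zeroE)
  hence "X = {}" using 0 by auto
  thus ?case by simp
next
  case (Suc n)
  show ?case
  proof (cases "X = {}")
    case False
    then obtain r where r: "r \<in> X" by auto
    define Q where "Q = synthetic_div P r"
    have eq: "P = [:-r, 1:] * Q + [:poly P r:]" unfolding Q_def by (rule synthetic_div_correct'[symmetric])
    have dQ: "degree Q = n" using Suc.hyps(2) by (simp add: Q_def degree_synthetic_div)
    have "Q \<noteq> 0"
    proof
      assume "Q = 0"
      hence "degree P = 0" using eq by (metis add_0 degree_pCons_0 mult_zero_right)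
      thus False using Suc.hyps(2) by simp
    qed
    have "lead_coeff P = coeff ([:-r, 1:] * Q) (Suc n)"
      using Suc.hyps(2) by (subst eq) (simp flip: Suc.hyps(2))
    also have "\<dots> = lead_coeff Q" using dQ by (simp add: coeff_eq_0)
    finally have lc: "lead_coeff P = lead_coeff Q" .
    have "card (X - {r}) \<le> degree Q"
    proof (rule Suc.hyps(1))
      fix s assume s: "s \<in> X - {r}"
      have "poly P s = (s - r) * poly Q s + poly P r" by (subst eq) (simp add: algebra_simps)
      hence "p dvd (s - r) * poly Q s" using Suc.prems(3)[of s] Suc.prems(3)[OF r] s
        by (metis DiffD1 dvd_add_left_iff)
      thus "p dvd poly Q s" using Suc.prems(4)[of s r] s r assms(1) by (auto simp: prime_dvd_mult_iff)
    qed (use Suc.prems dQ lc in auto)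
    thus ?thesis using Suc.hyps(2) Suc.prems(1) r dQ by (simp add: card_Diff_singleton)
  qed simp
qed

lemma rho_prime_le:
  assumes "prime p" "\<not> int p dvd lead_coeff P"
  shows "rho P p \<le> degree P"
  unfolding rho_def
proof (rule card_incong_roots_le[of "int p"])
  fix r s assume *: "r \<in> roots_mod P p" "s \<in> roots_mod P p" "r \<noteq> s"
  show "\<not> int p dvd r - s"
  proof
    assume "int p dvd r - s"
    hence "r mod int p = s mod int p" by (simp add: mod_eq_dvd_iff)
    thus False using * by (simp add: roots_mod_def)
  qed
next
  show "int p dvd poly P r" if "r \<in> roots_mod P p" for r using that by (simp add: roots_mod_def)
qed (use assms in auto)

text \<open>The kernel of evaluation at \<open>r\<close> modulo \<open>m\<close>. For
  \<open>r \<in> roots_mod F p\<close> it is the maximal ideal generated by \<open>p\<close> and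
  \<open>t - r\<close>, and it contains \<open>F\<close>.\<close>

definition rideal :: "nat \<Rightarrow> int \<Rightarrow> int poly set" where
  "rideal m r = {A. int m dvd poly A r}"

lemma pideal_rideal: "pideal (rideal m r)"
  by (auto simp: pideal_def rideal_def)

lemma rideal_complete:
  assumes "m > 0"
  shows "\<exists>s\<in>(\<lambda>c. [:c:]) ` {0..<int m}. B - s \<in> rideal m r"
proof
  show "[:poly B r mod int m:] \<in> (\<lambda>c. [:c:]) ` {0..<int m}" using assms by auto
  show "B - [:poly B r mod int m:] \<in> rideal m r" by (simp add: rideal_def)
qed

lemma rideal_incong:
  assumes "s \<in> (\<lambda>c. [:c:]) ` {0..<int m}" "s' \<in> (\<lambda>c. [:c:]) ` {0..<int m}" "s \<noteq> s'"
  shows "s - s' \<notin> rideal m r"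
proof
  obtain a b where ab: "s = [:a:]" "s' = [:b:]" "0 \<le> a" "a < int m" "0 \<le> b" "b < int m" using assms by auto
  assume "s - s' \<in> rideal m r"
  hence "int m dvd a - b" using ab by (simp add: rideal_def)
  hence "a mod int m = b mod int m" by (simp add: mod_eq_dvd_iff)
  thus False using assms(3) ab by simp
qed

lemma card_consts: "card ((\<lambda>c::int. [:c:]) ` {0..<int m}) = m" "finite ((\<lambda>c::int. [:c:]) ` {0..<int m})"
  by (subst card_image) (auto simp: inj_on_def)

text \<open>Chinese remainder theorem for the ideals \<open>(p, t - r)\<close>. The polynomial
  \<open>E\<close> vanishes at all earlier pairs but not at the new one: a pair with the same prime
  contributes the factor \<open>t - s\<close>, a pair with another prime \<open>q\<close> the
  constant \<open>q\<close>.\<close>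

lemma interpolation_mod:
  fixes R :: "(nat \<times> int) set"
  assumes "finite R" "\<And>p r. (p, r) \<in> R \<Longrightarrow> prime p \<and> 0 \<le> r \<and> r < int p"
  shows "\<exists>B. \<forall>(p, r)\<in>R. int p dvd poly B r - \<phi> (p, r)"
  using assms
proof (induction R rule: finite_induct)
  case (insert x R)
  obtain p r where x: "x = (p, r)" by (cases x)
  obtain B where B: "\<forall>(p, r)\<in>R. int p dvd poly B r - \<phi> (p, r)" using insert by auto
  define E where "E = (\<Prod>(q, s)\<in>R. if q = p then [:-s, 1:] else [:int q:])"
  have p: "prime (int p)" "0 \<le> r" "r < int p" using insert.prems[of p r] x by auto
  have "\<not> int p dvd poly E r"
  proof
    assume "int p dvd poly E r"
    then obtain y where y: "y \<in> R" "int p dvd poly (case y of (q, s) \<Rightarrow> if q = p then [:-s, 1:] else [:int q:]) r"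
      using p(1) insert.hyps(1) by (auto simp: E_def poly_prod prime_dvd_prod_iff)
    obtain q s where qs: "y = (q, s)" by (cases y)
    have q: "prime q" "0 \<le> s" "s < int q" using insert.prems[of q s] y qs by auto
    show False
    proof (cases "q = p")
      case True
      hence "int p dvd r - s" using y qs by simp
      hence "r mod int p = s mod int p" by (simp add: mod_eq_dvd_iff)
      hence "r = s" using p q True by simp
      thus False using insert.hyps(2) y qs x True by simp
    next
      case False
      thus False using y qs q p primes_dvd_imp_eq[of p q] by auto
    qed
  qed
  hence "coprime (poly E r) (int p)" using p(1) by (metis prime_imp_coprime coprime_commute)
  then obtain c v where c: "c * poly E r + v * int p = 1"
    using bezout_int[of "poly E r" "int p"] by (auto simp: coprime_iff_gcd_eq_1)
  define t where "t = c * (\<phi> (p, r) - poly B r)"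
  have "poly E r * c - 1 = - v * int p" using c by (simp add: algebra_simps)
  moreover have "int p dvd - v * int p" by simp
  ultimately have "int p dvd poly E r * c - 1" by (simp only:)
  hence "int p dvd (poly E r * c - 1) * (\<phi> (p, r) - poly B r)" by (rule dvd_mult2)
  hence 1: "int p dvd poly (B + smult t E) r - \<phi> (p, r)" by (simp add: t_def algebra_simps)
  have 2: "int q dvd poly (B + smult t E) s - \<phi> (q, s)" if "(q, s) \<in> R" for q s
  proof -
    have "int q dvd poly (if q = p then [:-s, 1:] else [:int q:]) s" by simp
    also have "\<dots> dvd poly E s" unfolding E_def poly_prod
      using dvd_prodI[OF insert.hyps(1) that, of "\<lambda>x. poly (case x of (q, sa) \<Rightarrow> if q = p then [:-sa, 1:] else [:int q:]) s"] by simp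
    finally have "int q dvd t * poly E s" by (rule dvd_mult)
    moreover have "int q dvd poly B s - \<phi> (q, s)" using B that by auto
    ultimately have "int q dvd t * poly E s + (poly B s - \<phi> (q, s))" by (rule dvd_add)
    thus ?thesis by (simp add: algebra_simps)
  qed
  show ?case using 1 2 by (intro exI[of _ "B + smult t E"]) (auto simp: x)
qed auto

definition mertens :: "int poly \<Rightarrow> real \<Rightarrow> real" where
  "mertens P y = (\<Sum>p\<in>primes_upto y. real (rho P p) * ln (real p) / real p)"

lemma ln_prime_nonneg [simp]: "prime p \<Longrightarrow> ln (real p) \<ge> 0"
  by (simp add: prime_gt_0_nat Suc_leI)

lemma mertens_mono: "y \<le> z \<Longrightarrow> mertens P y \<le> mertens P z"
  unfolding mertens_def by (rule sum_mono2) (auto simp: in_primes_upto)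

lemma mertens_nonneg: "mertens P y \<ge> 0"
  unfolding mertens_def by (rule sum_nonneg) (auto simp: in_primes_upto)

context monic_irr
begin

lemma rho_le_d: "prime p \<Longrightarrow> rho F p \<le> d"
  using rho_prime_le[of p F] monic deg by (auto simp: prime_nat_iff)

text \<open>By interpolation every assignment of residues to the pairs in \<open>R\<close> is the
  vector of values of some polynomial. Replacing it by its small representative modulo
  \<open>(A, F)\<close> keeps these values, since \<open>A\<close> and \<open>F\<close> vanish at
  all pairs. So the box of size \<open>C0 * H\<close> has at least as many elements as there are
  assignments.\<close>

lemma common_roots_bound:
  assumes A: "A \<in> box H" "A \<noteq> 0" and H: "H \<ge> 0"
    and R: "finite R" "\<And>p r. (p, r) \<in> R \<Longrightarrow> prime p \<and> r \<in> roots_mod F p \<and> int p dvd poly A r"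
  shows "(\<Prod>(p, r)\<in>R. p) \<le> nat (2 * (C0 * H) + 1) ^ d"
proof -
  let ?X = "PiE R (\<lambda>(p, r). {0..<int p})"
  let ?f = "\<lambda>B. restrict (\<lambda>(p, r). poly B r mod int p) R"
  have CH: "C0 * H \<ge> 0" using C0_pos H by simp
  have "?X \<subseteq> ?f ` box (C0 * H)"
  proof
    fix \<phi> assume phi: "\<phi> \<in> ?X"
    have "\<exists>B. \<forall>(p, r)\<in>R. int p dvd poly B r - \<phi> (p, r)"
      by (rule interpolation_mod[OF R(1)]) (use R(2) in \<open>auto simp: roots_mod_def\<close>)
    then obtain B where B: "\<And>p r. (p, r) \<in> R \<Longrightarrow> int p dvd poly B r - \<phi> (p, r)" by auto
    obtain B' Q W where B': "B' \<in> box (C0 * H)" "B - B' = A * Q + F * W" using reduction[OF A, of B] by auto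
    have "poly B' r mod int p = \<phi> (p, r)" if pr: "(p, r) \<in> R" for p r
    proof -
      have "int p dvd poly (A * Q + F * W) r" using R(2)[OF pr] by (auto simp: roots_mod_def)
      hence "int p dvd poly B r - poly B' r" by (simp flip: B'(2))
      hence "int p dvd (poly B r - \<phi> (p, r)) - (poly B r - poly B' r)" using B[OF pr] by (metis dvd_diff)
      moreover have "(poly B r - \<phi> (p, r)) - (poly B r - poly B' r) = poly B' r - \<phi> (p, r)" by simp
      ultimately have "int p dvd poly B' r - \<phi> (p, r)" by (simp only:)
      hence "poly B' r mod int p = \<phi> (p, r) mod int p" by (simp add: mod_eq_dvd_iff)
      moreover have "\<phi> (p, r) \<in> {0..<int p}" using phi pr by (fastforce simp: PiE_def Pi_def)
      ultimately show ?thesis by simp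
    qed
    hence "?f B' = \<phi>" using phi by (intro ext) (auto simp: restrict_def PiE_def extensional_def)
    thus "\<phi> \<in> ?f ` box (C0 * H)" using B'(1) by blast
  qed
  hence "card ?X \<le> card (box (C0 * H))" using card_box(1)[OF CH] by (rule surj_card_le[rotated])
  also have "card ?X = (\<Prod>(p, r)\<in>R. p)" using R(1) by (subst card_PiE) (auto intro!: prod.cong)
  finally show ?thesis using card_box(2)[OF CH] by simp
qed

lemma common_roots_ln_bound:
  assumes A: "A \<in> box H" "A \<noteq> 0" and H: "H \<ge> 0"
    and R: "finite R" "\<And>p r. (p, r) \<in> R \<Longrightarrow> prime p \<and> r \<in> roots_mod F p \<and> int p dvd poly A r"
  shows "(\<Sum>(p, r)\<in>R. ln (real p)) \<le> real d * ln (real_of_int (2 * (C0 * H) + 1))"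
proof -
  have CH: "C0 * H \<ge> 0" using C0_pos H by simp
  have pos: "real p > 0" if "(p, r) \<in> R" for p r using R(2)[OF that] by (auto simp: prime_gt_0_nat)
  have "(\<Sum>(p, r)\<in>R. ln (real p)) = ln (\<Prod>(p, r)\<in>R. real p)"
    using R(1) pos by (subst ln_prod) (fastforce intro!: sum.cong)+
  also have "(\<Prod>(p, r)\<in>R. real p) = real (\<Prod>(p, r)\<in>R. p)" by (simp add: case_prod_beta)
  also have "ln \<dots> \<le> ln (real (nat (2 * (C0 * H) + 1) ^ d))"
  proof (rule ln_mono)
    show "0 < real (\<Prod>(p, r)\<in>R. p)" using pos by (auto intro!: prod_pos)
    show "real (\<Prod>(p, r)\<in>R. p) \<le> real (nat (2 * (C0 * H) + 1) ^ d)"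
      using common_roots_bound[OF A H R] by (simp only: of_nat_le_iff)
  qed
  also have "\<dots> = real d * ln (real_of_int (2 * (C0 * H) + 1))"
    using CH by (simp add: ln_realpow)
  finally show ?thesis .
qed

text \<open>Double counting of the pairs of an \<open>A\<close> in a box and a root \<open>r\<close> of \<open>F\<close> modulo \<open>p\<close> with \<open>p\<close> dividing \<open>A r\<close>. For fixed
  \<open>A\<close>, interpolation makes the product of these primes at most the number of classes modulo \<open>(A, F)\<close>;
  for fixed \<open>(p, r)\<close>, the number of \<open>A\<close> is at least its expected value.\<close>

lemma mertens_upper_aux:
  assumes y: "y \<ge> 1" and K: "real K ^ d \<le> y" "y < (real K + 1) ^ d" and H: "H \<ge> 0"
  defines "H' \<equiv> H + C0 * int K"
  shows "(2 * real_of_int H + 1) ^ d * mertens F y \<le>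
      (2 * real_of_int H' + 1) ^ d * (real d * ln (real_of_int (2 * (C0 * H') + 1))) + real d * theta y"
proof -
  have H': "H' \<ge> 0" using H C0_pos by (simp add: H'_def)
  let ?R = "Sigma (primes_upto y) (roots_mod F)"
  have finR: "finite ?R" by auto
  let ?X = "box H' - {0}"
  have finX: "finite ?X" using card_box(1)[OF H'] by simp
  let ?T = "\<Sum>A\<in>?X. \<Sum>(p, r)\<in>?R. if int p dvd poly A r then ln (real p) else 0"
  have "(2 * real_of_int H + 1) ^ d * mertens F y - real d * theta y \<le>
        (\<Sum>(p, r)\<in>?R. ln (real p) * ((2 * real_of_int H + 1) ^ d / real p - 1))"
  proof -
    have "(\<Sum>(p, r)\<in>?R. ln (real p) * ((2 * real_of_int H + 1) ^ d / real p - 1)) =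
      (\<Sum>p\<in>primes_upto y. \<Sum>r\<in>roots_mod F p. ln (real p) * ((2 * real_of_int H + 1) ^ d / real p - 1))"
      by (subst sum.Sigma) auto
    also have "\<dots> = (\<Sum>p\<in>primes_upto y. real (rho F p) * (ln (real p) * ((2 * real_of_int H + 1) ^ d / real p - 1)))"
      by (simp add: rho_def)
    also have "\<dots> = (2 * real_of_int H + 1) ^ d * mertens F y - (\<Sum>p\<in>primes_upto y. real (rho F p) * ln (real p))"
      unfolding mertens_def by (simp add: sum_distrib_left sum_subtractf algebra_simps)
    finally have eq: "(\<Sum>(p, r)\<in>?R. ln (real p) * ((2 * real_of_int H + 1) ^ d / real p - 1)) =
      (2 * real_of_int H + 1) ^ d * mertens F y - (\<Sum>p\<in>primes_upto y. real (rho F p) * ln (real p))" .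
    have "(\<Sum>p\<in>primes_upto y. real (rho F p) * ln (real p)) \<le> real d * theta y"
      unfolding theta_def sum_distrib_left using rho_le_d
      by (intro sum_mono mult_right_mono) (auto simp: in_primes_upto)
    thus ?thesis unfolding eq by simp
  qed
  also have "\<dots> \<le> (\<Sum>(p, r)\<in>?R. ln (real p) * real (card (rideal p r \<inter> ?X)))"
  proof (rule sum_mono, clarify)
    fix p r assume p: "p \<in> primes_upto y" and r: "r \<in> roots_mod F p"
    have pp: "prime p" "p > 0" using p by (auto simp: in_primes_upto prime_gt_0_nat)
    have FI: "F \<in> rideal p r" using r by (simp add: roots_mod_def rideal_def)
    have "real p \<le> y" using p by (simp add: in_primes_upto)
    also note K(2)
    finally have "real p < real ((K + 1) ^ d)" by (simp add: add.commute)
    hence "card ((\<lambda>c::int. [:c:]) ` {0..<int p}) < (K + 1) ^ d" by (simp only: card_consts of_nat_less_iff)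
    from ideal_small_element[OF pideal_rideal card_consts(2) rideal_complete[OF pp(2)] this]
    obtain A where A: "A \<in> rideal p r" "A \<in> box (int K)" "A \<noteq> 0" by blast
    have "nat (2 * H + 1) ^ d \<le> p * card (rideal p r \<inter> box H')"
      using ideal_count_lower[OF pideal_rideal FI A card_consts(2) rideal_complete[OF pp(2)] H]
      by (simp add: card_consts H'_def)
    hence "real (nat (2 * H + 1) ^ d) \<le> real (p * card (rideal p r \<inter> box H'))" by (simp only: of_nat_le_iff)
    hence "(2 * real_of_int H + 1) ^ d / real p \<le> real (card (rideal p r \<inter> box H'))"
      using H pp by (simp add: field_simps)
    \<comment> \<open>The zero polynomial lies in every ideal, but
      \<open>common_roots_ln_bound\<close> does not apply to it, so it is left out. These losses add
      up to at most \<open>real d * theta y\<close>.\<close>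
    moreover have "card (rideal p r \<inter> box H') = card (rideal p r \<inter> ?X) + 1"
    proof -
      have "rideal p r \<inter> box H' = insert 0 (rideal p r \<inter> ?X)"
        using H' d_pos by (auto simp: rideal_def box_def)
      thus ?thesis using finX by simp
    qed
    ultimately show "ln (real p) * ((2 * real_of_int H + 1) ^ d / real p - 1) \<le>
        ln (real p) * real (card (rideal p r \<inter> ?X))"
      using pp by (intro mult_left_mono) auto
  qed
  also have "\<dots> = ?T"
  proof -
    have "(\<Sum>A\<in>?X. if int p dvd poly A r then ln (real p) else 0) = ln (real p) * real (card (rideal p r \<inter> ?X))" for p r
    proof -
      have "(\<Sum>A\<in>?X. if int p dvd poly A r then ln (real p) else 0) = (\<Sum>A\<in>{A\<in>?X. int p dvd poly A r}. ln (real p))"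
        using finX by (subst sum.inter_filter) auto
      also have "{A\<in>?X. int p dvd poly A r} = rideal p r \<inter> ?X" by (auto simp: rideal_def)
      finally show ?thesis by simp
    qed
    thus ?thesis by (subst sum.swap) (simp add: case_prod_beta)
  qed
  also have "\<dots> \<le> (\<Sum>A\<in>?X. real d * ln (real_of_int (2 * (C0 * H') + 1)))"
  proof (rule sum_mono)
    fix A assume A: "A \<in> ?X"
    have "(\<Sum>(p, r)\<in>?R. if int p dvd poly A r then ln (real p) else 0) =
        (\<Sum>(p, r)\<in>{x\<in>?R. int (fst x) dvd poly A (snd x)}. ln (real p))"
      using finR by (subst sum.inter_filter) (auto simp: case_prod_beta intro!: sum.cong)
    also have "\<dots> \<le> real d * ln (real_of_int (2 * (C0 * H') + 1))"
      by (rule common_roots_ln_bound) (use A H' finR in \<open>auto simp: in_primes_upto\<close>)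
    finally show "(\<Sum>(p, r)\<in>?R. if int p dvd poly A r then ln (real p) else 0) \<le> \<dots>" .
  qed
  also have "\<dots> \<le> (2 * real_of_int H' + 1) ^ d * (real d * ln (real_of_int (2 * (C0 * H') + 1)))"
  proof -
    have "real (card ?X) \<le> real (card (box H'))" using card_box(1)[OF H'] by (simp add: card_mono)
    also have "\<dots> = (2 * real_of_int H' + 1) ^ d" using card_box(2)[OF H'] H' by simp
    finally show ?thesis using H' C0_pos by (simp add: mult_right_mono)
  qed
  finally show ?thesis by simp
qed

text \<open>With \<open>K\<close> about \<open>y powr (1 / d)\<close>, the logarithm of the bound
  for the product of the primes is \<open>ln y + d * ln L\<close> up to a constant;
  \<open>ln L\<close> is the source of the error \<open>ln (ln y)\<close>.\<close>

theorem mertens_upper: "\<exists>C\<ge>0. \<forall>y\<ge>exp (exp 1). mertens F y \<le> ln y + C * ln (ln y)"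
proof -
  define c where "c = real d * ln (3 * real_of_int C0 ^ 2)"
  have d1: "real d \<ge> 1" using d_pos by simp
  have "eventually (\<lambda>y::real. (1 + 2 * real d / ln y) * (ln y + c + real d * ln (ln y + 2)) + 4 * real d
       \<le> ln y + (real d + 1) * ln (ln y)) at_top"
    using d1 by real_asymp
  moreover have "eventually (\<lambda>y::real. ln y \<ge> real d) at_top" by real_asymp
  moreover have "eventually (\<lambda>y::real. y \<ge> exp (exp 1)) at_top" by (rule eventually_ge_at_top)
  ultimately have "eventually (\<lambda>y. mertens F y \<le> ln y + (real d + 1) * ln (ln y)) at_top"
  proof eventually_elim
    case (elim y)
    have y1: "y \<ge> 1" using elim(3) by (meson exp_ge_zero one_le_exp_iff order_trans)
    have lny: "ln y \<ge> 1" using elim(2) d1 by linarith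
    \<comment> \<open>The least size for which the pigeonhole principle provides an ideal element
      for all primes up to \<open>y\<close>.\<close>
    define K where "K = nat \<lfloor>y powr (1 / real d)\<rfloor>"
    have pw: "(y powr (1 / real d)) ^ d = y" using y1 d_pos by (simp flip: powr_realpow add: powr_powr)
    have rt1: "y powr (1 / real d) \<ge> 1" using y1 by (simp add: ge_one_powr_ge_zero)
    have Kr: "real K \<le> y powr (1 / real d)" "y powr (1 / real d) < real K + 1" "real K \<ge> 1"
    proof -
      have "\<lfloor>y powr (1 / real d)\<rfloor> \<ge> 1" using rt1 by (simp add: le_floor_iff)
      thus "real K \<le> y powr (1 / real d)" "y powr (1 / real d) < real K + 1" "real K \<ge> 1"
        unfolding K_def by linarith+
    qed
    have K: "real K ^ d \<le> y" "y < (real K + 1) ^ d"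
      using power_mono[OF Kr(1), of d] power_strict_mono[OF Kr(2), of d] pw d_pos rt1 by auto
    \<comment> \<open>The box is enlarged by \<open>C0 * K\<close>, a relative change of
      \<open>1 / L\<close> per coefficient. Against the main term \<open>ln y\<close> this is
      harmless once \<open>L\<close> is of order \<open>ln y\<close>, and \<open>L\<close> itself
      enters the error only through its logarithm.\<close>
    define L where "L = nat \<lceil>ln y\<rceil>"
    have L: "real L \<ge> ln y" "real L \<le> ln y + 1" using lny unfolding L_def by linarith+
    have L1: "real L \<ge> 1" "real L \<ge> real d" using L lny elim(2) by linarith+
    define B where "B = real_of_int C0 * real K"
    have B1: "B \<ge> 1" unfolding B_def using C0_pos Kr(3) mult_mono[of 1 "real_of_int C0" 1 "real K"] by simp
    define H where "H = C0 * int K * int L"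
    have H0: "H \<ge> 0" using C0_pos by (simp add: H_def)
    have rH: "real_of_int H = B * real L" by (simp add: H_def B_def)
    have rH': "B * real L + real_of_int C0 * real_of_int (int K) = B * (real L + 1)"
      by (simp add: B_def algebra_simps)
    let ?l = "real d * ln (2 * (real_of_int C0 * (B * (real L + 1))) + 1)"
    have aux: "(2 * (B * real L) + 1) ^ d * mertens F y \<le>
        (2 * (B * (real L + 1)) + 1) ^ d * ?l + real d * theta y"
      using mertens_upper_aux[OF y1 K H0]
      by (simp only: of_int_add of_int_mult of_int_numeral of_int_1 rH rH')
    have BL: "B * real L \<ge> 0" using B1 by simp
    have pos: "(2 * (B * real L) + 1) ^ d > 0" using BL by (intro zero_less_power) linarith
    have ratio: "(2 * (B * (real L + 1)) + 1) ^ d \<le> (1 + 2 * real d / ln y) * (2 * (B * real L) + 1) ^ d"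
    proof -
      have "2 * (B * (real L + 1)) + 1 \<le> (1 + 1 / real L) * (2 * (B * real L) + 1)"
        using L1 by (simp add: field_simps)
      hence "(2 * (B * (real L + 1)) + 1) ^ d \<le> ((1 + 1 / real L) * (2 * (B * real L) + 1)) ^ d"
        using B1 BL by (intro power_mono) auto
      also have "\<dots> = (1 + 1 / real L) ^ d * (2 * (B * real L) + 1) ^ d" by (simp add: power_mult_distrib)
      also have "(1 + 1 / real L) ^ d \<le> exp (1 / real L) ^ d"
        using L1 by (intro power_mono exp_ge_add_one_self) auto
      also have "\<dots> = exp (real d / real L)" by (simp flip: exp_of_nat_mult)
      also have "\<dots> \<le> 1 + real d / real L + (real d / real L)\<^sup>2" using L1 by (intro exp_bound) auto
      also have "\<dots> \<le> 1 + 2 * (real d / real L)"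
        using L1 mult_left_mono[of "real d / real L" 1 "real d / real L"] by (simp add: power2_eq_square)
      also have "\<dots> \<le> 1 + 2 * (real d / ln y)"
        using L lny L1 by (intro add_left_mono mult_left_mono divide_left_mono) auto
      finally show ?thesis using pos by simp
    qed
    have l: "?l \<le> ln y + c + real d * ln (ln y + 2)"
    proof -
      have C01: "real_of_int C0 \<ge> 1" using C0_pos by simp
      have BL1: "real_of_int C0 * (B * (real L + 1)) \<ge> 1"
        using C01 B1 L1 mult_mono[of 1 "real_of_int C0" 1 "B * (real L + 1)"] mult_mono[of 1 B 1 "real L + 1"] by simp
      have "2 * (real_of_int C0 * (B * (real L + 1))) + 1 \<le> 3 * (real_of_int C0 * (B * (real L + 1)))" using BL1 by linarith
      also have "\<dots> = (3 * real_of_int C0 ^ 2) * real K * (real L + 1)" by (simp add: B_def power2_eq_square)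
      finally have "ln (2 * (real_of_int C0 * (B * (real L + 1))) + 1) \<le> ln ((3 * real_of_int C0 ^ 2) * real K * (real L + 1))"
        using BL1 by (intro ln_mono) auto
      also have "\<dots> = ln (3 * real_of_int C0 ^ 2) + ln (real K) + ln (real L + 1)"
        using C01 Kr(3) L1 by (subst ln_mult; (subst ln_mult)?) auto
      also have "\<dots> \<le> ln (3 * real_of_int C0 ^ 2) + ln (real K) + ln (ln y + 2)"
        using L L1 by (intro add_left_mono ln_mono) auto
      finally have "?l \<le> real d * (ln (3 * real_of_int C0 ^ 2) + ln (real K) + ln (ln y + 2))"
        by (intro mult_left_mono) auto
      also have "\<dots> = c + real d * ln (real K) + real d * ln (ln y + 2)" by (simp add: c_def algebra_simps)
      also have "real d * ln (real K) = ln (real K ^ d)" using Kr(3) by (simp add: ln_realpow)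
      also have "\<dots> \<le> ln y" using K(1) Kr(3) by (intro ln_mono) auto
      finally show ?thesis by simp
    qed
    have l0: "?l \<ge> 0" using B1 L1 C0_pos by (intro mult_nonneg_nonneg) auto
    have th: "real d * theta y \<le> 4 * real d * (2 * (B * real L) + 1) ^ d"
    proof -
      have "theta y \<le> 4 * y" using y1 by (intro theta_le) auto
      also have "y \<le> (real K + 1) ^ d" using K(2) by simp
      also have "(real K + 1) ^ d \<le> (2 * (B * real L) + 1) ^ d"
      proof (intro power_mono)
        have "real K \<le> B" unfolding B_def using C0_pos mult_right_mono[of 1 "real_of_int C0" "real K"] by simp
        also have "B \<le> B * real L" using B1 L1 mult_left_mono[of 1 "real L" B] by simp
        finally show "real K + 1 \<le> 2 * (B * real L) + 1" using BL by linarith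
      qed auto
      finally have "theta y \<le> 4 * (2 * (B * real L) + 1) ^ d" by simp
      hence "real d * theta y \<le> real d * (4 * (2 * (B * real L) + 1) ^ d)" by (intro mult_left_mono) auto
      thus ?thesis by (simp add: mult_ac)
    qed
    let ?D = "(2 * (B * real L) + 1) ^ d"
    have "?D * mertens F y \<le> (1 + 2 * real d / ln y) * ?D * ?l + 4 * real d * ?D"
      using aux th mult_right_mono[OF ratio l0] by linarith
    also have "\<dots> = ?D * ((1 + 2 * real d / ln y) * ?l + 4 * real d)" by (simp add: algebra_simps)
    finally have "mertens F y \<le> (1 + 2 * real d / ln y) * ?l + 4 * real d" using pos by simp
    also have "(1 + 2 * real d / ln y) * ?l \<le> (1 + 2 * real d / ln y) * (ln y + c + real d * ln (ln y + 2))"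
      using l lny by (intro mult_left_mono) auto
    finally show ?case using elim(1) by linarith
  qed
  then obtain y1 where y1: "\<And>y. y \<ge> y1 \<Longrightarrow> mertens F y \<le> ln y + (real d + 1) * ln (ln y)"
    by (auto simp: eventually_at_top_linorder)
  \<comment> \<open>Below \<open>y1\<close> monotonicity and \<open>ln (ln y) \<ge> 1\<close>
    suffice; the limit \<open>exp (exp 1)\<close> is chosen for the latter.\<close>
  define C where "C = max (real d + 1) (mertens F y1)"
  show ?thesis
  proof (intro exI[of _ C] conjI allI impI)
    show "C \<ge> 0" by (simp add: C_def)
    fix y :: real assume y: "y \<ge> exp (exp 1)"
    have "ln y \<ge> ln (exp (exp 1))" using y by (intro ln_mono) auto
    hence l1: "ln y \<ge> exp 1" by simp
    hence "ln (ln y) \<ge> ln (exp 1)" by (intro ln_mono) auto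
    hence l2: "ln (ln y) \<ge> 1" by simp
    have l0: "ln y \<ge> 0" using l1 by (meson exp_ge_zero order_trans)
    show "mertens F y \<le> ln y + C * ln (ln y)"
    proof (cases "y \<ge> y1")
      case True
      have "(real d + 1) * ln (ln y) \<le> C * ln (ln y)" using l2 by (intro mult_right_mono) (auto simp: C_def)
      thus ?thesis using y1[OF True] by linarith
    next
      case False
      hence "mertens F y \<le> mertens F y1" by (intro mertens_mono) auto
      also have "\<dots> \<le> C * 1" by (simp add: C_def)
      also have "\<dots> \<le> C * ln (ln y)" using l2 by (intro mult_left_mono) (auto simp: C_def)
      finally show ?thesis using l0 by simp
    qed
  qed
qed

end

section \<open>Norms and maximal ideals\<close>

lemma int_poly_eventually_pos:
  fixes P :: "int poly"
  assumes "lead_coeff P > 0"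
  shows "\<exists>n. \<forall>x\<ge>n. poly P x > 0"
proof -
  let ?Q = "map_poly real_of_int P"
  have "lead_coeff ?Q > 0" using assms by simp
  from poly_pinfty_gt_lc[OF this] obtain n where n: "\<And>x. x \<ge> n \<Longrightarrow> poly ?Q x \<ge> lead_coeff ?Q" by auto
  have "poly P x > 0" if "x \<ge> \<lceil>n\<rceil>" for x
  proof -
    have "real_of_int (poly P x) = poly ?Q (real_of_int x)" by simp
    also have "\<dots> \<ge> lead_coeff ?Q" using that by (intro n) linarith
    finally have "real_of_int (poly P x) > 0" using \<open>lead_coeff ?Q > 0\<close> by linarith
    thus ?thesis by simp
  qed
  thus ?thesis by blast
qed

text \<open>For large \<open>x\<close> the value \<open>poly F x\<close> exceeds
  \<open>\<bar>poly D x\<bar>\<close> for the difference \<open>D\<close> of smaller degree, so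
  divisibility forces \<open>poly D x = 0\<close> there.\<close>

lemma monic_eq_of_dvd_values:
  fixes G F :: "int poly"
  assumes "degree F = d" "coeff F d = 1" "degree G = d" "coeff G d = 1" "d > 0"
    and dvd: "\<And>a. poly F a dvd poly G a"
  shows "G = F"
proof (rule ccontr)
  assume "G \<noteq> F"
  define D where "D = G - F"
  have D0: "D \<noteq> 0" using \<open>G \<noteq> F\<close> by (simp add: D_def)
  have dD: "degree D < d"
  proof -
    have "\<forall>i\<ge>d. coeff D i = 0"
    proof (intro allI impI)
      fix i assume "i \<ge> d"
      thus "coeff D i = 0" using assms(1-4) by (cases "i = d") (auto simp: D_def coeff_eq_0)
    qed
    thus ?thesis using assms(5) by (simp add: degree_less_iff_coeff)
  qed
  have "degree (F + - D) = d" "degree (F + D) = d" using dD assms(1)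
    by (simp_all only: degree_add_eq_left degree_minus)
  hence "degree (F - D) = d" "degree (F + D) = d" by simp_all
  moreover have "coeff (F - D) d = 1" "coeff (F + D) d = 1" using dD assms(2) by (auto simp: coeff_eq_0)
  ultimately have "lead_coeff (F - D) > 0" "lead_coeff (F + D) > 0" by simp_all
  then obtain n1 n2 where n: "\<And>x. x \<ge> n1 \<Longrightarrow> poly (F - D) x > 0" "\<And>x. x \<ge> n2 \<Longrightarrow> poly (F + D) x > 0"
    using int_poly_eventually_pos by meson
  have "poly D x = 0" if "x \<ge> max n1 n2" for x
  proof -
    have "\<bar>poly D x\<bar> < poly F x" using n(1)[of x] n(2)[of x] that by auto
    moreover have "poly F x dvd poly D x" using dvd[of x] by (simp add: D_def)
    ultimately show ?thesis using dvd_imp_le_int[of "poly D x" "poly F x"] by fastforce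
  qed
  hence "{max n1 n2..} \<subseteq> {x. poly D x = 0}" by auto
  moreover have "finite {x. poly D x = 0}" using D0 by (rule poly_roots_finite)
  moreover have "infinite {max n1 n2..}" by (rule infinite_Ici)
  ultimately show False using finite_subset by blast
qed

lemma taylor_square_dvd: "(h::int)\<^sup>2 dvd poly P (x + h) - poly P x - h * poly (pderiv P) x"
proof (induction P rule: pCons_induct)
  case (pCons a P)
  have "poly (pCons a P) (x + h) - poly (pCons a P) x - h * poly (pderiv (pCons a P)) x =
      (x + h) * (poly P (x + h) - poly P x - h * poly (pderiv P) x) + h\<^sup>2 * poly (pderiv P) x"
    by (simp add: pderiv_pCons algebra_simps power2_eq_square)
  thus ?case using pCons by simp
qed simp

text \<open>The uniqueness half of Hensel's lemma: the difference of the values is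
  \<open>s - r\<close> times a factor prime to \<open>p\<close>.\<close>

lemma hensel_unique:
  fixes p :: int
  assumes "prime p" "\<not> p dvd poly (pderiv P) r" "p dvd s - r" "p ^ j dvd poly P r" "p ^ j dvd poly P s"
  shows "p ^ j dvd s - r"
proof -
  obtain w where w: "poly P (r + (s - r)) - poly P r - (s - r) * poly (pderiv P) r = (s - r)\<^sup>2 * w"
    using taylor_square_dvd[of "s - r" P r] by (auto elim: dvdE)
  have "poly P s - poly P r = (s - r) * (poly (pderiv P) r + (s - r) * w)"
    using w by (simp add: algebra_simps power2_eq_square)
  hence "p ^ j dvd (s - r) * (poly (pderiv P) r + (s - r) * w)" using assms(4,5) by (metis dvd_diff)
  moreover have "\<not> p dvd poly (pderiv P) r + (s - r) * w"
  proof
    assume *: "p dvd poly (pderiv P) r + (s - r) * w"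
    have "p dvd (s - r) * w" using assms(3) by (rule dvd_mult2)
    hence "p dvd poly (pderiv P) r" using * by (simp add: dvd_add_left_iff)
    thus False using assms(2) by simp
  qed
  hence "coprime (p ^ j) (poly (pderiv P) r + (s - r) * w)"
    using assms(1) by (metis prime_imp_coprime coprime_power_left_iff)
  ultimately show ?thesis by (simp add: coprime_dvd_mult_left_iff)
qed

text \<open>By \<open>hensel_unique\<close>, reduction modulo \<open>p\<close> is injective on the
  roots modulo \<open>p ^ j\<close>.\<close>

lemma rho_prime_power_le:
  assumes p: "prime p" and j: "j > 0" and nd: "\<And>r. int p dvd poly P r \<Longrightarrow> \<not> int p dvd poly (pderiv P) r"
  shows "rho P (p ^ j) \<le> rho P p"
  unfolding rho_def
proof (rule card_inj_on_le[of "\<lambda>r. r mod int p"])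
  have pp: "int p dvd int p ^ j" using j by simp
  show "inj_on (\<lambda>r. r mod int p) (roots_mod P (p ^ j))"
  proof (rule inj_onI)
    fix r s assume *: "r \<in> roots_mod P (p ^ j)" "s \<in> roots_mod P (p ^ j)" "r mod int p = s mod int p"
    have d: "int p ^ j dvd poly P r" "int p ^ j dvd poly P s" using * by (auto simp: roots_mod_def)
    have "int p dvd s - r" using *(3) by (metis mod_eq_dvd_iff)
    moreover have "\<not> int p dvd poly (pderiv P) r" using d(1) pp nd dvd_trans by blast
    ultimately have "int p ^ j dvd s - r" using d p by (intro hensel_unique[of _ P]) auto
    hence "s mod int p ^ j = r mod int p ^ j" by (simp add: mod_eq_dvd_iff)
    thus "r = s" using * by (simp add: roots_mod_def)
  qed
  show "(\<lambda>r. r mod int p) ` roots_mod P (p ^ j) \<subseteq> roots_mod P p"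
  proof clarify
    fix r assume "r \<in> roots_mod P (p ^ j)"
    hence "int p dvd poly P r" using pp by (auto simp: roots_mod_def intro: dvd_trans)
    thus "r mod int p \<in> roots_mod P p" using p by (simp add: roots_mod_def poly_dvd_mod prime_gt_0_nat)
  qed
qed simp

context monic_irr
begin

section \<open>The norm on Z[t] / (F) as a determinant\<close>

lemma red_sum: "red (\<Sum>i\<in>S. f i) = (\<Sum>i\<in>S. red (f i))"
proof (induction S rule: infinite_finite_induct)
  case (infinite S)
  thus ?case using red_id[of 0] d_pos by simp
next
  case empty
  thus ?case using red_id[of 0] d_pos by simp
qed (simp add: red_add)

text \<open>The matrix of multiplication by \<open>A\<close> on Z[t] / (F) in the basis
  \<open>1, t, ..., t ^ (d - 1)\<close>; its determinant \<open>N\<close> is the norm.\<close>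

definition Mmat :: "int poly \<Rightarrow> int mat" where
  "Mmat A = mat d d (\<lambda>(i, j). coeff (red (A * monom 1 j)) i)"

definition N :: "int poly \<Rightarrow> int" where "N A = det (Mmat A)"

lemma Mmat_carrier [simp]: "Mmat A \<in> carrier_mat d d" by (simp add: Mmat_def)

lemma N_cong: assumes "F dvd A - B" shows "N A = N B"
proof -
  have "red (A * monom 1 j) = red (B * monom 1 j)" for j
  proof (rule red_cong)
    have "F dvd (A - B) * monom 1 j" using assms by (rule dvd_mult2)
    thus "F dvd A * monom 1 j - B * monom 1 j" by (simp add: algebra_simps)
  qed
  thus ?thesis by (simp add: N_def Mmat_def)
qed

lemma Mmat_mult: "Mmat (A * B) = Mmat A * Mmat B"
proof (rule eq_matI)
  fix i j assume "i < dim_row (Mmat A * Mmat B)" "j < dim_col (Mmat A * Mmat B)"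
  hence ij: "i < d" "j < d" by (auto simp: Mmat_def)
  define T where "T = red (B * monom 1 j)"
  have dT: "degree T < d" by (simp add: T_def red)
  have T: "T = (\<Sum>k<d. monom (coeff T k) k)"
  proof (rule poly_eqI)
    fix n show "coeff T n = coeff (\<Sum>k<d. monom (coeff T k) k) n"
      using dT by (cases "n < d") (auto simp: coeff_sum if_distrib sum.delta coeff_eq_0 cong: if_cong)
  qed
  have "red (A * B * monom 1 j) = red (A * T)" unfolding T_def by (simp add: red_mult_right mult.assoc)
  also have "A * T = (\<Sum>k<d. smult (coeff T k) (A * monom 1 k))"
    by (subst T) (simp add: sum_distrib_left smult_monom flip: mult_smult_right)
  also have "red \<dots> = (\<Sum>k<d. smult (coeff T k) (red (A * monom 1 k)))" by (simp add: red_sum red_smult)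
  finally have "coeff (red (A * B * monom 1 j)) i = (\<Sum>k<d. coeff T k * coeff (red (A * monom 1 k)) i)"
    by (simp add: coeff_sum)
  thus "Mmat (A * B) $$ (i, j) = (Mmat A * Mmat B) $$ (i, j)" using ij
    by (simp add: Mmat_def scalar_prod_def T_def lessThan_atLeast0 mult.commute)
qed (auto simp: Mmat_def)

lemma N_mult: "N (A * B) = N A * N B"
  unfolding N_def Mmat_mult by (rule det_mult[OF Mmat_carrier Mmat_carrier])

lemma Mmat_add_const: "Mmat ([:a:] + A) = a \<cdot>\<^sub>m 1\<^sub>m d + Mmat A"
proof (rule eq_matI)
  fix i j assume "i < dim_row (a \<cdot>\<^sub>m 1\<^sub>m d + Mmat A)" "j < dim_col (a \<cdot>\<^sub>m 1\<^sub>m d + Mmat A)"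
  hence ij: "i < d" "j < d" by (auto simp: Mmat_def)
  have "red (([:a:] + A) * monom 1 j) = smult a (red (monom 1 j)) + red (A * monom 1 j)"
    by (simp add: distrib_right red_add red_smult)
  also have "red (monom 1 j) = monom 1 j" using ij by (intro red_id) (simp add: degree_monom_eq)
  finally show "Mmat ([:a:] + A) $$ (i, j) = (a \<cdot>\<^sub>m 1\<^sub>m d + Mmat A) $$ (i, j)" using ij by (auto simp: Mmat_def)
qed (auto simp: Mmat_def)

lemma Mmat_0: "Mmat 0 = 0\<^sub>m d d"
  using red_id[of 0] d_pos by (intro eq_matI) (auto simp: Mmat_def)

lemma N_const: "N [:c:] = c ^ d"
proof -
  have "Mmat [:c:] = c \<cdot>\<^sub>m 1\<^sub>m d" using Mmat_add_const[of c 0] by (simp add: Mmat_0)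
  thus ?thesis by (simp add: N_def)
qed

text \<open>As a function of the constant coefficient the norm is the characteristic polynomial of
  minus the multiplication matrix. Being monic of degree \<open>d\<close>, it is rarely small or
  highly divisible, which bounds exceptional sets in the lower Mertens estimate.\<close>

lemma N_monic_poly: "\<exists>G. degree G = d \<and> coeff G d = 1 \<and> (\<forall>a. N ([:a:] + A) = poly G a)"
proof -
  define X where "X = - Mmat A"
  have X: "X \<in> carrier_mat d d" by (simp add: X_def)
  have "poly (char_poly X) a = N ([:a:] + A)" for a
  proof -
    have ph: "comm_ring_hom (\<lambda>q :: int poly. poly q a)" by unfold_locales auto
    have "poly (char_poly X) a = det (map_mat (\<lambda>q. poly q a) (char_poly_matrix X))"
      unfolding char_poly_def by (rule comm_ring_hom.hom_det[OF ph, symmetric])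
    also have "map_mat (\<lambda>q. poly q a) (char_poly_matrix X) = Mmat ([:a:] + A)"
      unfolding Mmat_add_const using X
      by (intro eq_matI) (auto simp: char_poly_matrix_def X_def Mmat_def)
    finally show ?thesis by (simp add: N_def)
  qed
  thus ?thesis using degree_monic_char_poly[OF X] by metis
qed

text \<open>The norm of \<open>a - t\<close> is monic in \<open>a\<close>, so by
  \<open>monic_eq_of_dvd_values\<close> it suffices that \<open>poly F a\<close> divides it for all
  integers \<open>a\<close>.\<close>

lemma N_linear: "N [:-r, 1:] = (-1) ^ d * poly F r"
proof -
  obtain G where G: "degree G = d" "coeff G d = 1" "\<And>a. N ([:a:] + [:0, -1:]) = poly G a"
    using N_monic_poly[of "[:0, -1:]"] by auto
  have dvd: "poly F a dvd poly G a" for a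
  proof -
    let ?A = "[:a, -1:]"
    let ?M = "Mmat ?A"
    \<comment> \<open>Evaluation at \<open>a\<close> annihilates \<open>a - t\<close>; hence the row
      vector \<open>1, a, a ^ 2, ...\<close> times the matrix is zero modulo
      \<open>poly F a\<close>.\<close>
    have col: "poly F a dvd (\<Sum>i<d. a ^ i * ?M $$ (i, j))" if j: "j < d" for j
    proof -
      let ?T = "red (?A * monom 1 j)"
      have "(\<Sum>i<d. a ^ i * ?M $$ (i, j)) = (\<Sum>i<d. coeff ?T i * a ^ i)"
        using j by (simp add: Mmat_def mult.commute)
      also have "\<dots> = poly ?T a" using red(1)[of "?A * monom 1 j"]
        by (subst poly_altdef) (intro sum.mono_neutral_right, auto simp: coeff_eq_0)
      also have "\<dots> = poly (?A * monom 1 j) a - poly (?A * monom 1 j - ?T) a" by simp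
      also have "poly (?A * monom 1 j) a = 0" by simp
      finally have e: "(\<Sum>i<d. a ^ i * ?M $$ (i, j)) = 0 - poly (?A * monom 1 j - ?T) a" .
      have "poly F a dvd poly (?A * monom 1 j - ?T) a"
        using red(2)[of "?A * monom 1 j"] by (metis dvdE dvd_triv_left poly_mult)
      thus ?thesis unfolding e by simp
    qed
    let ?B = "adj_mat ?M"
    have B: "?B \<in> carrier_mat d d" "?M * ?B = det ?M \<cdot>\<^sub>m 1\<^sub>m d" using adj_mat[OF Mmat_carrier] by auto
    \<comment> \<open>Multiplication by the adjugate transfers this to the determinant, because the
      entry of index 0 of the row vector is 1.\<close>
    have "det ?M = (\<Sum>i<d. a ^ i * (det ?M \<cdot>\<^sub>m 1\<^sub>m d) $$ (i, 0))"
      using d_pos by (simp add: if_distrib sum.delta cong: if_cong)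
    also have "\<dots> = (\<Sum>i<d. a ^ i * (?M * ?B) $$ (i, 0))" by (simp only: B(2))
    also have "\<dots> = (\<Sum>i<d. a ^ i * (\<Sum>j<d. ?M $$ (i, j) * ?B $$ (j, 0)))"
    proof (intro sum.cong refl)
      fix i assume i: "i \<in> {..<d}"
      have "dim_row ?B = d" "dim_col ?B = d" "dim_row ?M = d" "dim_col ?M = d"
        using B(1) Mmat_carrier[of ?A] by (auto simp del: Mmat_carrier)
      thus "a ^ i * (?M * ?B) $$ (i, 0) = a ^ i * (\<Sum>j<d. ?M $$ (i, j) * ?B $$ (j, 0))"
        using i d_pos by (simp add: scalar_prod_def lessThan_atLeast0)
    qed
    also have "\<dots> = (\<Sum>j<d. (\<Sum>i<d. a ^ i * ?M $$ (i, j)) * ?B $$ (j, 0))"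
      by (simp add: sum_distrib_left sum_distrib_right mult.assoc) (rule sum.swap)
    also have "poly F a dvd \<dots>"
    proof (rule dvd_sum)
      fix j assume "j \<in> {..<d}"
      thus "poly F a dvd (\<Sum>i<d. a ^ i * ?M $$ (i, j)) * ?B $$ (j, 0)"
        by (intro dvd_mult2[OF col]) simp
    qed
    finally have "poly F a dvd N ?A" by (simp add: N_def)
    thus ?thesis using G(3)[of a] by simp
  qed
  have GF: "G = F" by (rule monic_eq_of_dvd_values[OF deg monic G(1,2) d_pos dvd])
  have "N [:-r, 1:] = N ([:-1:] * [:r, -1:])" by simp
  also have "\<dots> = (-1) ^ d * N [:r, -1:]" by (simp only: N_mult N_const)
  also have "N [:r, -1:] = poly F r" using G(3)[of r] GF by simp
  finally show ?thesis .
qed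

text \<open>Modulo \<open>p\<close> the matrix is the identity.\<close>

lemma N_one_plus: "int p dvd N (1 + smult (int p) W) - 1"
proof -
  let ?A = "1 + smult (int p) W"
  have 1: "Mmat ?A = 1 \<cdot>\<^sub>m 1\<^sub>m d + Mmat (smult (int p) W)" using Mmat_add_const[of 1] by (simp add: one_pCons)
  have 2: "Mmat (smult (int p) W) $$ (i, j) = int p * coeff (red (W * monom 1 j)) i" if "i < d" "j < d" for i j
    using that by (simp add: Mmat_def red_smult)
  have entry: "[Mmat ?A $$ (i, j) = (1\<^sub>m d :: int mat) $$ (i, j)] (mod int p)" if ij: "i < d" "j < d" for i j
  proof -
    have "Mmat ?A $$ (i, j) = (1\<^sub>m d :: int mat) $$ (i, j) + Mmat (smult (int p) W) $$ (i, j)"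
      unfolding 1 using ij by (simp add: Mmat_def)
    thus ?thesis unfolding 2[OF ij] by (simp add: cong_iff_dvd_diff)
  qed
  have "[det (Mmat ?A) = det (1\<^sub>m d :: int mat)] (mod int p)"
    unfolding det_def'[OF Mmat_carrier] det_def'[OF one_carrier_mat]
  proof (intro cong_sum cong_mult cong_refl cong_prod entry)
    fix q i assume "q \<in> {q. q permutes {0..<d}}" "i \<in> {0..<d}"
    thus "i < d" "q i < d" using permutes_in_image[of q "{0..<d}" i] by auto
  qed
  thus ?thesis by (simp add: N_def cong_iff_dvd_diff)
qed

text \<open>A Bezout identity says that \<open>A * U\<close> is a nonzero constant \<open>m\<close>
  modulo \<open>F\<close>, whence \<open>N A * N U = m ^ d\<close>.\<close>

lemma N_nonzero: assumes "A \<noteq> 0" "degree A < d" shows "N A \<noteq> 0"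
proof -
  obtain U V m where m: "m \<noteq> 0" "A * U + F * V = [:m:]" using bez[OF assms] by auto
  have "F dvd A * U - [:m:]" unfolding m(2)[symmetric] by simp
  hence "N (A * U) = N [:m:]" by (rule N_cong)
  hence "N A * N U = m ^ d" by (simp add: N_mult N_const)
  thus ?thesis using m(1) by auto
qed

section \<open>Maximal ideals of Z[t] / (F) above a prime\<close>

definition maxideal :: "nat \<Rightarrow> int poly set \<Rightarrow> bool" where
  "maxideal p J \<longleftrightarrow> pideal J \<and> 1 \<notin> J \<and> [:int p:] \<in> J \<and> F \<in> J \<and>
     (\<forall>J'. pideal J' \<and> J \<subseteq> J' \<and> 1 \<notin> J' \<longrightarrow> J' = J)"

lemma maxideal_exists:
  assumes I: "pideal I" "1 \<notin> I" "[:int p:] \<in> I" "F \<in> I"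
  shows "\<exists>J. maxideal p J \<and> I \<subseteq> J"
proof -
  let ?A = "{J. pideal J \<and> I \<subseteq> J \<and> 1 \<notin> J}"
  have "\<exists>M\<in>?A. \<forall>X\<in>?A. M \<subseteq> X \<longrightarrow> X = M"
  proof (rule subset_Zorn_nonempty)
    show "?A \<noteq> {}" using I by blast
    fix C assume C: "C \<noteq> {}" "subset.chain ?A C"
    have sub: "C \<subseteq> ?A" and tot: "\<And>X Y. X \<in> C \<Longrightarrow> Y \<in> C \<Longrightarrow> X \<subseteq> Y \<or> Y \<subseteq> X"
      using C(2) by (auto simp: subset_chain_def)
    have "pideal (\<Union>C)" unfolding pideal_def
    proof (intro conjI ballI allI)
      show "0 \<in> \<Union>C" using C(1) sub pidealD(1) by blast
    next
      fix a b assume "a \<in> \<Union>C" "b \<in> \<Union>C"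
      then obtain X Y where XY: "X \<in> C" "Y \<in> C" "a \<in> X" "b \<in> Y" by auto
      from tot[OF XY(1,2)] show "a + b \<in> \<Union>C"
      proof
        assume "X \<subseteq> Y"
        hence "a + b \<in> Y" using XY sub pidealD(2)[of Y a b] by auto
        thus ?thesis using XY by auto
      next
        assume "Y \<subseteq> X"
        hence "a + b \<in> X" using XY sub pidealD(2)[of X a b] by auto
        thus ?thesis using XY by auto
      qed
    next
      fix a q assume "a \<in> \<Union>C"
      then obtain X where X: "X \<in> C" "a \<in> X" by auto
      hence "q * a \<in> X" using sub pidealD(3)[of X a q] by auto
      thus "q * a \<in> \<Union>C" using X by auto
    qed
    thus "\<Union>C \<in> ?A" using C(1) sub by auto
  qed
  then obtain J where JA: "J \<in> ?A" and Jm: "\<forall>X\<in>?A. J \<subseteq> X \<longrightarrow> X = J" by (elim bexE)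
  have J: "pideal J" "I \<subseteq> J" "1 \<notin> J" using JA by simp_all
  have "maxideal p J" unfolding maxideal_def
  proof (intro conjI allI impI)
    fix J' assume "pideal J' \<and> J \<subseteq> J' \<and> 1 \<notin> J'"
    thus "J' = J" using J(2) Jm[rule_format, of J'] by auto
  qed (use J I in auto)
  thus ?thesis using J(2) by blast
qed

lemma maxidealD:
  assumes "maxideal p J"
  shows "pideal J" "1 \<notin> J" "[:int p:] \<in> J" "F \<in> J"
  using assms by (auto simp: maxideal_def)

lemma maxideal_unit:
  assumes J: "maxideal p J" and a: "a \<notin> J"
  shows "\<exists>u. 1 - u * a \<in> J"
proof (rule ccontr)
  assume *: "\<not> ?thesis"
  note J' = pidealD[OF maxidealD(1)[OF J]]
  define J' where "J' = {j + u * a | j u. j \<in> J}"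
  have "pideal J'" unfolding pideal_def
  proof (intro conjI ballI allI)
    show "0 \<in> J'" unfolding J'_def using J'(1) by (intro CollectI exI[of _ 0]) auto
  next
    fix x y assume "x \<in> J'" "y \<in> J'"
    then obtain j u j' u' where "x = j + u * a" "j \<in> J" "y = j' + u' * a" "j' \<in> J" by (auto simp: J'_def)
    hence "x + y = (j + j') + (u + u') * a" "j + j' \<in> J" using J'(2) by (auto simp: algebra_simps)
    thus "x + y \<in> J'" unfolding J'_def by blast
  next
    fix x q assume "x \<in> J'"
    then obtain j u where "x = j + u * a" "j \<in> J" by (auto simp: J'_def)
    hence "q * x = q * j + (q * u) * a" "q * j \<in> J" using J'(3) by (auto simp: algebra_simps)
    thus "q * x \<in> J'" unfolding J'_def by blast
  qed
  moreover have "J \<subseteq> J'"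
  proof
    fix j assume "j \<in> J"
    moreover have "j = j + 0 * a" by simp
    ultimately show "j \<in> J'" unfolding J'_def by blast
  qed
  moreover have "1 \<notin> J'"
  proof
    assume "1 \<in> J'"
    then obtain j u where "1 = j + u * a" "j \<in> J" by (auto simp: J'_def)
    hence "1 - u * a \<in> J" by (metis add_diff_cancel_right')
    thus False using * by blast
  qed
  ultimately have "J' = J" using J unfolding maxideal_def by blast
  moreover have "a \<in> J'"
  proof -
    have "a = 0 + 1 * a" by simp
    thus ?thesis unfolding J'_def using J'(1) by blast
  qed
  ultimately show False using a by simp
qed

lemma maxideal_prime:
  assumes J: "maxideal p J" and ab: "a * b \<in> J" "a \<notin> J"
  shows "b \<in> J"
proof -
  note J' = pidealD[OF maxidealD(1)[OF J]]
  obtain u where "1 - u * a \<in> J" using maxideal_unit[OF J ab(2)] by auto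
  hence "b * (1 - u * a) + u * (a * b) \<in> J" using ab(1) J'(2,3) by blast
  thus ?thesis by (simp add: algebra_simps)
qed

lemma maxideal_const:
  assumes p: "prime p" and J: "maxideal p J"
  shows "[:c:] \<in> J \<longleftrightarrow> int p dvd c"
proof
  note J' = pidealD[OF maxidealD(1)[OF J]]
  show "[:c:] \<in> J" if dv: "int p dvd c"
  proof -
    obtain k where "c = int p * k" using dv by (auto elim: dvdE)
    hence "[:c:] = [:k:] * [:int p:]" by (simp add: mult.commute)
    thus ?thesis using J'(3)[OF maxidealD(3)[OF J]] by (simp only:)
  qed
  show "int p dvd c" if c: "[:c:] \<in> J"
  proof (rule ccontr)
    assume "\<not> int p dvd c"
    hence "coprime c (int p)" using p by (metis prime_imp_coprime coprime_commute prime_nat_int_transfer)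
    then obtain u v where uv: "u * c + v * int p = 1"
      using bezout_int[of c "int p"] by (auto simp: coprime_iff_gcd_eq_1)
    have "[:u:] * [:c:] + [:v:] * [:int p:] \<in> J" by (intro J'(2,3) c maxidealD(3)[OF J])
    moreover have "[:u:] * [:c:] + [:v:] * [:int p:] = 1" using uv by (simp add: one_pCons mult.commute)
    ultimately show False using maxidealD(2)[OF J] by simp
  qed
qed

text \<open>Otherwise \<open>Z\<close>, \<open>F\<close> and \<open>p\<close> generate the unit
  ideal, so \<open>Z\<close> has an inverse modulo \<open>p\<close> and \<open>F\<close>, and
  multiplicativity makes \<open>N Z\<close> invertible modulo \<open>p\<close>.\<close>

lemma prime_dvd_N_maxideal:
  assumes p: "prime p" "int p dvd N Z"
  shows "\<exists>J. maxideal p J \<and> Z \<in> J"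
proof (rule ccontr)
  assume *: "\<not> ?thesis"
  define I where "I = {Z * U + F * V + [:int p:] * W | U V W. True}"
  have mem: "Z * U + F * V + [:int p:] * W \<in> I" for U V W unfolding I_def by blast
  have I: "pideal I" unfolding pideal_def
  proof (intro conjI ballI allI)
    show "0 \<in> I" using mem[of 0 0 0] by simp
  next
    fix x y assume "x \<in> I" "y \<in> I"
    then obtain U V W U' V' W' where "x = Z * U + F * V + [:int p:] * W" "y = Z * U' + F * V' + [:int p:] * W'"
      by (auto simp: I_def)
    thus "x + y \<in> I" using mem[of "U + U'" "V + V'" "W + W'"] by (simp add: algebra_simps smult_add_right)
  next
    fix x q assume "x \<in> I"
    then obtain U V W where "x = Z * U + F * V + [:int p:] * W" by (auto simp: I_def)
    thus "q * x \<in> I" using mem[of "q * U" "q * V" "q * W"] by (simp add: algebra_simps)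
  qed
  have "Z \<in> I" "F \<in> I" "[:int p:] \<in> I" using mem[of 1 0 0] mem[of 0 1 0] mem[of 0 0 1] by simp_all
  hence "1 \<in> I" using maxideal_exists[OF I] * by blast
  then obtain U V W where e: "1 = Z * U + F * V + [:int p:] * W" by (auto simp: I_def)
  have "F dvd Z * U - (1 + smult (int p) (- W))"
  proof -
    have "Z * U - (1 + smult (int p) (- W)) = F * (- V)" by (subst e) (simp add: algebra_simps)
    thus ?thesis by simp
  qed
  hence "N (Z * U) = N (1 + smult (int p) (- W))" by (rule N_cong)
  hence "int p dvd N Z * N U - 1" using N_one_plus[of p "- W"] by (simp add: N_mult)
  moreover have "int p dvd N Z * N U" using p(2) by (rule dvd_mult2)
  ultimately have "int p dvd 1" by (metis dvd_diff diff_diff_eq2 add_diff_cancel_left')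
  thus False using p(1) by (simp add: prime_gt_1_nat not_prime_unit)
qed

text \<open>For maximal ideals this is residue degree one: \<open>t\<close> is congruent to an
  integer, and so is every polynomial.\<close>

definition linear_ideal :: "nat \<Rightarrow> int poly set \<Rightarrow> bool" where
  "linear_ideal p J \<longleftrightarrow> (\<exists>r. [:-r, 1:] \<in> J)"

lemma linear_ideal_root:
  assumes p: "prime p" and J: "maxideal p J" "linear_ideal p J"
  shows "\<exists>r\<in>roots_mod F p. \<forall>A. A \<in> J \<longleftrightarrow> int p dvd poly A r"
proof -
  note J' = pidealD[OF maxidealD(1)[OF J(1)]]
  obtain s where s: "[:-s, 1:] \<in> J" using J(2) by (auto simp: linear_ideal_def)
  have iff: "A \<in> J \<longleftrightarrow> int p dvd poly A s" for A
  proof -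
    have A: "A = [:-s, 1:] * synthetic_div A s + [:poly A s:]" by (rule synthetic_div_correct'[symmetric])
    have "A \<in> J \<longleftrightarrow> [:poly A s:] \<in> J"
    proof
      assume "A \<in> J"
      hence "A - [:-s, 1:] * synthetic_div A s \<in> J" by (intro J'(5) J'(4) s)
      thus "[:poly A s:] \<in> J" using A by (metis add_diff_cancel_left')
    next
      assume "[:poly A s:] \<in> J"
      hence "[:-s, 1:] * synthetic_div A s + [:poly A s:] \<in> J" by (intro J'(2) J'(4) s)
      thus "A \<in> J" using A by simp
    qed
    thus ?thesis using maxideal_const[OF p J(1)] by simp
  qed
  show ?thesis
  proof (intro bexI[of _ "s mod int p"] allI)
    show "s mod int p \<in> roots_mod F p" using iff[of F] maxidealD(4)[OF J(1)] p
      by (simp add: roots_mod_def poly_dvd_mod prime_gt_0_nat)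
    show "A \<in> J \<longleftrightarrow> int p dvd poly A (s mod int p)" for A using iff[of A] by (simp add: poly_dvd_mod)
  qed
qed

text \<open>Without a polynomial \<open>t - r\<close> in \<open>J\<close>, the classes of 1 and
  \<open>t\<close> are linearly independent over the residues modulo \<open>p\<close>; so
  \<open>J\<close> has index at least \<open>p\<^sup>2\<close>.\<close>

lemma nonlinear_incong:
  assumes p: "prime p" and J: "maxideal p J" "\<not> linear_ideal p J"
    and ab: "a \<in> {0..<int p}" "b \<in> {0..<int p}" "a' \<in> {0..<int p}" "b' \<in> {0..<int p}"
    and mem: "[:a, b:] - [:a', b':] \<in> J"
  shows "a = a' \<and> b = b'"
proof -
  note J' = pidealD[OF maxidealD(1)[OF J(1)]]
  have eqI: "x = y" if "x \<in> {0..<int p}" "y \<in> {0..<int p}" "int p dvd x - y" for x y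
  proof -
    have "x mod int p = y mod int p" using that(3) by (simp add: mod_eq_dvd_iff)
    thus ?thesis using that by simp
  qed
  have "b = b'"
  proof (rule ccontr)
    assume "b \<noteq> b'"
    hence "\<not> int p dvd b - b'" using eqI ab by blast
    hence "coprime (b - b') (int p)" using p by (metis prime_imp_coprime coprime_commute prime_nat_int_transfer)
    then obtain u v where uv: "u * (b - b') + v * int p = 1"
      using bezout_int[of "b - b'" "int p"] by (auto simp: coprime_iff_gcd_eq_1)
    have "[:u:] * ([:a, b:] - [:a', b':]) + ([:0, v:] * [:int p:]) \<in> J"
      by (intro J'(2,3) mem maxidealD(3)[OF J(1)])
    moreover have "[:u:] * ([:a, b:] - [:a', b':]) + ([:0, v:] * [:int p:]) = [:- (- u * (a - a')), 1:]"
      using uv by (simp add: algebra_simps)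
    ultimately show False using J(2) unfolding linear_ideal_def by metis
  qed
  moreover have "a = a'"
  proof -
    have "[:a - a':] \<in> J" using mem \<open>b = b'\<close> by simp
    hence "int p dvd a - a'" using maxideal_const[OF p J(1)] by simp
    thus ?thesis using eqI ab by blast
  qed
  ultimately show ?thesis by simp
qed

lemma maxideal_prod:
  assumes J: "maxideal p J" and S: "finite S" "\<And>x. x \<in> S \<Longrightarrow> f x \<notin> J"
  shows "prod f S \<notin> J"
  using S
proof (induction S rule: finite_induct)
  case empty
  thus ?case using maxidealD(2)[OF J] by simp
next
  case (insert x S)
  thus ?case using maxideal_prime[OF J, of "f x" "prod f S"] by auto
qed

lemma pideal_sum: "pideal I \<Longrightarrow> (\<And>x. x \<in> S \<Longrightarrow> f x \<in> I) \<Longrightarrow> sum f S \<in> I"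
  by (induction S rule: infinite_finite_induct) (auto intro: pidealD)

text \<open>Chinese remainder theorem: for each of the given ideals some \<open>e J\<close> lies in
  all the others but not in it. The combinations with coefficients modulo \<open>p\<close> are
  pairwise incongruent modulo \<open>p\<close> and \<open>F\<close>, where there are only
  \<open>p ^ d\<close> classes.\<close>

lemma card_maxideals:
  assumes p: "prime p"
  shows "finite {J. maxideal p J} \<and> card {J. maxideal p J} \<le> d"
proof (rule finite_if_finite_subsets_card_bdd)
  fix G assume G: "G \<subseteq> {J. maxideal p J}" "finite G"
  have "\<exists>e. e \<notin> J \<and> (\<forall>J'\<in>G - {J}. e \<in> J')" if J: "J \<in> G" for J
  proof -
    have mJ: "maxideal p J" using J G by auto
    have "\<exists>x. x \<in> J' \<and> x \<notin> J" if J': "J' \<in> G - {J}" for J'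
    proof (rule ccontr)
      assume "\<not> ?thesis"
      hence "J' \<subseteq> J" by auto
      moreover have "maxideal p J'" using J' G by auto
      ultimately have "J = J'" using maxidealD(1,2)[OF mJ] unfolding maxideal_def by blast
      thus False using J' by simp
    qed
    then obtain x where x: "\<And>J'. J' \<in> G - {J} \<Longrightarrow> x J' \<in> J' \<and> x J' \<notin> J" by metis
    have "prod x (G - {J}) \<notin> J" by (rule maxideal_prod[OF mJ]) (use x G in auto)
    moreover have "prod x (G - {J}) \<in> J'" if J': "J' \<in> G - {J}" for J'
    proof -
      have "prod x (G - {J}) = x J' * prod x (G - {J} - {J'})" using G J' by (intro prod.remove) auto
      moreover have "pideal J'" using J' G maxidealD(1) by auto
      ultimately show ?thesis using pidealD(4)[of J' "x J'"] x[OF J'] by simp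
    qed
    ultimately show ?thesis by blast
  qed
  then obtain e where e: "\<And>J. J \<in> G \<Longrightarrow> e J \<notin> J" "\<And>J J'. J \<in> G \<Longrightarrow> J' \<in> G \<Longrightarrow> J' \<noteq> J \<Longrightarrow> e J \<in> J'"
    by (metis insert_Diff insert_iff)
  let ?T = "{A :: int poly. degree A < d \<and> (\<forall>i. coeff A i \<in> {0..<int p})}"
  let ?P = "PiE G (\<lambda>_. {0..<int p})"
  define X where "X c = (\<Sum>J\<in>G. [:c J:] * e J)" for c :: "int poly set \<Rightarrow> int"
  define g where "g c = map_poly (\<lambda>v. v mod int p) (red (X c))" for c
  have p0: "p > 0" using p by (simp add: prime_gt_0_nat)
  have T: "finite ?T" "card ?T = p ^ d" using card_coeff_in[of "{0..<int p}"] p0 by auto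
  have "g ` ?P \<subseteq> ?T"
  proof clarify
    fix c
    have "\<forall>i\<ge>d. coeff (g c) i = 0" using red(1)[of "X c"] by (simp add: g_def coeff_map_poly coeff_eq_0)
    thus "degree (g c) < d \<and> (\<forall>i. coeff (g c) i \<in> {0..<int p})"
      using d_pos p0 by (simp add: degree_less_iff_coeff g_def coeff_map_poly)
  qed
  moreover have "inj_on g ?P"
  proof (rule inj_onI)
    fix c c' assume c: "c \<in> ?P" "c' \<in> ?P" and eq: "g c = g c'"
    have cong: "int p dvd coeff (red (X c) - red (X c')) i" for i
    proof -
      have "coeff (g c) i = coeff (g c') i" using eq by simp
      thus ?thesis by (simp add: g_def coeff_map_poly mod_eq_dvd_iff)
    qed
    hence "[:int p:] dvd red (X c) - red (X c')" by (simp add: const_poly_dvd_iff)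
    then obtain W where W: "red (X c) - red (X c') = [:int p:] * W" by (auto elim: dvdE)
    obtain V V' where V: "X c - red (X c) = F * V" "X c' - red (X c') = F * V'"
      using red(2)[of "X c"] red(2)[of "X c'"] unfolding dvd_def by blast
    have XX: "X c - X c' = [:int p:] * W + F * (V - V')"
      unfolding right_diff_distrib V[symmetric] W[symmetric] by simp
    have "c J = c' J" if J: "J \<in> G" for J
    proof -
      have mJ: "maxideal p J" using J G by auto
      note J' = pidealD[OF maxidealD(1)[OF mJ]]
      define R where "R = (\<Sum>J'\<in>G - {J}. [:c J' - c' J':] * e J')"
      have XJ: "X c - X c' \<in> J" unfolding XX by (intro J'(2) J'(4) maxidealD(3,4)[OF mJ])
      have "X c - X c' = (\<Sum>J\<in>G. [:c J - c' J:] * e J)"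
        unfolding X_def sum_subtractf[symmetric] by (intro sum.cong refl) (simp add: smult_diff_left)
      also have "\<dots> = [:c J - c' J:] * e J + R"
        unfolding R_def by (rule sum.remove) (use G J in auto)
      finally have e1: "X c - X c' = [:c J - c' J:] * e J + R" .
      have "R \<in> J" unfolding R_def
        by (rule pideal_sum[OF maxidealD(1)[OF mJ]], rule J'(3)) (use e J in auto)
      hence "X c - X c' - R \<in> J" by (rule J'(5)[OF XJ])
      hence "[:c J - c' J:] * e J \<in> J" by (simp only: e1 add_diff_cancel_right')
      hence "e J * [:c J - c' J:] \<in> J" by (simp only: mult.commute)
      hence "[:c J - c' J:] \<in> J" using maxideal_prime[OF mJ] e(1)[OF J] by blast
      hence "int p dvd c J - c' J" using maxideal_const[OF p mJ] by simp
      hence "c J mod int p = c' J mod int p" by (simp add: mod_eq_dvd_iff)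
      moreover have "c J \<in> {0..<int p}" "c' J \<in> {0..<int p}" using c J by auto
      ultimately show ?thesis by simp
    qed
    thus "c = c'" using c by (intro PiE_ext[OF c]) auto
  qed
  ultimately have "card ?P \<le> card ?T" using T(1) by (intro card_inj_on_le)
  hence "p ^ card G \<le> p ^ d" using T(2) G(2) by (simp add: card_PiE)
  thus "card G \<le> d" using prime_gt_1_nat[OF p] power_le_imp_le_exp by blast
qed

end

section \<open>Squares of primes that divide the norm\<close>

lemma card_UN_times_le:
  fixes q n B :: nat
  assumes "finite T" "card T \<le> n" "\<And>x. x \<in> T \<Longrightarrow> card (G x) * q \<le> B"
  shows "card (\<Union>x\<in>T. G x) * q \<le> n * B"
proof -
  have "card (\<Union>x\<in>T. G x) * q \<le> (\<Sum>x\<in>T. card (G x)) * q" by (intro mult_le_mono1 card_UN_le assms)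
  also have "\<dots> = (\<Sum>x\<in>T. card (G x) * q)" by (rule sum_distrib_right)
  also have "\<dots> \<le> (\<Sum>x\<in>T. B)" by (rule sum_mono) (use assms in auto)
  also have "\<dots> \<le> n * B" using assms(2) by simp
  finally show ?thesis .
qed

context monic_irr
begin

text \<open>A substitute for the discriminant: outside its prime divisors all roots of
  \<open>F\<close> modulo \<open>p\<close> are simple.\<close>

definition Delta :: int where
  "Delta = (SOME m. m \<noteq> 0 \<and> (\<exists>U V. pderiv F * U + F * V = [:m:]))"

lemma Delta: "Delta \<noteq> 0" "\<exists>U V. pderiv F * U + F * V = [:Delta:]"
proof -
  have "pderiv F \<noteq> 0" using deg d_pos by (simp add: pderiv_eq_0_iff)
  moreover have "degree (pderiv F) < d" using deg d_pos by (simp add: degree_pderiv)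
  ultimately have "\<exists>m. m \<noteq> 0 \<and> (\<exists>U V. pderiv F * U + F * V = [:m:])" using bez by meson
  from someI_ex[OF this] show "Delta \<noteq> 0" "\<exists>U V. pderiv F * U + F * V = [:Delta:]"
    unfolding Delta_def by auto
qed

lemma simple_root: assumes "\<not> int p dvd Delta" "int p dvd poly F r" shows "\<not> int p dvd poly (pderiv F) r"
proof
  assume *: "int p dvd poly (pderiv F) r"
  obtain U V where UV: "pderiv F * U + F * V = [:Delta:]" using Delta(2) by auto
  have "Delta = poly (pderiv F) r * poly U r + poly F r * poly V r"
    using arg_cong[OF UV, of "\<lambda>P. poly P r"] by simp
  hence "int p dvd Delta" using * assms(2) by simp
  thus False using assms(1) by simp
qed

text \<open>For \<open>p\<close> not dividing \<open>Delta\<close> these are the ways in which \<open>p\<^sup>2\<close> can divide the norm of \<open>A\<close>. Each confines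
  \<open>A\<close> to one of boundedly many ideals of index at least \<open>p\<^sup>2\<close>.\<close>

definition Bad :: "nat \<Rightarrow> int poly \<Rightarrow> bool" where
  "Bad p A \<longleftrightarrow> (\<exists>J. maxideal p J \<and> \<not> linear_ideal p J \<and> A \<in> J) \<or>
     (\<exists>r\<in>roots_mod F p. \<exists>s\<in>roots_mod F p. r \<noteq> s \<and> int p dvd poly A r \<and> int p dvd poly A s) \<or>
     (\<exists>s\<in>roots_mod F (p\<^sup>2). int (p\<^sup>2) dvd poly A s)"

lemma not_Bad_root:
  assumes p: "prime p" and dvd: "int p dvd N A" and nb: "\<not> Bad p A"
  shows "\<exists>r\<in>roots_mod F p. int p dvd poly A r"
proof -
  obtain J where J: "maxideal p J" "A \<in> J" using prime_dvd_N_maxideal[OF p dvd] by auto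
  hence "linear_ideal p J" using nb by (auto simp: Bad_def)
  from linear_ideal_root[OF p J(1) this] J(2) show ?thesis by auto
qed

text \<open>Let \<open>r\<close> be the root obtained from \<open>p\<close> dividing
  \<open>N A\<close>. After moving \<open>r\<close> within its class to \<open>r'\<close> with
  \<open>poly F r'\<close> divisible by \<open>p\<close> exactly once, a multiple of
  \<open>A\<close> by a factor prime to \<open>p\<close> is \<open>(t - r') * Z\<close> modulo
  \<open>F\<close>. The norm of \<open>t - r'\<close> takes up only one factor \<open>p\<close>, so
  \<open>p\<close> divides \<open>N Z\<close>, and \<open>Z\<close> must vanish at the same root.
  This produces a common root of \<open>F\<close> and \<open>A\<close> modulo
  \<open>p\<^sup>2\<close>.\<close>

lemma square_dvd_N_Bad:
  assumes p: "prime p" "\<not> int p dvd Delta" and dvd: "(int p)\<^sup>2 dvd N A"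
  shows "Bad p A"
proof (rule ccontr)
  assume nb: "\<not> Bad p A"
  let ?p = "int p"
  have pp: "prime ?p" using p by simp
  have p0: "?p > 0" "?p \<noteq> 0" using p(1) by (simp_all add: prime_gt_0_nat)
  have "?p dvd N A" using dvd by (meson dvd_power dvd_trans pos2)
  then obtain r where r: "r \<in> roots_mod F p" "?p dvd poly A r" using not_Bad_root[OF p(1) _ nb] by auto
  have Fr: "?p dvd poly F r" using r by (simp add: roots_mod_def)
  have sr: "\<not> ?p dvd poly (pderiv F) r" using simple_root[OF p(2) Fr] .
  have tay: "?p\<^sup>2 dvd poly F (r + ?p * t) - poly F r - ?p * t * poly (pderiv F) r" for t
  proof -
    have "?p\<^sup>2 dvd (?p * t)\<^sup>2" by (simp add: power_mult_distrib)
    thus ?thesis using taylor_square_dvd[of "?p * t" F r] dvd_trans by blast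
  qed
  \<comment> \<open>One of \<open>t = 0\<close> and \<open>t = 1\<close> works: modulo
    \<open>p\<^sup>2\<close> the two values differ by \<open>p\<close> times the derivative at the
    simple root \<open>r\<close>.\<close>
  have "\<exists>t. \<not> ?p\<^sup>2 dvd poly F (r + ?p * t)"
  proof (rule ccontr)
    assume "\<not> ?thesis"
    hence a: "?p\<^sup>2 dvd poly F (r + ?p * 0)" "?p\<^sup>2 dvd poly F (r + ?p * 1)" by blast+
    hence "?p\<^sup>2 dvd (poly F (r + ?p * 1) - poly F r) - (poly F (r + ?p * 1) - poly F r - ?p * 1 * poly (pderiv F) r)"
      using tay[of 1] by (metis add.right_neutral dvd_diff mult_zero_right)
    hence "?p * ?p dvd ?p * poly (pderiv F) r" by (simp add: power2_eq_square)
    hence "?p dvd poly (pderiv F) r" using p0 by simp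
    thus False using sr by simp
  qed
  then obtain t where t: "\<not> ?p\<^sup>2 dvd poly F (r + ?p * t)" by auto
  define r' where "r' = r + ?p * t"
  have rr': "?p dvd poly P r' \<longleftrightarrow> ?p dvd poly P r" for P
    using poly_dvd_mod[of ?p P r'] poly_dvd_mod[of ?p P r] by (simp add: r'_def)
  obtain c where c: "poly F r' = ?p * c" using Fr rr' by (auto elim: dvdE)
  have pc: "\<not> ?p dvd c" using t c unfolding r'_def by (auto simp: power2_eq_square)
  obtain b where b: "poly A r' = ?p * b" using r(2) rr' by (auto elim: dvdE)
  define q where "q = synthetic_div A r'"
  define k where "k = synthetic_div F r'"
  have Aq: "A = [:-r', 1:] * q + [:poly A r':]" unfolding q_def by (rule synthetic_div_correct'[symmetric])
  have Fk: "F = [:-r', 1:] * k + [:poly F r':]" unfolding k_def by (rule synthetic_div_correct'[symmetric])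
  \<comment> \<open>At \<open>r'\<close> the polynomials \<open>A\<close> and \<open>F\<close> have
    the values \<open>p * b\<close> and \<open>p * c\<close>; hence \<open>c * A - b * F\<close>
    vanishes there and is \<open>t - r'\<close> times \<open>Z\<close>.\<close>
  define Z where "Z = [:c:] * q - [:b:] * k"
  have cA: "[:c:] * A = [:-r', 1:] * Z + [:b:] * F"
  proof -
    have cb: "[:c:] * [:poly A r':] = [:b:] * [:poly F r':]" unfolding b c by (simp add: mult_ac)
    have "[:c:] * A = [:-r', 1:] * ([:c:] * q) + [:c:] * [:poly A r':]"
      by (subst Aq) (simp only: distrib_left mult.left_commute)
    also have "\<dots> = [:-r', 1:] * ([:c:] * q) + [:b:] * [:poly F r':]" by (simp only: cb)
    also have "\<dots> = [:-r', 1:] * Z + [:b:] * ([:-r', 1:] * k + [:poly F r':])"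
      unfolding Z_def by (simp only: distrib_left right_diff_distrib mult.left_commute)
    finally show ?thesis using Fk by simp
  qed
  have "F dvd [:c:] * A - [:-r', 1:] * Z" unfolding cA by (simp add: dvd_smult)
  hence "N ([:c:] * A) = N ([:-r', 1:] * Z)" by (rule N_cong)
  hence NN: "c ^ d * N A = (-1) ^ d * (?p * c) * N Z" by (simp only: N_mult N_const N_linear c)
  have "?p * ?p dvd c ^ d * N A" using dvd by (simp add: power2_eq_square)
  hence "?p * ?p dvd ?p * ((-1) ^ d * (c * N Z))" by (simp add: NN mult_ac)
  hence "?p dvd (-1) ^ d * (c * N Z)" using p0 by simp
  hence "?p dvd c * N Z" by (cases "even d") auto
  hence "?p dvd N Z" using pp pc by (simp add: prime_dvd_mult_iff)
  then obtain J where J: "maxideal p J" "Z \<in> J" using prime_dvd_N_maxideal[OF p(1)] by auto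
  note J' = pidealD[OF maxidealD(1)[OF J(1)]]
  have "[:c:] * A \<in> J" unfolding cA by (intro J'(2,3) J(2) maxidealD(4)[OF J(1)])
  moreover have "[:c:] \<notin> J" using maxideal_const[OF p(1) J(1)] pc by simp
  ultimately have "A \<in> J" using maxideal_prime[OF J(1)] by blast
  hence "linear_ideal p J" using nb J(1) by (auto simp: Bad_def)
  from linear_ideal_root[OF p(1) J(1) this] obtain r2 where
    r2: "r2 \<in> roots_mod F p" "\<And>B. B \<in> J \<longleftrightarrow> ?p dvd poly B r2" by auto
  have "r2 = r" using nb r r2 \<open>A \<in> J\<close> unfolding Bad_def by blast
  hence Zr: "?p dvd poly Z r" using r2 J(2) by simp
  \<comment> \<open>A Newton step lifts \<open>r\<close> to a root \<open>s\<close> of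
    \<open>F\<close> modulo \<open>p\<^sup>2\<close>.\<close>
  have "coprime (poly (pderiv F) r) ?p" using sr pp by (metis prime_imp_coprime coprime_commute)
  then obtain u v where uv: "u * poly (pderiv F) r + v * ?p = 1"
    using bezout_int[of "poly (pderiv F) r" "?p"] by (auto simp: coprime_iff_gcd_eq_1)
  obtain m where m: "poly F r = ?p * m" using Fr by (auto elim: dvdE)
  define s where "s = r + ?p * (- u * m)"
  have Fs: "?p\<^sup>2 dvd poly F s"
  proof -
    have "poly F r + ?p * (- u * m) * poly (pderiv F) r = ?p * m * (1 - u * poly (pderiv F) r)"
      by (simp add: m algebra_simps)
    also have "1 - u * poly (pderiv F) r = v * ?p" using uv by linarith
    finally have e: "poly F r + ?p * (- u * m) * poly (pderiv F) r = ?p\<^sup>2 * (m * v)" by (simp add: power2_eq_square)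
    have e2: "poly F s = (poly F s - poly F r - ?p * (- u * m) * poly (pderiv F) r) + ?p\<^sup>2 * (m * v)"
      unfolding e[symmetric] by simp
    have "?p\<^sup>2 dvd (poly F s - poly F r - ?p * (- u * m) * poly (pderiv F) r) + ?p\<^sup>2 * (m * v)"
      using tay[of "- u * m"] unfolding s_def by (intro dvd_add) auto
    thus ?thesis by (subst e2)
  qed
  have sp: "?p dvd poly P s \<longleftrightarrow> ?p dvd poly P r" for P
  proof -
    have "s mod ?p = r mod ?p" unfolding s_def by (rule mod_mult_self2)
    thus ?thesis using poly_dvd_mod[of ?p P s] poly_dvd_mod[of ?p P r] by simp
  qed
  have "c * poly A s = (s - r') * poly Z s + b * poly F s"
    using arg_cong[OF cA, of "\<lambda>P. poly P s"] by (simp add: algebra_simps)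
  moreover have "?p\<^sup>2 dvd (s - r') * poly Z s"
  proof -
    have "s - r' = ?p * (- u * m - t)" by (simp add: s_def r'_def algebra_simps)
    hence "?p dvd s - r'" by simp
    moreover have "?p dvd poly Z s" using sp Zr by simp
    ultimately show ?thesis unfolding power2_eq_square by (rule mult_dvd_mono)
  qed
  ultimately have "?p\<^sup>2 dvd c * poly A s" using Fs by simp
  moreover have "coprime (?p\<^sup>2) c" using pp pc by (metis prime_imp_coprime coprime_power_left_iff)
  ultimately have As: "?p\<^sup>2 dvd poly A s" by (simp add: coprime_dvd_mult_right_iff)
  have "s mod ?p\<^sup>2 \<in> roots_mod F (p\<^sup>2)" using Fs p0 by (simp add: roots_mod_def poly_dvd_mod)
  moreover have "int (p\<^sup>2) dvd poly A (s mod ?p\<^sup>2)" using As by (simp add: poly_dvd_mod)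
  ultimately show False using nb unfolding Bad_def by blast
qed

text \<open>If the count is not zero, an element counted serves itself as the small element of the
  ideal. So the index of the ideal may be arbitrarily large, at the price of a box larger by a
  constant factor.\<close>

lemma ideal_count_nonzero:
  assumes I: "pideal I" "F \<in> I" and S: "finite S" "\<And>s s'. s \<in> S \<Longrightarrow> s' \<in> S \<Longrightarrow> s \<noteq> s' \<Longrightarrow> s - s' \<notin> I"
    and H: "H \<ge> 0"
  shows "card (I \<inter> (box H - {0})) * card S \<le> nat (2 * (H + C0 * H) + 1) ^ d"
proof (cases "I \<inter> (box H - {0}) = {}")
  case False
  then obtain A where A: "A \<in> I" "A \<in> box H" "A \<noteq> 0" by auto
  have "card (I \<inter> (box H - {0})) \<le> card (I \<inter> box H)"
    using card_box(1)[OF H] by (intro card_mono) auto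
  hence "card (I \<inter> (box H - {0})) * card S \<le> card (I \<inter> box H) * card S" by simp
  also have "\<dots> \<le> nat (2 * (H + C0 * H) + 1) ^ d" by (rule ideal_count_upper[OF I A S H])
  finally show ?thesis .
qed simp

lemma card_linear_polys:
  "card ((\<lambda>(a, b). [:a, b:]) ` ({0..<int p} \<times> {0..<int p})) = p\<^sup>2"
  by (subst card_image) (auto simp: inj_on_def card_cartesian_product power2_eq_square)

text \<open>There are at most \<open>d\<close> maximal ideals, \<open>d * d\<close> pairs of roots
  and \<open>d\<close> roots modulo \<open>p\<^sup>2\<close>. In each case \<open>p\<^sup>2\<close>
  incongruent polynomials are explicit: linear ones in the first two, constants in the
  third.\<close>

lemma Bad_count:
  assumes p: "prime p" "\<not> int p dvd Delta" and H: "H \<ge> 0"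
  shows "card {A \<in> box H - {0}. Bad p A} * p\<^sup>2 \<le> (d + d * d + d) * nat (2 * (H + C0 * H) + 1) ^ d"
proof -
  let ?X = "box H - {0}"
  let ?B = "nat (2 * (H + C0 * H) + 1) ^ d"
  let ?L = "(\<lambda>(a, b). [:a, b:] :: int poly) ` ({0..<int p} \<times> {0..<int p})"
  define J1 where "J1 = {J. maxideal p J \<and> \<not> linear_ideal p J}"
  define R where "R = roots_mod F p"
  define R2 where "R2 = {(r, s). r \<in> R \<and> s \<in> R \<and> r \<noteq> s}"
  define S where "S = roots_mod F (p\<^sup>2)"
  have finX: "finite ?X" using card_box(1)[OF H] by simp
  have J1: "finite J1" "card J1 \<le> d"
  proof -
    have *: "J1 \<subseteq> {J. maxideal p J}" by (auto simp: J1_def)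
    show "finite J1" using card_maxideals[OF p(1)] * finite_subset by blast
    show "card J1 \<le> d" using card_maxideals[OF p(1)] card_mono[OF _ *] by linarith
  qed
  have R: "finite R" "card R \<le> d" using rho_le_d[OF p(1)] by (auto simp: R_def rho_def)
  have R2s: "R2 \<subseteq> R \<times> R" by (auto simp: R2_def)
  have R2: "finite R2" "card R2 \<le> d * d"
  proof -
    show "finite R2" using R2s R(1) finite_subset by blast
    have "card R2 \<le> card (R \<times> R)" using R2s R(1) by (intro card_mono) auto
    also have "\<dots> \<le> d * d" using R(2) by (simp add: card_cartesian_product mult_le_mono)
    finally show "card R2 \<le> d * d" .
  qed
  have S: "finite S" "card S \<le> d"
  proof -
    show "finite S" by (simp add: S_def)
    have "rho F (p\<^sup>2) \<le> rho F p" by (rule rho_prime_power_le[OF p(1)]) (use simple_root[OF p(2)] in auto)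
    thus "card S \<le> d" using rho_le_d[OF p(1)] by (simp add: S_def rho_def)
  qed
  have c1: "card (J \<inter> ?X) * p\<^sup>2 \<le> ?B" if J: "J \<in> J1" for J
  proof -
    have mJ: "maxideal p J" "\<not> linear_ideal p J" using J by (auto simp: J1_def)
    have "card (J \<inter> ?X) * card ?L \<le> ?B"
    proof (rule ideal_count_nonzero[OF maxidealD(1,4)[OF mJ(1)] _ _ H])
      fix s s' assume *: "s \<in> ?L" "s' \<in> ?L" "s \<noteq> s'"
      then obtain a b a' b' where "s = [:a, b:]" "s' = [:a', b':]" "a \<in> {0..<int p}" "b \<in> {0..<int p}"
        "a' \<in> {0..<int p}" "b' \<in> {0..<int p}" by auto
      thus "s - s' \<notin> J" using nonlinear_incong[OF p(1) mJ, of a b a' b'] *(3) by auto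
    qed simp
    thus ?thesis by (simp only: card_linear_polys)
  qed
  have c2: "card ({A. int p dvd poly A r \<and> int p dvd poly A s} \<inter> ?X) * p\<^sup>2 \<le> ?B" if rs: "(r, s) \<in> R2" for r s
  proof -
    let ?I = "{A. int p dvd poly A r \<and> int p dvd poly A s}"
    have r: "0 \<le> r" "r < int p" "0 \<le> s" "s < int p" "r \<noteq> s" "int p dvd poly F r" "int p dvd poly F s"
      using rs by (auto simp: R2_def R_def roots_mod_def)
    have eqI: "x = y" if "x \<in> {0..<int p}" "y \<in> {0..<int p}" "int p dvd x - y" for x y
    proof -
      have "x mod int p = y mod int p" using that(3) by (simp add: mod_eq_dvd_iff)
      thus ?thesis using that by simp
    qed
    have "card (?I \<inter> ?X) * card ?L \<le> ?B"
    proof (rule ideal_count_nonzero[OF _ _ _ _ H])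
      show "pideal ?I" by (auto simp: pideal_def)
      show "F \<in> ?I" using r by simp
      fix f f' assume *: "f \<in> ?L" "f' \<in> ?L" "f \<noteq> f'"
      then obtain a b a' b' where ab: "f = [:a, b:]" "f' = [:a', b':]" "a \<in> {0..<int p}" "b \<in> {0..<int p}"
        "a' \<in> {0..<int p}" "b' \<in> {0..<int p}" by auto
      show "f - f' \<notin> ?I"
      proof
        assume "f - f' \<in> ?I"
        hence 1: "int p dvd (a - a') + r * (b - b')" "int p dvd (a - a') + s * (b - b')" using ab by auto
        hence "int p dvd ((a - a') + r * (b - b')) - ((a - a') + s * (b - b'))" by (rule dvd_diff)
        hence "int p dvd (r - s) * (b - b')" by (simp add: algebra_simps)
        moreover have "\<not> int p dvd r - s" using eqI[of r s] r by auto
        ultimately have "int p dvd b - b'" using p(1) by (simp add: prime_dvd_mult_iff)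
        hence b: "b = b'" using eqI ab by blast
        hence "int p dvd a - a'" using 1 by simp
        hence "a = a'" using eqI ab by blast
        thus False using b ab *(3) by simp
      qed
    qed simp
    thus ?thesis by (simp only: card_linear_polys)
  qed
  have c3: "card (rideal (p\<^sup>2) s \<inter> ?X) * p\<^sup>2 \<le> ?B" if s: "s \<in> S" for s
  proof -
    have "card (rideal (p\<^sup>2) s \<inter> ?X) * card ((\<lambda>c::int. [:c:]) ` {0..<int (p\<^sup>2)}) \<le> ?B"
    proof (rule ideal_count_nonzero[OF pideal_rideal _ _ _ H])
      show "F \<in> rideal (p\<^sup>2) s" using s by (simp add: S_def rideal_def roots_mod_def)
    qed (use rideal_incong in auto)
    thus ?thesis by (simp only: card_consts)
  qed
  let ?U1 = "\<Union>J\<in>J1. J \<inter> ?X"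
  let ?U2 = "\<Union>x\<in>R2. {A. int p dvd poly A (fst x) \<and> int p dvd poly A (snd x)} \<inter> ?X"
  let ?U3 = "\<Union>s\<in>S. rideal (p\<^sup>2) s \<inter> ?X"
  have "{A \<in> ?X. Bad p A} \<subseteq> ?U1 \<union> ?U2 \<union> ?U3"
  proof
    fix A assume "A \<in> {A \<in> ?X. Bad p A}"
    hence A: "A \<in> ?X" "Bad p A" by simp_all
    from A(2) consider J where "J \<in> J1" "A \<in> J" | r s where "(r, s) \<in> R2" "int p dvd poly A r" "int p dvd poly A s"
      | s where "s \<in> S" "A \<in> rideal (p\<^sup>2) s"
      unfolding Bad_def J1_def R2_def R_def S_def rideal_def by blast
    thus "A \<in> ?U1 \<union> ?U2 \<union> ?U3"
    proof cases
      case 2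
      hence "A \<in> ?U2" using A(1) by (intro UN_I[of "(r, s)"]) simp_all
      thus ?thesis by blast
    qed (use A(1) in blast)+
  qed
  moreover have "finite (?U1 \<union> ?U2 \<union> ?U3)" by (rule finite_subset[OF _ finX]) blast
  ultimately have "card {A \<in> ?X. Bad p A} \<le> card (?U1 \<union> ?U2 \<union> ?U3)" by (rule card_mono[rotated])
  also have "\<dots> \<le> card ?U1 + card ?U2 + card ?U3"
    using card_Un_le[of "?U1 \<union> ?U2" ?U3] card_Un_le[of ?U1 ?U2] by linarith
  finally have "card {A \<in> ?X. Bad p A} * p\<^sup>2 \<le> (card ?U1 + card ?U2 + card ?U3) * p\<^sup>2"
    by (rule mult_le_mono1)
  hence total: "card {A \<in> ?X. Bad p A} * p\<^sup>2 \<le> card ?U1 * p\<^sup>2 + card ?U2 * p\<^sup>2 + card ?U3 * p\<^sup>2"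
    by (simp only: add_mult_distrib)
  have "card ?U1 * p\<^sup>2 \<le> d * ?B" by (rule card_UN_times_le[OF J1 c1])
  moreover have "card ?U2 * p\<^sup>2 \<le> (d * d) * ?B" by (rule card_UN_times_le[OF R2]) (use c2 in auto)
  moreover have "card ?U3 * p\<^sup>2 \<le> d * ?B" by (rule card_UN_times_le[OF S c3])
  ultimately show ?thesis using total unfolding add_mult_distrib by linarith
qed

end

section \<open>The lower Mertens estimate\<close>

lemma card_residue_interval:
  assumes "q > 0"
  shows "real (card {n\<in>{a..<a + int L}. int q dvd n - b}) \<le> real L / real q + 1"
proof (cases "L = 0")
  case False
  let ?S = "{n\<in>{a..<a + int L}. int q dvd n - b}"
  have "inj_on (\<lambda>n. (n - a) div int q) ?S"
  proof (rule inj_onI)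
    fix m n assume mn: "m \<in> ?S" "n \<in> ?S" "(m - a) div int q = (n - a) div int q"
    have "int q dvd m - b" "int q dvd n - b" using mn by auto
    hence "int q dvd (m - b) - (n - b)" by (rule dvd_diff)
    hence "(m - a) mod int q = (n - a) mod int q" by (simp add: mod_eq_dvd_iff)
    hence "m - a = n - a" using mn(3) by (metis mult_div_mod_eq)
    thus "m = n" by simp
  qed
  moreover have "(\<lambda>n. (n - a) div int q) ` ?S \<subseteq> {0..int ((L - 1) div q)}"
  proof clarify
    fix n assume n: "n \<in> {a..<a + int L}"
    have "(n - a) div int q \<le> int (L - 1) div int q" using n assms False by (intro zdiv_mono1) auto
    thus "(n - a) div int q \<in> {0..int ((L - 1) div q)}" using n assms by (simp add: zdiv_int pos_imp_zdiv_nonneg_iff)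
  qed
  ultimately have "card ?S \<le> card {0..int ((L - 1) div q)}" by (intro card_inj_on_le) auto
  hence "real (card ?S) \<le> real ((L - 1) div q) + 1" by simp
  also have "real ((L - 1) div q) \<le> real (L - 1) / real q" by (rule of_nat_div_le_of_nat) 
  also have "\<dots> \<le> real L / real q" by (intro divide_right_mono) auto
  finally show ?thesis by simp
qed auto

text \<open>Fix one point \<open>b0\<close>. At most \<open>2 * lam\<close> points lie within
  \<open>lam\<close> of it; at the others the monic quotient by \<open>t - b0\<close> is at most
  \<open>2 * T / lam\<close>, and the induction continues with it. Each of the \<open>n\<close>
  rounds doubles the bound, which explains \<open>2 ^ n\<close>.\<close>

lemma small_values_monic:
  fixes G :: "int poly" and lam :: nat
  assumes "degree G = n" "coeff G n = 1" "finite Y" "\<And>b. b \<in> Y \<Longrightarrow> real_of_int \<bar>poly G b\<bar> \<le> T"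
    "2 ^ n * T < real lam ^ n" "lam > 0"
  shows "card Y \<le> 2 * n * lam"
  using assms(1-5)
proof (induction n arbitrary: G Y T)
  case 0
  then obtain c where "G = [:c:]" by (metis degree_eq_zeroE)
  hence G: "G = 1" using 0(2) by (simp add: one_pCons)
  have "Y = {}"
  proof (rule ccontr)
    assume "Y \<noteq> {}"
    then obtain b where "b \<in> Y" by auto
    from 0(4)[OF this] 0(5) G show False by simp
  qed
  thus ?case by simp
next
  case (Suc n)
  show ?case
  proof (cases "Y = {}")
    case False
    then obtain b0 where b0: "b0 \<in> Y" by auto
    define Q where "Q = synthetic_div G b0"
    have eq: "G = [:-b0, 1:] * Q + [:poly G b0:]" unfolding Q_def by (rule synthetic_div_correct'[symmetric])
    have dQ: "degree Q = n" using Suc.prems(1) by (simp add: Q_def degree_synthetic_div)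
    have "coeff G (Suc n) = coeff Q n" using dQ by (subst eq) (simp add: coeff_eq_0)
    hence lQ: "coeff Q n = 1" using Suc.prems(2) by simp
    define Y1 where "Y1 = {b\<in>Y. \<bar>b - b0\<bar> < int lam}"
    define Y2 where "Y2 = {b\<in>Y. \<bar>b - b0\<bar> \<ge> int lam}"
    have Y: "Y = Y1 \<union> Y2" by (auto simp: Y1_def Y2_def)
    have "Y1 \<subseteq> {b0 - int lam..<b0 + int lam}" by (auto simp: Y1_def)
    hence "card Y1 \<le> card {b0 - int lam..<b0 + int lam}" by (intro card_mono) auto
    hence c1: "card Y1 \<le> 2 * lam" by simp
    have c2: "card Y2 \<le> 2 * n * lam"
    proof (rule Suc.IH[OF dQ lQ, of Y2 "2 * T / real lam"])
      show "finite Y2" using Suc.prems(3) by (simp add: Y2_def)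
      show "2 ^ n * (2 * T / real lam) < real lam ^ n" using Suc.prems(5) assms(6) by (simp add: field_simps)
      fix b assume b: "b \<in> Y2"
      have "poly G b = (b - b0) * poly Q b + poly G b0" by (subst eq) (simp add: algebra_simps)
      hence "\<bar>b - b0\<bar> * \<bar>poly Q b\<bar> \<le> \<bar>poly G b\<bar> + \<bar>poly G b0\<bar>" unfolding abs_mult[symmetric] by linarith
      hence "real_of_int (\<bar>b - b0\<bar> * \<bar>poly Q b\<bar>) \<le> real_of_int (\<bar>poly G b\<bar> + \<bar>poly G b0\<bar>)"
        by (simp only: of_int_le_iff)
      also have "\<dots> \<le> 2 * T" using Suc.prems(4)[OF b0] Suc.prems(4)[of b] b by (simp add: Y2_def)
      finally have "real_of_int \<bar>b - b0\<bar> * real_of_int \<bar>poly Q b\<bar> \<le> 2 * T" by simp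
      moreover have "real lam * real_of_int \<bar>poly Q b\<bar> \<le> real_of_int \<bar>b - b0\<bar> * real_of_int \<bar>poly Q b\<bar>"
      proof (rule mult_right_mono)
        have "int lam \<le> \<bar>b - b0\<bar>" using b by (simp add: Y2_def)
        thus "real lam \<le> real_of_int \<bar>b - b0\<bar>" by linarith
      qed simp
      ultimately show "real_of_int \<bar>poly Q b\<bar> \<le> 2 * T / real lam"
        using assms(6) by (simp add: field_simps)
    qed
    have "card Y \<le> card Y1 + card Y2" unfolding Y by (rule card_Un_le)
    also have "\<dots> \<le> 2 * Suc n * lam" using c1 c2 by (simp add: algebra_simps)
    finally show ?thesis .
  qed simp
qed

lemma prime_power_dvd_cancel:
  fixes p :: int
  assumes p: "prime p" and dvd: "p ^ (j + i) dvd x * y" and nd: "\<not> p ^ Suc i dvd x"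
  shows "p ^ j dvd y"
proof -
  have x0: "x \<noteq> 0" using nd by auto
  have u: "\<not> is_unit p" using p by (auto simp: not_prime_unit)
  show ?thesis
  proof (cases "y = 0")
    case False
    have "j + i \<le> multiplicity p (x * y)" using dvd x0 False u by (intro multiplicity_geI) auto
    also have "\<dots> = multiplicity p x + multiplicity p y"
      using p x0 False by (intro prime_elem_multiplicity_mult_distrib) auto
    also have "multiplicity p x \<le> i"
    proof (rule ccontr)
      assume "\<not> ?thesis"
      hence "p ^ Suc i dvd x" by (intro multiplicity_dvd') auto
      thus False using nd by simp
    qed
    finally have "j \<le> multiplicity p y" by simp
    thus ?thesis by (rule multiplicity_dvd')
  qed simp
qed

text \<open>The same induction with the \<open>p\<close>-adic distance. Points that agree with
  \<open>b0\<close> modulo \<open>p ^ Suc i\<close> are counted directly; at the others the quotient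
  loses at most \<open>p ^ i\<close>, so the exponent \<open>n * i + 1\<close> is down to 1 when the
  polynomial has become constant.\<close>

lemma padic_values_monic:
  fixes G :: "int poly" and p :: nat
  assumes p: "prime p" and "degree G = n" "coeff G n = 1" "Y \<subseteq> {a..<a + int L}"
    "\<And>b. b \<in> Y \<Longrightarrow> int p ^ (n * i + 1) dvd poly G b"
  shows "real (card Y) \<le> real n * (real L / real p ^ Suc i + 1)"
  using assms(2-)
proof (induction n arbitrary: G Y)
  case 0
  then obtain c where "G = [:c:]" by (metis degree_eq_zeroE)
  hence G: "G = 1" using 0(2) by (simp add: one_pCons)
  have "Y = {}"
  proof (rule ccontr)
    assume "Y \<noteq> {}"
    then obtain b where "b \<in> Y" by auto
    from 0(4)[OF this] G p show False by (simp add: prime_gt_1_nat not_prime_unit)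
  qed
  thus ?case by simp
next
  case (Suc n)
  show ?case
  proof (cases "Y = {}")
    case True
    thus ?thesis by simp
  next
    case False
    then obtain b0 where b0: "b0 \<in> Y" by auto
    define Q where "Q = synthetic_div G b0"
    have eq: "G = [:-b0, 1:] * Q + [:poly G b0:]" unfolding Q_def by (rule synthetic_div_correct'[symmetric])
    have dQ: "degree Q = n" using Suc.prems(1) by (simp add: Q_def degree_synthetic_div)
    have "coeff G (Suc n) = coeff Q n" using dQ by (subst eq) (simp add: coeff_eq_0)
    hence lQ: "coeff Q n = 1" using Suc.prems(2) by simp
    define Y1 where "Y1 = {b\<in>Y. int (p ^ Suc i) dvd b - b0}"
    define Y2 where "Y2 = {b\<in>Y. \<not> int (p ^ Suc i) dvd b - b0}"
    have Y: "Y = Y1 \<union> Y2" by (auto simp: Y1_def Y2_def)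
    have "Y1 \<subseteq> {b\<in>{a..<a + int L}. int (p ^ Suc i) dvd b - b0}" using Suc.prems(3) by (auto simp: Y1_def)
    hence "card Y1 \<le> card {b\<in>{a..<a + int L}. int (p ^ Suc i) dvd b - b0}"
      by (intro card_mono finite_subset[of "{b\<in>{a..<a + int L}. int (p ^ Suc i) dvd b - b0}" "{a..<a + int L}"]) auto
    moreover have "p ^ Suc i > 0" using prime_gt_0_nat[OF p] by simp
    ultimately have "real (card Y1) \<le> real L / real (p ^ Suc i) + 1"
      using card_residue_interval[of "p ^ Suc i" a L b0] by linarith
    hence "real (card Y1) \<le> real L / real p ^ Suc i + 1" by (simp only: of_nat_power)
    moreover have "real (card Y2) \<le> real n * (real L / real p ^ Suc i + 1)"
    proof (rule Suc.IH[OF dQ lQ])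
      show "Y2 \<subseteq> {a..<a + int L}" using Suc.prems(3) by (auto simp: Y2_def)
      fix b assume b: "b \<in> Y2"
      have "poly G b = (b - b0) * poly Q b + poly G b0" by (subst eq) (simp add: algebra_simps)
      hence "(b - b0) * poly Q b = poly G b - poly G b0" by simp
      moreover have "int p ^ (Suc n * i + 1) dvd poly G b - poly G b0"
        using b b0 Suc.prems(4) by (intro dvd_diff) (auto simp: Y2_def)
      moreover have "Suc n * i + 1 = (n * i + 1) + i" by simp
      ultimately have "int p ^ ((n * i + 1) + i) dvd (b - b0) * poly Q b" by (simp only:)
      moreover have "\<not> int p ^ Suc i dvd b - b0" using b by (simp add: Y2_def)
      ultimately show "int p ^ (n * i + 1) dvd poly Q b" using p prime_power_dvd_cancel[of "int p" "n * i + 1" i "b - b0" "poly Q b"] by simp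
    qed
    moreover have "real (card Y) \<le> real (card Y1) + real (card Y2)"
      unfolding Y using card_Un_le[of Y1 Y2] by linarith
    moreover have "real (Suc n) * (real L / real p ^ Suc i + 1) =
        (real L / real p ^ Suc i + 1) + real n * (real L / real p ^ Suc i + 1)"
      by (simp only: of_nat_Suc distrib_right mult_1)
    ultimately show ?thesis by linarith
  qed
qed

lemma ln_eq_sum_multiplicity:
  assumes "n > 0"
  shows "ln (real n) = (\<Sum>p\<in>prime_factors n. real (multiplicity p n) * ln (real p))"
proof -
  have "real n = real (\<Prod>p\<in>prime_factors n. p ^ multiplicity p n)"
    using prime_factorization_nat[OF assms] by simp
  also have "\<dots> = (\<Prod>p\<in>prime_factors n. real p ^ multiplicity p n)" by simp
  finally have "ln (real n) = ln (\<Prod>p\<in>prime_factors n. real p ^ multiplicity p n)" by simp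
  also have "\<dots> = (\<Sum>p\<in>prime_factors n. ln (real p ^ multiplicity p n))"
    by (rule ln_prod) (auto simp: prime_gt_0_nat in_prime_factors_imp_prime)
  also have "\<dots> = (\<Sum>p\<in>prime_factors n. real (multiplicity p n) * ln (real p))"
    by (intro sum.cong refl ln_realpow)
  finally show ?thesis .
qed

lemma inverse_square_le_telescope: "s > 0 \<Longrightarrow> 1 / (s + 1)\<^sup>2 \<le> 1 / s - 1 / (s + 1 :: real)"
proof -
  assume s: "s > 0"
  have "1 / (s + 1)\<^sup>2 \<le> 1 / (s * (s + 1))"
  proof (rule frac_le)
    show "s * (s + 1) \<le> (s + 1)\<^sup>2" unfolding power2_eq_square using s by (intro mult_right_mono) simp_all
    show "0 < s * (s + 1)" using s by (intro mult_pos_pos) simp_all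
  qed simp_all
  also have "\<dots> = 1 / s - 1 / (s + 1)" using s diff_frac_eq[of s "s + 1" 1 1] by simp
  finally show ?thesis .
qed

lemma sum_inverse_squares_tail:
  fixes w :: nat
  assumes "w > 0" "finite S" "\<And>n. n \<in> S \<Longrightarrow> n > w"
  shows "(\<Sum>n\<in>S. 1 / (real n)\<^sup>2) \<le> 1 / real w"
proof -
  define m where "m = Max (insert 0 S)"
  let ?g = "\<lambda>i. w + i + 1"
  let ?h = "\<lambda>i. 1 / (real w + real i)"
  have "S \<subseteq> ?g ` {..<m}"
  proof
    fix n assume n: "n \<in> S"
    hence "n \<le> m" unfolding m_def using assms(2) by (intro Max_ge) auto
    moreover have "n > w" using assms(3)[OF n] .
    ultimately show "n \<in> ?g ` {..<m}" using assms(1) by (intro image_eqI[of _ _ "n - w - 1"]) auto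
  qed
  hence "(\<Sum>n\<in>S. 1 / (real n)\<^sup>2) \<le> (\<Sum>n\<in>?g ` {..<m}. 1 / (real n)\<^sup>2)" by (intro sum_mono2) auto
  also have "\<dots> = (\<Sum>i<m. 1 / (real w + real i + 1)\<^sup>2)" by (subst sum.reindex) (auto simp: inj_on_def add_ac)
  also have "\<dots> \<le> (\<Sum>i<m. ?h i - ?h (Suc i))"
  proof (rule sum_mono)
    fix i
    show "1 / (real w + real i + 1)\<^sup>2 \<le> ?h i - ?h (Suc i)"
      using inverse_square_le_telescope[of "real w + real i"] assms(1) by (simp add: add_ac)
  qed
  also have "\<dots> = ?h 0 - ?h m" by (rule sum_lessThan_telescope')
  also have "\<dots> \<le> 1 / real w" by simp
  finally show ?thesis .
qed

section \<open>Exceptional polynomials in a box\<close>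

context monic_irr
begin

text \<open>A bound for the constant coefficient with all others fixed carries over to the box. By
  \<open>N_monic_poly\<close> the fibres then concern one monic polynomial at a time.\<close>

lemma card_box_fibres:
  assumes E: "E \<subseteq> box H" and H: "H \<ge> 0"
    and fib: "\<And>A. real (card {a\<in>{-H..H}. [:a:] + A \<in> E}) \<le> m"
  shows "real (card E) * real_of_int (2 * H + 1) \<le> m * real_of_int (2 * H + 1) ^ d"
proof -
  define B0 where "B0 = {A\<in>box H. coeff A 0 = 0}"
  have finB: "finite (box H)" by (rule card_box(1)[OF H])
  have finB0: "finite B0" using finB by (simp add: B0_def)
  let ?S = "SIGMA A:B0. {a\<in>{-H..H}. [:a:] + A \<in> E}"
  have "E \<subseteq> (\<lambda>(A, a). [:a:] + A) ` ?S"
  proof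
    fix A assume A: "A \<in> E"
    hence AH: "A \<in> box H" using E by auto
    have "A - [:coeff A 0:] \<in> B0"
    proof -
      have "degree (A - [:coeff A 0:]) < d" using AH d_pos by (auto simp: box_def degree_diff_less)
      moreover have "\<bar>coeff (A - [:coeff A 0:]) i\<bar> \<le> H" for i
        using AH H by (cases i) (auto simp: box_def)
      ultimately show ?thesis by (simp add: B0_def box_def)
    qed
    moreover have "coeff A 0 \<in> {-H..H}" using AH by (auto simp: box_def abs_le_iff dest!: spec[of _ 0])
    moreover have "A = [:coeff A 0:] + (A - [:coeff A 0:])" by simp
    ultimately show "A \<in> (\<lambda>(A, a). [:a:] + A) ` ?S" using A
      by (intro image_eqI[of _ _ "(A - [:coeff A 0:], coeff A 0)"]) auto
  qed
  moreover have finf: "finite {a\<in>{-H..H}. [:a:] + A \<in> E}" for A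
    by (rule finite_subset[of _ "{-H..H}"]) auto
  hence "finite ?S" using finB0 by (intro finite_SigmaI)
  ultimately have "card E \<le> card ?S" by (rule surj_card_le[rotated])
  also have "\<dots> = (\<Sum>A\<in>B0. card {a\<in>{-H..H}. [:a:] + A \<in> E})"
    using finB0 finf by (intro card_SigmaI) auto
  finally have "real (card E) \<le> (\<Sum>A\<in>B0. real (card {a\<in>{-H..H}. [:a:] + A \<in> E}))"
    unfolding of_nat_sum[symmetric] of_nat_le_iff .
  also have "\<dots> \<le> (\<Sum>A\<in>B0. m)" by (intro sum_mono fib)
  finally have 1: "real (card E) \<le> real (card B0) * m" by simp
  have m0: "m \<ge> 0" by (rule order_trans[OF of_nat_0_le_iff fib[of 0]])
  have "card (B0 \<times> {-H..H}) \<le> card (box H)"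
  proof (rule card_inj_on_le[of "\<lambda>(A, a). [:a:] + A"])
    show "inj_on (\<lambda>(A, a). [:a:] + A) (B0 \<times> {-H..H})"
    proof (rule inj_onI, clarify)
      fix A a A' a' assume *: "A \<in> B0" "A' \<in> B0" "[:a:] + A = [:a':] + A'"
      have "a = a'" using arg_cong[OF *(3), of "\<lambda>P. coeff P 0"] *(1,2) by (simp add: B0_def)
      thus "A = A' \<and> a = a'" using *(3) by simp
    qed
    show "(\<lambda>(A, a). [:a:] + A) ` (B0 \<times> {-H..H}) \<subseteq> box H"
    proof clarify
      fix A a assume *: "A \<in> B0" "a \<in> {-H..H}"
      have "degree ([:a:] + A) < d" using * d_pos by (intro degree_add_less) (auto simp: B0_def box_def)
      moreover have "\<bar>coeff ([:a:] + A) i\<bar> \<le> H" for i using * by (cases i) (auto simp: B0_def box_def)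
      ultimately show "[:a:] + A \<in> box H" by (simp add: box_def)
    qed
  qed (rule finB)
  moreover have "card {-H..H} = nat (2 * H + 1)" by simp
  ultimately have "card B0 * nat (2 * H + 1) \<le> nat (2 * H + 1) ^ d"
    by (simp only: card_cartesian_product card_box(2)[OF H])
  hence "real (card B0 * nat (2 * H + 1)) \<le> real (nat (2 * H + 1) ^ d)" by (simp only: of_nat_le_iff)
  moreover have "real (nat (2 * H + 1)) = real_of_int (2 * H + 1)" using H by simp
  ultimately have 2: "real (card B0) * real_of_int (2 * H + 1) \<le> real_of_int (2 * H + 1) ^ d"
    by (simp only: of_nat_mult of_nat_power)
  have "real (card E) * real_of_int (2 * H + 1) \<le> (real (card B0) * m) * real_of_int (2 * H + 1)"
    by (rule mult_right_mono[OF 1]) (use H in simp)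
  also have "\<dots> = m * (real (card B0) * real_of_int (2 * H + 1))" by simp
  also have "\<dots> \<le> m * real_of_int (2 * H + 1) ^ d" by (rule mult_left_mono[OF 2 m0])
  finally show ?thesis .
qed

lemma card_small_norm:
  assumes H: "H \<ge> 0" and lam: "lam > 0" "2 ^ d * T < real lam ^ d"
  shows "real (card {A\<in>box H. real_of_int \<bar>N A\<bar> \<le> T}) * real_of_int (2 * H + 1)
      \<le> real (2 * d * lam) * real_of_int (2 * H + 1) ^ d"
proof (rule card_box_fibres[OF _ H])
  fix A
  obtain G where G: "degree G = d" "coeff G d = 1" "\<And>a. N ([:a:] + A) = poly G a" using N_monic_poly by blast
  have "card {a\<in>{-H..H}. [:a:] + A \<in> {A\<in>box H. real_of_int \<bar>N A\<bar> \<le> T}} \<le> 2 * d * lam"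
    by (rule small_values_monic[OF G(1,2) finite_subset[of _ "{-H..H}"] _ lam(2,1)]) (use G(3) in auto)
  thus "real (card {a\<in>{-H..H}. [:a:] + A \<in> {A\<in>box H. real_of_int \<bar>N A\<bar> \<le> T}}) \<le> real (2 * d * lam)"
    by (simp only: of_nat_le_iff)
qed auto

lemma card_prime_power_norm:
  assumes H: "H \<ge> 0" and p: "prime p"
  shows "real (card {A\<in>box H. int p ^ (d * i + 1) dvd N A}) * real_of_int (2 * H + 1)
      \<le> (real d * (real_of_int (2 * H + 1) / real p ^ Suc i + 1)) * real_of_int (2 * H + 1) ^ d"
proof (rule card_box_fibres[OF _ H])
  fix A
  obtain G where G: "degree G = d" "coeff G d = 1" "\<And>a. N ([:a:] + A) = poly G a" using N_monic_poly by blast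
  have "real (card {a\<in>{-H..H}. [:a:] + A \<in> {A\<in>box H. int p ^ (d * i + 1) dvd N A}})
       \<le> real d * (real (nat (2 * H + 1)) / real p ^ Suc i + 1)"
    by (rule padic_values_monic[OF p G(1,2), of _ "-H"]) (use G(3) H in auto)
  thus "real (card {a\<in>{-H..H}. [:a:] + A \<in> {A\<in>box H. int p ^ (d * i + 1) dvd N A}})
     \<le> real d * (real_of_int (2 * H + 1) / real p ^ Suc i + 1)" using H by simp
qed auto


text \<open>The losses from the zero polynomial, the \<open>Bad\<close> polynomials and those
  divisible by high powers of small primes, in this order, relative to the box and in units of
  \<open>1 / w\<close>.\<close>

definition C3 :: real where
  "C3 = 1 + real (d + d * d + d) * (1 + real_of_int C0) ^ d + 2 * real d"

lemma C3_pos: "C3 \<ge> 1"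
  unfolding C3_def using C0_pos by simp

lemma card_root_ideal_le:
  assumes p: "prime p" and r: "r \<in> roots_mod F p" and H: "H \<ge> 0"
  shows "card (rideal p r \<inter> (box H - {0})) * p \<le> nat (2 * (H + C0 * H) + 1) ^ d"
proof -
  have "card (rideal p r \<inter> (box H - {0})) * card ((\<lambda>c::int. [:c:]) ` {0..<int p}) \<le> nat (2 * (H + C0 * H) + 1) ^ d"
  proof (rule ideal_count_nonzero[OF pideal_rideal _ _ _ H])
    show "F \<in> rideal p r" using r by (simp add: rideal_def roots_mod_def)
  qed (use rideal_incong in auto)
  thus ?thesis by (simp only: card_consts)
qed

text \<open>A prime \<open>p \<le> w\<close> enters with exponent at most \<open>d * i\<close> where
  \<open>p ^ i \<le> w\<^sup>2\<close>, hence contributes at most \<open>2 * d * ln w\<close>. For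
  \<open>p > w\<close> the assumption \<open>\<bar>Delta\<bar> \<le> w\<close> makes
  \<open>square_dvd_N_Bad\<close> applicable, so \<open>p\<close> divides the norm only once and
  comes from a root.\<close>

lemma norm_ln_le:
  assumes A: "A \<in> box H - {0}" and H: "H \<ge> 0" and w: "w > 0" "\<bar>Delta\<bar> \<le> int w"
    and nB: "\<And>p. prime p \<Longrightarrow> p > w \<Longrightarrow> \<not> Bad p A"
    and small: "\<And>p. prime p \<Longrightarrow> p \<le> w \<Longrightarrow> \<exists>i. real p ^ i \<le> real w ^ 2 \<and> \<not> int p ^ (d * i + 1) dvd N A"
  shows "ln (real_of_int \<bar>N A\<bar>) \<le> real w * (2 * real d * ln (real w)) +
    (\<Sum>p\<in>primes_upto (real (nat (2 * (H + C0 * H) + 1) ^ d)).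
        \<Sum>r\<in>roots_mod F p. if int p dvd poly A r then ln (real p) else 0)"
proof -
  define n where "n = nat \<bar>N A\<bar>"
  have N0: "N A \<noteq> 0" using A by (intro N_nonzero) (auto simp: box_def)
  hence n0: "n > 0" by (simp add: n_def)
  have intn: "int n = \<bar>N A\<bar>" by (simp add: n_def)
  have dvdn: "m dvd n \<longleftrightarrow> int m dvd N A" for m
    by (metis dvd_abs_iff int_dvd_int_iff intn)
  let ?P = "prime_factors n"
  let ?P1 = "{p\<in>?P. p \<le> w}" and ?P2 = "{p\<in>?P. p > w}"
  let ?Q = "primes_upto (real (nat (2 * (H + C0 * H) + 1) ^ d))"
  let ?g = "\<lambda>p. \<Sum>r\<in>roots_mod F p. if int p dvd poly A r then ln (real p) else 0"
  have "ln (real_of_int \<bar>N A\<bar>) = ln (real n)" by (simp add: n_def)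
  also have "\<dots> = (\<Sum>p\<in>?P. real (multiplicity p n) * ln (real p))" by (rule ln_eq_sum_multiplicity[OF n0])
  also have "\<dots> = (\<Sum>p\<in>?P1 \<union> ?P2. real (multiplicity p n) * ln (real p))"
    by (rule sum.cong) auto
  also have "\<dots> = (\<Sum>p\<in>?P1. real (multiplicity p n) * ln (real p)) + (\<Sum>p\<in>?P2. real (multiplicity p n) * ln (real p))"
    by (rule sum.union_disjoint) auto
  also have "(\<Sum>p\<in>?P1. real (multiplicity p n) * ln (real p)) \<le> real w * (2 * real d * ln (real w))"
  proof -
    have "(\<Sum>p\<in>?P1. real (multiplicity p n) * ln (real p)) \<le> (\<Sum>p\<in>?P1. 2 * real d * ln (real w))"
    proof (rule sum_mono)
      fix p assume "p \<in> ?P1"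
      hence p: "prime p" "p \<le> w" by (auto simp: in_prime_factors_imp_prime)
      obtain i where i: "real p ^ i \<le> real w ^ 2" "\<not> int p ^ (d * i + 1) dvd N A" using small[OF p] by auto
      have "\<not> p ^ (d * i + 1) dvd n" using i(2) unfolding dvdn by simp
      hence "multiplicity p n \<le> d * i"
        by (metis Suc_eq_plus1 multiplicity_dvd' not_less_eq_eq)
      hence "real (multiplicity p n) * ln (real p) \<le> real (d * i) * ln (real p)"
        by (intro mult_right_mono of_nat_mono) (use p in simp_all)
      also have "\<dots> = real d * ln (real p ^ i)" using prime_gt_0_nat[OF p(1)] by (simp add: ln_realpow)
      also have "\<dots> \<le> real d * ln (real w ^ 2)"
        using i(1) prime_gt_0_nat[OF p(1)] by (intro mult_left_mono ln_mono) auto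
      also have "\<dots> = 2 * real d * ln (real w)" using w by (simp add: ln_realpow)
      finally show "real (multiplicity p n) * ln (real p) \<le> 2 * real d * ln (real w)" .
    qed
    also have "\<dots> = real (card ?P1) * (2 * real d * ln (real w))" by simp
    also have "\<dots> \<le> real w * (2 * real d * ln (real w))"
    proof (rule mult_right_mono)
      have "?P1 \<subseteq> {1..w}" by (auto simp: in_prime_factors_imp_prime prime_gt_0_nat Suc_leI)
      hence "card ?P1 \<le> card {1..w}" by (intro card_mono) auto
      thus "real (card ?P1) \<le> real w" by simp
      show "0 \<le> 2 * real d * ln (real w)" using w by simp
    qed
    finally show ?thesis .
  qed
  also have "(\<Sum>p\<in>?P2. real (multiplicity p n) * ln (real p)) \<le> (\<Sum>p\<in>?P2. ?g p)"
  proof (rule sum_mono)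
    fix p assume "p \<in> ?P2"
    hence p: "prime p" "p > w" "p dvd n" by (auto simp: in_prime_factors_imp_prime)
    have nd: "\<not> int p dvd Delta"
    proof
      assume "int p dvd Delta"
      hence "\<bar>int p\<bar> \<le> \<bar>Delta\<bar>" using Delta(1) by (intro dvd_imp_le_int) auto
      thus False using w(2) p(2) by simp
    qed
    have "multiplicity p n \<le> 1"
    proof (rule ccontr)
      assume "\<not> ?thesis"
      hence "p ^ 2 dvd n" by (intro multiplicity_dvd') auto
      hence "(int p)\<^sup>2 dvd N A" unfolding dvdn by simp
      thus False using square_dvd_N_Bad[OF p(1) nd] nB[OF p(1,2)] by blast
    qed
    hence "real (multiplicity p n) * ln (real p) \<le> 1 * ln (real p)"
      using p by (intro mult_right_mono) auto
    moreover obtain r where r: "r \<in> roots_mod F p" "int p dvd poly A r"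
      using not_Bad_root[OF p(1) _ nB[OF p(1,2)]] p(3) dvdn by blast
    have "(if int p dvd poly A r then ln (real p) else 0) \<le> ?g p"
      using p r by (intro member_le_sum) auto
    ultimately show "real (multiplicity p n) * ln (real p) \<le> ?g p" using r(2) by simp
  qed
  also have "(\<Sum>p\<in>?P2. ?g p) \<le> (\<Sum>p\<in>?Q. ?g p)"
  proof (rule sum_mono2)
    show "?P2 \<subseteq> ?Q"
    proof
      fix p assume "p \<in> ?P2"
      hence p: "prime p" "p > w" "p dvd n" by (auto simp: in_prime_factors_imp_prime)
      obtain r where r: "r \<in> roots_mod F p" "int p dvd poly A r"
        using not_Bad_root[OF p(1) _ nB[OF p(1,2)]] p(3) dvdn by blast
      \<comment> \<open>\<open>A\<close> itself shows that the ideal meets the box, and the counting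
        bound then limits \<open>p\<close>.\<close>
      have "A \<in> rideal p r \<inter> (box H - {0})" using A r by (simp add: rideal_def)
      moreover have "finite (rideal p r \<inter> (box H - {0}))" using card_box(1)[OF H] by simp
      ultimately have "card (rideal p r \<inter> (box H - {0})) \<ge> 1"
        by (metis One_nat_def Suc_leI card_gt_0_iff empty_iff)
      hence "1 * p \<le> card (rideal p r \<inter> (box H - {0})) * p" by (rule mult_le_mono1)
      also note card_root_ideal_le[OF p(1) r(1) H]
      finally have "p \<le> nat (2 * (H + C0 * H) + 1) ^ d" by simp
      hence "real p \<le> real (nat (2 * (H + C0 * H) + 1) ^ d)" by (simp only: of_nat_le_iff)
      thus "p \<in> ?Q" using p(1) by (simp only: in_primes_upto simp_thms)
    qed
  qed (auto simp: in_primes_upto intro!: sum_nonneg)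
  finally show ?thesis by simp
qed

text \<open>Summing \<open>ln \<bar>N A\<bar>\<close> over a box. Discarded are the \<open>A\<close> of small norm, those divisible by a high power of a
  prime up to \<open>w\<close>, and those that are \<open>Bad\<close> for a larger prime; for the others the norm is, up to primes
  below \<open>w\<close>, a product of distinct primes \<open>p\<close> dividing \<open>A r\<close> at a root \<open>r\<close> of \<open>F\<close> modulo \<open>p\<close>.\<close>

lemma mertens_lower_aux:
  assumes y: "y \<ge> 1" and K: "K > 0" "y < (real K + 1) ^ d" and L: "L > 0"
    and w: "w \<ge> 2" "\<bar>Delta\<bar> \<le> int w"
  defines "H \<equiv> C0 * int K * int L"
  assumes wH: "real w ^ 2 \<le> 2 * real_of_int H + 1"
  defines "T \<equiv> real d * ln (real K / 3) - real w * (2 * real d * ln (real w))"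
  assumes T0: "T \<ge> 0"
  defines "B1 \<equiv> (1 + real_of_int C0) ^ d * (2 * real_of_int H + 1) ^ d"
  shows "(1 - C3 / real w - real d / real L) * T \<le> (1 + 1 / real L) ^ d * mertens F y +
    real d * (1 + real_of_int C0) ^ d * (\<Sum>p\<in>primes_upto B1 - primes_upto y. ln (real p) / real p)"
proof -
  define X where "X = box H - {0}"
  define M where "M = (2 * real_of_int H + 1) ^ d"
  define c where "c = d + d * d + d"
  define B where "B = nat (2 * (H + C0 * H) + 1) ^ d"
  have C01: "real_of_int C0 \<ge> 1" using C0_pos by simp
  have H0: "H \<ge> 0" using C0_pos by (simp add: H_def)
  have HKL: "real_of_int H \<ge> real K * real L"
  proof -
    have "1 * (real K * real L) \<le> real_of_int C0 * (real K * real L)" by (intro mult_right_mono C01) auto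
    thus ?thesis by (simp add: H_def mult.assoc)
  qed
  have H1: "2 * real_of_int H + 1 \<ge> 1" using H0 by simp
  have M1: "M \<ge> 2 * real_of_int H + 1"
  proof -
    have "(2 * real_of_int H + 1) ^ 1 \<le> (2 * real_of_int H + 1) ^ d"
      using H1 d_pos by (intro power_increasing) auto
    thus ?thesis by (simp add: M_def)
  qed
  have M0: "M > 0" using M1 H1 by linarith
  have cardbox: "real (card (box H)) = M" using card_box(2)[OF H0] H0 by (simp add: M_def)
  have finbox: "finite (box H)" by (rule card_box(1)[OF H0])
  have BM: "real B \<le> B1"
  proof -
    have "real B = (2 * (real_of_int H + real_of_int C0 * real_of_int H) + 1) ^ d"
      using H0 C0_pos by (simp add: B_def)
    also have "\<dots> \<le> ((1 + real_of_int C0) * (2 * real_of_int H + 1)) ^ d"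
      using H0 C01 by (intro power_mono) (auto simp: algebra_simps)
    finally show ?thesis by (simp add: B1_def power_mult_distrib)
  qed
  have B1M: "B1 = (1 + real_of_int C0) ^ d * M" by (simp add: B1_def M_def)

  \<comment> \<open>The threshold \<open>(K / 3) ^ d\<close> leaves room for the factor
    \<open>2 ^ d\<close> of \<open>small_values_monic\<close> with \<open>lam = K\<close>.\<close>
  define E1 where "E1 = {A\<in>box H. real_of_int \<bar>N A\<bar> \<le> (real K / 3) ^ d}"
  have E1: "real (card E1) \<le> M * (real d / real L)"
  proof -
    have "2 ^ d * (real K / 3) ^ d = (2 * real K / 3) ^ d" by (simp add: power_mult_distrib flip: power_mult_distrib)
    also have "\<dots> < real K ^ d" using K(1) d_pos by (intro power_strict_mono) auto
    finally have "2 ^ d * (real K / 3) ^ d < real K ^ d" .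
    from card_small_norm[OF H0 K(1) this]
    have a: "real (card E1) * (2 * real_of_int H + 1) \<le> real (2 * d * K) * M" by (simp add: E1_def M_def)
    have "real (card E1) * (2 * (real K * real L)) \<le> real (card E1) * (2 * real_of_int H + 1)"
      using HKL by (intro mult_left_mono) auto
    also note a
    finally have "(real (card E1) * real L) * (2 * real K) \<le> (real d * M) * (2 * real K)" by (simp add: mult_ac)
    hence "real (card E1) * real L \<le> real d * M" using K(1) by (subst (asm) mult_le_cancel_right) auto
    thus ?thesis using L by (simp add: field_simps)
  qed

  \<comment> \<open>For primes beyond \<open>c * B\<close> the bound
    \<open>c * B / p\<^sup>2\<close> is below 1, so no \<open>Bad\<close> polynomial exists there
    and finitely many primes suffice.\<close>
  define PB where "PB = {p. prime p \<and> w < p \<and> p \<le> c * B}"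
  have finPB: "finite PB" by (rule finite_subset[of _ "{..c * B}"]) (auto simp: PB_def)
  define E2 where "E2 = (\<Union>p\<in>PB. {A\<in>X. Bad p A})"
  have good: "\<not> int p dvd Delta" if "prime p" "w < p" for p
  proof
    assume "int p dvd Delta"
    hence "\<bar>int p\<bar> \<le> \<bar>Delta\<bar>" using Delta(1) by (intro dvd_imp_le_int) auto
    thus False using w(2) that(2) by simp
  qed
  have badc: "card {A\<in>X. Bad p A} * p\<^sup>2 \<le> c * B" if "prime p" "w < p" for p
    using Bad_count[OF that(1) good[OF that] H0] by (simp only: X_def B_def c_def)
  have finX: "finite X" using finbox by (simp add: X_def)
  have E2mem: "A \<in> E2" if A: "A \<in> X" "Bad p A" and p: "prime p" "w < p" for A p
  proof -
    have "card {A\<in>X. Bad p A} > 0" using A finX by (auto simp: card_gt_0_iff)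
    hence "p * p \<le> card {A\<in>X. Bad p A} * p\<^sup>2" by (simp add: power2_eq_square)
    also have "\<dots> \<le> c * B" by (rule badc[OF p])
    finally have "p \<le> c * B" using le_square[of p] by linarith
    thus ?thesis using A p by (auto simp: E2_def PB_def)
  qed
  have E2: "real (card E2) \<le> M * (real c * (1 + real_of_int C0) ^ d / real w)"
  proof -
    have "card E2 \<le> (\<Sum>p\<in>PB. card {A\<in>X. Bad p A})" unfolding E2_def by (rule card_UN_le[OF finPB])
    hence "real (card E2) \<le> (\<Sum>p\<in>PB. real (card {A\<in>X. Bad p A}))" unfolding of_nat_sum[symmetric] of_nat_le_iff .
    also have "\<dots> \<le> (\<Sum>p\<in>PB. real (c * B) * (1 / (real p)\<^sup>2))"
    proof (rule sum_mono)
      fix p assume "p \<in> PB"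
      hence p: "prime p" "w < p" by (auto simp: PB_def)
      have "real (card {A\<in>X. Bad p A} * p\<^sup>2) \<le> real (c * B)" using badc[OF p] by (simp only: of_nat_le_iff)
      hence "real (card {A\<in>X. Bad p A}) * (real p)\<^sup>2 \<le> real (c * B)" by (simp only: of_nat_mult of_nat_power)
      thus "real (card {A\<in>X. Bad p A}) \<le> real (c * B) * (1 / (real p)\<^sup>2)"
        using prime_gt_0_nat[OF p(1)] by (simp add: field_simps)
    qed
    also have "\<dots> = real (c * B) * (\<Sum>p\<in>PB. 1 / (real p)\<^sup>2)" by (rule sum_distrib_left[symmetric])
    also have "\<dots> \<le> real (c * B) * (1 / real w)"
      using w(1) finPB by (intro mult_left_mono sum_inverse_squares_tail) (auto simp: PB_def)
    also have "\<dots> \<le> (real c * B1) * (1 / real w)"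
      using BM by (intro mult_right_mono) (auto simp: mult_left_mono)
    finally show ?thesis unfolding B1M by (simp add: mult_ac)
  qed

  \<comment> \<open>A power up to \<open>w\<^sup>2\<close> keeps the contribution of
    \<open>p\<close> to the logarithm of the norm small, while the next power being at least
    \<open>w\<^sup>2\<close> makes the excluded set sparse even after summation over up to
    \<open>w\<close> primes.\<close>
  have "\<exists>i. real p ^ i \<le> real w ^ 2 \<and> real w ^ 2 \<le> real p ^ Suc i" if p: "prime p" for p :: nat
  proof -
    have "\<exists>n. real w ^ 2 < real p ^ n" using prime_gt_1_nat[OF p] by (intro real_arch_pow) simp
    then obtain n where n: "real w ^ 2 < real p ^ n" by blast
    define m where "m = (LEAST n. real w ^ 2 < real p ^ n)"
    have m: "real w ^ 2 < real p ^ m" unfolding m_def by (rule LeastI[of _ n]) (rule n)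
    have "m \<noteq> 0"
    proof
      assume "m = 0"
      hence "real w ^ 2 < 1" using m by simp
      moreover have "1 \<le> real w ^ 2" using w(1) by (intro one_le_power) simp
      ultimately show False by linarith
    qed
    then obtain i where i: "m = Suc i" by (cases m) auto
    have "\<not> real w ^ 2 < real p ^ i"
      using not_less_Least[of i "\<lambda>n. real w ^ 2 < real p ^ n"] i by (simp add: m_def)
    thus ?thesis using m i by (intro exI[of _ i]) auto
  qed
  then obtain ii where ii: "\<And>p. prime p \<Longrightarrow> real p ^ ii p \<le> real w ^ 2" "\<And>p. prime p \<Longrightarrow> real w ^ 2 \<le> real p ^ Suc (ii p)"
    by metis
  define PW where "PW = {p. prime p \<and> p \<le> w}"
  have finPW: "finite PW" by (rule finite_subset[of _ "{..w}"]) (auto simp: PW_def)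
  define E3 where "E3 = (\<Union>p\<in>PW. {A\<in>box H. int p ^ (d * ii p + 1) dvd N A})"
  have w2: "real w ^ 2 > 0" using w(1) by simp
  have E3: "real (card E3) \<le> M * (2 * real d / real w)"
  proof -
    have "card E3 \<le> (\<Sum>p\<in>PW. card {A\<in>box H. int p ^ (d * ii p + 1) dvd N A})"
      unfolding E3_def by (rule card_UN_le[OF finPW])
    hence "real (card E3) \<le> (\<Sum>p\<in>PW. real (card {A\<in>box H. int p ^ (d * ii p + 1) dvd N A}))"
      unfolding of_nat_sum[symmetric] of_nat_le_iff .
    also have "\<dots> \<le> (\<Sum>p\<in>PW. M * (2 * real d / real w ^ 2))"
    proof (rule sum_mono)
      fix p assume "p \<in> PW"
      hence p: "prime p" by (simp add: PW_def)
      define e where "e = real (card {A\<in>box H. int p ^ (d * ii p + 1) dvd N A})"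
      define h where "h = 2 * real_of_int H + 1"
      have h: "h > 0" "real w ^ 2 \<le> h" using H1 wH by (auto simp: h_def)
      have "e * h \<le> (real d * (h / real p ^ Suc (ii p) + 1)) * M"
        using card_prime_power_norm[OF H0 p, of "ii p"] by (simp add: e_def h_def M_def)
      also have "\<dots> \<le> (real d * (h / real w ^ 2 + h / real w ^ 2)) * M"
      proof (intro mult_right_mono mult_left_mono add_mono)
        show "h / real p ^ Suc (ii p) \<le> h / real w ^ 2"
          by (rule divide_left_mono[OF ii(2)[OF p] less_imp_le[OF h(1)]
                mult_pos_pos[OF less_le_trans[OF w2 ii(2)[OF p]] w2]])
        show "1 \<le> h / real w ^ 2" using h w2 by simp
      qed (use M0 in auto)
      also have "\<dots> = (M * (2 * real d / real w ^ 2)) * h" by (simp add: mult_ac)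
      finally have "e \<le> M * (2 * real d / real w ^ 2)" using h(1) by (subst (asm) mult_le_cancel_right) auto
      thus "real (card {A\<in>box H. int p ^ (d * ii p + 1) dvd N A}) \<le> M * (2 * real d / real w ^ 2)"
        by (simp only: e_def)
    qed
    also have "\<dots> = real (card PW) * (M * (2 * real d / real w ^ 2))" by simp
    also have "\<dots> \<le> real w * (M * (2 * real d / real w ^ 2))"
    proof (rule mult_right_mono)
      have "PW \<subseteq> {1..w}" by (auto simp: PW_def prime_gt_0_nat Suc_leI)
      hence "card PW \<le> card {1..w}" by (intro card_mono) auto
      thus "real (card PW) \<le> real w" by simp
    qed (use M0 in auto)
    also have "\<dots> = M * (2 * real d / real w)" using w(1) by (simp add: power2_eq_square)
    finally show ?thesis .
  qed

  define Fs where "Fs = X - (E1 \<union> E2 \<union> E3)"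
  have finE: "finite E1" "finite E2" "finite E3"
  proof -
    show "finite E1" using finbox by (simp add: E1_def)
    show "finite E2" by (rule finite_subset[OF _ finX]) (auto simp: E2_def)
    show "finite E3" by (rule finite_subset[OF _ finbox]) (auto simp: E3_def)
  qed
  have cardFs: "real (card Fs) \<ge> M * (1 - C3 / real w - real d / real L)"
  proof -
    have "0 \<in> box H" using H0 d_pos by (simp add: box_def)
    hence "card (box H) = Suc (card X)" using finbox unfolding X_def by (intro card.remove)
    hence cX: "real (card X) = M - 1" using cardbox by simp
    have "X \<subseteq> Fs \<union> (E1 \<union> E2 \<union> E3)" by (auto simp: Fs_def)
    moreover have "finite Fs" using finX by (simp add: Fs_def)
    ultimately have "card X \<le> card (Fs \<union> (E1 \<union> E2 \<union> E3))" using finE by (intro card_mono) auto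
    also have "\<dots> \<le> card Fs + (card E1 + card E2 + card E3)"
      using card_Un_le[of Fs "E1 \<union> E2 \<union> E3"] card_Un_le[of "E1 \<union> E2" E3] card_Un_le[of E1 E2] by linarith
    finally have "real (card X) \<le> real (card Fs) + (real (card E1) + real (card E2) + real (card E3))" by linarith
    moreover have "1 \<le> M * (1 / real w)"
    proof -
      have "real w * 1 \<le> real w * real w" using w(1) by (intro mult_left_mono) auto
      hence "real w \<le> M" using M1 wH by (simp add: power2_eq_square)
      thus ?thesis using w(1) by simp
    qed
    ultimately have "M - M * (1 / real w) - M * (real d / real L) - M * (real c * (1 + real_of_int C0) ^ d / real w)
        - M * (2 * real d / real w) \<le> real (card Fs)"
      using cX E1 E2 E3 by linarith
    moreover have "M - M * (1 / real w) - M * (real d / real L) - M * (real c * (1 + real_of_int C0) ^ d / real w)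
        - M * (2 * real d / real w) = M * (1 - C3 / real w - real d / real L)"
      using w(1) by (simp add: C3_def c_def field_simps)
    ultimately show ?thesis by simp
  qed

  let ?Q = "primes_upto (real B)"
  let ?g = "\<lambda>A. \<Sum>p\<in>?Q. \<Sum>r\<in>roots_mod F p. if int p dvd poly A r then ln (real p) else 0"
  have each: "T \<le> ?g A" if A: "A \<in> Fs" for A
  proof -
    have A': "A \<in> X" "A \<notin> E1" "A \<notin> E2" "A \<notin> E3" using A by (auto simp: Fs_def)
    have AX: "A \<in> box H - {0}" using A'(1) by (simp add: X_def)
    have "(real K / 3) ^ d < real_of_int \<bar>N A\<bar>" using A'(2) AX by (auto simp: E1_def)
    hence "ln ((real K / 3) ^ d) \<le> ln (real_of_int \<bar>N A\<bar>)" using K(1) by (intro ln_mono) auto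
    also have "ln ((real K / 3) ^ d) = real d * ln (real K / 3)" by (rule ln_realpow) 
    also have "ln (real_of_int \<bar>N A\<bar>) \<le> real w * (2 * real d * ln (real w)) + ?g A"
      unfolding B_def
    proof (rule norm_ln_le[OF AX H0 _ w(2)])
      show "w > 0" using w(1) by simp
      show "\<not> Bad p A" if "prime p" "p > w" for p using E2mem[OF A'(1) _ that] A'(3) by blast
      show "\<exists>i. real p ^ i \<le> real w ^ 2 \<and> \<not> int p ^ (d * i + 1) dvd N A" if "prime p" "p \<le> w" for p
        using A'(4) AX that ii(1)[OF that(1)] by (intro exI[of _ "ii p"]) (auto simp: E3_def PW_def)
    qed
    finally show ?thesis by (simp add: T_def)
  qed
  have "M * (1 - C3 / real w - real d / real L) * T \<le> real (card Fs) * T"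
    by (rule mult_right_mono[OF cardFs T0])
  also have "\<dots> = (\<Sum>A\<in>Fs. T)" by simp
  also have "\<dots> \<le> (\<Sum>A\<in>Fs. ?g A)" by (rule sum_mono[OF each])
  also have "\<dots> \<le> (\<Sum>A\<in>X. ?g A)"
    using finX by (intro sum_mono2) (auto simp: Fs_def in_primes_upto intro!: sum_nonneg)
  also have "\<dots> = (\<Sum>p\<in>?Q. \<Sum>A\<in>X. \<Sum>r\<in>roots_mod F p. if int p dvd poly A r then ln (real p) else 0)"
    by (rule sum.swap)
  also have "\<dots> = (\<Sum>p\<in>?Q. \<Sum>r\<in>roots_mod F p. real (card (rideal p r \<inter> X)) * ln (real p))"
  proof (rule sum.cong[OF refl])
    fix p
    have "(\<Sum>A\<in>X. \<Sum>r\<in>roots_mod F p. if int p dvd poly A r then ln (real p) else 0) =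
      (\<Sum>r\<in>roots_mod F p. \<Sum>A\<in>X. if int p dvd poly A r then ln (real p) else 0)" by (rule sum.swap)
    also have "\<dots> = (\<Sum>r\<in>roots_mod F p. real (card (rideal p r \<inter> X)) * ln (real p))"
    proof (rule sum.cong[OF refl])
      fix r
      have "(\<Sum>A\<in>X. if int p dvd poly A r then ln (real p) else 0) = (\<Sum>A\<in>{A\<in>X. int p dvd poly A r}. ln (real p))"
        using finX by (subst sum.inter_filter) auto
      also have "{A\<in>X. int p dvd poly A r} = rideal p r \<inter> X" by (auto simp: rideal_def)
      finally show "(\<Sum>A\<in>X. if int p dvd poly A r then ln (real p) else 0) = real (card (rideal p r \<inter> X)) * ln (real p)"
        by simp
    qed
    finally show "(\<Sum>A\<in>X. \<Sum>r\<in>roots_mod F p. if int p dvd poly A r then ln (real p) else 0) =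
      (\<Sum>r\<in>roots_mod F p. real (card (rideal p r \<inter> X)) * ln (real p))" .
  qed
  \<comment> \<open>Up to \<open>y\<close> the pigeonhole element of size \<open>K\<close> gives a
    count within the factor \<open>(1 + 1 / L) ^ d\<close> of the expected value. Beyond
    \<open>y\<close> only the crude bound \<open>B1 / p\<close> is used, on a range that is short on
    the logarithmic scale.\<close>
  also have "\<dots> \<le> (\<Sum>p\<in>?Q \<inter> primes_upto y. \<Sum>r\<in>roots_mod F p. real (card (rideal p r \<inter> X)) * ln (real p)) +
      (\<Sum>p\<in>?Q - primes_upto y. \<Sum>r\<in>roots_mod F p. real (card (rideal p r \<inter> X)) * ln (real p))"
    by (subst sum.Int_Diff[of _ _ "primes_upto y"]) auto
  also have "(\<Sum>p\<in>?Q \<inter> primes_upto y. \<Sum>r\<in>roots_mod F p. real (card (rideal p r \<inter> X)) * ln (real p))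
      \<le> (1 + 1 / real L) ^ d * M * mertens F y"
  proof -
    have "(\<Sum>p\<in>?Q \<inter> primes_upto y. \<Sum>r\<in>roots_mod F p. real (card (rideal p r \<inter> X)) * ln (real p))
      \<le> (\<Sum>p\<in>?Q \<inter> primes_upto y. (1 + 1 / real L) ^ d * M * (real (rho F p) * ln (real p) / real p))"
    proof (rule sum_mono)
      fix p assume "p \<in> ?Q \<inter> primes_upto y"
      hence p: "prime p" "real p \<le> y" by (auto simp: in_primes_upto)
      have p0: "p > 0" using p by (simp add: prime_gt_0_nat)
      have "real (card (rideal p r \<inter> X)) * ln (real p) \<le> ((1 + 1 / real L) ^ d * M / real p) * ln (real p)"
        if r: "r \<in> roots_mod F p" for r
      proof (rule mult_right_mono)
        have FI: "F \<in> rideal p r" using r by (simp add: roots_mod_def rideal_def)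
        have "real p < real ((K + 1) ^ d)" using p(2) K(2) by (simp add: add.commute)
        hence "card ((\<lambda>c::int. [:c:]) ` {0..<int p}) < (K + 1) ^ d" by (simp only: card_consts of_nat_less_iff)
        from ideal_small_element[OF pideal_rideal card_consts(2) rideal_complete[OF p0] this]
        obtain A where A: "A \<in> rideal p r" "A \<in> box (int K)" "A \<noteq> 0" by blast
        have "card (rideal p r \<inter> box H) * card ((\<lambda>c::int. [:c:]) ` {0..<int p}) \<le> nat (2 * (H + C0 * int K) + 1) ^ d"
          by (rule ideal_count_upper[OF pideal_rideal FI A card_consts(2) rideal_incong H0])
        hence "real (card (rideal p r \<inter> box H) * p) \<le> real (nat (2 * (H + C0 * int K) + 1) ^ d)"
          by (simp only: card_consts of_nat_le_iff)
        also have "\<dots> = (2 * (real_of_int H + real_of_int C0 * real K) + 1) ^ d" using H0 C0_pos by simp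
        also have "\<dots> \<le> ((1 + 1 / real L) * (2 * real_of_int H + 1)) ^ d"
        proof (rule power_mono)
          have "real_of_int C0 * real K = real_of_int H / real L" using L by (simp add: H_def)
          thus "2 * (real_of_int H + real_of_int C0 * real K) + 1 \<le> (1 + 1 / real L) * (2 * real_of_int H + 1)"
            using L by (simp add: algebra_simps)
        qed (use H0 C01 in auto)
        also have "\<dots> = (1 + 1 / real L) ^ d * M" by (simp add: M_def power_mult_distrib)
        finally have "real (card (rideal p r \<inter> box H)) \<le> (1 + 1 / real L) ^ d * M / real p"
          using p0 by (simp add: field_simps)
        moreover have "card (rideal p r \<inter> X) \<le> card (rideal p r \<inter> box H)"
          using finbox by (intro card_mono) (auto simp: X_def)
        ultimately show "real (card (rideal p r \<inter> X)) \<le> (1 + 1 / real L) ^ d * M / real p" by linarith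
      qed (use p in simp)
      hence "(\<Sum>r\<in>roots_mod F p. real (card (rideal p r \<inter> X)) * ln (real p)) \<le>
          (\<Sum>r\<in>roots_mod F p. ((1 + 1 / real L) ^ d * M / real p) * ln (real p))" by (rule sum_mono)
      thus "(\<Sum>r\<in>roots_mod F p. real (card (rideal p r \<inter> X)) * ln (real p)) \<le>
          (1 + 1 / real L) ^ d * M * (real (rho F p) * ln (real p) / real p)" by (simp add: rho_def mult_ac)
    qed
    also have "\<dots> \<le> (\<Sum>p\<in>primes_upto y. (1 + 1 / real L) ^ d * M * (real (rho F p) * ln (real p) / real p))"
      using M0 by (intro sum_mono2) (auto simp: in_primes_upto)
    also have "\<dots> = (1 + 1 / real L) ^ d * M * mertens F y" by (simp add: mertens_def sum_distrib_left)
    finally show ?thesis .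
  qed
  also have "(\<Sum>p\<in>?Q - primes_upto y. \<Sum>r\<in>roots_mod F p. real (card (rideal p r \<inter> X)) * ln (real p))
      \<le> real d * B1 * (\<Sum>p\<in>primes_upto B1 - primes_upto y. ln (real p) / real p)"
  proof -
    have "(\<Sum>p\<in>?Q - primes_upto y. \<Sum>r\<in>roots_mod F p. real (card (rideal p r \<inter> X)) * ln (real p))
      \<le> (\<Sum>p\<in>?Q - primes_upto y. real d * B1 * (ln (real p) / real p))"
    proof (rule sum_mono)
      fix p assume "p \<in> ?Q - primes_upto y"
      hence p: "prime p" by (auto simp: in_primes_upto)
      have p0: "p > 0" using p by (simp add: prime_gt_0_nat)
      have B10: "B1 \<ge> 0" using BM by (meson of_nat_0_le_iff order_trans)
      have "(\<Sum>r\<in>roots_mod F p. real (card (rideal p r \<inter> X)) * ln (real p)) \<le>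
          (\<Sum>r\<in>roots_mod F p. (B1 / real p) * ln (real p))"
      proof (intro sum_mono mult_right_mono)
        fix r assume r: "r \<in> roots_mod F p"
        have "real (card (rideal p r \<inter> X) * p) \<le> real B"
          using card_root_ideal_le[OF p r H0] by (simp only: of_nat_le_iff X_def B_def)
        hence "real (card (rideal p r \<inter> X)) * real p \<le> B1" using BM by simp
        thus "real (card (rideal p r \<inter> X)) \<le> B1 / real p" using p0 by (simp add: field_simps)
      qed (use p in simp)
      also have "\<dots> = real (rho F p) * (B1 * (ln (real p) / real p))" by (simp add: rho_def)
      also have "\<dots> \<le> real d * (B1 * (ln (real p) / real p))"
        using rho_le_d[OF p] B10 p by (intro mult_right_mono) auto
      finally show "(\<Sum>r\<in>roots_mod F p. real (card (rideal p r \<inter> X)) * ln (real p)) \<le> real d * B1 * (ln (real p) / real p)"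
        by (simp add: mult.assoc)
    qed
    also have "\<dots> \<le> (\<Sum>p\<in>primes_upto B1 - primes_upto y. real d * B1 * (ln (real p) / real p))"
    proof (rule sum_mono2)
      show "?Q - primes_upto y \<subseteq> primes_upto B1 - primes_upto y" using BM by (auto simp: in_primes_upto)
    next
      fix p assume "p \<in> primes_upto B1 - primes_upto y - (?Q - primes_upto y)"
      hence p: "prime p" by (auto simp: in_primes_upto)
      have B10: "B1 \<ge> 0" using BM by (meson of_nat_0_le_iff order_trans)
      show "0 \<le> real d * B1 * (ln (real p) / real p)" using B10 p by simp
    qed simp
    also have "\<dots> = real d * B1 * (\<Sum>p\<in>primes_upto B1 - primes_upto y. ln (real p) / real p)"
      by (rule sum_distrib_left[symmetric])
    finally show ?thesis .
  qed
  finally have "M * ((1 - C3 / real w - real d / real L) * T) \<le> M * ((1 + 1 / real L) ^ d * mertens F y +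
    real d * (1 + real_of_int C0) ^ d * (\<Sum>p\<in>primes_upto B1 - primes_upto y. ln (real p) / real p))"
    unfolding B1M by (simp add: algebra_simps)
  thus ?thesis using M0 by (subst (asm) mult_le_cancel_left) auto
qed


text \<open>The exceptional sets cost a proportion \<open>1 / w\<close> of \<open>ln y\<close>, the
  primes up to \<open>w\<close> cost \<open>w * ln w\<close> up to a constant, and the factor
  \<open>(1 + 1 / L) ^ d\<close> is absorbed by means of the upper estimate. With \<open>w\<close>
  about \<open>ln (ln y)\<close> the first loss dominates and is the error term.\<close>

theorem mertens_lower: "\<exists>C\<ge>0. \<forall>y\<ge>exp (exp 1). mertens F y \<ge> ln y - C * (ln y / ln (ln y))"
proof -
  obtain C1 where C1: "C1 \<ge> 0" "\<And>y. y \<ge> exp (exp 1) \<Longrightarrow> mertens F y \<le> ln y + C1 * ln (ln y)"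
    using mertens_upper by blast
  define c1 where "c1 = 3 * real_of_int C0 * (1 + real_of_int C0)"
  define b where "b = 8 * real d * (1 + real_of_int C0) ^ d"
  define D where "D = real d"
  define C3' where "C3' = C3"
  define De where "De = real_of_int \<bar>Delta\<bar>"
  have C01: "real_of_int C0 \<ge> 1" using C0_pos by simp
  have c1: "c1 \<ge> 1" unfolding c1_def using C01 mult_mono[of 1 "real_of_int C0" 1 "1 + real_of_int C0"] by simp
  have b0: "b \<ge> 0" using C01 by (simp add: b_def)
  have D1: "D \<ge> 1" using d_pos by (simp add: D_def)
  have C3': "C3' \<ge> 1" using C3_pos by (simp add: C3'_def)
  let ?T = "\<lambda>y::real. ln y - D * ln 6 - (ln (ln y) + 1) * (2 * D * ln (ln (ln y) + 1))"
  have "eventually (\<lambda>y::real. ln y \<ge> D \<and> ln (ln y) \<ge> De) at_top"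
    by (intro eventually_conj) real_asymp+
  moreover have "eventually (\<lambda>y::real. ln (ln y) \<ge> 2) at_top" by real_asymp
  moreover have "eventually (\<lambda>y::real. (ln (ln y) + 1) ^ 2 \<le> ln y) at_top" by real_asymp
  moreover have "eventually (\<lambda>y::real. y \<ge> exp (exp 1)) at_top" by (rule eventually_ge_at_top)
  moreover have "eventually (\<lambda>y::real. ?T y \<ge> 0) at_top" using D1 by real_asymp
  moreover have "eventually (\<lambda>y::real. 1 - C3' / ln (ln y) - D / ln y \<ge> 0) at_top" by real_asymp
  moreover have "eventually (\<lambda>y::real. (1 - C3' / ln (ln y) - D / ln y) * ?T y - 2 * D * (1 + C1)
      - b * (D * (ln (c1 * (ln y + 1)) / ln 2) + 1) \<ge> ln y - (C3' + 1) * (ln y / ln (ln y))) at_top"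
    using c1 by real_asymp
  ultimately have "eventually (\<lambda>y. mertens F y \<ge> ln y - (C3' + 1) * (ln y / ln (ln y))) at_top"
  proof eventually_elim
    case (elim y)
    have y1: "y \<ge> 1" using elim(4) by (meson exp_ge_zero one_le_exp_iff order_trans)
    have lny: "ln y \<ge> 1" using elim(1) D1 by linarith
    have l2: "ln (ln y) \<le> ln y" using lny ln_le_minus_one[of "ln y"] by linarith
    define K where "K = nat \<lfloor>y powr (1 / real d)\<rfloor>"
    have pw: "(y powr (1 / real d)) ^ d = y" using y1 d_pos by (simp flip: powr_realpow add: powr_powr)
    have rt1: "y powr (1 / real d) \<ge> 1" using y1 by (simp add: ge_one_powr_ge_zero)
    have Kr: "real K \<le> y powr (1 / real d)" "y powr (1 / real d) < real K + 1" "real K \<ge> 1"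
    proof -
      have "\<lfloor>y powr (1 / real d)\<rfloor> \<ge> 1" using rt1 by (simp add: le_floor_iff)
      thus "real K \<le> y powr (1 / real d)" "y powr (1 / real d) < real K + 1" "real K \<ge> 1"
        unfolding K_def by linarith+
    qed
    have K: "real K ^ d \<le> y" "y < (real K + 1) ^ d"
      using power_mono[OF Kr(1), of d] power_strict_mono[OF Kr(2), of d] pw d_pos rt1 by auto
    have K0: "K > 0" using Kr(3) by simp
    define L where "L = nat \<lceil>ln y\<rceil>"
    have L: "real L \<ge> ln y" "real L \<le> ln y + 1" using lny unfolding L_def by linarith+
    have L1: "real L \<ge> 1" "real L \<ge> D" using L lny elim(1) by linarith+
    have L0: "L > 0" using L1 by simp
    define w where "w = nat \<lceil>ln (ln y)\<rceil>"
    have w: "real w \<ge> ln (ln y)" "real w \<le> ln (ln y) + 1" using elim(2) unfolding w_def by linarith+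
    have w2: "w \<ge> 2" using w elim(2) by linarith
    have wD: "\<bar>Delta\<bar> \<le> int w"
    proof -
      have "real_of_int \<bar>Delta\<bar> \<le> real_of_int (int w)" using w elim(1) by (simp add: De_def)
      thus ?thesis by (simp only: of_int_le_iff)
    qed
    define H where "H = C0 * int K * int L"
    have HKL: "real_of_int H = real_of_int C0 * real K * real L" by (simp add: H_def)
    have CK: "1 \<le> real_of_int C0 * real K" using C01 Kr(3) mult_mono[of 1 "real_of_int C0" 1 "real K"] by simp
    have HL: "real_of_int H \<ge> real L" using CK mult_right_mono[of 1 "real_of_int C0 * real K" "real L"] by (simp add: HKL)
    have wH: "real w ^ 2 \<le> 2 * real_of_int (C0 * int K * int L) + 1"
    proof -
      have "real w ^ 2 \<le> (ln (ln y) + 1) ^ 2" using w by (intro power_mono) auto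
      also have "\<dots> \<le> ln y" by (rule elim(3))
      also have "\<dots> \<le> real_of_int H" using L HL by linarith
      finally show ?thesis using HL L1 unfolding H_def[symmetric] by linarith
    qed
    define T where "T = real d * ln (real K / 3) - real w * (2 * real d * ln (real w))"
    have TT: "?T y \<le> T"
    proof -
      have "y \<le> (real K + 1) ^ d" using K(2) by simp
      also have "\<dots> \<le> (2 * real K) ^ d" using Kr(3) by (intro power_mono) auto
      finally have "ln y \<le> ln ((2 * real K) ^ d)" using y1 by (intro ln_mono) auto
      also have "\<dots> = D * ln (2 * real K)" unfolding D_def by (rule ln_realpow)
      also have "ln (2 * real K) = ln (6 * (real K / 3))" by simp
      also have "\<dots> = ln 6 + ln (real K / 3)" using Kr(3) by (subst ln_mult) auto
      finally have 1: "ln y \<le> D * ln 6 + D * ln (real K / 3)" by (simp add: algebra_simps)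
      have "real w * (2 * real d * ln (real w)) \<le> (ln (ln y) + 1) * (2 * D * ln (ln (ln y) + 1))"
      proof (intro mult_mono)
        show "ln (real w) \<le> ln (ln (ln y) + 1)" using w w2 by (intro ln_mono) auto
      qed (use w w2 elim(2) in \<open>auto simp: D_def\<close>)
      thus ?thesis using 1 by (simp add: T_def D_def)
    qed
    have T0: "T \<ge> 0" using TT elim(5) by linarith
    define B1 where "B1 = (1 + real_of_int C0) ^ d * (2 * real_of_int H + 1) ^ d"
    define S where "S = (\<Sum>p\<in>primes_upto B1 - primes_upto y. ln (real p) / real p)"
    have main: "(1 - C3' / real w - D / real L) * T \<le> (1 + 1 / real L) ^ d * mertens F y +
        real d * (1 + real_of_int C0) ^ d * S"
      using mertens_lower_aux[OF y1 K0 K(2) L0 w2 wD wH T0[unfolded T_def]]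
      unfolding T_def S_def B1_def H_def C3'_def D_def .
    have "(1 - C3' / ln (ln y) - D / ln y) * ?T y \<le> (1 - C3' / real w - D / real L) * T"
    proof (rule mult_mono)
      have "C3' / real w \<le> C3' / ln (ln y)" using w elim(2) C3' by (intro divide_left_mono mult_pos_pos) auto
      moreover have "D / real L \<le> D / ln y" using L lny D1 by (intro divide_left_mono mult_pos_pos) auto
      ultimately show "1 - C3' / ln (ln y) - D / ln y \<le> 1 - C3' / real w - D / real L" by linarith
      thus "0 \<le> 1 - C3' / real w - D / real L" using elim(6) by linarith
    qed (use TT elim(5) in auto)
    also note main
    also have "(1 + 1 / real L) ^ d * mertens F y \<le> mertens F y + 2 * D * (1 + C1)"
    proof -
      have "(1 + 1 / real L) ^ d \<le> exp (1 / real L) ^ d"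
        using L1 by (intro power_mono exp_ge_add_one_self) auto
      also have "\<dots> = exp (D / real L)" by (simp add: D_def flip: exp_of_nat_mult)
      also have "\<dots> \<le> 1 + D / real L + (D / real L)\<^sup>2" using L1 D1 by (intro exp_bound) auto
      also have "\<dots> \<le> 1 + 2 * (D / real L)"
        using L1 D1 mult_left_mono[of "D / real L" 1 "D / real L"] by (simp add: power2_eq_square)
      also have "\<dots> \<le> 1 + 2 * (D / ln y)"
        using L lny D1 by (intro add_left_mono mult_left_mono divide_left_mono mult_pos_pos) auto
      finally have "(1 + 1 / real L) ^ d * mertens F y \<le> (1 + 2 * (D / ln y)) * mertens F y"
        by (intro mult_right_mono mertens_nonneg)
      also have "\<dots> = mertens F y + (2 * D / ln y) * mertens F y" by (simp add: algebra_simps)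
      also have "(2 * D / ln y) * mertens F y \<le> (2 * D / ln y) * (ln y + C1 * ln y)"
      proof (rule mult_left_mono)
        have "C1 * ln (ln y) \<le> C1 * ln y" using l2 C1(1) by (intro mult_left_mono) auto
        thus "mertens F y \<le> ln y + C1 * ln y" using C1(2)[OF elim(4)] by linarith
        show "0 \<le> 2 * D / ln y" using D1 lny by simp
      qed
      also have "\<dots> = 2 * D * (1 + C1)" using lny by (simp add: field_simps)
      finally show ?thesis by simp
    qed
    also have "real d * (1 + real_of_int C0) ^ d * S \<le> b * (D * (ln (c1 * (ln y + 1)) / ln 2) + 1)"
    proof -
      have c1L: "c1 * real L \<ge> 1" using c1 L1 mult_mono[of 1 c1 1 "real L"] by simp
      \<comment> \<open>The number of doublings that lead from \<open>y\<close> to at least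
        \<open>B1\<close>, which is at most \<open>(c1 * L) ^ d * y\<close>; it is of order
        \<open>ln (ln y)\<close>.\<close>
      define m where "m = nat \<lceil>D * log 2 (c1 * real L)\<rceil>"
      have lg: "D * log 2 (c1 * real L) \<ge> 0" using c1L D1 by simp
      have m: "D * log 2 (c1 * real L) \<le> real m" "real m \<le> D * log 2 (c1 * real L) + 1"
        using lg unfolding m_def by linarith+
      have "B1 \<le> 2 ^ m * y"
      proof -
        have "B1 = ((1 + real_of_int C0) * (2 * real_of_int H + 1)) ^ d" by (simp add: B1_def power_mult_distrib)
        also have "\<dots> \<le> ((1 + real_of_int C0) * (3 * real_of_int H)) ^ d"
          using HL L1 C01 by (intro power_mono mult_left_mono) auto
        also have "\<dots> = (c1 * real L) ^ d * real K ^ d"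
          unfolding HKL c1_def power_mult_distrib[symmetric] by (simp only: mult_ac)
        also have "\<dots> \<le> (c1 * real L) ^ d * y" using c1L by (intro mult_left_mono K(1)) auto
        also have "(c1 * real L) ^ d = 2 powr (D * log 2 (c1 * real L))"
        proof -
          have pos: "c1 * real L > 0" using c1L by linarith
          have "2 powr (D * log 2 (c1 * real L)) = (2 powr (log 2 (c1 * real L))) powr D"
            by (simp only: powr_powr mult.commute)
          also have "\<dots> = (c1 * real L) powr real d" using pos by (simp add: D_def)
          also have "\<dots> = (c1 * real L) ^ d" by (rule powr_realpow[OF pos])
          finally show ?thesis by simp
        qed
        also have "\<dots> \<le> 2 powr (real m)" using m by (intro powr_mono) auto
        also have "\<dots> = 2 ^ m" by (simp add: powr_realpow)
        finally show ?thesis using y1 by simp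
      qed
      hence "S \<le> (\<Sum>p\<in>primes_upto (2 ^ m * y) - primes_upto y. ln (real p) / real p)"
        unfolding S_def by (intro sum_mono2) (auto simp: in_primes_upto)
      also have "\<dots> \<le> 8 * real m" using y1 by (intro sum_primes_dyadic) auto
      also have "\<dots> \<le> 8 * (D * log 2 (c1 * real L) + 1)" using m by simp
      also have "\<dots> \<le> 8 * (D * (ln (c1 * (ln y + 1)) / ln 2) + 1)"
      proof -
        have "ln (c1 * real L) \<le> ln (c1 * (ln y + 1))" using c1L L c1 by (intro ln_mono mult_left_mono) auto
        hence "log 2 (c1 * real L) \<le> ln (c1 * (ln y + 1)) / ln 2" unfolding log_def by (intro divide_right_mono) auto
        thus ?thesis using D1 by (intro mult_left_mono add_right_mono) auto
      qed
      finally have "real d * (1 + real_of_int C0) ^ d * S \<le>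
          real d * (1 + real_of_int C0) ^ d * (8 * (D * (ln (c1 * (ln y + 1)) / ln 2) + 1))"
        using C01 by (intro mult_left_mono) auto
      thus ?thesis unfolding b_def by (simp only: mult_ac)
    qed
    finally show ?case using elim(7) by linarith
  qed
  then obtain y1 where y1: "\<And>y. y \<ge> y1 \<Longrightarrow> mertens F y \<ge> ln y - (C3' + 1) * (ln y / ln (ln y))"
    by (auto simp: eventually_at_top_linorder)
  \<comment> \<open>Below \<open>y1\<close> this constant makes the subtracted term at least
    \<open>ln y\<close>, so nonnegativity of the Mertens sum suffices.\<close>
  define C where "C = max (C3' + 1) (ln (ln (max y1 (exp (exp 1)))))"
  show ?thesis
  proof (intro exI[of _ C] conjI allI impI)
    show "C \<ge> 0" using C3' by (simp add: C_def)
    fix y :: real assume y: "y \<ge> exp (exp 1)"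
    have "ln y \<ge> ln (exp (exp 1))" using y by (intro ln_mono) auto
    hence l1: "ln y \<ge> exp 1" by simp
    hence "ln (ln y) \<ge> ln (exp 1)" by (intro ln_mono) auto
    hence l2: "ln (ln y) \<ge> 1" by simp
    have l0: "ln y > 0" using l1 by (meson exp_gt_zero less_le_trans)
    have l3: "ln (ln y) > 0" using l2 by linarith
    have q: "ln y / ln (ln y) \<ge> 0" by (rule divide_nonneg_nonneg[OF less_imp_le[OF l0] less_imp_le[OF l3]])
    show "ln y - C * (ln y / ln (ln y)) \<le> mertens F y"
    proof (cases "y \<ge> y1")
      case True
      have "(C3' + 1) * (ln y / ln (ln y)) \<le> C * (ln y / ln (ln y))" using q by (intro mult_right_mono) (auto simp: C_def)
      thus ?thesis using y1[OF True] by linarith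
    next
      case False
      let ?z = "max y1 (exp (exp 1))"
      have "y \<le> ?z" "y > 0" using False y less_le_trans[OF exp_gt_zero y] by auto
      hence "ln y \<le> ln ?z" by (intro ln_mono) auto
      hence "ln (ln y) \<le> ln (ln ?z)" using ln_mono l0 by blast
      also have "\<dots> \<le> C" by (simp add: C_def)
      finally have "ln (ln y) * (ln y / ln (ln y)) \<le> C * (ln y / ln (ln y))" by (rule mult_right_mono[OF _ q])
      moreover have "ln (ln y) * (ln y / ln (ln y)) = ln y" using less_imp_neq[OF l3] by (metis nonzero_mult_div_cancel_left times_divide_eq_right)
      ultimately have "ln y \<le> C * (ln y / ln (ln y))" by linarith
      thus ?thesis using mertens_nonneg[of F y] by linarith
    qed
  qed
qed

end

section \<open>Irreducible polynomials that need not be monic\<close>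

text \<open>With \<open>a\<close> the leading coefficient, \<open>monicize f\<close> is \<open>a ^ (degree f - 1) * f (t / a)\<close>.\<close>

definition monicize :: "int poly \<Rightarrow> int poly" where
  "monicize f = (\<Sum>i<degree f. monom (coeff f i * lead_coeff f ^ (degree f - 1 - i)) i) + monom 1 (degree f)"

lemma coeff_monicize:
  "coeff (monicize f) i = (if i < degree f then coeff f i * lead_coeff f ^ (degree f - 1 - i)
     else if i = degree f then 1 else 0)"
proof -
  have "coeff (monicize f) i = (\<Sum>k<degree f. if k = i then coeff f k * lead_coeff f ^ (degree f - 1 - k) else 0) +
      (if degree f = i then 1 else 0)"
    unfolding monicize_def coeff_add coeff_sum coeff_monom ..
  also have "(\<Sum>k<degree f. if k = i then coeff f k * lead_coeff f ^ (degree f - 1 - k) else 0) =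
      (if i \<in> {..<degree f} then coeff f i * lead_coeff f ^ (degree f - 1 - i) else 0)"
    by (rule sum.delta) simp
  finally show ?thesis by auto
qed

lemma pcompose_monicize:
  assumes "degree f > 0"
  shows "pcompose (monicize f) [:0, lead_coeff f:] = smult (lead_coeff f ^ (degree f - 1)) f"
proof (rule poly_eqI)
  fix i
  let ?a = "lead_coeff f" and ?n = "degree f"
  consider "i < ?n" | "i = ?n" | "i > ?n" by linarith
  thus "coeff (pcompose (monicize f) [:0, ?a:]) i = coeff (smult (?a ^ (?n - 1)) f) i"
  proof cases
    case 1
    hence "?a ^ i * ?a ^ (?n - 1 - i) = ?a ^ (?n - 1)" by (simp flip: power_add)
    thus ?thesis using 1 by (simp add: coeff_pcompose_linear coeff_monicize)
  next
    case 2
    have "?a ^ ?n = ?a ^ (?n - 1) * ?a" using assms by (metis power_minus_mult)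
    thus ?thesis using 2 by (simp add: coeff_pcompose_linear coeff_monicize)
  next
    case 3
    thus ?thesis by (simp add: coeff_pcompose_linear coeff_monicize coeff_eq_0)
  qed
qed

text \<open>A factorisation of \<open>monicize f\<close> pulls back along
  \<open>t \<mapsto> a * t\<close> to one of a constant multiple of \<open>f\<close>. As
  \<open>f\<close> is prime it divides one of the factors, and comparing degrees shows that the gcd
  of \<open>A\<close> and \<open>monicize f\<close> is constant.\<close>

lemma monic_irr_monicize:
  fixes f :: "int poly"
  assumes irr: "irreducible f" and deg: "degree f > 0"
  shows "monic_irr (monicize f) (degree f)"
proof
  let ?F = "monicize f" and ?n = "degree f" and ?a = "lead_coeff f"
  have f0: "f \<noteq> 0" using deg by auto
  have a0: "?a \<noteq> 0" using f0 by simp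
  show m: "coeff ?F ?n = 1" by (simp add: coeff_monicize)
  show dF: "degree ?F = ?n"
  proof (rule antisym)
    show "degree ?F \<le> ?n" by (rule degree_le) (simp add: coeff_monicize)
    show "?n \<le> degree ?F" using m by (intro le_degree) simp
  qed
  show "?n > 0" by (rule deg)
  fix A :: "int poly" assume A: "A \<noteq> 0" "degree A < ?n"
  define h where "h = gcd A ?F"
  have h0: "h \<noteq> 0" using A by (simp add: h_def)
  obtain k where k: "?F = h * k" unfolding h_def by (meson dvdE gcd_dvd2)
  have F0: "?F \<noteq> 0" using m by auto
  hence k0: "k \<noteq> 0" using k by auto
  let ?c = "\<lambda>P. pcompose P [:0, ?a:]"
  have dc: "degree (?c P) = degree P" for P using a0 by (simp add: degree_pcompose)
  have c0: "?c P \<noteq> 0" if "P \<noteq> 0" for P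
  proof
    assume "?c P = 0"
    hence "coeff P i = 0" for i using coeff_pcompose_linear[of P ?a i] a0 by simp
    thus False using that by (simp add: poly_eq_iff)
  qed
  have "?c h * ?c k = smult (?a ^ (?n - 1)) f" using pcompose_monicize[OF deg] by (simp add: k pcompose_mult)
  hence "f dvd ?c h * ?c k" by (simp add: dvd_smult)
  moreover have "prime_elem f" using irr by (rule irreducible_imp_prime_elem)
  ultimately consider "f dvd ?c h" | "f dvd ?c k" using prime_elem_dvd_multD by blast
  hence "degree h = 0"
  proof cases
    case 1
    have "?n \<le> degree h" using dvd_imp_degree_le[OF 1 c0[OF h0]] unfolding dc .
    moreover have "degree h \<le> degree A" using A by (intro dvd_imp_degree_le) (auto simp: h_def)
    ultimately show ?thesis using A by linarith
  next
    case 2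
    have "?n \<le> degree k" using dvd_imp_degree_le[OF 2 c0[OF k0]] unfolding dc .
    moreover have "degree h + degree k = ?n" using dF k h0 k0 by (metis degree_mult_eq)
    ultimately show ?thesis by linarith
  qed
  thus "\<exists>U V m. m \<noteq> 0 \<and> A * U + ?F * V = [:m:]" using int_poly_bezout[OF A(1), of ?F] by (simp add: h_def)
qed

lemma poly_monicize:
  assumes "degree f > 0"
  shows "poly (monicize f) (lead_coeff f * x) = lead_coeff f ^ (degree f - 1) * poly f x"
  using arg_cong[OF pcompose_monicize[OF assms], of "\<lambda>P. poly P x"] by (simp add: poly_pcompose mult.commute)

text \<open>Modulo such \<open>p\<close> the leading coefficient \<open>a\<close> is invertible, and
  \<open>x \<mapsto> a * x\<close> matches the roots of \<open>f\<close> with those of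
  \<open>monicize f\<close>; one injection in each direction is enough.\<close>

lemma rho_monicize:
  assumes deg: "degree f > 0" and p: "prime p" "\<not> int p dvd lead_coeff f"
  shows "rho (monicize f) p = rho f p"
proof -
  let ?a = "lead_coeff f" and ?p = "int p"
  have pp: "prime ?p" using p by simp
  have p0: "?p > 0" using p(1) by (simp add: prime_gt_0_nat)
  have "coprime ?a ?p" using pp p(2) by (metis prime_imp_coprime coprime_commute)
  then obtain u v where uv: "u * ?a + v * ?p = 1"
    using bezout_int[of ?a ?p] by (auto simp: coprime_iff_gcd_eq_1)
  have ua: "?p dvd u * (?a * x) - x" "?p dvd ?a * (u * x) - x" for x
  proof -
    have "u * ?a - 1 = - v * ?p" using uv by linarith
    hence "?p dvd (u * ?a - 1) * x" by simp
    thus "?p dvd u * (?a * x) - x" "?p dvd ?a * (u * x) - x" by (simp_all add: algebra_simps)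
  qed
  have iff: "?p dvd poly (monicize f) (?a * x) \<longleftrightarrow> ?p dvd poly f x" for x
  proof -
    have "\<not> ?p dvd ?a ^ (degree f - 1)" using prime_dvd_power[OF pp] p(2) by blast
    thus ?thesis unfolding poly_monicize[OF deg] prime_dvd_mult_iff[OF pp] by blast
  qed
  have cong: "?p dvd poly P x \<longleftrightarrow> ?p dvd poly P z" if "?p dvd x - z" for P x z
  proof -
    have "x mod ?p = z mod ?p" using that by (simp add: mod_eq_dvd_iff)
    thus ?thesis using poly_dvd_mod[of ?p P x] poly_dvd_mod[of ?p P z] by simp
  qed
  have le: "card X \<le> card Y" if "finite Y" "X \<subseteq> {0..<?p}" "\<And>x. x \<in> X \<Longrightarrow> (s * x) mod ?p \<in> Y"
     "\<And>x. ?p dvd t * (s * x) - x" for X Y s t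
  proof (rule card_inj_on_le[OF _ _ that(1)])
    show "inj_on (\<lambda>x. (s * x) mod ?p) X"
    proof (rule inj_onI)
      fix x z assume *: "x \<in> X" "z \<in> X" "(s * x) mod ?p = (s * z) mod ?p"
      have "?p dvd s * x - s * z" using *(3) by (simp add: mod_eq_dvd_iff)
      hence "?p dvd t * (s * x - s * z)" by (rule dvd_mult)
      hence "?p dvd t * (s * x - s * z) - (t * (s * x) - x) + (t * (s * z) - z)"
        by (rule dvd_add[OF dvd_diff[OF _ that(4)] that(4)])
      hence "?p dvd x - z" by (simp add: algebra_simps)
      hence "x mod ?p = z mod ?p" by (simp add: mod_eq_dvd_iff)
      moreover have "x \<in> {0..<?p}" "z \<in> {0..<?p}" using * that(2) by auto
      ultimately show "x = z" by simp
    qed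
  qed (use that(3) in auto)
  show ?thesis unfolding rho_def
  proof (rule antisym)
    show "card (roots_mod f p) \<le> card (roots_mod (monicize f) p)"
    proof (rule le[of _ _ ?a u])
      fix x assume "x \<in> roots_mod f p"
      hence "?p dvd poly (monicize f) (?a * x)" unfolding iff by (simp add: roots_mod_def)
      thus "(?a * x) mod ?p \<in> roots_mod (monicize f) p" using p0 by (simp add: roots_mod_def poly_dvd_mod)
    qed (use ua roots_mod_subset in auto)
    show "card (roots_mod (monicize f) p) \<le> card (roots_mod f p)"
    proof (rule le[of _ _ u ?a])
      fix x assume "x \<in> roots_mod (monicize f) p"
      hence "?p dvd poly (monicize f) x" by (simp add: roots_mod_def)
      hence "?p dvd poly (monicize f) (?a * (u * x))" using cong[OF ua(2)] by blast
      hence "?p dvd poly f (u * x)" unfolding iff .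
      thus "(u * x) mod ?p \<in> roots_mod f p" using p0 by (simp add: roots_mod_def poly_dvd_mod)
    qed (use ua roots_mod_subset in auto)
  qed
qed

text \<open>Only the finitely many prime divisors of \<open>a\<close> can spoil the comparison, and
  \<open>rho P p \<le> p\<close> bounds the loss at each of them by \<open>ln p\<close>.\<close>

lemma mertens_differ:
  assumes "a \<noteq> 0" "\<And>p. prime p \<Longrightarrow> \<not> int p dvd a \<Longrightarrow> rho P p \<le> rho Q p"
  shows "mertens P y \<le> mertens Q y + (\<Sum>p\<in>prime_factors (nat \<bar>a\<bar>). ln (real p))"
proof -
  let ?S = "{p\<in>primes_upto y. int p dvd a}"
  have "mertens P y \<le> (\<Sum>p\<in>primes_upto y. real (rho Q p) * ln (real p) / real p + (if int p dvd a then ln (real p) else 0))"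
    unfolding mertens_def
  proof (rule sum_mono)
    fix p assume "p \<in> primes_upto y"
    hence p: "prime p" "p > 0" by (auto simp: in_primes_upto prime_gt_0_nat)
    have q0: "0 \<le> real (rho Q p) * ln (real p) / real p" using p by simp
    show "real (rho P p) * ln (real p) / real p \<le> real (rho Q p) * ln (real p) / real p + (if int p dvd a then ln (real p) else 0)"
    proof (cases "int p dvd a")
      case True
      have "real (rho P p) * ln (real p) \<le> real p * ln (real p)"
        using rho_le[of P p] p by (intro mult_right_mono) auto
      hence "real (rho P p) * ln (real p) / real p \<le> ln (real p)" using p by (simp add: field_simps)
      thus ?thesis using q0 True by simp
    next
      case False
      have "real (rho P p) * ln (real p) / real p \<le> real (rho Q p) * ln (real p) / real p"
        using assms(2)[OF p(1) False] p by (intro divide_right_mono mult_right_mono) auto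
      thus ?thesis using False by simp
    qed
  qed
  also have "\<dots> = mertens Q y + (\<Sum>p\<in>primes_upto y. if int p dvd a then ln (real p) else 0)"
    by (simp add: mertens_def sum.distrib)
  also have "(\<Sum>p\<in>primes_upto y. if int p dvd a then ln (real p) else 0) = (\<Sum>p\<in>?S. ln (real p))"
    by (subst sum.inter_filter) auto
  also have "\<dots> \<le> (\<Sum>p\<in>prime_factors (nat \<bar>a\<bar>). ln (real p))"
  proof (rule sum_mono2)
    show "?S \<subseteq> prime_factors (nat \<bar>a\<bar>)"
    proof
      fix p assume "p \<in> ?S"
      hence p: "prime p" "int p dvd a" by (auto simp: in_primes_upto)
      have "int p dvd int (nat \<bar>a\<bar>)" using p(2) by simp
      hence "p dvd nat \<bar>a\<bar>" by (simp only: int_dvd_int_iff)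
      thus "p \<in> prime_factors (nat \<bar>a\<bar>)" using p(1) assms(1) by (intro prime_factorsI) auto
    qed
  qed (auto dest: in_prime_factors_imp_prime)
  finally show ?thesis by simp
qed

lemma loglog_facts:
  fixes y :: real
  assumes "y \<ge> exp (exp 1)"
  shows "ln (ln y) \<ge> 1" "ln y \<ge> exp 1" "ln y > 0" "ln (ln y) > 0" "ln (ln y) \<le> ln y" "y > 0"
    "1 \<le> ln y / ln (ln y)" "ln (ln y) \<le> 4 * (ln y / ln (ln y))"
proof -
  show y0: "y > 0" using less_le_trans[OF exp_gt_zero assms] .
  have "ln y \<ge> ln (exp (exp 1))" using assms by (intro ln_mono) auto
  thus l1: "ln y \<ge> exp 1" by simp
  hence "ln (ln y) \<ge> ln (exp 1)" by (intro ln_mono) auto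
  thus l2: "ln (ln y) \<ge> 1" by simp
  show l0: "ln y > 0" using l1 by (meson exp_gt_zero less_le_trans)
  show l3: "ln (ln y) > 0" using l2 by linarith
  show l4: "ln (ln y) \<le> ln y" using ln_le_minus_one[OF l0] by linarith
  show "1 \<le> ln y / ln (ln y)" using l3 l4 by (simp only: le_divide_eq_1_pos)
  \<comment> \<open>From \<open>t / 2 \<le> exp (t / 2)\<close> one gets
    \<open>t\<^sup>2 \<le> 4 * exp t\<close>, which is the factor 4.\<close>
  define t where "t = ln (ln y)"
  have t: "t > 0" "exp t = ln y" using l3 l0 by (auto simp: t_def)
  have "(t / 2) ^ 2 \<le> (exp (t / 2)) ^ 2"
    using t(1) exp_ge_add_one_self[of "t / 2"] by (intro power_mono) linarith+
  also have "\<dots> = exp t" by (simp add: power2_eq_square flip: exp_add)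
  finally have "t * t \<le> 4 * ln y" using t(2) by (simp add: power2_eq_square)
  hence "t \<le> 4 * ln y / t" using t(1) by (simp only: pos_le_divide_eq)
  thus "ln (ln y) \<le> 4 * (ln y / ln (ln y))" by (simp add: t_def)
qed

theorem irreducible_mertens:
  fixes f :: "int poly"
  assumes "irreducible f" "degree f > 0"
  shows "\<exists>C\<ge>0. \<forall>y\<ge>exp (exp 1). mertens f y \<le> ln y + C * ln (ln y) \<and> mertens f y \<ge> ln y - C * (ln y / ln (ln y))"
proof -
  interpret monic_irr "monicize f" "degree f" by (rule monic_irr_monicize[OF assms])
  obtain C1 where C1: "C1 \<ge> 0" "\<And>y. y \<ge> exp (exp 1) \<Longrightarrow> mertens (monicize f) y \<le> ln y + C1 * ln (ln y)"
    using mertens_upper by blast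
  obtain C2 where C2: "C2 \<ge> 0" "\<And>y. y \<ge> exp (exp 1) \<Longrightarrow> mertens (monicize f) y \<ge> ln y - C2 * (ln y / ln (ln y))"
    using mertens_lower by blast
  have a0: "lead_coeff f \<noteq> 0" using assms(2) by auto
  define c where "c = (\<Sum>p\<in>prime_factors (nat \<bar>lead_coeff f\<bar>). ln (real p))"
  have c0: "c \<ge> 0" unfolding c_def by (intro sum_nonneg) (auto dest: in_prime_factors_imp_prime)
  define C where "C = C1 + C2 + c"
  show ?thesis
  proof (intro exI[of _ C] conjI allI impI)
    show "C \<ge> 0" using C1(1) C2(1) c0 by (simp add: C_def)
    fix y :: real assume y: "y \<ge> exp (exp 1)"
    note l = loglog_facts[OF y]
    have m1: "mertens f y \<le> mertens (monicize f) y + c"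
      unfolding c_def by (rule mertens_differ[OF a0]) (metis rho_monicize assms(2) order_refl)
    have m2: "mertens (monicize f) y \<le> mertens f y + c"
      unfolding c_def by (rule mertens_differ[OF a0]) (metis rho_monicize assms(2) order_refl)
    have "C1 * ln (ln y) + c * 1 \<le> C1 * ln (ln y) + (C2 + c) * ln (ln y)"
      by (intro add_left_mono mult_mono l(1)) (use l(1) c0 C2(1) in linarith)+
    thus "mertens f y \<le> ln y + C * ln (ln y)" using m1 C1(2)[OF y] unfolding C_def distrib_right by linarith
    have "C2 * (ln y / ln (ln y)) + c * 1 \<le> C2 * (ln y / ln (ln y)) + (C1 + c) * (ln y / ln (ln y))"
      by (intro add_left_mono mult_mono l(7)) (use l(7) c0 C1(1) in linarith)+
    also have "\<dots> = C * (ln y / ln (ln y))" unfolding C_def by (simp only: distrib_right)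
    finally show "ln y - C * (ln y / ln (ln y)) \<le> mertens f y" using m2 C2(2)[OF y] by linarith
  qed
qed

section \<open>Second moments and roots modulo prime powers\<close>

lemma sum_ln_square_bounded:
  "\<exists>B\<ge>0. \<forall>S. finite S \<longrightarrow> (\<Sum>n\<in>S. (ln (real n))\<^sup>2 / (real n)\<^sup>2) \<le> B"
proof -
  let ?g = "\<lambda>n::nat. (ln (real n))\<^sup>2 / (real n)\<^sup>2"
  let ?r = "\<lambda>n::nat. 1 / sqrt (real n)"
  have "(\<lambda>n. ?r n) \<longlonglongrightarrow> 0" by real_asymp
  hence "summable (\<lambda>n. ?r n - ?r (Suc n))" by (rule telescope_summable')
  moreover have "eventually (\<lambda>n::nat. norm (?g n) \<le> ?r n - ?r (Suc n)) sequentially"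
  proof -
    have "eventually (\<lambda>x::real. (ln x)\<^sup>2 / x\<^sup>2 \<le> 1 / sqrt x - 1 / sqrt (1 + x)) at_top" by real_asymp
    hence "eventually (\<lambda>n::nat. ?g n \<le> 1 / sqrt (real n) - 1 / sqrt (1 + real n)) sequentially"
      by (rule eventually_compose_filterlim[OF _ filterlim_real_sequentially])
    thus ?thesis by simp
  qed
  ultimately have s: "summable ?g" by (rule summable_comparison_test_ev[rotated])
  show ?thesis
  proof (intro exI[of _ "suminf ?g"] conjI allI impI)
    show "0 \<le> suminf ?g" by (rule suminf_nonneg[OF s]) simp
    fix S :: "nat set" assume "finite S"
    thus "sum ?g S \<le> suminf ?g" by (intro sum_le_suminf[OF s]) auto
  qed
qed

text \<open>Partial summation. The Mertens sums at smaller arguments enter with a negative sign, so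
  an upper bound for the second moment needs the lower estimate \<open>lo\<close>, whose error
  determines the result.\<close>

lemma mertens_square_sum:
  assumes C: "C \<ge> 0"
    and up: "\<And>y. y \<ge> exp (exp 1) \<Longrightarrow> mertens P y \<le> ln y + C * ln (ln y)"
    and lo: "\<And>y. y \<ge> exp (exp 1) \<Longrightarrow> mertens P y \<ge> ln y - C * (ln y / ln (ln y))"
    and z: "z \<ge> exp (exp 1)"
  shows "(\<Sum>p\<in>primes_upto z. real (rho P p) * (ln (real p))\<^sup>2 / real p) \<le>
      (ln z)\<^sup>2 / 2 + (5 * C + exp 1 + 2) * ((ln z)\<^sup>2 / ln (ln z))"
proof -
  note l = loglog_facts[OF z]
  define q where "q = ln z / ln (ln z)"
  have q1: "q \<ge> 1" using l(7) by (simp only: q_def)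
  \<comment> \<open>A uniform error for all \<open>n \<le> z\<close>:
    \<open>ln n / ln (ln n)\<close> increases from \<open>exp (exp 1)\<close> on, and the summand
    \<open>exp 1\<close> covers smaller \<open>n\<close>, where
    \<open>ln n \<le> exp 1\<close>.\<close>
  define E where "E = (C + exp 1) * q"
  define N where "N = nat \<lfloor>z\<rfloor>"
  have z1: "z \<ge> 1" using z by (meson exp_ge_zero one_le_exp_iff order_trans)
  have "\<lfloor>z\<rfloor> \<ge> 1" using z1 by (simp add: le_floor_iff)
  hence N: "real N \<le> z" "z < real N + 1" "N \<ge> 1" unfolding N_def by linarith+
  have pu: "primes_upto z = primes_upto (real N)"
  proof -
    have "real p \<le> z \<longleftrightarrow> real p \<le> real N" for p :: nat
    proof
      assume "real p \<le> z"
      hence "real p < real (N + 1)" using N(2) by simp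
      thus "real p \<le> real N" by simp
    qed (use N(1) in linarith)
    thus ?thesis by (simp add: primes_upto_def)
  qed
  define a where "a p = real (rho P p) * ln (real p) / real p" for p
  define dl where "dl n = ln (real (Suc n)) - ln (real n)" for n :: nat
  have a0: "a p \<ge> 0" if "prime p" for p using that by (simp add: a_def)
  have dl0: "dl n \<ge> 0" "dl n \<le> 1 / real n" if "n \<ge> 1" for n
  proof -
    have "ln (real n) \<le> ln (real (Suc n))" using that by (intro ln_mono) auto
    thus "dl n \<ge> 0" unfolding dl_def by linarith
    have "dl n = ln (real (Suc n) / real n)" unfolding dl_def using that by (subst ln_div) auto
    also have "\<dots> \<le> real (Suc n) / real n - 1" using that by (intro ln_le_minus_one) auto
    also have "\<dots> = 1 / real n" using that by (simp add: field_simps)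
    finally show "dl n \<le> 1 / real n" .
  qed
  have tel: "(\<Sum>n\<in>{p..<N}. dl n) = ln (real N) - ln (real p)" if "p \<le> N" for p
    unfolding dl_def using sum_Suc_diff'[OF that, of "\<lambda>n. ln (real n)"] .
  have "(\<Sum>p\<in>primes_upto z. real (rho P p) * (ln (real p))\<^sup>2 / real p) = (\<Sum>p\<in>primes_upto (real N). a p * ln (real p))"
    unfolding pu by (intro sum.cong refl) (simp add: a_def power2_eq_square)
  also have "\<dots> = (\<Sum>p\<in>primes_upto (real N). ln (real N) * a p - (\<Sum>n\<in>{p..<N}. dl n * a p))"
  proof (rule sum.cong[OF refl])
    fix p assume "p \<in> primes_upto (real N)"
    hence "p \<le> N" by (simp add: in_primes_upto)
    from tel[OF this] have "(\<Sum>n\<in>{p..<N}. dl n * a p) = (ln (real N) - ln (real p)) * a p"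
      by (simp add: sum_distrib_right[symmetric])
    thus "a p * ln (real p) = ln (real N) * a p - (\<Sum>n\<in>{p..<N}. dl n * a p)" by (simp add: algebra_simps)
  qed
  also have "\<dots> = ln (real N) * mertens P z - (\<Sum>p\<in>primes_upto (real N). \<Sum>n\<in>{p..<N}. dl n * a p)"
    unfolding pu mertens_def sum_subtractf by (simp add: a_def sum_distrib_left)
  also have "(\<Sum>p\<in>primes_upto (real N). \<Sum>n\<in>{p..<N}. dl n * a p) = (\<Sum>n\<in>{1..<N}. dl n * mertens P (real n))"
  proof -
    have "(\<Sum>p\<in>primes_upto (real N). \<Sum>n\<in>{p..<N}. dl n * a p) =
        (\<Sum>p\<in>primes_upto (real N). \<Sum>n\<in>{n\<in>{1..<N}. p \<le> n}. dl n * a p)"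
    proof (rule sum.cong[OF refl])
      fix p assume "p \<in> primes_upto (real N)"
      hence "p \<ge> 1" by (auto simp: in_primes_upto prime_gt_0_nat Suc_leI)
      hence "{p..<N} = {n\<in>{1..<N}. p \<le> n}" by auto
      thus "(\<Sum>n\<in>{p..<N}. dl n * a p) = (\<Sum>n\<in>{n\<in>{1..<N}. p \<le> n}. dl n * a p)" by (simp only:)
    qed
    also have "\<dots> = (\<Sum>n\<in>{1..<N}. \<Sum>p\<in>{p\<in>primes_upto (real N). p \<le> n}. dl n * a p)"
      by (rule sum.swap_restrict) auto
    also have "\<dots> = (\<Sum>n\<in>{1..<N}. dl n * mertens P (real n))"
    proof (rule sum.cong[OF refl])
      fix n assume n: "n \<in> {1..<N}"
      have "{p\<in>primes_upto (real N). p \<le> n} = primes_upto (real n)" using n by (auto simp: in_primes_upto)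
      thus "(\<Sum>p\<in>{p\<in>primes_upto (real N). p \<le> n}. dl n * a p) = dl n * mertens P (real n)"
        by (simp add: mertens_def a_def sum_distrib_left)
    qed
    finally show ?thesis .
  qed
  finally have eq: "(\<Sum>p\<in>primes_upto z. real (rho P p) * (ln (real p))\<^sup>2 / real p) =
     ln (real N) * mertens P z - (\<Sum>n\<in>{1..<N}. dl n * mertens P (real n))" .
  have low: "mertens P (real n) \<ge> ln (real n) - E" if n: "n \<ge> 1" "real n \<le> z" for n
  proof (cases "real n \<ge> exp (exp 1)")
    case True
    note l' = loglog_facts[OF True]
    have "ln (real n) \<le> ln z" using n l' by (intro ln_mono) auto
    hence "ln (ln z) / ln z \<le> ln (ln (real n)) / ln (real n)" by (intro ln_x_over_x_mono l'(2))
    hence "inverse (ln (ln (real n)) / ln (real n)) \<le> inverse (ln (ln z) / ln z)"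
      using l l' by (intro le_imp_inverse_le divide_pos_pos) auto
    hence "ln (real n) / ln (ln (real n)) \<le> q" by (simp only: q_def inverse_divide)
    hence "C * (ln (real n) / ln (ln (real n))) \<le> C * q" using C by (intro mult_left_mono)
    also have "\<dots> \<le> E" unfolding E_def using q1 by (intro mult_right_mono) auto
    finally show ?thesis using lo[OF True] by linarith
  next
    case False
    have "ln (real n) \<le> ln (exp (exp 1))" using n False by (intro ln_mono) auto
    also have "\<dots> = exp 1 * 1" by simp
    also have "\<dots> \<le> (C + exp 1) * q" using q1 C by (intro mult_mono) auto
    finally show ?thesis using mertens_nonneg[of P "real n"] unfolding E_def by linarith
  qed
  have E0: "E \<ge> 0" unfolding E_def using C q1 by (intro mult_nonneg_nonneg) auto
  have "(\<Sum>n\<in>{1..<N}. dl n * mertens P (real n)) \<ge> (\<Sum>n\<in>{1..<N}. dl n * (ln (real n) - E))"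
    using N by (intro sum_mono mult_left_mono low dl0) auto
  moreover have "(\<Sum>n\<in>{1..<N}. dl n * (ln (real n) - E)) = (\<Sum>n\<in>{1..<N}. dl n * ln (real n)) - E * ln (real N)"
  proof -
    have "(\<Sum>n\<in>{1..<N}. dl n * (ln (real n) - E)) = (\<Sum>n\<in>{1..<N}. dl n * ln (real n)) - (\<Sum>n\<in>{1..<N}. dl n) * E"
      by (simp add: right_diff_distrib sum_subtractf sum_distrib_right)
    thus ?thesis using tel[OF N(3)] by simp
  qed
  moreover have "(\<Sum>n\<in>{1..<N}. dl n * ln (real n)) \<ge> (ln (real N))\<^sup>2 / 2 - 1"
  proof -
    have "(ln (real N))\<^sup>2 / 2 = (\<Sum>n\<in>{1..<N}. (ln (real (Suc n)))\<^sup>2 / 2 - (ln (real n))\<^sup>2 / 2)"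
      using sum_Suc_diff'[OF N(3), of "\<lambda>n. (ln (real n))\<^sup>2 / 2"] by simp
    also have "\<dots> \<le> (\<Sum>n\<in>{1..<N}. dl n * ln (real n) + (1 / (real n)\<^sup>2) / 2)"
    proof (rule sum_mono)
      fix n assume n: "n \<in> {1..<N}"
      have "ln (real (Suc n)) = ln (real n) + dl n" by (simp add: dl_def)
      hence "(ln (real (Suc n)))\<^sup>2 / 2 - (ln (real n))\<^sup>2 / 2 = dl n * ln (real n) + (dl n)\<^sup>2 / 2"
        by (simp only:) (simp add: power2_eq_square algebra_simps add_divide_distrib)
      also have "(dl n)\<^sup>2 \<le> (1 / real n)\<^sup>2" using dl0[of n] n by (intro power_mono) auto
      finally show "(ln (real (Suc n)))\<^sup>2 / 2 - (ln (real n))\<^sup>2 / 2 \<le> dl n * ln (real n) + (1 / (real n)\<^sup>2) / 2"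
        by (simp add: power_divide)
    qed
    also have "\<dots> = (\<Sum>n\<in>{1..<N}. dl n * ln (real n)) + (\<Sum>n\<in>{1..<N}. 1 / (real n)\<^sup>2) / 2"
      by (simp only: sum.distrib sum_divide_distrib)
    also have "(\<Sum>n\<in>{1..<N}. 1 / (real n)\<^sup>2) \<le> 2"
    proof -
      have "(\<Sum>n\<in>{1..<N}. 1 / (real n)\<^sup>2) \<le> (\<Sum>n\<in>insert 1 {2..<N}. 1 / (real n)\<^sup>2)" by (rule sum_mono2) auto
      also have "\<dots> = 1 / (real 1)\<^sup>2 + (\<Sum>n\<in>{2..<N}. 1 / (real n)\<^sup>2)" by (rule sum.insert) auto
      also have "(\<Sum>n\<in>{2..<N}. 1 / (real n)\<^sup>2) \<le> 1 / real 1" by (rule sum_inverse_squares_tail) auto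
      finally show ?thesis by simp
    qed
    finally show ?thesis by linarith
  qed
  ultimately have S: "(\<Sum>n\<in>{1..<N}. dl n * mertens P (real n)) \<ge> (ln (real N))\<^sup>2 / 2 - 1 - E * ln (real N)" by linarith
  have lN: "ln (real N) \<le> ln z" "ln (real N) \<ge> 0" using N by (auto intro!: ln_mono)
  have lN2: "ln z \<le> ln (real N) + 1"
  proof -
    have "ln z \<le> ln (real (Suc N))" using N l(6) by (intro ln_mono) auto
    also have "\<dots> = ln (real N) + dl N" by (simp add: dl_def)
    also have "dl N \<le> 1 / real N" using dl0(2)[OF N(3)] .
    also have "\<dots> \<le> 1" using N(3) by simp
    finally show ?thesis by simp
  qed
  have sq: "(ln z)\<^sup>2 / 2 - ln z \<le> (ln (real N))\<^sup>2 / 2"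
  proof -
    have "(ln z)\<^sup>2 - (ln (real N))\<^sup>2 = (ln z - ln (real N)) * (ln z + ln (real N))"
      by (simp add: power2_eq_square algebra_simps)
    also have "\<dots> \<le> 1 * (2 * ln z)" using lN lN2 by (intro mult_mono) auto
    finally show ?thesis by simp
  qed
  have "ln (real N) * mertens P z \<le> ln z * (ln z + C * ln (ln z))"
    using lN up[OF z] mertens_nonneg[of P z] l by (intro mult_mono) auto
  moreover have "E * ln (real N) \<le> E * ln z" using lN E0 by (intro mult_left_mono)
  ultimately have "(\<Sum>p\<in>primes_upto z. real (rho P p) * (ln (real p))\<^sup>2 / real p) \<le>
      ln z * (ln z + C * ln (ln z)) - (ln z)\<^sup>2 / 2 + ln z + 1 + E * ln z" unfolding eq using S sq by linarith
  also have "\<dots> = (ln z)\<^sup>2 / 2 + ln z * (C * ln (ln z)) + ln z * 1 + 1 + ln z * ((C + exp 1) * q)"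
    unfolding E_def by (simp add: power2_eq_square algebra_simps)
  \<comment> \<open>The final constant collects \<open>4 * C\<close> from the upper estimate at
    \<open>z\<close>, \<open>C + exp 1\<close> from \<open>E\<close>, and 1 each for the terms
    \<open>ln z\<close> and 1 caused by rounding.\<close>
  also have "\<dots> \<le> (ln z)\<^sup>2 / 2 + ln z * (C * (4 * q)) + ln z * q + ln z * q + ln z * ((C + exp 1) * q)"
  proof -
    have "C * ln (ln z) \<le> C * (4 * q)" using l(8) C unfolding q_def by (intro mult_left_mono)
    hence "ln z * (C * ln (ln z)) \<le> ln z * (C * (4 * q))" by (rule mult_left_mono[OF _ less_imp_le[OF l(3)]])
    moreover have "ln z * 1 \<le> ln z * q" by (rule mult_left_mono[OF q1 less_imp_le[OF l(3)]])
    moreover have "1 \<le> ln z * q"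
    proof -
      have "1 \<le> ln z" using l(1,5) by linarith
      thus ?thesis using q1 mult_mono[of 1 "ln z" 1 q] by linarith
    qed
    ultimately show ?thesis by linarith
  qed
  also have "\<dots> = (ln z)\<^sup>2 / 2 + (5 * C + exp 1 + 2) * (ln z * q)" by (simp add: algebra_simps)
  also have "ln z * q = (ln z)\<^sup>2 / ln (ln z)" by (simp add: q_def power2_eq_square)
  finally show ?thesis .
qed

text \<open>If \<open>p\<close> does not divide \<open>R\<close>, roots modulo \<open>p\<close> are
  simple and the case \<open>j = 1\<close> suffices. Otherwise let \<open>p ^ e\<close> divide
  \<open>R\<close> exactly. At a root modulo a higher power the derivative is not divisible by
  \<open>p ^ (e + 1)\<close>, so a root is determined by its residue modulo
  \<open>p ^ (e + 1)\<close> up to a multiple of \<open>p ^ (j - e)\<close>. This leaves at most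
  \<open>p ^ (2 * e + 1)\<close> roots, and \<open>p ^ e\<close> and \<open>p\<close> are both at
  most \<open>\<bar>R\<bar>\<close>.\<close>

lemma rho_prime_power_bounded:
  fixes h :: "int poly"
  assumes UV: "h * U + pderiv h * V = [:R:]" and R: "R \<noteq> 0" and h: "h \<noteq> 0"
    and p: "prime p" and j: "j \<ge> 1"
  shows "int (rho h (p ^ j)) \<le> int (degree h) + \<bar>lead_coeff h\<bar> + \<bar>R\<bar> ^ 3"
proof (cases "int p dvd R")
  case False
  have "\<not> int p dvd poly (pderiv h) r" if "int p dvd poly h r" for r
  proof
    assume *: "int p dvd poly (pderiv h) r"
    have "R = poly h r * poly U r + poly (pderiv h) r * poly V r"
      using arg_cong[OF UV, of "\<lambda>P. poly P r"] by simp
    hence "int p dvd R" using * that by simp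
    thus False using False by simp
  qed
  hence 1: "rho h (p ^ j) \<le> rho h p" using p j by (intro rho_prime_power_le) auto
  have R3: "\<bar>R\<bar> ^ 3 \<ge> 0" by simp
  show ?thesis
  proof (cases "int p dvd lead_coeff h")
    case True
    hence "\<bar>int p\<bar> \<le> \<bar>lead_coeff h\<bar>" using h by (intro dvd_imp_le_int) auto
    thus ?thesis using 1 rho_le[of h p] R3 by linarith
  next
    case False
    thus ?thesis using 1 rho_prime_le[OF p False] R3 by linarith
  qed
next
  case True
  define e where "e = multiplicity (int p) R"
  have pp: "prime (int p)" using p by simp
  have u: "\<not> is_unit (int p)" using pp by (auto simp: not_prime_unit)
  have pe: "int p ^ e dvd R" unfolding e_def by (rule multiplicity_dvd)
  have npe: "\<not> int p ^ Suc e dvd R"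
  proof
    assume "int p ^ Suc e dvd R"
    hence "Suc e \<le> multiplicity (int p) R" using R u by (intro multiplicity_geI) auto
    thus False by (simp add: e_def)
  qed
  have p0: "p > 0" using p by (simp add: prime_gt_0_nat)
  have "int p ^ e \<le> \<bar>R\<bar>" using dvd_imp_le_int[OF R pe] by simp
  moreover have "int p \<le> \<bar>R\<bar>" using dvd_imp_le_int[OF R True] by simp
  ultimately have "(int p ^ e * int p ^ e) * int p \<le> (\<bar>R\<bar> * \<bar>R\<bar>) * \<bar>R\<bar>" by (intro mult_mono) auto
  moreover have "int p ^ (2 * e + 1) = (int p ^ e * int p ^ e) * int p" by (simp only: mult_2 power_add power_one_right)
  ultimately have big: "int p ^ (2 * e + 1) \<le> \<bar>R\<bar> ^ 3" by (simp only: power3_eq_cube)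
  have "rho h (p ^ j) \<le> p ^ (2 * e + 1)"
  proof (cases "j \<le> 2 * e + 1")
    case True
    have "rho h (p ^ j) \<le> p ^ j" by (rule rho_le)
    also have "\<dots> \<le> p ^ (2 * e + 1)" using True p0 by (intro power_increasing) auto
    finally show ?thesis .
  next
    case False
    hence je: "j > 2 * e + 1" by simp
    \<comment> \<open>Roots with equal first component are congruent modulo
      \<open>p ^ (j - e)\<close>; the second component, one of \<open>p ^ e\<close> values, then
      separates them.\<close>
    let ?f = "\<lambda>r. (r mod int p ^ Suc e, r div int p ^ (j - e))"
    have "inj_on ?f (roots_mod h (p ^ j))"
    proof (rule inj_onI)
      fix r s assume *: "r \<in> roots_mod h (p ^ j)" "s \<in> roots_mod h (p ^ j)" "?f r = ?f s"
      have hr: "int p ^ j dvd poly h r" "int p ^ j dvd poly h s" using * by (auto simp: roots_mod_def)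
      have "r mod int p ^ Suc e = s mod int p ^ Suc e" using *(3) by simp
      hence rs: "int p ^ Suc e dvd s - r" by (metis mod_eq_dvd_iff)
      obtain w where w: "poly h (r + (s - r)) - poly h r - (s - r) * poly (pderiv h) r = (s - r)\<^sup>2 * w"
        using taylor_square_dvd[of "s - r" h r] by (auto elim: dvdE)
      have eq: "poly h s - poly h r = (poly (pderiv h) r + (s - r) * w) * (s - r)"
        using w by (simp add: algebra_simps power2_eq_square)
      have "int p ^ j dvd poly h s - poly h r" using hr by (intro dvd_diff)
      moreover have "j = (j - e) + e" using je by simp
      ultimately have "int p ^ ((j - e) + e) dvd (poly (pderiv h) r + (s - r) * w) * (s - r)"
        using eq by metis
      moreover have "\<not> int p ^ Suc e dvd poly (pderiv h) r + (s - r) * w"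
      proof
        assume a: "int p ^ Suc e dvd poly (pderiv h) r + (s - r) * w"
        have "int p ^ Suc e dvd (s - r) * w" using rs by (rule dvd_mult2)
        hence "int p ^ Suc e dvd poly (pderiv h) r" using a by (simp only: dvd_add_left_iff)
        moreover have "int p ^ Suc e dvd int p ^ j" using je by (intro le_imp_power_dvd) simp
        hence "int p ^ Suc e dvd poly h r" using hr(1) dvd_trans by blast
        ultimately have "int p ^ Suc e dvd poly h r * poly U r + poly (pderiv h) r * poly V r"
          by (intro dvd_add dvd_mult2)
        moreover have "R = poly h r * poly U r + poly (pderiv h) r * poly V r"
          using arg_cong[OF UV, of "\<lambda>P. poly P r"] by simp
        ultimately show False using npe by simp
      qed
      ultimately have "int p ^ (j - e) dvd s - r" using prime_power_dvd_cancel[OF pp] by blast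
      hence "r mod int p ^ (j - e) = s mod int p ^ (j - e)" by (metis mod_eq_dvd_iff)
      moreover have "r div int p ^ (j - e) = s div int p ^ (j - e)" using *(3) by simp
      ultimately show "r = s" by (metis mult_div_mod_eq)
    qed
    moreover have "?f ` roots_mod h (p ^ j) \<subseteq> {0..<int p ^ Suc e} \<times> {0..<int p ^ e}"
    proof (rule image_subsetI)
      fix r assume r: "r \<in> roots_mod h (p ^ j)"
      hence r': "0 \<le> r" "r < int p ^ j" by (auto simp: roots_mod_def)
      have pos: "int p ^ n > 0" for n using p0 by simp
      have "j = e + (j - e)" using je by simp
      hence rlt: "r < int p ^ e * int p ^ (j - e)" using r'(2) by (metis power_add)
      have "r div int p ^ (j - e) < int p ^ e"
      proof (rule ccontr)
        assume "\<not> ?thesis"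
        hence "int p ^ e * int p ^ (j - e) \<le> (r div int p ^ (j - e)) * int p ^ (j - e)"
          using pos[of "j - e"] by (intro mult_right_mono) linarith+
        also have "\<dots> \<le> r" using pos_mod_sign[OF pos[of "j - e"], of r] div_mult_mod_eq[of r "int p ^ (j - e)"] by linarith
        finally show False using rlt by linarith
      qed
      moreover have "r div int p ^ (j - e) \<ge> 0" using r'(1) pos[of "j - e"] by (simp add: pos_imp_zdiv_nonneg_iff)
      moreover have "r mod int p ^ Suc e \<in> {0..<int p ^ Suc e}" using pos[of "Suc e"] by (simp del: power_Suc)
      ultimately show "?f r \<in> {0..<int p ^ Suc e} \<times> {0..<int p ^ e}" by simp
    qed
    ultimately have "card (roots_mod h (p ^ j)) \<le> card ({0..<int p ^ Suc e} \<times> {0..<int p ^ e})"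
      by (intro card_inj_on_le) auto
    also have "\<dots> = nat (int p ^ Suc e) * nat (int p ^ e)" by (simp add: card_cartesian_product)
    also have "\<dots> = p ^ Suc e * p ^ e" by (simp only: nat_power_eq[OF of_nat_0_le_iff] nat_int)
    also have "\<dots> = p ^ (2 * e + 1)" by (simp add: power_add mult_2)
    finally show ?thesis by (simp add: rho_def)
  qed
  hence "int (rho h (p ^ j)) \<le> int (p ^ (2 * e + 1))" by (simp only: of_nat_le_iff)
  also have "\<dots> \<le> \<bar>R\<bar> ^ 3" using big by simp
  finally show ?thesis by simp
qed

section \<open>Prime powers dividing the values of the radical\<close>

text \<open>Smoothness of a value of \<open>f\<close> passes to the divisor \<open>rad f\<close>,
  which has degree exactly \<open>d\<close>. It has no repeated factor, and this is what bounds the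
  number of its roots modulo prime powers.\<close>

definition rad :: "int poly \<Rightarrow> int poly" where "rad f = \<Prod>(irred_factors f)"

lemma irred_factorsD:
  assumes "q \<in> irred_factors f"
  shows "prime q" "irreducible q" "degree q > 0" "q dvd f" "q \<noteq> 0"
  using assms unfolding irred_factors_def
  by (auto simp: prime_def irreducible_imp_prime_elem)

lemma finite_irred_factors: "f \<noteq> 0 \<Longrightarrow> finite (irred_factors f)"
proof (rule finite_subset[of _ "prime_factors f"])
  assume "f \<noteq> 0"
  thus "irred_factors f \<subseteq> prime_factors f" using irred_factorsD by (auto intro!: prime_factorsI)
qed simp

lemma degree_rad: "degree (rad f) = total_degree f"
proof (cases "finite (irred_factors f)")
  case True
  thus ?thesis unfolding rad_def total_degree_def using irred_factorsD(5) by (subst degree_prod_sum_eq) auto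
next
  case False
  thus ?thesis by (simp add: rad_def total_degree_def)
qed

lemma rad_dvd: assumes "f \<noteq> 0" shows "rad f dvd f"
  unfolding rad_def
proof (rule prod_coprime_dvd)
  show "finite (irred_factors f)" by (rule finite_irred_factors[OF assms])
  show "coprime a b" if "a \<in> irred_factors f" "b \<in> irred_factors f" "a \<noteq> b" for a b
    using irred_factorsD(1)[OF that(1)] irred_factorsD(1)[OF that(2)] that(3) by (rule primes_coprime)
qed (rule irred_factorsD(4))

lemma dvd_prod_primes_unit:
  fixes u :: "int poly"
  assumes "finite S" "\<And>q. q \<in> S \<Longrightarrow> prime q" "\<And>q. q \<in> S \<Longrightarrow> \<not> q dvd u" "u dvd \<Prod>S"
  shows "u dvd 1"
  using assms
proof (induction S rule: finite_induct)
  case (insert q S)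
  have "coprime q u" using insert.prems(1,2) by (intro prime_imp_coprime) auto
  hence "coprime u q" by (simp add: coprime_commute)
  moreover have "u dvd q * \<Prod>S" using insert by simp
  ultimately have "u dvd \<Prod>S" by (simp add: coprime_dvd_mult_right_iff)
  thus ?case using insert by auto
qed simp

text \<open>An irreducible factor \<open>q\<close> of \<open>rad f\<close> that also divides the
  derivative divides \<open>pderiv q\<close> times the other factors; its degree and the
  distinctness of the factors exclude this.\<close>

lemma rad_bezout:
  assumes f: "f \<noteq> 0"
  shows "\<exists>U V R. R \<noteq> 0 \<and> rad f * U + pderiv (rad f) * V = [:R:]"
proof (rule int_poly_bezout)
  have fin: "finite (irred_factors f)" by (rule finite_irred_factors[OF f])
  show "rad f \<noteq> 0" using rad_dvd[OF f] f by auto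
  have "gcd (rad f) (pderiv (rad f)) dvd 1"
  proof (rule dvd_prod_primes_unit[OF fin])
    show "prime q" if "q \<in> irred_factors f" for q using irred_factorsD(1)[OF that] .
    show "gcd (rad f) (pderiv (rad f)) dvd \<Prod>(irred_factors f)" unfolding rad_def by simp
    fix q assume q: "q \<in> irred_factors f"
    note qD = irred_factorsD[OF q]
    show "\<not> q dvd gcd (rad f) (pderiv (rad f))"
    proof
      assume "q dvd gcd (rad f) (pderiv (rad f))"
      hence d: "q dvd pderiv (rad f)" using dvd_trans gcd_dvd2 by blast
      define k where "k = \<Prod>(irred_factors f - {q})"
      have rk: "rad f = q * k" unfolding rad_def k_def using fin q by (intro prod.remove)
      have "q dvd pderiv q * k"
      proof -
        have "pderiv (rad f) = q * pderiv k + k * pderiv q" unfolding rk by (rule pderiv_mult)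
        hence "q dvd k * pderiv q" using d by (simp add: dvd_add_right_iff)
        thus ?thesis by (simp only: mult.commute)
      qed
      hence "q dvd pderiv q \<or> q dvd k" using qD(1) by (simp add: prime_dvd_mult_iff)
      thus False
      proof
        assume a: "q dvd pderiv q"
        have "pderiv q \<noteq> 0" using qD(3) by (simp add: pderiv_eq_0_iff)
        hence "degree q \<le> degree (pderiv q)" by (rule dvd_imp_degree_le[OF a])
        thus False using qD(3) by (simp add: degree_pderiv)
      next
        assume "q dvd k"
        then obtain s where s: "s \<in> irred_factors f - {q}" "q dvd s"
          unfolding k_def using qD(1) fin by (auto simp: prime_dvd_prod_iff)
        hence "q = s" using primes_dvd_imp_eq[OF qD(1) irred_factorsD(1), of s f] by auto
        thus False using s by simp
      qed
    qed
  qed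
  hence "is_unit (gcd (rad f) (pderiv (rad f)))" .
  thus "degree (gcd (rad f) (pderiv (rad f))) = 0" by (metis is_unit_polyE degree_pCons_0)
qed

lemma rho_rad_le:
  assumes f: "f \<noteq> 0" and p: "prime p"
  shows "rho (rad f) p \<le> (\<Sum>q\<in>irred_factors f. rho q p)"
proof -
  have fin: "finite (irred_factors f)" by (rule finite_irred_factors[OF f])
  have "roots_mod (rad f) p \<subseteq> (\<Union>q\<in>irred_factors f. roots_mod q p)"
    using p fin by (auto simp: roots_mod_def rad_def poly_prod prime_dvd_prod_iff)
  hence "card (roots_mod (rad f) p) \<le> card (\<Union>q\<in>irred_factors f. roots_mod q p)"
    using fin by (intro card_mono) auto
  also have "\<dots> \<le> (\<Sum>q\<in>irred_factors f. card (roots_mod q p))" by (rule card_UN_le[OF fin])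
  finally show ?thesis by (simp add: rho_def)
qed

section \<open>Sums over prime powers up to \<open>y\<close>\<close>

definition PP :: "real \<Rightarrow> (nat \<times> nat) set" where
  "PP y = {(p, j). prime p \<and> j \<ge> 1 \<and> real p ^ j \<le> y}"

lemma PP_D:
  assumes "(p, j) \<in> PP y"
  shows "prime p" "j \<ge> 1" "real p ^ j \<le> y" "real p \<le> y" "j \<le> nat \<lfloor>y\<rfloor>"
proof -
  show a: "prime p" "j \<ge> 1" "real p ^ j \<le> y" using assms by (auto simp: PP_def)
  have p1: "real p \<ge> 2" using prime_ge_2_nat[OF a(1)] by simp
  have "real p ^ 1 \<le> real p ^ j" using p1 a(2) by (intro power_increasing) auto
  hence "real p \<le> real p ^ j" by (simp only: power_one_right)
  thus "real p \<le> y" using a(3) by linarith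
  have "real j < real (2 ^ j)" by (simp only: of_nat_less_iff less_exp)
  also have "\<dots> \<le> real p ^ j" using p1 by (simp add: power_mono)
  finally have "real j \<le> y" using a(3) by linarith
  thus "j \<le> nat \<lfloor>y\<rfloor>" by (rule le_nat_floor)
qed

lemma PP_subset: "PP y \<subseteq> primes_upto y \<times> {1..nat \<lfloor>y\<rfloor>}"
proof clarify
  fix p j assume "(p, j) \<in> PP y"
  note D = PP_D[OF this]
  show "p \<in> primes_upto y \<and> j \<in> {1..nat \<lfloor>y\<rfloor>}" using D(1,2,4,5) by (simp add: in_primes_upto)
qed

lemma finite_PP [simp]: "finite (PP y)"
  by (rule finite_subset[OF PP_subset]) simp

text \<open>The constant is the sum of \<open>(2 * k + 3) / 2 ^ k\<close> over all
  \<open>k\<close>.\<close>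

lemma geometric_weight_le:
  fixes x :: real
  assumes "0 \<le> x" "x \<le> 1 / 2"
  shows "(\<Sum>j\<in>{2..J}. (2 * real j - 1) * x ^ j) \<le> 10 * x\<^sup>2"
proof -
  have s: "(\<Sum>k<m. (2 * real k + 3) * (1 / 2) ^ k) = 10 - (4 * real m + 10) * (1 / 2 :: real) ^ m" for m
    by (induction m) (auto simp: algebra_simps)
  have "(\<Sum>j\<in>{2..J}. (2 * real j - 1) * x ^ j) \<le> (\<Sum>j\<in>(\<lambda>k. k + 2) ` {..<J}. (2 * real j - 1) * x ^ j)"
  proof (rule sum_mono2)
    show "{2..J} \<subseteq> (\<lambda>k. k + 2) ` {..<J}"
    proof
      fix j assume "j \<in> {2..J}"
      thus "j \<in> (\<lambda>k. k + 2) ` {..<J}" by (intro image_eqI[of _ _ "j - 2"]) auto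
    qed
  qed (use assms in \<open>auto\<close>)
  also have "\<dots> = (\<Sum>k<J. (2 * real k + 3) * x ^ (k + 2))"
    by (subst sum.reindex) (auto simp: inj_on_def algebra_simps)
  also have "\<dots> = x\<^sup>2 * (\<Sum>k<J. (2 * real k + 3) * x ^ k)"
    by (simp add: sum_distrib_left power_add power2_eq_square mult_ac)
  also have "\<dots> \<le> x\<^sup>2 * 10"
  proof (rule mult_left_mono)
    have "(\<Sum>k<J. (2 * real k + 3) * x ^ k) \<le> (\<Sum>k<J. (2 * real k + 3) * (1 / 2) ^ k)"
      using assms by (intro sum_mono mult_left_mono power_mono) auto
    also have "\<dots> \<le> 10" unfolding s by simp
    finally show "(\<Sum>k<J. (2 * real k + 3) * x ^ k) \<le> 10" .
  qed simp
  finally show ?thesis by (simp only: mult.commute)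
qed

text \<open>Exponents \<open>j \<ge> 2\<close> contribute only a constant, so sums over prime powers
  reduce to sums over primes. The weight \<open>2 * j - 1\<close> is the one that occurs in
  \<open>Sq\<close>.\<close>

lemma PP_sum_split:
  fixes G :: "nat \<Rightarrow> nat \<Rightarrow> real"
  assumes nn: "\<And>p j. prime p \<Longrightarrow> j \<ge> 1 \<Longrightarrow> G p j \<ge> 0"
    and S: "S \<subseteq> PP y" and T: "\<And>p. (p, 1) \<in> S \<Longrightarrow> p \<in> T" and T': "finite T" "\<And>p. p \<in> T \<Longrightarrow> prime p"
    and K: "K \<ge> 0" "\<And>p j. prime p \<Longrightarrow> j \<ge> 2 \<Longrightarrow> G p j \<le> K * ((2 * real j - 1) * (ln (real p))\<^sup>2 / real p ^ j)"
    and B: "\<And>S. finite S \<Longrightarrow> (\<Sum>n\<in>S. (ln (real n))\<^sup>2 / (real n)\<^sup>2) \<le> B"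
  shows "(\<Sum>(p, j)\<in>S. G p j) \<le> (\<Sum>p\<in>T. G p 1) + 10 * K * B"
proof -
  let ?J = "nat \<lfloor>y\<rfloor>"
  let ?A = "(\<lambda>p. (p, 1::nat)) ` T" and ?B = "primes_upto y \<times> {2..?J}"
  have "S \<subseteq> ?A \<union> ?B"
  proof
    fix x assume x: "x \<in> S"
    obtain p j where pj: "x = (p, j)" by (cases x)
    have D: "(p, j) \<in> PP y" using x S pj by auto
    note D = PP_D[OF D]
    show "x \<in> ?A \<union> ?B"
    proof (cases "j = 1")
      case True
      thus ?thesis using T[of p] x pj by auto
    next
      case False
      hence "(p, j) \<in> ?B" using D by (auto simp: in_primes_upto)
      thus ?thesis using pj by simp
    qed
  qed
  hence "(\<Sum>(p, j)\<in>S. G p j) \<le> (\<Sum>(p, j)\<in>?A \<union> ?B. G p j)"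
    using T' nn by (intro sum_mono2) (auto simp: in_primes_upto)
  also have "\<dots> = (\<Sum>(p, j)\<in>?A. G p j) + (\<Sum>(p, j)\<in>?B. G p j)"
    using T' by (intro sum.union_disjoint) auto
  also have "(\<Sum>(p, j)\<in>?A. G p j) = (\<Sum>p\<in>T. G p 1)" by (subst sum.reindex) (auto simp: inj_on_def)
  also have "(\<Sum>(p, j)\<in>?B. G p j) = (\<Sum>p\<in>primes_upto y. \<Sum>j\<in>{2..?J}. G p j)"
    by (simp add: sum.cartesian_product)
  also have "\<dots> \<le> (\<Sum>p\<in>primes_upto y. (10 * K) * ((ln (real p))\<^sup>2 / (real p)\<^sup>2))"
  proof (rule sum_mono)
    fix p assume "p \<in> primes_upto y"
    hence p: "prime p" by (simp add: in_primes_upto)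
    have p2: "real p \<ge> 2" using prime_ge_2_nat[OF p] by simp
    have "(\<Sum>j\<in>{2..?J}. G p j) \<le> (\<Sum>j\<in>{2..?J}. (K * (ln (real p))\<^sup>2) * ((2 * real j - 1) * (1 / real p) ^ j))"
    proof (rule sum_mono)
      fix j assume "j \<in> {2..?J}"
      hence "G p j \<le> K * ((2 * real j - 1) * (ln (real p))\<^sup>2 / real p ^ j)" using K(2)[OF p] by simp
      thus "G p j \<le> (K * (ln (real p))\<^sup>2) * ((2 * real j - 1) * (1 / real p) ^ j)"
        by (simp add: power_divide mult_ac)
    qed
    also have "\<dots> = (K * (ln (real p))\<^sup>2) * (\<Sum>j\<in>{2..?J}. (2 * real j - 1) * (1 / real p) ^ j)"
      by (rule sum_distrib_left[symmetric])
    also have "\<dots> \<le> (K * (ln (real p))\<^sup>2) * (10 * (1 / real p)\<^sup>2)"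
      using K(1) p2 by (intro mult_left_mono geometric_weight_le) auto
    also have "\<dots> = (10 * K) * ((ln (real p))\<^sup>2 / (real p)\<^sup>2)" by (simp add: power_divide)
    finally show "(\<Sum>j\<in>{2..?J}. G p j) \<le> (10 * K) * ((ln (real p))\<^sup>2 / (real p)\<^sup>2)" .
  qed
  also have "\<dots> = (10 * K) * (\<Sum>p\<in>primes_upto y. (ln (real p))\<^sup>2 / (real p)\<^sup>2)" by (rule sum_distrib_left[symmetric])
  also have "\<dots> \<le> (10 * K) * B" using K(1) by (intro mult_left_mono B) auto
  finally show ?thesis by simp
qed

text \<open>First powers contribute \<open>theta y\<close>. A higher power has its prime below
  \<open>sqrt y\<close>, and all powers of one prime together contribute at most
  \<open>ln y \<le> 2 * sqrt y\<close>; hence \<open>4 + 2\<close>.\<close>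

lemma PP_theta_le: assumes "y \<ge> 1" shows "(\<Sum>(p, j)\<in>PP y. ln (real p)) \<le> 6 * y"
proof -
  let ?A = "(\<lambda>p. (p, 1::nat)) ` primes_upto y"
  define S where "S p = {j. j \<ge> 2 \<and> real p ^ j \<le> y}" for p
  have finS: "finite (S p)" if "prime p" for p
  proof (rule finite_subset[of _ "{..nat \<lfloor>y\<rfloor>}"])
    show "S p \<subseteq> {..nat \<lfloor>y\<rfloor>}"
    proof
      fix j assume "j \<in> S p"
      hence "(p, j) \<in> PP y" using that by (auto simp: S_def PP_def)
      thus "j \<in> {..nat \<lfloor>y\<rfloor>}" using PP_D(5) by simp
    qed
  qed simp
  let ?B = "Sigma (primes_upto (sqrt y)) S"
  have finB: "finite ?B" using finS by (intro finite_SigmaI) (auto simp: in_primes_upto)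
  have "PP y \<subseteq> ?A \<union> ?B"
  proof
    fix x assume x: "x \<in> PP y"
    obtain p j where pj: "x = (p, j)" by (cases x)
    note D = PP_D[OF x[unfolded pj]]
    show "x \<in> ?A \<union> ?B"
    proof (cases "j = 1")
      case True
      thus ?thesis using D pj by (auto simp: in_primes_upto)
    next
      case False
      have p2: "real p \<ge> 2" using prime_ge_2_nat[OF D(1)] by simp
      have "real p ^ 2 \<le> real p ^ j" using False D(2) p2 by (intro power_increasing) auto
      hence "real p \<le> sqrt y" using D(3) by (intro real_le_rsqrt) linarith
      hence "(p, j) \<in> ?B" using D False by (simp add: in_primes_upto S_def)
      thus ?thesis using pj by simp
    qed
  qed
  hence "(\<Sum>(p, j)\<in>PP y. ln (real p)) \<le> (\<Sum>(p, j)\<in>?A \<union> ?B. ln (real p))"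
    using finB by (intro sum_mono2) (auto simp: in_primes_upto)
  also have "\<dots> = (\<Sum>(p, j)\<in>?A. ln (real p)) + (\<Sum>(p, j)\<in>?B. ln (real p))"
    using finB by (intro sum.union_disjoint) (auto simp: S_def)
  also have "(\<Sum>(p, j)\<in>?A. ln (real p)) = theta y"
    unfolding theta_def by (subst sum.reindex) (auto simp: inj_on_def)
  also have "(\<Sum>(p, j)\<in>?B. ln (real p)) = (\<Sum>p\<in>primes_upto (sqrt y). \<Sum>j\<in>S p. ln (real p))"
    using finS by (subst sum.Sigma) (auto simp: in_primes_upto)
  also have "\<dots> \<le> (\<Sum>p\<in>primes_upto (sqrt y). ln y)"
  proof (rule sum_mono)
    fix p assume "p \<in> primes_upto (sqrt y)"
    hence p: "prime p" by (simp add: in_primes_upto)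
    have p2: "real p \<ge> 2" using prime_ge_2_nat[OF p] by simp
    have lp: "ln (real p) > 0" using p2 by simp
    define J where "J = nat \<lfloor>ln y / ln (real p)\<rfloor>"
    have "S p \<subseteq> {1..J}"
    proof
      fix j assume j: "j \<in> S p"
      hence "ln (real p ^ j) \<le> ln y" using p2 by (intro ln_mono) (auto simp: S_def)
      hence "real j * ln (real p) \<le> ln y" by (simp add: ln_realpow)
      hence "real j \<le> ln y / ln (real p)" using lp by (simp only: pos_le_divide_eq)
      hence "j \<le> J" unfolding J_def by (rule le_nat_floor)
      thus "j \<in> {1..J}" using j by (simp add: S_def)
    qed
    hence "card (S p) \<le> J" using card_mono[of "{1..J}" "S p"] by simp
    moreover have "real J \<le> ln y / ln (real p)"
    proof -
      have "ln y / ln (real p) \<ge> 0" using assms lp by (intro divide_nonneg_pos) auto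
      thus ?thesis unfolding J_def by linarith
    qed
    ultimately have "real (card (S p)) \<le> ln y / ln (real p)" by linarith
    hence "real (card (S p)) * ln (real p) \<le> ln y" using lp by (simp only: pos_le_divide_eq)
    thus "(\<Sum>j\<in>S p. ln (real p)) \<le> ln y" by simp
  qed
  also have "\<dots> = real (card (primes_upto (sqrt y))) * ln y" by simp
  also have "\<dots> \<le> sqrt y * (2 * sqrt y)"
  proof (rule mult_mono)
    have "primes_upto (sqrt y) \<subseteq> {1..nat \<lfloor>sqrt y\<rfloor>}"
      by (auto simp: in_primes_upto prime_gt_0_nat Suc_leI intro: le_nat_floor)
    hence "card (primes_upto (sqrt y)) \<le> card {1..nat \<lfloor>sqrt y\<rfloor>}" by (intro card_mono) auto
    hence "card (primes_upto (sqrt y)) \<le> nat \<lfloor>sqrt y\<rfloor>" by simp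
    moreover have "real (nat \<lfloor>sqrt y\<rfloor>) \<le> sqrt y" using assms by simp
    ultimately show "real (card (primes_upto (sqrt y))) \<le> sqrt y" by linarith
    have "ln y = 2 * ln (sqrt y)" using assms by (simp add: ln_sqrt)
    also have "\<dots> \<le> 2 * sqrt y" using ln_le_minus_one[of "sqrt y"] assms by simp
    finally show "ln y \<le> 2 * sqrt y" .
  qed (use assms in auto)
  also have "\<dots> = 2 * y" using assms by simp
  finally show ?thesis using theta_le[of y] assms by linarith
qed

definition S1 :: "int poly \<Rightarrow> (nat \<times> nat) set \<Rightarrow> real" where
  "S1 h S = (\<Sum>(p, j)\<in>S. ln (real p) * (real (rho h (p ^ j)) / real p ^ j))"

text \<open>The diagonal part of a second moment: \<open>2 * j - 1\<close> pairs of exponents have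
  maximum \<open>j\<close>, and two powers of the same prime divide a value simultaneously exactly
  when the larger one does.\<close>

definition Sq :: "int poly \<Rightarrow> (nat \<times> nat) set \<Rightarrow> real" where
  "Sq h S = (\<Sum>(p, j)\<in>S. (2 * real j - 1) * (ln (real p))\<^sup>2 * (real (rho h (p ^ j)) / real p ^ j))"

text \<open>The limit \<open>exp (exp 2)\<close> is chosen so that \<open>sqrt y\<close> still
  satisfies the assumption of \<open>loglog_facts\<close>.\<close>

lemma sqrt_loglog:
  fixes y :: real
  assumes "y \<ge> exp (exp 2)"
  shows "y \<ge> exp (exp 1)" "sqrt y \<ge> exp (exp 1)" "ln (sqrt y) = ln y / 2" "ln (ln (sqrt y)) \<ge> ln (ln y) / 2"
proof -
  have e2: "exp (1::real) \<ge> 2" using exp_ge_add_one_self[of 1] by simp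
  have "exp (2::real) = exp 1 * exp 1" by (simp flip: exp_add)
  hence e3: "exp (2::real) \<ge> 2 * exp 1" using mult_right_mono[OF e2, of "exp 1"] by simp
  show y1: "y \<ge> exp (exp 1)" using assms by (meson exp_le_cancel_iff one_le_numeral order_trans)
  have "exp (exp 1) ^ 2 = exp (2 * exp (1::real))" by (simp flip: exp_double)
  also have "\<dots> \<le> exp (exp 2)" using e3 by simp
  also have "\<dots> \<le> y" by (rule assms)
  finally show "sqrt y \<ge> exp (exp 1)" by (rule real_le_rsqrt)
  note l = loglog_facts[OF y1]
  show hs: "ln (sqrt y) = ln y / 2" using l(6) by (simp add: ln_sqrt)
  have "ln y \<ge> ln (exp (exp 2))" using assms by (intro ln_mono) auto
  hence "ln y \<ge> exp 2" by simp
  hence "ln (ln y) \<ge> ln (exp 2)" by (intro ln_mono) auto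
  hence 2: "ln (ln y) \<ge> 2" by simp
  have "ln (ln y / 2) = ln (ln y) - ln 2" using l(3) by (subst ln_div) auto
  moreover have "ln (2::real) \<le> 1" using ln_le_minus_one[of 2] by simp
  ultimately show "ln (ln (sqrt y)) \<ge> ln (ln y) / 2" unfolding hs using 2 by linarith
qed

lemma ln_le_two_ln_square: assumes "prime p" shows "ln (real p) \<le> 2 * (ln (real p))\<^sup>2"
proof -
  have p2: "real p \<ge> 2" using prime_ge_2_nat[OF assms] by simp
  have "ln (1 / 2 :: real) \<le> 1 / 2 - 1" by (rule ln_le_minus_one) simp
  hence "ln (2::real) \<ge> 1 / 2" by (simp add: ln_div)
  moreover have "ln (real p) \<ge> ln 2" using p2 by (intro ln_mono) auto
  ultimately have h: "ln (real p) \<ge> 1 / 2" by linarith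
  hence "ln (real p) * 1 \<le> ln (real p) * (2 * ln (real p))" by (intro mult_left_mono) auto
  thus ?thesis by (simp add: power2_eq_square)
qed

text \<open>The sums over all of \<open>PP y\<close> and \<open>PP (sqrt y)\<close> need upper
  Mertens bounds only and have the small error \<open>ln (ln y)\<close>; this matters because
  \<open>S1 h (PP y)\<close> is later raised to the power \<open>j\<close>. The range above
  \<open>sqrt y\<close> and the second moment involve differences, hence the lower estimate with its
  larger error.\<close>

theorem rad_prime_power_sums:
  assumes f: "f \<noteq> 0"
  defines "h \<equiv> rad f" and "g \<equiv> real (num_factors f)"
  shows "\<exists>C\<ge>1. (\<forall>p j. prime p \<longrightarrow> j \<ge> 1 \<longrightarrow> real (rho h (p ^ j)) \<le> C) \<and>
    (\<forall>y\<ge>exp (exp 2). S1 h (PP y) \<le> g * ln y + C * ln (ln y) \<and>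
       S1 h (PP (sqrt y)) \<le> g * (ln y / 2) + C * ln (ln y) \<and>
       S1 h (PP y - PP (sqrt y)) \<le> g * (ln y / 2) + C * (ln y / ln (ln y)) \<and>
       Sq h (PP (sqrt y)) \<le> g * ((ln y)\<^sup>2 / 8) + C * ((ln y)\<^sup>2 / ln (ln y)))"
proof -
  define I where "I = irred_factors f"
  have finI: "finite I" unfolding I_def by (rule finite_irred_factors[OF f])
  have gI: "g = real (card I)" by (simp add: g_def num_factors_def I_def)
  have h0: "h \<noteq> 0" unfolding h_def using rad_dvd[OF f] f by auto
  obtain U V R where R: "R \<noteq> 0" "h * U + pderiv h * V = [:R:]" using rad_bezout[OF f] unfolding h_def by blast
  define Cr where "Cr = real_of_int (int (degree h) + \<bar>lead_coeff h\<bar> + \<bar>R\<bar> ^ 3)"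
  have Cr: "real (rho h (p ^ j)) \<le> Cr" if "prime p" "j \<ge> 1" for p j
  proof -
    have "int (rho h (p ^ j)) \<le> int (degree h) + \<bar>lead_coeff h\<bar> + \<bar>R\<bar> ^ 3"
      by (rule rho_prime_power_bounded[OF R(2,1) h0 that])
    hence "real_of_int (int (rho h (p ^ j))) \<le> Cr" unfolding Cr_def by (simp only: of_int_le_iff)
    thus ?thesis by simp
  qed
  have Cr0: "Cr \<ge> 0" unfolding Cr_def by simp
  obtain B where B: "B \<ge> 0" "\<And>S. finite S \<Longrightarrow> (\<Sum>n\<in>S. (ln (real n))\<^sup>2 / (real n)\<^sup>2) \<le> B"
    using sum_ln_square_bounded by blast
  have "\<forall>q\<in>I. \<exists>C\<ge>0. \<forall>y\<ge>exp (exp 1). mertens q y \<le> ln y + C * ln (ln y) \<and> mertens q y \<ge> ln y - C * (ln y / ln (ln y))"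
    unfolding I_def using irreducible_mertens irred_factorsD(2,3) by blast
  then obtain Cq where Cq: "\<And>q. q \<in> I \<Longrightarrow> Cq q \<ge> 0"
    "\<And>q y. q \<in> I \<Longrightarrow> y \<ge> exp (exp 1) \<Longrightarrow> mertens q y \<le> ln y + Cq q * ln (ln y)"
    "\<And>q y. q \<in> I \<Longrightarrow> y \<ge> exp (exp 1) \<Longrightarrow> mertens q y \<ge> ln y - Cq q * (ln y / ln (ln y))"
    by metis
  define c where "c = (\<Sum>q\<in>I. Cq q)"
  have c0: "c \<ge> 0" unfolding c_def using Cq(1) by (rule sum_nonneg)
  have cq: "Cq q \<le> c" if "q \<in> I" for q unfolding c_def using that Cq(1) finI by (intro member_le_sum) auto
  have up: "mertens q y \<le> ln y + c * ln (ln y)" if "q \<in> I" "y \<ge> exp (exp 1)" for q y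
  proof -
    have "Cq q * ln (ln y) \<le> c * ln (ln y)" by (rule mult_right_mono[OF cq[OF that(1)] less_imp_le[OF loglog_facts(4)[OF that(2)]]])
    thus ?thesis using Cq(2)[OF that] by linarith
  qed
  have lo: "mertens q y \<ge> ln y - c * (ln y / ln (ln y))" if "q \<in> I" "y \<ge> exp (exp 1)" for q y
  proof -
    have "0 \<le> ln y / ln (ln y)" using loglog_facts(7)[OF that(2)] by linarith
    hence "Cq q * (ln y / ln (ln y)) \<le> c * (ln y / ln (ln y))" by (rule mult_right_mono[OF cq[OF that(1)]])
    thus ?thesis using Cq(3)[OF that] by linarith
  qed
  have rsum: "(\<Sum>p\<in>T. real (rho h p) * v p) \<le> (\<Sum>q\<in>I. \<Sum>p\<in>T. real (rho q p) * v p)"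
    if T: "finite T" "\<And>p. p \<in> T \<Longrightarrow> prime p" and v: "\<And>p. p \<in> T \<Longrightarrow> v p \<ge> 0" for T and v :: "nat \<Rightarrow> real"
  proof -
    have "(\<Sum>p\<in>T. real (rho h p) * v p) \<le> (\<Sum>p\<in>T. \<Sum>q\<in>I. real (rho q p) * v p)"
    proof (rule sum_mono)
      fix p assume p: "p \<in> T"
      have "real (rho h p) \<le> real (\<Sum>q\<in>I. rho q p)"
        using rho_rad_le[OF f T(2)[OF p]] unfolding h_def I_def by (simp only: of_nat_le_iff)
      hence "real (rho h p) * v p \<le> real (\<Sum>q\<in>I. rho q p) * v p" by (rule mult_right_mono[OF _ v[OF p]])
      thus "real (rho h p) * v p \<le> (\<Sum>q\<in>I. real (rho q p) * v p)" by (simp add: sum_distrib_right)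
    qed
    also have "\<dots> = (\<Sum>q\<in>I. \<Sum>p\<in>T. real (rho q p) * v p)" by (rule sum.swap)
    finally show ?thesis .
  qed
  define D where "D = 10 * (2 * Cr) * B"
  have D0: "D \<ge> 0" unfolding D_def using Cr0 B(1) by simp
  have S1_le: "S1 h S \<le> (\<Sum>q\<in>I. \<Sum>p\<in>T. real (rho q p) * (ln (real p) / real p)) + D"
    if S: "S \<subseteq> PP y" "\<And>p. (p, 1) \<in> S \<Longrightarrow> p \<in> T" and T: "finite T" "\<And>p. p \<in> T \<Longrightarrow> prime p" for S T y
  proof -
    have "S1 h S \<le> (\<Sum>p\<in>T. ln (real p) * (real (rho h (p ^ 1)) / real p ^ 1)) + 10 * (2 * Cr) * B"
      unfolding S1_def
    proof (rule PP_sum_split[OF _ S T _ _ B(2)])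
      fix p j :: nat assume p: "prime p" "j \<ge> 2"
      have p0: "real p > 0" using p(1) by (simp add: prime_gt_0_nat)
      have "ln (real p) * (real (rho h (p ^ j)) / real p ^ j) \<le> (2 * (ln (real p))\<^sup>2) * (Cr / real p ^ j)"
        using p p0 Cr[of p j] ln_le_two_ln_square[OF p(1)] by (intro mult_mono divide_right_mono) auto
      also have "\<dots> = 2 * Cr * (1 * ((ln (real p))\<^sup>2 / real p ^ j))" by simp
      also have "\<dots> \<le> 2 * Cr * ((2 * real j - 1) * ((ln (real p))\<^sup>2 / real p ^ j))"
        using Cr0 p by (intro mult_left_mono mult_right_mono) auto
      finally show "ln (real p) * (real (rho h (p ^ j)) / real p ^ j) \<le> 2 * Cr * ((2 * real j - 1) * (ln (real p))\<^sup>2 / real p ^ j)"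
        by simp
    qed (use Cr0 in auto)
    also have "(\<Sum>p\<in>T. ln (real p) * (real (rho h (p ^ 1)) / real p ^ 1)) = (\<Sum>p\<in>T. real (rho h p) * (ln (real p) / real p))"
      by (intro sum.cong) auto
    also have "\<dots> \<le> (\<Sum>q\<in>I. \<Sum>p\<in>T. real (rho q p) * (ln (real p) / real p))" by (rule rsum) (use T in auto)
    finally show ?thesis by (simp add: D_def)
  qed
  define C where "C = 1 + Cr + D + g * c + 5 * (g * c) + g * (5 * c + exp 1 + 2)"
  have g0: "g \<ge> 0" by (simp add: g_def)
  have gc: "g * c \<ge> 0" using g0 c0 by simp
  have ge: "g * (5 * c + exp 1 + 2) \<ge> 0" using g0 c0 by (intro mult_nonneg_nonneg) auto
  show ?thesis
  proof (intro exI[of _ C] conjI allI impI)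
    show "C \<ge> 1" unfolding C_def using Cr0 D0 gc ge by linarith
    show "real (rho h (p ^ j)) \<le> C" if "prime p" "j \<ge> 1" for p j
      using Cr[OF that] D0 gc ge unfolding C_def by linarith
    fix y :: real assume y: "y \<ge> exp (exp 2)"
    note s = sqrt_loglog[OF y]
    note l = loglog_facts[OF s(1)] and l' = loglog_facts[OF s(2)]
    define q where "q = ln y / ln (ln y)"
    have q1: "q \<ge> 1" unfolding q_def by (rule l(7))
    have mert: "(\<Sum>p\<in>primes_upto z. real (rho r p) * (ln (real p) / real p)) = mertens r z" for r z
      by (simp add: mertens_def)
    have lll: "ln (ln (sqrt y)) \<le> ln (ln y)" unfolding s(3) using l(3) by (intro ln_mono) auto
    have absorb: "g * c * v + D \<le> C * v" if "v \<ge> 1" for v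
    proof -
      have "D * 1 \<le> D * v" by (rule mult_left_mono[OF that D0])
      moreover have "(g * c + D) * v \<le> C * v" using that Cr0 gc ge unfolding C_def by (intro mult_right_mono) linarith+
      ultimately show ?thesis by (simp add: distrib_right)
    qed
    show "S1 h (PP y) \<le> g * ln y + C * ln (ln y)"
    proof -
      have "S1 h (PP y) \<le> (\<Sum>r\<in>I. \<Sum>p\<in>primes_upto y. real (rho r p) * (ln (real p) / real p)) + D"
        by (rule S1_le[of _ y]) (auto dest: PP_D simp: in_primes_upto)
      also have "\<dots> \<le> (\<Sum>r\<in>I. ln y + c * ln (ln y)) + D"
        unfolding mert by (intro add_right_mono sum_mono up s(1))
      also have "\<dots> = g * ln y + (g * c * ln (ln y) + D)" by (simp add: gI algebra_simps)
      finally show ?thesis using absorb[OF l(1)] by linarith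
    qed
    show "S1 h (PP (sqrt y)) \<le> g * (ln y / 2) + C * ln (ln y)"
    proof -
      have "S1 h (PP (sqrt y)) \<le> (\<Sum>r\<in>I. \<Sum>p\<in>primes_upto (sqrt y). real (rho r p) * (ln (real p) / real p)) + D"
        by (rule S1_le[of _ "sqrt y"]) (auto dest: PP_D simp: in_primes_upto)
      also have "\<dots> \<le> (\<Sum>r\<in>I. ln y / 2 + c * ln (ln y)) + D"
        unfolding mert
      proof (intro add_right_mono sum_mono)
        fix r assume r: "r \<in> I"
        have "c * ln (ln (sqrt y)) \<le> c * ln (ln y)" by (rule mult_left_mono[OF lll c0])
        thus "mertens r (sqrt y) \<le> ln y / 2 + c * ln (ln y)" using up[OF r s(2)] s(3) by linarith
      qed
      also have "\<dots> = g * (ln y / 2) + (g * c * ln (ln y) + D)" by (simp add: gI algebra_simps)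
      finally show ?thesis using absorb[OF l(1)] by linarith
    qed
    have inv: "ln (sqrt y) / ln (ln (sqrt y)) \<le> q"
    proof -
      have "ln (sqrt y) / ln (ln (sqrt y)) \<le> ln (sqrt y) / (ln (ln y) / 2)"
        by (rule divide_left_mono[OF s(4) less_imp_le[OF l'(3)]]) (use l(4) l'(4) in simp)
      thus ?thesis unfolding s(3) q_def by simp
    qed
    show "S1 h (PP y - PP (sqrt y)) \<le> g * (ln y / 2) + C * (ln y / ln (ln y))"
    proof -
      have sub: "primes_upto (sqrt y) \<subseteq> primes_upto y"
      proof -
        have "sqrt y \<le> y"
        proof -
          have "sqrt y \<ge> 1" using s(2) by (meson exp_ge_zero one_le_exp_iff order_trans)
          hence "sqrt y * 1 \<le> sqrt y * sqrt y" by (intro mult_left_mono) auto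
          thus ?thesis using l(6) by simp
        qed
        thus ?thesis by (auto simp: in_primes_upto)
      qed
      have "S1 h (PP y - PP (sqrt y)) \<le>
          (\<Sum>r\<in>I. \<Sum>p\<in>primes_upto y - primes_upto (sqrt y). real (rho r p) * (ln (real p) / real p)) + D"
      proof (rule S1_le[of _ y])
        fix p assume "(p, 1) \<in> PP y - PP (sqrt y)"
        thus "p \<in> primes_upto y - primes_upto (sqrt y)" by (auto simp: PP_def in_primes_upto)
      qed (auto simp: in_primes_upto)
      also have "\<dots> \<le> (\<Sum>r\<in>I. ln y / 2 + 5 * c * q) + D"
      proof (intro add_right_mono sum_mono)
        fix r assume r: "r \<in> I"
        have "(\<Sum>p\<in>primes_upto y - primes_upto (sqrt y). real (rho r p) * (ln (real p) / real p)) = mertens r y - mertens r (sqrt y)"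
          unfolding mert[symmetric] by (rule sum_diff[OF finite_primes_upto sub])
        also have "\<dots> \<le> (ln y + c * ln (ln y)) - (ln (sqrt y) - c * (ln (sqrt y) / ln (ln (sqrt y))))"
          by (intro diff_mono up[OF r s(1)] lo[OF r s(2)])
        also have "\<dots> \<le> ln y / 2 + 5 * c * q"
        proof -
          have "c * ln (ln y) \<le> c * (4 * q)" unfolding q_def by (rule mult_left_mono[OF l(8) c0])
          moreover have "c * (ln (sqrt y) / ln (ln (sqrt y))) \<le> c * q" by (rule mult_left_mono[OF inv c0])
          ultimately show ?thesis using s(3) by linarith
        qed
        finally show "(\<Sum>p\<in>primes_upto y - primes_upto (sqrt y). real (rho r p) * (ln (real p) / real p)) \<le> ln y / 2 + 5 * c * q" .
      qed
      also have "\<dots> = g * (ln y / 2) + (5 * (g * c) * q + D)" by (simp add: gI algebra_simps)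
      also have "5 * (g * c) * q + D \<le> C * q"
      proof -
        have "D * 1 \<le> D * q" by (rule mult_left_mono[OF q1 D0])
        moreover have "(5 * (g * c) + D) * q \<le> C * q" using q1 Cr0 gc ge unfolding C_def by (intro mult_right_mono) linarith+
        ultimately show ?thesis by (simp add: distrib_right)
      qed
      finally show ?thesis by (simp add: q_def)
    qed
    show "Sq h (PP (sqrt y)) \<le> g * ((ln y)\<^sup>2 / 8) + C * ((ln y)\<^sup>2 / ln (ln y))"
    proof -
      define Z where "Z = (ln y)\<^sup>2 / ln (ln y)"
      have Z1: "Z \<ge> 1"
      proof -
        have "1 \<le> ln y" using l(1,5) by linarith
        hence "1 * 1 \<le> ln y * q" using q1 by (intro mult_mono) auto
        thus ?thesis by (simp add: Z_def q_def power2_eq_square)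
      qed
      let ?T = "primes_upto (sqrt y)"
      have "Sq h (PP (sqrt y)) \<le> (\<Sum>p\<in>?T. (2 * real 1 - 1) * (ln (real p))\<^sup>2 * (real (rho h (p ^ 1)) / real p ^ 1)) + 10 * Cr * B"
        unfolding Sq_def
      proof (rule PP_sum_split[OF _ order_refl _ _ _ Cr0 _ B(2)])
        fix p j :: nat assume p: "prime p" "j \<ge> 2"
        have p0: "real p > 0" using p(1) by (simp add: prime_gt_0_nat)
        have "(2 * real j - 1) * (ln (real p))\<^sup>2 * (real (rho h (p ^ j)) / real p ^ j) \<le> (2 * real j - 1) * (ln (real p))\<^sup>2 * (Cr / real p ^ j)"
          using p p0 Cr[of p j] by (intro mult_left_mono divide_right_mono) auto
        thus "(2 * real j - 1) * (ln (real p))\<^sup>2 * (real (rho h (p ^ j)) / real p ^ j) \<le> Cr * ((2 * real j - 1) * (ln (real p))\<^sup>2 / real p ^ j)"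
          by (simp add: mult_ac)
      qed (auto dest: PP_D simp: in_primes_upto)
      also have "(\<Sum>p\<in>?T. (2 * real 1 - 1) * (ln (real p))\<^sup>2 * (real (rho h (p ^ 1)) / real p ^ 1)) =
         (\<Sum>p\<in>?T. real (rho h p) * ((ln (real p))\<^sup>2 / real p))" by (intro sum.cong) auto
      also have "\<dots> \<le> (\<Sum>r\<in>I. \<Sum>p\<in>?T. real (rho r p) * ((ln (real p))\<^sup>2 / real p))"
        by (rule rsum) (auto simp: in_primes_upto)
      also have "\<dots> \<le> (\<Sum>r\<in>I. (ln y)\<^sup>2 / 8 + (5 * c + exp 1 + 2) * Z)"
      proof (rule sum_mono)
        fix r assume r: "r \<in> I"
        have "(\<Sum>p\<in>?T. real (rho r p) * ((ln (real p))\<^sup>2 / real p)) \<le>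
           (ln (sqrt y))\<^sup>2 / 2 + (5 * c + exp 1 + 2) * ((ln (sqrt y))\<^sup>2 / ln (ln (sqrt y)))"
          using mertens_square_sum[OF c0 up[OF r] lo[OF r] s(2)] by simp
        also have "(ln (sqrt y))\<^sup>2 / 2 = (ln y)\<^sup>2 / 8" unfolding s(3) by (simp add: power_divide)
        also have "(5 * c + exp 1 + 2) * ((ln (sqrt y))\<^sup>2 / ln (ln (sqrt y))) \<le> (5 * c + exp 1 + 2) * Z"
        proof (rule mult_left_mono)
          have "ln (sqrt y) * (ln (sqrt y) / ln (ln (sqrt y))) \<le> ln y * q"
          proof (rule mult_mono[OF _ inv])
            show "ln (sqrt y) \<le> ln y" unfolding s(3) using l(3) by linarith
            show "0 \<le> ln y" using l(3) by linarith
            show "0 \<le> ln (sqrt y) / ln (ln (sqrt y))" using l'(7) by linarith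
          qed
          thus "(ln (sqrt y))\<^sup>2 / ln (ln (sqrt y)) \<le> Z" by (simp add: Z_def q_def power2_eq_square)
        qed (use c0 in auto)
        finally show "(\<Sum>p\<in>?T. real (rho r p) * ((ln (real p))\<^sup>2 / real p)) \<le> (ln y)\<^sup>2 / 8 + (5 * c + exp 1 + 2) * Z"
          by simp
      qed
      also have "\<dots> = g * ((ln y)\<^sup>2 / 8) + g * (5 * c + exp 1 + 2) * Z" by (simp add: gI algebra_simps)
      finally have "Sq h (PP (sqrt y)) \<le> g * ((ln y)\<^sup>2 / 8) + (g * (5 * c + exp 1 + 2) * Z + 10 * Cr * B)" by simp
      also have "g * (5 * c + exp 1 + 2) * Z + 10 * Cr * B \<le> C * Z"
      proof -
        have "10 * Cr * B \<le> D" unfolding D_def using Cr0 B(1) by simp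
        moreover have "D * 1 \<le> D * Z" by (rule mult_left_mono[OF Z1 D0])
        moreover have "(g * (5 * c + exp 1 + 2) + D) * Z \<le> C * Z" using Z1 Cr0 gc ge unfolding C_def by (intro mult_right_mono) linarith+
        moreover have "(g * (5 * c + exp 1 + 2) + D) * Z = g * (5 * c + exp 1 + 2) * Z + D * Z" by (rule distrib_right)
        ultimately show ?thesis by linarith
      qed
      finally show ?thesis by (simp add: Z_def)
    qed
  qed
qed

section \<open>The weighted sieve\<close>

lemma sum_prod_lists:
  fixes \<phi> :: "'a \<Rightarrow> real"
  assumes "finite Q"
  shows "(\<Sum>qs\<in>{qs. set qs \<subseteq> Q \<and> length qs = j}. prod_list (map \<phi> qs)) = (\<Sum>q\<in>Q. \<phi> q) ^ j"
proof (induction j)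
  case 0
  have "{qs. set qs \<subseteq> Q \<and> length qs = 0} = {[]}" by auto
  thus ?case by simp
next
  case (Suc j)
  let ?L = "{qs. set qs \<subseteq> Q \<and> length qs = j}"
  have eq: "{qs. set qs \<subseteq> Q \<and> length qs = Suc j} = (\<lambda>(q, qs). q # qs) ` (Q \<times> ?L)"
  proof (rule equalityI)
    show "{qs. set qs \<subseteq> Q \<and> length qs = Suc j} \<subseteq> (\<lambda>(q, qs). q # qs) ` (Q \<times> ?L)"
    proof
      fix qs assume "qs \<in> {qs. set qs \<subseteq> Q \<and> length qs = Suc j}"
      thus "qs \<in> (\<lambda>(q, qs). q # qs) ` (Q \<times> ?L)" by (cases qs) auto
    qed
  qed auto
  have "(\<Sum>qs\<in>{qs. set qs \<subseteq> Q \<and> length qs = Suc j}. prod_list (map \<phi> qs)) =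
      (\<Sum>x\<in>Q \<times> ?L. prod_list (map \<phi> (case x of (q, qs) \<Rightarrow> q # qs)))"
    unfolding eq by (subst sum.reindex) (auto simp: inj_on_def)
  also have "\<dots> = (\<Sum>(q, qs)\<in>Q \<times> ?L. \<phi> q * prod_list (map \<phi> qs))" by (intro sum.cong) auto
  also have "\<dots> = (\<Sum>q\<in>Q. \<Sum>qs\<in>?L. \<phi> q * prod_list (map \<phi> qs))" by (rule sum.cartesian_product[symmetric])
  also have "\<dots> = (\<Sum>q\<in>Q. \<phi> q) * (\<Sum>qs\<in>?L. prod_list (map \<phi> qs))" by (rule sum_product[symmetric])
  finally show ?case using Suc by simp
qed

lemma dvd_prod_list_member: "x \<in> set xs \<Longrightarrow> x dvd prod_list (xs :: nat list)"
  by (induction xs) auto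

definition pp_dvd :: "int poly \<Rightarrow> int \<Rightarrow> (nat \<times> nat) \<Rightarrow> bool" where
  "pp_dvd h n q \<longleftrightarrow> int (fst q ^ snd q) dvd poly h n"

text \<open>\<open>pp_al\<close> is the density of the \<open>n\<close> whose value is divisible by
  the prime power, \<open>pp_be\<close> the number of residue classes, each of which costs a
  rounding error of at most 1.\<close>

definition pp_al :: "int poly \<Rightarrow> (nat \<times> nat) \<Rightarrow> real" where
  "pp_al h q = real (rho h (fst q ^ snd q)) / real (fst q ^ snd q)"

definition pp_be :: "int poly \<Rightarrow> (nat \<times> nat) \<Rightarrow> real" where
  "pp_be h q = real (rho h (fst q ^ snd q))"

text \<open>Distinct primes make the moduli coprime, and for an upper bound the injective half of
  the Chinese remainder theorem is enough.\<close>

lemma roots_of_list_bound: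
  assumes "\<And>q. q \<in> set qs \<Longrightarrow> prime (fst q)" "distinct (map fst qs)"
  defines "m \<equiv> prod_list (map (\<lambda>q. fst q ^ snd q) qs)"
  shows "m > 0 \<and> card {r\<in>{0..<int m}. \<forall>q\<in>set qs. pp_dvd h r q} \<le> prod_list (map (\<lambda>q. rho h (fst q ^ snd q)) qs)"
  using assms(1,2) unfolding m_def
proof (induction qs)
  case Nil
  have "{r\<in>{0..<int 1}. True} = {0}" by auto
  thus ?case by simp
next
  case (Cons q qs)
  define a where "a = fst q ^ snd q"
  define m where "m = prod_list (map (\<lambda>q. fst q ^ snd q) qs)"
  have IH: "m > 0" "card {r\<in>{0..<int m}. \<forall>q\<in>set qs. pp_dvd h r q} \<le> prod_list (map (\<lambda>q. rho h (fst q ^ snd q)) qs)"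
    using Cons unfolding m_def by auto
  have pq: "prime (fst q)" using Cons.prems(1) by simp
  have sep: "prime (fst z)" "fst z \<noteq> fst q" if "z \<in> set qs" for z
    using Cons.prems that by (auto simp: image_iff)
  have a0: "a > 0" using pq by (simp add: a_def prime_gt_0_nat)
  have cop: "coprime a m"
  proof -
    have "coprime a (prod_list (map (\<lambda>q. fst q ^ snd q) ys))" if "set ys \<subseteq> set qs" for ys
      using that
    proof (induction ys)
      case (Cons z ys)
      hence "coprime a (fst z ^ snd z)" unfolding a_def using pq sep[of z]
        by (metis coprime_power_left_iff coprime_power_right_iff list.set_intros(1) primes_coprime subsetD)
      thus ?case using Cons by simp
    qed simp
    thus ?thesis unfolding m_def by blast
  qed
  let ?A = "{r\<in>{0..<int m}. \<forall>q\<in>set qs. pp_dvd h r q}"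
  let ?S = "{r\<in>{0..<int (a * m)}. \<forall>q\<in>set (q # qs). pp_dvd h r q}"
  let ?f = "\<lambda>r. (r mod int a, r mod int m)"
  have "inj_on ?f ?S"
  proof (rule inj_onI)
    fix r s assume *: "r \<in> ?S" "s \<in> ?S" "?f r = ?f s"
    have "int a dvd r - s" "int m dvd r - s" using *(3) by (auto simp: mod_eq_dvd_iff)
    moreover have "coprime (int a) (int m)" using cop by simp
    ultimately have "int a * int m dvd r - s" by (intro divides_mult)
    hence "r mod int (a * m) = s mod int (a * m)" by (simp add: mod_eq_dvd_iff)
    moreover have "r \<in> {0..<int (a * m)}" "s \<in> {0..<int (a * m)}" using * by auto
    ultimately show "r = s" by simp
  qed
  moreover have "?f ` ?S \<subseteq> roots_mod h a \<times> ?A"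
  proof (rule image_subsetI)
    fix r assume r: "r \<in> ?S"
    have "int a dvd poly h r" using r by (simp add: pp_dvd_def a_def)
    hence 1: "r mod int a \<in> roots_mod h a" using a0 by (simp add: roots_mod_def poly_dvd_mod)
    have "pp_dvd h (r mod int m) z" if z: "z \<in> set qs" for z
    proof -
      have dm: "fst z ^ snd z dvd m" unfolding m_def using z by (intro dvd_prod_list_member) auto
      have "int (fst z ^ snd z) dvd int m" using dm by (simp only: int_dvd_int_iff)
      moreover have "int m dvd r mod int m - r" by (simp add: mod_eq_dvd_iff[symmetric])
      ultimately have "int (fst z ^ snd z) dvd r mod int m - r" by (rule dvd_trans)
      hence "int (fst z ^ snd z) dvd poly h (r mod int m) - poly h r" using poly_diff_dvd dvd_trans by blast
      moreover have "int (fst z ^ snd z) dvd poly h r" using r z by (simp add: pp_dvd_def)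
      ultimately have "int (fst z ^ snd z) dvd (poly h (r mod int m) - poly h r) + poly h r" by (rule dvd_add)
      thus ?thesis by (simp add: pp_dvd_def)
    qed
    hence 2: "r mod int m \<in> ?A" using IH(1) by simp
    show "?f r \<in> roots_mod h a \<times> ?A" using 1 2 by simp
  qed
  moreover have "finite (roots_mod h a \<times> ?A)" by (intro finite_cartesian_product finite_roots_mod finite_subset[of ?A "{0..<int m}"]) auto
  ultimately have "card ?S \<le> card (roots_mod h a \<times> ?A)" by (rule card_inj_on_le)
  also have "\<dots> = rho h a * card ?A" by (simp add: card_cartesian_product rho_def)
  also have "\<dots> \<le> rho h a * prod_list (map (\<lambda>q. rho h (fst q ^ snd q)) qs)" using IH(2) by simp
  finally show ?case using a0 IH(1) by (simp add: a_def m_def)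
qed

text \<open>Each residue class modulo \<open>m\<close> has at most \<open>x / m + 1\<close> members,
  and both resulting terms are multiplicative in the list.\<close>

lemma count_list_bound:
  fixes x :: real
  assumes q: "\<And>q. q \<in> set qs \<Longrightarrow> prime (fst q)" "distinct (map fst qs)" and x: "x \<ge> 0"
    and N: "N \<subseteq> {n. 1 \<le> n \<and> real_of_int n \<le> x}"
  shows "real (card {n\<in>N. \<forall>q\<in>set qs. pp_dvd h n q}) \<le>
     x * prod_list (map (pp_al h) qs) + prod_list (map (pp_be h) qs)"
proof -
  define m where "m = prod_list (map (\<lambda>q. fst q ^ snd q) qs)"
  define A where "A = {r\<in>{0..<int m}. \<forall>q\<in>set qs. pp_dvd h r q}"
  have m: "m > 0" "card A \<le> prod_list (map (\<lambda>q. rho h (fst q ^ snd q)) qs)"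
    using roots_of_list_bound[OF q, of h] by (auto simp: m_def A_def)
  define L where "L = nat \<lfloor>x\<rfloor>"
  have L: "real L \<le> x" using x unfolding L_def by simp
  have finA: "finite A" unfolding A_def by (rule finite_subset[of _ "{0..<int m}"]) auto
  let ?G = "\<lambda>r. {n\<in>{1..<1 + int L}. int m dvd n - r}"
  have finG: "finite (?G r)" for r by (rule finite_subset[of _ "{1..<1 + int L}"]) auto
  have "{n\<in>N. \<forall>q\<in>set qs. pp_dvd h n q} \<subseteq> (\<Union>r\<in>A. ?G r)"
  proof
    fix n assume n: "n \<in> {n\<in>N. \<forall>q\<in>set qs. pp_dvd h n q}"
    have n1: "1 \<le> n" "real_of_int n \<le> x" using n N by auto
    hence "n \<le> \<lfloor>x\<rfloor>" by (simp add: le_floor_iff)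
    hence "n \<in> {1..<1 + int L}" using n1 unfolding L_def by simp
    moreover have "n mod int m \<in> A"
    proof -
      have "pp_dvd h (n mod int m) z" if z: "z \<in> set qs" for z
      proof -
        have dm: "fst z ^ snd z dvd m" unfolding m_def using z by (intro dvd_prod_list_member) auto
        have "int (fst z ^ snd z) dvd int m" using dm by (simp only: int_dvd_int_iff)
        moreover have "int m dvd n mod int m - n" by (simp add: mod_eq_dvd_iff[symmetric])
        ultimately have "int (fst z ^ snd z) dvd n mod int m - n" by (rule dvd_trans)
        hence "int (fst z ^ snd z) dvd poly h (n mod int m) - poly h n" using poly_diff_dvd dvd_trans by blast
        moreover have "int (fst z ^ snd z) dvd poly h n" using n z by (simp add: pp_dvd_def)
        ultimately have "int (fst z ^ snd z) dvd (poly h (n mod int m) - poly h n) + poly h n" by (rule dvd_add)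
        thus ?thesis by (simp add: pp_dvd_def)
      qed
      thus ?thesis using m(1) by (simp add: A_def)
    qed
    moreover have "int m dvd n - n mod int m" by simp
    ultimately show "n \<in> (\<Union>r\<in>A. ?G r)" by blast
  qed
  hence "card {n\<in>N. \<forall>q\<in>set qs. pp_dvd h n q} \<le> card (\<Union>r\<in>A. ?G r)" using finA finG by (intro card_mono finite_UN_I) auto
  also have "\<dots> \<le> (\<Sum>r\<in>A. card (?G r))" by (rule card_UN_le[OF finA])
  finally have "real (card {n\<in>N. \<forall>q\<in>set qs. pp_dvd h n q}) \<le> (\<Sum>r\<in>A. real (card (?G r)))"
    unfolding of_nat_sum[symmetric] of_nat_le_iff .
  also have "\<dots> \<le> (\<Sum>r\<in>A. real L / real m + 1)" by (intro sum_mono card_residue_interval m(1))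
  also have "\<dots> \<le> real (card A) * (x / real m + 1)" using L m(1) by (simp add: mult_left_mono divide_right_mono)
  also have "\<dots> \<le> real (prod_list (map (\<lambda>q. rho h (fst q ^ snd q)) qs)) * (x / real m + 1)"
    using m(2) x by (intro mult_right_mono of_nat_mono) auto
  also have "real (prod_list (map (\<lambda>q. rho h (fst q ^ snd q)) qs)) = prod_list (map (pp_be h) qs)"
    by (induction qs) (auto simp: pp_be_def)
  also have "prod_list (map (pp_be h) qs) * (x / real m + 1) = x * (prod_list (map (pp_be h) qs) / real m) + prod_list (map (pp_be h) qs)"
    by (simp add: algebra_simps)
  also have "prod_list (map (pp_be h) qs) / real m = prod_list (map (pp_al h) qs)"
    unfolding m_def
  proof (induction qs)
    case (Cons q qs)
    have "prod_list (map (pp_be h) (q # qs)) / real (prod_list (map (\<lambda>q. fst q ^ snd q) (q # qs))) =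
      (pp_be h q * prod_list (map (pp_be h) qs)) / (real (fst q ^ snd q) * real (prod_list (map (\<lambda>q. fst q ^ snd q) qs)))"
      by simp
    also have "\<dots> = (pp_be h q / real (fst q ^ snd q)) * (prod_list (map (pp_be h) qs) / real (prod_list (map (\<lambda>q. fst q ^ snd q) qs)))"
      by (rule times_divide_times_eq[symmetric])
    also have "\<dots> = pp_al h q * prod_list (map (pp_al h) qs)" unfolding Cons by (simp only: pp_be_def pp_al_def)
    finally show ?case by simp
  qed simp
  finally show ?thesis .
qed


section \<open>Inequalities for second moments\<close>

lemma weighted_cauchy_schwarz:
  fixes w a :: "'a \<Rightarrow> real"
  assumes w: "\<And>i. i \<in> I \<Longrightarrow> w i \<ge> 0"
  shows "(\<Sum>i\<in>I. w i * a i)\<^sup>2 \<le> (\<Sum>i\<in>I. w i) * (\<Sum>i\<in>I. w i * (a i)\<^sup>2)"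
proof -
  define V A1 A2 where "V = (\<Sum>i\<in>I. w i)" and "A1 = (\<Sum>i\<in>I. w i * a i)" and "A2 = (\<Sum>i\<in>I. w i * (a i)\<^sup>2)"
  have V0: "V \<ge> 0" unfolding V_def by (rule sum_nonneg[OF w])
  have q: "A2 - 2 * t * A1 + t\<^sup>2 * V \<ge> 0" for t
  proof -
    have "0 \<le> (\<Sum>i\<in>I. w i * (a i - t)\<^sup>2)" using w by (intro sum_nonneg) auto
    also have "\<dots> = (\<Sum>i\<in>I. w i * (a i)\<^sup>2 - 2 * t * (w i * a i) + t\<^sup>2 * w i)"
      by (intro sum.cong refl) (simp add: power2_eq_square algebra_simps)
    also have "\<dots> = A2 - 2 * t * A1 + t\<^sup>2 * V"
      unfolding V_def A1_def A2_def by (simp only: sum.distrib sum_subtractf sum_distrib_left)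
    finally show ?thesis .
  qed
  show ?thesis
  proof (cases "V = 0")
    case False
    hence V: "V > 0" using V0 by simp
    have "A2 - 2 * (A1 / V) * A1 + (A1 / V)\<^sup>2 * V = A2 - A1\<^sup>2 / V"
      using V by (simp add: power2_eq_square field_simps)
    hence "A1\<^sup>2 / V \<le> A2" using q[of "A1 / V"] by simp
    hence "A1\<^sup>2 \<le> A2 * V" using V by (simp only: pos_divide_le_eq)
    thus ?thesis unfolding V_def A1_def A2_def by (simp only: mult.commute)
  next
    case True
    have "A1 = 0"
    proof (cases "finite I")
      case fin: True
      have "\<forall>i\<in>I. w i = 0" using True w fin unfolding V_def by (subst (asm) sum_nonneg_eq_0_iff) auto
      thus ?thesis unfolding A1_def by (intro sum.neutral) auto
    qed (simp add: A1_def)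
    thus ?thesis using True unfolding V_def A1_def by simp
  qed
qed

text \<open>Every pair of powers of one prime is charged to the larger exponent \<open>j\<close>:
  \<open>j\<close> pairs in which the second exponent is at most \<open>j\<close>, and
  \<open>j - 1\<close> pairs in which the first one is smaller.\<close>

lemma same_base_sum_le:
  fixes l :: "nat \<times> nat \<Rightarrow> real"
  assumes E: "finite E" "\<And>q. q \<in> E \<Longrightarrow> snd q \<ge> 1" and l: "\<And>q. l q = v (fst q)"
  shows "(\<Sum>q\<in>E. \<Sum>q'\<in>{q'\<in>E. fst q' = fst q}. l q * l q') \<le> (\<Sum>q\<in>E. (2 * real (snd q) - 1) * (l q)\<^sup>2)"
proof -
  let ?le = "\<lambda>q. {q'\<in>E. fst q' = fst q \<and> snd q' \<le> snd q}"
  let ?lt = "\<lambda>q. {q'\<in>E. fst q' = fst q \<and> snd q' < snd q}"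
  let ?gt = "\<lambda>q. {q'\<in>E. fst q' = fst q \<and> snd q < snd q'}"
  have "(\<Sum>q\<in>E. \<Sum>q'\<in>{q'\<in>E. fst q' = fst q}. l q * l q') =
      (\<Sum>q\<in>E. (\<Sum>q'\<in>?le q. (l q)\<^sup>2) + (\<Sum>q'\<in>?gt q. (l q)\<^sup>2))"
  proof (rule sum.cong[OF refl])
    fix q
    have "(\<Sum>q'\<in>{q'\<in>E. fst q' = fst q}. l q * l q') = (\<Sum>q'\<in>?le q \<union> ?gt q. (l q)\<^sup>2)"
      by (intro sum.cong) (auto simp: l power2_eq_square)
    also have "\<dots> = (\<Sum>q'\<in>?le q. (l q)\<^sup>2) + (\<Sum>q'\<in>?gt q. (l q)\<^sup>2)"
      using E(1) by (intro sum.union_disjoint) auto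
    finally show "(\<Sum>q'\<in>{q'\<in>E. fst q' = fst q}. l q * l q') = (\<Sum>q'\<in>?le q. (l q)\<^sup>2) + (\<Sum>q'\<in>?gt q. (l q)\<^sup>2)" .
  qed
  also have "\<dots> = (\<Sum>q\<in>E. \<Sum>q'\<in>?le q. (l q)\<^sup>2) + (\<Sum>q\<in>E. \<Sum>q'\<in>?gt q. (l q)\<^sup>2)" by (rule sum.distrib)
  also have "(\<Sum>q\<in>E. \<Sum>q'\<in>?gt q. (l q)\<^sup>2) = (\<Sum>q'\<in>E. \<Sum>q\<in>{q\<in>E. fst q' = fst q \<and> snd q < snd q'}. (l q)\<^sup>2)"
    by (rule sum.swap_restrict[OF E(1) E(1)])
  also have "\<dots> = (\<Sum>q'\<in>E. \<Sum>q\<in>?lt q'. (l q')\<^sup>2)"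
    by (intro sum.cong refl) (auto simp: l)
  also have "(\<Sum>q\<in>E. \<Sum>q'\<in>?le q. (l q)\<^sup>2) + (\<Sum>q\<in>E. \<Sum>q'\<in>?lt q. (l q)\<^sup>2) =
      (\<Sum>q\<in>E. (real (card (?le q)) + real (card (?lt q))) * (l q)\<^sup>2)"
    by (simp add: sum.distrib distrib_right)
  also have "\<dots> \<le> (\<Sum>q\<in>E. (2 * real (snd q) - 1) * (l q)\<^sup>2)"
  proof (intro sum_mono mult_right_mono)
    fix q assume q: "q \<in> E"
    have "card (?le q) \<le> card {1..snd q}"
      by (rule card_inj_on_le[of snd]) (use E(2) in \<open>auto simp: inj_on_def prod_eq_iff\<close>)
    moreover have "card (?lt q) \<le> card {1..<snd q}"
      by (rule card_inj_on_le[of snd]) (use E(2) in \<open>auto simp: inj_on_def prod_eq_iff\<close>)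
    ultimately show "real (card (?le q)) + real (card (?lt q)) \<le> 2 * real (snd q) - 1"
      using E(2)[OF q] by simp
  qed simp
  finally show ?thesis .
qed

text \<open>\<open>Ns\<close> holds the counted integers after removal of the exceptions. The
  assumption \<open>pp\<close> bounds full prime powers, not only primes: it ensures that one prime
  absorbs at most \<open>ln y\<close> of the logarithm of the value.\<close>

locale smooth_sieve =
  fixes h :: "int poly" and x y X :: real and Ns :: "int set"
  assumes x: "x \<ge> 0" and y: "y \<ge> 1"
    and Ns: "Ns \<subseteq> {n. 1 \<le> n \<and> real_of_int n \<le> x}"
    and nz: "\<And>n. n \<in> Ns \<Longrightarrow> poly h n \<noteq> 0"
    and pp: "\<And>n p j. n \<in> Ns \<Longrightarrow> prime p \<Longrightarrow> j \<ge> 1 \<Longrightarrow> int (p ^ j) dvd poly h n \<Longrightarrow> real p ^ j \<le> y"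
    and big: "\<And>n. n \<in> Ns \<Longrightarrow> ln (real_of_int \<bar>poly h n\<bar>) \<ge> X"
begin

lemma finite_Ns: "finite Ns"
proof (rule finite_subset[of _ "{1..\<lfloor>x\<rfloor>}"])
  show "Ns \<subseteq> {1..\<lfloor>x\<rfloor>}" using Ns by (auto simp: le_floor_iff)
qed simp

definition lam :: "nat \<times> nat \<Rightarrow> real" where "lam q = ln (real (fst q))"

text \<open>A pair \<open>(p, i)\<close> stands for the prime power \<open>p ^ i\<close>. Distinct powers of the same prime are different
  elements of \<open>PP y\<close>, so that \<open>lam\<close> plays the role of the von Mangoldt function.\<close>

definition Tu :: "nat \<Rightarrow> (nat \<times> nat) list set" where
  "Tu j = {qs. set qs \<subseteq> PP y \<and> length qs = j \<and> distinct (map fst qs)}"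

definition wt :: "(nat \<times> nat) list \<Rightarrow> real" where "wt qs = prod_list (map lam qs)"

definition dvl :: "int \<Rightarrow> (nat \<times> nat) list \<Rightarrow> bool" where "dvl n qs \<longleftrightarrow> (\<forall>q\<in>set qs. pp_dvd h n q)"

definition ext :: "int \<Rightarrow> (nat \<times> nat) list \<Rightarrow> (nat \<times> nat) set \<Rightarrow> (nat \<times> nat) set" where
  "ext n qs S = {q\<in>S. pp_dvd h n q \<and> fst q \<notin> fst ` set qs}"

lemma finite_Tu: "finite (Tu j)"
  by (rule finite_subset[of _ "{qs. set qs \<subseteq> PP y \<and> length qs = j}"]) (auto simp: Tu_def finite_lists_length_eq)

lemma PP_prime: "q \<in> PP z \<Longrightarrow> prime (fst q)" by (auto simp: PP_def)

lemma lam_nonneg: "q \<in> PP z \<Longrightarrow> lam q \<ge> 0"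
  unfolding lam_def using PP_prime ln_prime_nonneg by blast

lemma Tu_prime: "qs \<in> Tu j \<Longrightarrow> q \<in> set qs \<Longrightarrow> prime (fst q)"
  using PP_prime[of q y] by (auto simp: Tu_def)

lemma wt_nonneg: "qs \<in> Tu j \<Longrightarrow> wt qs \<ge> 0"
proof -
  assume "qs \<in> Tu j"
  hence "set qs \<subseteq> PP y" by (simp add: Tu_def)
  thus ?thesis unfolding wt_def by (induction qs) (auto intro!: mult_nonneg_nonneg lam_nonneg)
qed

text \<open>A prime with multiplicity \<open>a\<close> contributes \<open>ln p\<close> for each
  exponent up to \<open>a\<close>, so all prime powers dividing the value have total weight equal to
  its logarithm. A prime already used in \<open>qs\<close> takes away at most
  \<open>ln y\<close>.\<close>

lemma ext_lower:
  assumes n: "n \<in> Ns" and qs: "length qs = j"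
  shows "(\<Sum>q\<in>ext n qs (PP y). lam q) \<ge> X - real j * ln y"
proof -
  define m where "m = nat \<bar>poly h n\<bar>"
  have m0: "m > 0" using nz[OF n] by (simp add: m_def)
  have dvm: "a dvd m \<longleftrightarrow> int a dvd poly h n" for a
    by (metis dvd_abs_iff int_dvd_int_iff m_def abs_ge_zero nat_0_le)
  define P where "P = fst ` set qs"
  have finP: "finite P" by (simp add: P_def)
  have cP: "card P \<le> j" unfolding P_def using card_image_le[of "set qs" fst] card_length[of qs] qs by simp
  let ?F = "prime_factors m"
  let ?S = "SIGMA p:?F - P. {1..multiplicity p m}"
  have ppow: "real p ^ i \<le> y" if "p \<in> ?F" "i \<in> {1..multiplicity p m}" for p i
  proof -
    have "p ^ i dvd m" using that(2) by (intro multiplicity_dvd') simp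
    hence dv: "int (p ^ i) dvd poly h n" by (simp only: dvm)
    show ?thesis using pp[OF n _ _ dv] that by (auto dest: in_prime_factors_imp_prime)
  qed
  have "?S \<subseteq> ext n qs (PP y)"
  proof clarify
    fix p i assume pi: "p \<in> ?F" "p \<notin> P" "i \<in> {1..multiplicity p m}"
    have "p ^ i dvd m" using pi(3) by (intro multiplicity_dvd') simp
    hence "int (p ^ i) dvd poly h n" by (simp only: dvm)
    thus "(p, i) \<in> ext n qs (PP y)" using ppow[OF pi(1,3)] pi unfolding ext_def PP_def P_def
      by (auto simp: pp_dvd_def dest: in_prime_factors_imp_prime)
  qed
  hence "(\<Sum>q\<in>?S. lam q) \<le> (\<Sum>q\<in>ext n qs (PP y). lam q)"
    by (intro sum_mono2) (auto simp: ext_def lam_nonneg)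
  moreover have "(\<Sum>q\<in>?S. lam q) = (\<Sum>p\<in>?F - P. real (multiplicity p m) * ln (real p))"
  proof -
    have "(\<Sum>q\<in>?S. lam q) = (\<Sum>p\<in>?F - P. \<Sum>i\<in>{1..multiplicity p m}. lam (p, i))"
      by (subst sum.Sigma) (auto intro: sum.cong)
    thus ?thesis by (simp add: lam_def)
  qed
  moreover have "\<dots> = (\<Sum>p\<in>?F. real (multiplicity p m) * ln (real p)) - (\<Sum>p\<in>?F \<inter> P. real (multiplicity p m) * ln (real p))"
    by (subst sum.Int_Diff[of ?F _ P]) auto
  moreover have "(\<Sum>p\<in>?F. real (multiplicity p m) * ln (real p)) \<ge> X"
    using big[OF n] ln_eq_sum_multiplicity[OF m0] by (simp add: m_def)
  moreover have "(\<Sum>p\<in>?F \<inter> P. real (multiplicity p m) * ln (real p)) \<le> real j * ln y"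
  proof -
    have "(\<Sum>p\<in>?F \<inter> P. real (multiplicity p m) * ln (real p)) \<le> (\<Sum>p\<in>?F \<inter> P. ln y)"
    proof (rule sum_mono)
      fix p assume p: "p \<in> ?F \<inter> P"
      hence pr: "prime p" "p dvd m" by (auto dest: in_prime_factors_imp_prime)
      have "multiplicity p m \<ge> 1" using pr m0 by (intro multiplicity_geI) (auto simp: prime_nat_iff)
      hence "real p ^ multiplicity p m \<le> y" using ppow[of p "multiplicity p m"] p by simp
      moreover have "real p > 0" using pr(1) by (simp add: prime_gt_0_nat)
      ultimately have "ln (real p ^ multiplicity p m) \<le> ln y" by (intro ln_mono) auto
      thus "real (multiplicity p m) * ln (real p) \<le> ln y" by (simp add: ln_realpow)
    qed
    also have "\<dots> = real (card (?F \<inter> P)) * ln y" by simp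
    also have "\<dots> \<le> real j * ln y"
    proof (rule mult_right_mono)
      have "card (?F \<inter> P) \<le> card P" using finP by (intro card_mono) auto
      thus "real (card (?F \<inter> P)) \<le> real j" using cP by simp
    qed (use y in simp)
    finally show ?thesis .
  qed
  ultimately show ?thesis by linarith
qed

definition W :: "nat \<Rightarrow> int \<Rightarrow> real" where "W j n = (\<Sum>qs\<in>{qs\<in>Tu j. dvl n qs}. wt qs)"

lemma W_Suc: "W (Suc j) n = (\<Sum>qs\<in>{qs\<in>Tu j. dvl n qs}. wt qs * (\<Sum>q\<in>ext n qs (PP y). lam q))"
proof -
  let ?A = "{qs\<in>Tu j. dvl n qs}"
  let ?S = "SIGMA qs:?A. ext n qs (PP y)"
  have eq: "{qs\<in>Tu (Suc j). dvl n qs} = (\<lambda>(qs, q). q # qs) ` ?S"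
  proof (rule equalityI)
    show "{qs\<in>Tu (Suc j). dvl n qs} \<subseteq> (\<lambda>(qs, q). q # qs) ` ?S"
    proof
      fix l assume l: "l \<in> {qs\<in>Tu (Suc j). dvl n qs}"
      then obtain q qs where "l = q # qs" by (cases l) (auto simp: Tu_def)
      thus "l \<in> (\<lambda>(qs, q). q # qs) ` ?S" using l
        by (intro image_eqI[of _ _ "(qs, q)"]) (auto simp: Tu_def dvl_def ext_def)
    qed
    show "(\<lambda>(qs, q). q # qs) ` ?S \<subseteq> {qs\<in>Tu (Suc j). dvl n qs}"
      by (auto simp: Tu_def dvl_def ext_def)
  qed
  have "W (Suc j) n = (\<Sum>z\<in>?S. wt (case z of (qs, q) \<Rightarrow> q # qs))"
    unfolding W_def eq by (subst sum.reindex) (auto simp: inj_on_def)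
  also have "\<dots> = (\<Sum>(qs, q)\<in>?S. wt qs * lam q)" by (intro sum.cong) (auto simp: wt_def)
  also have "\<dots> = (\<Sum>qs\<in>?A. \<Sum>q\<in>ext n qs (PP y). wt qs * lam q)"
    using finite_Tu by (subst sum.Sigma) (auto simp: ext_def)
  finally show ?thesis by (simp add: sum_distrib_left)
qed

lemma W_lower:
  assumes n: "n \<in> Ns" and "\<And>i. i < j \<Longrightarrow> X - real i * ln y \<ge> 0"
  shows "(\<Prod>i<j. X - real i * ln y) \<le> W j n"
  using assms(2)
proof (induction j)
  case 0
  have "{qs\<in>Tu 0. dvl n qs} = {[]}" by (auto simp: Tu_def dvl_def)
  thus ?case by (simp add: W_def wt_def)
next
  case (Suc j)
  have "(\<Prod>i<Suc j. X - real i * ln y) = (\<Prod>i<j. X - real i * ln y) * (X - real j * ln y)" by simp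
  also have "\<dots> \<le> W j n * (X - real j * ln y)" using Suc by (intro mult_right_mono) auto
  also have "\<dots> = (\<Sum>qs\<in>{qs\<in>Tu j. dvl n qs}. wt qs * (X - real j * ln y))" unfolding W_def by (rule sum_distrib_right)
  also have "\<dots> \<le> W (Suc j) n" unfolding W_Suc
    by (intro sum_mono mult_left_mono ext_lower[OF n]) (auto simp: Tu_def intro: wt_nonneg[of _ j, unfolded Tu_def])
  finally show ?case .
qed

definition MA :: real where "MA = (\<Sum>q\<in>PP y. lam q * pp_al h q)"
definition MB :: real where "MB = (\<Sum>q\<in>PP y. lam q * pp_be h q)"

lemma pp_al_nonneg: "pp_al h q \<ge> 0" by (simp add: pp_al_def)
lemma pp_be_nonneg: "pp_be h q \<ge> 0" by (simp add: pp_be_def)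

text \<open>Giving up distinctness of the primes turns the sum over tuples into a power of a single
  sum.\<close>

lemma Tu_sum_le:
  assumes b: "\<And>q. b q \<ge> 0"
  shows "(\<Sum>qs\<in>Tu j. wt qs * prod_list (map b qs)) \<le> (\<Sum>q\<in>PP y. lam q * b q) ^ j"
proof -
  have e: "wt qs * prod_list (map b qs) = prod_list (map (\<lambda>q. lam q * b q) qs)" for qs
    by (induction qs) (auto simp: wt_def)
  have nn: "prod_list (map (\<lambda>q. lam q * b q) qs) \<ge> 0" if "set qs \<subseteq> PP y" for qs
    using that by (induction qs) (auto intro!: mult_nonneg_nonneg lam_nonneg b)
  have "(\<Sum>qs\<in>Tu j. wt qs * prod_list (map b qs)) = (\<Sum>qs\<in>Tu j. prod_list (map (\<lambda>q. lam q * b q) qs))" by (simp only: e)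
  also have "\<dots> \<le> (\<Sum>qs\<in>{qs. set qs \<subseteq> PP y \<and> length qs = j}. prod_list (map (\<lambda>q. lam q * b q) qs))"
  proof (rule sum_mono2)
    show "finite {qs. set qs \<subseteq> PP y \<and> length qs = j}" by (rule finite_lists_length_eq[OF finite_PP])
    show "Tu j \<subseteq> {qs. set qs \<subseteq> PP y \<and> length qs = j}" by (auto simp: Tu_def)
  qed (use nn in auto)
  also have "\<dots> = (\<Sum>q\<in>PP y. lam q * b q) ^ j" by (rule sum_prod_lists[OF finite_PP])
  finally show ?thesis .
qed

text \<open>A common form of the two counts in use: \<open>l\<close> runs over lists of one element
  for a first moment and of two for a second moment. Distinctness of all primes in
  \<open>l @ qs\<close> makes the densities multiply.\<close>

lemma weighted_count:
  fixes \<psi> :: "(nat \<times> nat) list \<Rightarrow> real"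
  assumes E: "finite E" "\<And>l. l \<in> E \<Longrightarrow> \<psi> l \<ge> 0" "\<And>l q. l \<in> E \<Longrightarrow> q \<in> set l \<Longrightarrow> prime (fst q)"
  shows "(\<Sum>n\<in>Ns. \<Sum>qs\<in>{qs\<in>Tu j. dvl n qs}. wt qs * (\<Sum>l\<in>{l\<in>E. dvl n l \<and> distinct (map fst (l @ qs))}. \<psi> l))
     \<le> x * (\<Sum>l\<in>E. \<psi> l * prod_list (map (pp_al h) l)) * MA ^ j + (\<Sum>l\<in>E. \<psi> l * prod_list (map (pp_be h) l)) * MB ^ j"
proof -
  let ?c = "\<lambda>n qs l. dvl n qs \<and> dvl n l \<and> distinct (map fst (l @ qs))"
  have "(\<Sum>n\<in>Ns. \<Sum>qs\<in>{qs\<in>Tu j. dvl n qs}. wt qs * (\<Sum>l\<in>{l\<in>E. dvl n l \<and> distinct (map fst (l @ qs))}. \<psi> l)) =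
     (\<Sum>n\<in>Ns. \<Sum>qs\<in>Tu j. \<Sum>l\<in>E. if ?c n qs l then wt qs * \<psi> l else 0)"
  proof (rule sum.cong[OF refl])
    fix n
    have "(\<Sum>qs\<in>{qs\<in>Tu j. dvl n qs}. wt qs * (\<Sum>l\<in>{l\<in>E. dvl n l \<and> distinct (map fst (l @ qs))}. \<psi> l)) =
      (\<Sum>qs\<in>Tu j. if dvl n qs then wt qs * (\<Sum>l\<in>{l\<in>E. dvl n l \<and> distinct (map fst (l @ qs))}. \<psi> l) else 0)"
      by (rule sum.inter_filter[OF finite_Tu])
    also have "\<dots> = (\<Sum>qs\<in>Tu j. \<Sum>l\<in>E. if ?c n qs l then wt qs * \<psi> l else 0)"
    proof (rule sum.cong[OF refl])
      fix qs
      have "wt qs * (\<Sum>l\<in>{l\<in>E. dvl n l \<and> distinct (map fst (l @ qs))}. \<psi> l) =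
        (\<Sum>l\<in>{l\<in>E. dvl n l \<and> distinct (map fst (l @ qs))}. wt qs * \<psi> l)" by (rule sum_distrib_left)
      also have "\<dots> = (\<Sum>l\<in>E. if dvl n l \<and> distinct (map fst (l @ qs)) then wt qs * \<psi> l else 0)"
        by (rule sum.inter_filter[OF E(1)])
      finally have r: "wt qs * (\<Sum>l\<in>{l\<in>E. dvl n l \<and> distinct (map fst (l @ qs))}. \<psi> l) = \<dots>" .
      show "(if dvl n qs then wt qs * (\<Sum>l\<in>{l\<in>E. dvl n l \<and> distinct (map fst (l @ qs))}. \<psi> l) else 0) =
        (\<Sum>l\<in>E. if ?c n qs l then wt qs * \<psi> l else 0)" unfolding r by (cases "dvl n qs") simp_all
    qed
    finally show "(\<Sum>qs\<in>{qs\<in>Tu j. dvl n qs}. wt qs * (\<Sum>l\<in>{l\<in>E. dvl n l \<and> distinct (map fst (l @ qs))}. \<psi> l)) =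
      (\<Sum>qs\<in>Tu j. \<Sum>l\<in>E. if ?c n qs l then wt qs * \<psi> l else 0)" .
  qed
  also have "\<dots> = (\<Sum>qs\<in>Tu j. \<Sum>n\<in>Ns. \<Sum>l\<in>E. if ?c n qs l then wt qs * \<psi> l else 0)" by (rule sum.swap)
  also have "\<dots> = (\<Sum>qs\<in>Tu j. \<Sum>l\<in>E. \<Sum>n\<in>Ns. if ?c n qs l then wt qs * \<psi> l else 0)"
    by (intro sum.cong refl sum.swap)
  also have "\<dots> \<le> (\<Sum>qs\<in>Tu j. \<Sum>l\<in>E. wt qs * \<psi> l * (x * (prod_list (map (pp_al h) l) * prod_list (map (pp_al h) qs))
       + prod_list (map (pp_be h) l) * prod_list (map (pp_be h) qs)))"
  proof (intro sum_mono)
    fix qs l assume qs: "qs \<in> Tu j" and l: "l \<in> E"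
    let ?r = "x * (prod_list (map (pp_al h) l) * prod_list (map (pp_al h) qs)) + prod_list (map (pp_be h) l) * prod_list (map (pp_be h) qs)"
    have w0: "wt qs * \<psi> l \<ge> 0" using wt_nonneg[OF qs] E(2)[OF l] by simp
    have pl: "prod_list (map (pp_al h) zs) \<ge> 0" "prod_list (map (pp_be h) zs) \<ge> 0" for zs
      by (induction zs) (auto simp: pp_al_nonneg pp_be_nonneg)
    have r0: "?r \<ge> 0" using x pl by simp
    show "(\<Sum>n\<in>Ns. if ?c n qs l then wt qs * \<psi> l else 0) \<le> wt qs * \<psi> l * ?r"
    proof (cases "distinct (map fst (l @ qs))")
      case True
      have "(\<Sum>n\<in>Ns. if ?c n qs l then wt qs * \<psi> l else 0) = (\<Sum>n\<in>{n\<in>Ns. \<forall>q\<in>set (l @ qs). pp_dvd h n q}. wt qs * \<psi> l)"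
        using True finite_Ns by (subst sum.inter_filter) (auto simp: dvl_def intro!: sum.cong)
      also have "\<dots> = wt qs * \<psi> l * real (card {n\<in>Ns. \<forall>q\<in>set (l @ qs). pp_dvd h n q})" by simp
      also have "\<dots> \<le> wt qs * \<psi> l * (x * prod_list (map (pp_al h) (l @ qs)) + prod_list (map (pp_be h) (l @ qs)))"
        using E(3)[OF l] Tu_prime[OF qs] by (intro mult_left_mono w0 count_list_bound[OF _ True x Ns]) auto
      finally show ?thesis by simp
    next
      case False
      hence "(\<Sum>n\<in>Ns. if ?c n qs l then wt qs * \<psi> l else 0) = 0" by (intro sum.neutral) auto
      thus ?thesis using mult_nonneg_nonneg[OF w0 r0] by linarith
    qed
  qed
  also have "\<dots> = x * (\<Sum>l\<in>E. \<psi> l * prod_list (map (pp_al h) l)) * (\<Sum>qs\<in>Tu j. wt qs * prod_list (map (pp_al h) qs)) +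
      (\<Sum>l\<in>E. \<psi> l * prod_list (map (pp_be h) l)) * (\<Sum>qs\<in>Tu j. wt qs * prod_list (map (pp_be h) qs))"
  proof -
    define a b u v where "a = (\<lambda>l. \<psi> l * prod_list (map (pp_al h) l))" and "b = (\<lambda>l. \<psi> l * prod_list (map (pp_be h) l))"
      and "u = (\<lambda>qs. wt qs * prod_list (map (pp_al h) qs))" and "v = (\<lambda>qs. wt qs * prod_list (map (pp_be h) qs))"
    have "(\<Sum>qs\<in>Tu j. \<Sum>l\<in>E. wt qs * \<psi> l * (x * (prod_list (map (pp_al h) l) * prod_list (map (pp_al h) qs))
       + prod_list (map (pp_be h) l) * prod_list (map (pp_be h) qs))) = (\<Sum>qs\<in>Tu j. \<Sum>l\<in>E. x * (u qs * a l) + v qs * b l)"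
      by (intro sum.cong refl) (simp add: a_def b_def u_def v_def algebra_simps)
    also have "\<dots> = x * (\<Sum>qs\<in>Tu j. \<Sum>l\<in>E. u qs * a l) + (\<Sum>qs\<in>Tu j. \<Sum>l\<in>E. v qs * b l)"
      by (simp add: sum.distrib sum_distrib_left)
    also have "\<dots> = x * (sum u (Tu j) * sum a E) + sum v (Tu j) * sum b E" by (simp only: sum_product)
    finally show ?thesis by (simp add: a_def b_def u_def v_def mult_ac)
  qed
  also have "\<dots> \<le> x * (\<Sum>l\<in>E. \<psi> l * prod_list (map (pp_al h) l)) * MA ^ j + (\<Sum>l\<in>E. \<psi> l * prod_list (map (pp_be h) l)) * MB ^ j"
  proof -
    have pl: "prod_list (map (pp_al h) zs) \<ge> 0" "prod_list (map (pp_be h) zs) \<ge> 0" for zs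
      by (induction zs) (auto simp: pp_al_nonneg pp_be_nonneg)
    show ?thesis unfolding MA_def MB_def
      using x E(2) pl by (intro add_mono mult_left_mono Tu_sum_le pp_al_nonneg pp_be_nonneg mult_nonneg_nonneg sum_nonneg) auto
  qed
  finally show ?thesis .
qed


lemma single_count:
  assumes S: "finite S" "\<And>q. q \<in> S \<Longrightarrow> prime (fst q)" "\<And>q. q \<in> S \<Longrightarrow> \<phi> q \<ge> 0"
  shows "(\<Sum>n\<in>Ns. \<Sum>qs\<in>{qs\<in>Tu j. dvl n qs}. wt qs * (\<Sum>q\<in>ext n qs S. \<phi> q))
     \<le> x * (\<Sum>q\<in>S. \<phi> q * pp_al h q) * MA ^ j + (\<Sum>q\<in>S. \<phi> q * pp_be h q) * MB ^ j"
proof -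
  let ?E = "(\<lambda>q. [q]) ` S"
  have inj: "inj_on (\<lambda>q. [q]) A" for A :: "(nat \<times> nat) set" by (auto simp: inj_on_def)
  have eq: "(\<Sum>q\<in>ext n qs S. \<phi> q) = (\<Sum>l\<in>{l\<in>?E. dvl n l \<and> distinct (map fst (l @ qs))}. \<phi> (hd l))"
    if "qs \<in> Tu j" for n qs
  proof -
    have "{l\<in>?E. dvl n l \<and> distinct (map fst (l @ qs))} = (\<lambda>q. [q]) ` ext n qs S"
      using that by (fastforce simp: ext_def dvl_def Tu_def image_iff)
    thus ?thesis by (simp add: sum.reindex[OF inj])
  qed
  have "(\<Sum>n\<in>Ns. \<Sum>qs\<in>{qs\<in>Tu j. dvl n qs}. wt qs * (\<Sum>q\<in>ext n qs S. \<phi> q)) =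
    (\<Sum>n\<in>Ns. \<Sum>qs\<in>{qs\<in>Tu j. dvl n qs}. wt qs * (\<Sum>l\<in>{l\<in>?E. dvl n l \<and> distinct (map fst (l @ qs))}. \<phi> (hd l)))"
    by (intro sum.cong refl arg_cong2[of _ _ _ _ "(*)"] eq) auto
  also have "\<dots> \<le> x * (\<Sum>l\<in>?E. \<phi> (hd l) * prod_list (map (pp_al h) l)) * MA ^ j + (\<Sum>l\<in>?E. \<phi> (hd l) * prod_list (map (pp_be h) l)) * MB ^ j"
    by (rule weighted_count) (use S in auto)
  also have "\<dots> = x * (\<Sum>q\<in>S. \<phi> q * pp_al h q) * MA ^ j + (\<Sum>q\<in>S. \<phi> q * pp_be h q) * MB ^ j"
    by (simp add: sum.reindex[OF inj])
  finally show ?thesis .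
qed

lemma pair_count:
  assumes S: "finite S" "\<And>q. q \<in> S \<Longrightarrow> prime (fst q)"
  shows "(\<Sum>n\<in>Ns. \<Sum>qs\<in>{qs\<in>Tu j. dvl n qs}. wt qs * (\<Sum>q\<in>ext n qs S. \<Sum>q'\<in>{q'\<in>ext n qs S. fst q' \<noteq> fst q}. lam q * lam q'))
     \<le> x * (\<Sum>q\<in>S. lam q * pp_al h q)\<^sup>2 * MA ^ j + (\<Sum>q\<in>S. lam q * pp_be h q)\<^sup>2 * MB ^ j"
proof -
  let ?g = "\<lambda>z :: (nat \<times> nat) \<times> (nat \<times> nat). [fst z, snd z]"
  let ?E = "?g ` (S \<times> S)"
  let ?ps = "\<lambda>l. lam (hd l) * lam (hd (tl l))"
  have inj: "inj_on ?g A" for A by (auto simp: inj_on_def prod_eq_iff)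
  have lam0: "lam q \<ge> 0" if "q \<in> S" for q unfolding lam_def using S(2)[OF that] by (rule ln_prime_nonneg)
  have fe: "finite (ext n qs S)" for n qs using S(1) by (simp add: ext_def)
  have eq: "(\<Sum>q\<in>ext n qs S. \<Sum>q'\<in>{q'\<in>ext n qs S. fst q' \<noteq> fst q}. lam q * lam q') =
      (\<Sum>l\<in>{l\<in>?E. dvl n l \<and> distinct (map fst (l @ qs))}. ?ps l)"
    if "qs \<in> Tu j" for n qs
  proof -
    have "{l\<in>?E. dvl n l \<and> distinct (map fst (l @ qs))} = ?g ` (SIGMA q:ext n qs S. {q'\<in>ext n qs S. fst q' \<noteq> fst q})"
    proof (rule equalityI)
      show "{l\<in>?E. dvl n l \<and> distinct (map fst (l @ qs))} \<subseteq> ?g ` (SIGMA q:ext n qs S. {q'\<in>ext n qs S. fst q' \<noteq> fst q})"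
      proof
        fix l assume "l \<in> {l\<in>?E. dvl n l \<and> distinct (map fst (l @ qs))}"
        then obtain q q' where l: "l = [q, q']" "q \<in> S" "q' \<in> S" "dvl n l" "distinct (map fst (l @ qs))" by auto
        hence "(q, q') \<in> (SIGMA q:ext n qs S. {q'\<in>ext n qs S. fst q' \<noteq> fst q})"
          by (auto simp: ext_def dvl_def image_iff)
        thus "l \<in> ?g ` (SIGMA q:ext n qs S. {q'\<in>ext n qs S. fst q' \<noteq> fst q})" using l(1) by (intro image_eqI[of _ _ "(q, q')"]) auto
      qed
      show "?g ` (SIGMA q:ext n qs S. {q'\<in>ext n qs S. fst q' \<noteq> fst q}) \<subseteq> {l\<in>?E. dvl n l \<and> distinct (map fst (l @ qs))}"
      proof (rule image_subsetI)
        fix z assume "z \<in> (SIGMA q:ext n qs S. {q'\<in>ext n qs S. fst q' \<noteq> fst q})"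
        hence z: "fst z \<in> ext n qs S" "snd z \<in> ext n qs S" "fst (snd z) \<noteq> fst (fst z)" by auto
        have "?g z \<in> ?E" using z(1,2) by (intro imageI) (auto simp: ext_def mem_Times_iff)
        moreover have "dvl n (?g z)" using z(1,2) by (simp add: dvl_def ext_def)
        moreover have "distinct (map fst (?g z @ qs))" using z that by (simp add: ext_def Tu_def)
        ultimately show "?g z \<in> {l\<in>?E. dvl n l \<and> distinct (map fst (l @ qs))}" by simp
      qed
    qed
    hence "(\<Sum>l\<in>{l\<in>?E. dvl n l \<and> distinct (map fst (l @ qs))}. ?ps l) =
       (\<Sum>z\<in>(SIGMA q:ext n qs S. {q'\<in>ext n qs S. fst q' \<noteq> fst q}). lam (fst z) * lam (snd z))"
      by (simp add: sum.reindex[OF inj])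
    also have "\<dots> = (\<Sum>q\<in>ext n qs S. \<Sum>q'\<in>{q'\<in>ext n qs S. fst q' \<noteq> fst q}. lam q * lam q')"
      using fe by (subst sum.Sigma) (auto simp: case_prod_beta)
    finally show ?thesis by simp
  qed
  have pr: "(\<Sum>l\<in>?E. ?ps l * prod_list (map b l)) = (\<Sum>q\<in>S. lam q * b q)\<^sup>2" for b
  proof -
    have "(\<Sum>l\<in>?E. ?ps l * prod_list (map b l)) = (\<Sum>z\<in>S \<times> S. (lam (fst z) * b (fst z)) * (lam (snd z) * b (snd z)))"
      by (subst sum.reindex[OF inj]) (auto intro!: sum.cong)
    also have "\<dots> = (\<Sum>q\<in>S. \<Sum>q'\<in>S. (lam q * b q) * (lam q' * b q'))"
      by (subst sum.cartesian_product) (simp add: case_prod_beta)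
    also have "\<dots> = (\<Sum>q\<in>S. lam q * b q)\<^sup>2" by (simp only: power2_eq_square sum_product)
    finally show ?thesis .
  qed
  have "(\<Sum>n\<in>Ns. \<Sum>qs\<in>{qs\<in>Tu j. dvl n qs}. wt qs * (\<Sum>q\<in>ext n qs S. \<Sum>q'\<in>{q'\<in>ext n qs S. fst q' \<noteq> fst q}. lam q * lam q')) =
    (\<Sum>n\<in>Ns. \<Sum>qs\<in>{qs\<in>Tu j. dvl n qs}. wt qs * (\<Sum>l\<in>{l\<in>?E. dvl n l \<and> distinct (map fst (l @ qs))}. ?ps l))"
    by (intro sum.cong refl arg_cong2[of _ _ _ _ "(*)"] eq) auto
  also have "\<dots> \<le> x * (\<Sum>l\<in>?E. ?ps l * prod_list (map (pp_al h) l)) * MA ^ j + (\<Sum>l\<in>?E. ?ps l * prod_list (map (pp_be h) l)) * MB ^ j"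
    by (rule weighted_count) (use S lam0 in auto)
  also have "\<dots> = x * (\<Sum>q\<in>S. lam q * pp_al h q)\<^sup>2 * MA ^ j + (\<Sum>q\<in>S. lam q * pp_be h q)\<^sup>2 * MB ^ j"
    by (simp only: pr)
  finally show ?thesis .
qed

lemma PP_sqrt_subset: "PP (sqrt y) \<subseteq> PP y"
proof -
  have "sqrt y * 1 \<le> sqrt y * sqrt y" using y by (intro mult_left_mono) auto
  hence "sqrt y \<le> y" using y by simp
  thus ?thesis by (auto simp: PP_def)
qed

text \<open>The index set consists of the pairs of an integer and a tuple dividing its value,
  weighted by \<open>wt\<close>. In the second moment of the part below \<open>sqrt y\<close>, pairs
  with different primes go to \<open>pair_count\<close>, and pairs with equal primes are reduced by
  \<open>same_base_sum_le\<close> to a first moment.\<close>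

theorem sieve_inequality:
  defines "V \<equiv> (\<lambda>j. \<Sum>n\<in>Ns. W j n)"
  shows "(X - real j * ln y) * V j \<le>
    x * (\<Sum>q\<in>PP y - PP (sqrt y). lam q * pp_al h q) * MA ^ j + (\<Sum>q\<in>PP y - PP (sqrt y). lam q * pp_be h q) * MB ^ j
    + sqrt (V j * (x * ((\<Sum>q\<in>PP (sqrt y). lam q * pp_al h q)\<^sup>2 + (\<Sum>q\<in>PP (sqrt y). (2 * real (snd q) - 1) * (lam q)\<^sup>2 * pp_al h q)) * MA ^ j
        + ((\<Sum>q\<in>PP (sqrt y). lam q * pp_be h q)\<^sup>2 + (\<Sum>q\<in>PP (sqrt y). (2 * real (snd q) - 1) * (lam q)\<^sup>2 * pp_be h q)) * MB ^ j))"
    and "V j \<ge> 0"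
proof -
  define Qs where "Qs = PP (sqrt y)"
  define Qb where "Qb = PP y - PP (sqrt y)"
  have Qs: "finite Qs" "\<And>q. q \<in> Qs \<Longrightarrow> prime (fst q)" "\<And>q. q \<in> Qs \<Longrightarrow> lam q \<ge> 0" "\<And>q. q \<in> Qs \<Longrightarrow> snd q \<ge> 1"
    unfolding Qs_def using PP_prime lam_nonneg PP_D(2) by auto
  have Qb: "finite Qb" "\<And>q. q \<in> Qb \<Longrightarrow> prime (fst q)" "\<And>q. q \<in> Qb \<Longrightarrow> lam q \<ge> 0"
    unfolding Qb_def using PP_prime lam_nonneg by auto
  let ?T = "\<lambda>n. {qs\<in>Tu j. dvl n qs}"
  let ?I = "SIGMA n:Ns. ?T n"
  define as where "as = (\<lambda>(n, qs). \<Sum>q\<in>ext n qs Qs. lam q)"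
  define ab where "ab = (\<lambda>(n, qs). \<Sum>q\<in>ext n qs Qb. lam q)"
  define w where "w = (\<lambda>(n :: int, qs). wt qs)"
  have finT: "finite (?T n)" for n using finite_Tu by simp
  have w0: "w i \<ge> 0" if "i \<in> ?I" for i using that wt_nonneg by (auto simp: w_def)
  have sig: "(\<Sum>i\<in>?I. G (fst i) (snd i)) = (\<Sum>n\<in>Ns. \<Sum>qs\<in>?T n. G n qs)" for G :: "int \<Rightarrow> (nat \<times> nat) list \<Rightarrow> real"
    using finite_Ns finT by (subst sum.Sigma) (auto simp: case_prod_beta)
  have V: "V j = (\<Sum>i\<in>?I. w i)"
    unfolding V_def W_def using sig[of "\<lambda>n qs. wt qs"] by (simp add: w_def case_prod_beta)
  show V0: "V j \<ge> 0" unfolding V by (rule sum_nonneg[OF w0])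
  have "(X - real j * ln y) * V j = (\<Sum>i\<in>?I. w i * (X - real j * ln y))"
    unfolding V by (subst mult.commute) (rule sum_distrib_right)
  also have "\<dots> \<le> (\<Sum>i\<in>?I. w i * (as i + ab i))"
  proof (intro sum_mono mult_left_mono w0)
    fix i assume i: "i \<in> ?I"
    obtain n qs where nq: "i = (n, qs)" by (cases i)
    have n: "n \<in> Ns" "length qs = j" using i nq by (auto simp: Tu_def)
    have e: "ext n qs (PP y) = ext n qs Qs \<union> ext n qs Qb" "ext n qs Qs \<inter> ext n qs Qb = {}"
      using PP_sqrt_subset by (auto simp: ext_def Qs_def Qb_def)
    have "(\<Sum>q\<in>ext n qs (PP y). lam q) = as i + ab i"
      unfolding e(1) as_def ab_def nq case_prod_conv using Qs(1) Qb(1) e(2) by (intro sum.union_disjoint) (auto simp: ext_def)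
    thus "X - real j * ln y \<le> as i + ab i" using ext_lower[OF n] by simp
  qed
  also have "\<dots> = (\<Sum>i\<in>?I. w i * ab i) + (\<Sum>i\<in>?I. w i * as i)" by (simp add: distrib_left sum.distrib)
  also have "(\<Sum>i\<in>?I. w i * ab i) \<le> x * (\<Sum>q\<in>Qb. lam q * pp_al h q) * MA ^ j + (\<Sum>q\<in>Qb. lam q * pp_be h q) * MB ^ j"
  proof -
    have "(\<Sum>i\<in>?I. w i * ab i) = (\<Sum>n\<in>Ns. \<Sum>qs\<in>?T n. wt qs * (\<Sum>q\<in>ext n qs Qb. lam q))"
      using sig[of "\<lambda>n qs. wt qs * (\<Sum>q\<in>ext n qs Qb. lam q)"] by (simp add: w_def ab_def case_prod_beta)
    thus ?thesis using single_count[of Qb lam j] Qb by simp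
  qed
  also have "(\<Sum>i\<in>?I. w i * as i) \<le> sqrt (V j * (\<Sum>i\<in>?I. w i * (as i)\<^sup>2))"
    unfolding V by (rule real_le_rsqrt) (rule weighted_cauchy_schwarz[OF w0])
  also have "\<dots> \<le> sqrt (V j * (x * ((\<Sum>q\<in>Qs. lam q * pp_al h q)\<^sup>2 + (\<Sum>q\<in>Qs. (2 * real (snd q) - 1) * (lam q)\<^sup>2 * pp_al h q)) * MA ^ j
        + ((\<Sum>q\<in>Qs. lam q * pp_be h q)\<^sup>2 + (\<Sum>q\<in>Qs. (2 * real (snd q) - 1) * (lam q)\<^sup>2 * pp_be h q)) * MB ^ j))"
  proof (intro real_sqrt_le_mono mult_left_mono V0)
    let ?d = "\<lambda>n qs. \<Sum>q\<in>ext n qs Qs. \<Sum>q'\<in>{q'\<in>ext n qs Qs. fst q' \<noteq> fst q}. lam q * lam q'"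
    let ?s = "\<lambda>n qs. \<Sum>q\<in>ext n qs Qs. (2 * real (snd q) - 1) * (lam q)\<^sup>2"
    have fe: "finite (ext n qs Qs)" for n qs using Qs(1) by (simp add: ext_def)
    have sq: "(\<Sum>q\<in>ext n qs Qs. lam q)\<^sup>2 \<le> ?d n qs + ?s n qs" for n qs
    proof -
      let ?E = "ext n qs Qs"
      have "(\<Sum>q\<in>?E. lam q)\<^sup>2 = (\<Sum>q\<in>?E. \<Sum>q'\<in>?E. lam q * lam q')" by (simp only: power2_eq_square sum_product)
      also have "\<dots> = (\<Sum>q\<in>?E. (\<Sum>q'\<in>{q'\<in>?E. fst q' \<noteq> fst q}. lam q * lam q') + (\<Sum>q'\<in>{q'\<in>?E. fst q' = fst q}. lam q * lam q'))"
      proof (rule sum.cong[OF refl])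
        fix q
        have "(\<Sum>q'\<in>?E. lam q * lam q') = (\<Sum>q'\<in>{q'\<in>?E. fst q' \<noteq> fst q} \<union> {q'\<in>?E. fst q' = fst q}. lam q * lam q')"
          by (intro sum.cong) auto
        also have "\<dots> = (\<Sum>q'\<in>{q'\<in>?E. fst q' \<noteq> fst q}. lam q * lam q') + (\<Sum>q'\<in>{q'\<in>?E. fst q' = fst q}. lam q * lam q')"
          using fe by (intro sum.union_disjoint) auto
        finally show "(\<Sum>q'\<in>?E. lam q * lam q') = \<dots>" .
      qed
      also have "\<dots> = ?d n qs + (\<Sum>q\<in>?E. \<Sum>q'\<in>{q'\<in>?E. fst q' = fst q}. lam q * lam q')" by (rule sum.distrib)
      also have "\<dots> \<le> ?d n qs + ?s n qs"
        using Qs(4) by (intro add_left_mono same_base_sum_le[OF fe, of _ _ lam "\<lambda>p. ln (real p)"]) (auto simp: ext_def lam_def)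
      finally show ?thesis .
    qed
    have "(\<Sum>i\<in>?I. w i * (as i)\<^sup>2) = (\<Sum>n\<in>Ns. \<Sum>qs\<in>?T n. wt qs * (\<Sum>q\<in>ext n qs Qs. lam q)\<^sup>2)"
      using sig[of "\<lambda>n qs. wt qs * (\<Sum>q\<in>ext n qs Qs. lam q)\<^sup>2"] by (simp add: w_def as_def case_prod_beta)
    also have "\<dots> \<le> (\<Sum>n\<in>Ns. \<Sum>qs\<in>?T n. wt qs * (?d n qs + ?s n qs))"
      by (intro sum_mono mult_left_mono sq) (auto intro: wt_nonneg)
    also have "\<dots> = (\<Sum>n\<in>Ns. \<Sum>qs\<in>?T n. wt qs * ?d n qs) + (\<Sum>n\<in>Ns. \<Sum>qs\<in>?T n. wt qs * ?s n qs)"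
      by (simp only: distrib_left sum.distrib)
    also have "\<dots> \<le> (x * (\<Sum>q\<in>Qs. lam q * pp_al h q)\<^sup>2 * MA ^ j + (\<Sum>q\<in>Qs. lam q * pp_be h q)\<^sup>2 * MB ^ j) +
       (x * (\<Sum>q\<in>Qs. (2 * real (snd q) - 1) * (lam q)\<^sup>2 * pp_al h q) * MA ^ j + (\<Sum>q\<in>Qs. (2 * real (snd q) - 1) * (lam q)\<^sup>2 * pp_be h q) * MB ^ j)"
    proof (rule add_mono)
      show "(\<Sum>n\<in>Ns. \<Sum>qs\<in>?T n. wt qs * ?d n qs) \<le> x * (\<Sum>q\<in>Qs. lam q * pp_al h q)\<^sup>2 * MA ^ j + (\<Sum>q\<in>Qs. lam q * pp_be h q)\<^sup>2 * MB ^ j"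
        by (rule pair_count[OF Qs(1,2)])
      show "(\<Sum>n\<in>Ns. \<Sum>qs\<in>?T n. wt qs * ?s n qs) \<le> x * (\<Sum>q\<in>Qs. (2 * real (snd q) - 1) * (lam q)\<^sup>2 * pp_al h q) * MA ^ j + (\<Sum>q\<in>Qs. (2 * real (snd q) - 1) * (lam q)\<^sup>2 * pp_be h q) * MB ^ j"
      proof (rule single_count[OF Qs(1,2)])
        fix q assume "q \<in> Qs"
        hence "real (snd q) \<ge> 1" using Qs(4) by simp
        thus "0 \<le> (2 * real (snd q) - 1) * (lam q)\<^sup>2" by (intro mult_nonneg_nonneg) auto
      qed
    qed
    also have "\<dots> = x * ((\<Sum>q\<in>Qs. lam q * pp_al h q)\<^sup>2 + (\<Sum>q\<in>Qs. (2 * real (snd q) - 1) * (lam q)\<^sup>2 * pp_al h q)) * MA ^ j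
        + ((\<Sum>q\<in>Qs. lam q * pp_be h q)\<^sup>2 + (\<Sum>q\<in>Qs. (2 * real (snd q) - 1) * (lam q)\<^sup>2 * pp_be h q)) * MB ^ j"
      by (simp only: distrib_left distrib_right add_ac)
    finally show "(\<Sum>i\<in>?I. w i * (as i)\<^sup>2) \<le> \<dots>" .
  qed
  finally show "(X - real j * ln y) * V j \<le>
    x * (\<Sum>q\<in>PP y - PP (sqrt y). lam q * pp_al h q) * MA ^ j + (\<Sum>q\<in>PP y - PP (sqrt y). lam q * pp_be h q) * MB ^ j
    + sqrt (V j * (x * ((\<Sum>q\<in>PP (sqrt y). lam q * pp_al h q)\<^sup>2 + (\<Sum>q\<in>PP (sqrt y). (2 * real (snd q) - 1) * (lam q)\<^sup>2 * pp_al h q)) * MA ^ j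
        + ((\<Sum>q\<in>PP (sqrt y). lam q * pp_be h q)\<^sup>2 + (\<Sum>q\<in>PP (sqrt y). (2 * real (snd q) - 1) * (lam q)\<^sup>2 * pp_be h q)) * MB ^ j))"
    unfolding Qs_def Qb_def by linarith
qed

end

section \<open>The quadratic inequality and the main theorem\<close>

definition gam :: "real \<Rightarrow> real" where "gam a = 1 / 2 + a + sqrt (a + a\<^sup>2)"

lemma gam_ge_half: "a \<ge> 0 \<Longrightarrow> gam a \<ge> 1 / 2"
  by (simp add: gam_def)

lemma le_gam:
  assumes "t \<ge> 0" "a \<ge> 0" "t \<le> 1 / 2 + sqrt (2 * a * t)"
  shows "t \<le> gam a"
proof (cases "t \<le> 1 / 2")
  case True
  thus ?thesis using gam_ge_half[OF assms(2)] by simp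
next
  case False
  hence "(t - 1 / 2)\<^sup>2 \<le> (sqrt (2 * a * t))\<^sup>2" using assms(3) by (intro power_mono) auto
  hence "(t - 1 / 2)\<^sup>2 \<le> 2 * a * t" using assms(1,2) by simp
  hence "(t - 1 / 2 - a)\<^sup>2 \<le> a + a\<^sup>2" by (simp add: power2_eq_square algebra_simps)
  hence "t - 1 / 2 - a \<le> sqrt (a + a\<^sup>2)" by (rule real_le_rsqrt)
  thus ?thesis by (simp add: gam_def)
qed

text \<open>Used to replace \<open>d * u - j\<close> by \<open>d * u\<close> in the denominator of
  the argument; the price, a factor \<open>r\<close>, is recovered in
  \<open>falling_product_lower\<close>.\<close>

lemma gam_scale:
  assumes "a > 0" "r \<ge> 1"
  shows "gam (r * a) \<le> r * gam a"
proof -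
  have "r * a \<le> r\<^sup>2 * a" using assms by (simp add: power2_eq_square)
  hence "r * a + (r * a)\<^sup>2 \<le> r\<^sup>2 * (a + a\<^sup>2)" by (simp add: power_mult_distrib distrib_left)
  hence "sqrt (r * a + (r * a)\<^sup>2) \<le> sqrt (r\<^sup>2 * (a + a\<^sup>2))" by (rule real_sqrt_le_mono)
  also have "\<dots> = r * sqrt (a + a\<^sup>2)" using assms by (simp add: real_sqrt_mult)
  finally show ?thesis using assms by (simp add: gam_def distrib_left)
qed

text \<open>The last factor of the product occurs twice. All factors are at least
  \<open>v = (d - 1) * u\<close> since \<open>j + 1 \<le> u\<close>, and for
  \<open>j \<ge> 1\<close> the second factor times the repeated one is even at least
  \<open>d * u * v\<close>. This surplus pays for \<open>gam_scale\<close>.\<close>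

lemma falling_product_lower:
  fixes d u :: real
  assumes d: "d \<ge> 2" and u: "real (Suc j) \<le> u"
  shows "d * (d - 1) ^ j * u ^ Suc j * (d * u) \<le> (\<Prod>i<Suc j. d * u - real i) * (d * u - real j)"
proof (cases j)
  case 0
  thus ?thesis by simp
next
  case (Suc i)
  define D where "D = d * u"
  define v where "v = (d - 1) * u"
  have u0: "u \<ge> 1" using u by simp
  have v0: "v \<ge> 1" unfolding v_def using d u0 mult_mono[of 1 "d - 1" 1 u] by simp
  have D: "D = v + u" by (simp add: D_def v_def algebra_simps)
  have D0: "D \<ge> 1" using D v0 u0 by simp
  have "D * v \<le> D * (D - real (Suc j))" using D0 D u by (intro mult_left_mono) auto
  also have "\<dots> \<le> (D - 1) * (D - real j)" by (simp add: algebra_simps)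
  finally have key: "D * v \<le> (D - 1) * (D - real j)" .
  have "v ^ i = (\<Prod>m<i. v)" by simp
  also have "\<dots> \<le> (\<Prod>m<i. D - real (Suc (Suc m)))" using v0 D u Suc by (intro prod_mono) auto
  finally have rest: "v ^ i \<le> (\<Prod>m<i. D - real (Suc (Suc m)))" .
  have "d * (d - 1) ^ j * u ^ Suc j * (d * u) = D * ((D * v) * v ^ i)"
    by (simp add: D_def v_def Suc power_mult_distrib)
  also have "\<dots> \<le> D * (((D - 1) * (D - real j)) * (\<Prod>m<i. D - real (Suc (Suc m))))"
    using key rest D0 v0 by (intro mult_left_mono mult_mono order.trans[OF _ key]) auto
  also have "\<dots> = (\<Prod>i<Suc j. D - real i) * (D - real j)"
    unfolding Suc prod.lessThan_Suc_shift by simp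
  finally show ?thesis by (simp add: D_def)
qed

text \<open>The sieve inequality is quadratic in \<open>sqrt V\<close>, and \<open>gam\<close> is the largest root of
  \<open>t = 1 / 2 + sqrt (2 * a * t)\<close>.\<close>

lemma sieve_conclude:
  fixes d g u Y x \<eta> e N V X :: real
  assumes d: "d \<ge> 2" and g: "g > 0" and u: "real (Suc j) \<le> u" and Y: "Y > 0" and x: "x > 0"
    and e: "e \<ge> 0" and \<eta>: "0 \<le> \<eta>" "\<eta> < 1" and V: "V \<ge> 0" and N: "N \<ge> 0"
    and NV: "N * (\<Prod>i<j. X - real i * Y) \<le> V"
    and X: "\<And>i. i \<le> j \<Longrightarrow> X - real i * Y \<ge> Y * (d * u - real i) * (1 - \<eta>)"
    and main: "(X - real j * Y) * V \<le> (1 + e) * (x * (g * Y) ^ Suc j) / 2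
        + sqrt (2 * V * (x * (g * Y) ^ Suc j) * Y * ((2 * g + 1) / 16) * (1 + e))"
  shows "N * (1 - \<eta>) ^ (j + 2) \<le> (1 + e) * x *
    (gam ((2 * g + 1) / (16 * d * u)) * (g ^ Suc j / (d * (d - 1) ^ j * u ^ Suc j)))"
proof -
  define D where "D = d * u"
  define B where "B = (2 * g + 1) / 16"
  define M where "M = x * (g * Y) ^ Suc j"
  define E where "E = D - real j"
  define Z where "Z = Y * E * (1 - \<eta>)"
  define M' where "M' = (1 + e) * M / (1 - \<eta>)"
  \<comment> \<open>With \<open>V\<close> measured in these units the inequality becomes
    \<open>t \<le> 1 / 2 + sqrt (2 * A * t)\<close>; the factors \<open>1 + e\<close> and
    \<open>1 - \<eta>\<close> are hidden in \<open>M'\<close> and \<open>Z\<close>.\<close>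
  define t where "t = Z * V / M'"
  define A where "A = B / E"
  have u0: "u \<ge> 1" using u by simp
  have Du: "D \<ge> 2 * u" unfolding D_def using d u0 by (intro mult_right_mono) auto
  have E0: "E \<ge> 1" unfolding E_def using Du u u0 by simp
  have D0: "D > 0" using Du u0 by simp
  have B0: "B > 0" using g by (simp add: B_def)
  have A0: "A > 0" using B0 E0 by (simp add: A_def)
  have M0: "M > 0" using x g Y by (simp add: M_def)
  have Z0: "Z > 0" using Y E0 \<eta> by (simp add: Z_def)
  have M'0: "M' > 0" using M0 e \<eta> by (simp add: M'_def)
  have t0: "t \<ge> 0" using Z0 V M'0 by (simp add: t_def)
  have ZV: "Z * V = t * M'" using M'0 by (simp add: t_def)
  have M'M: "(1 + e) * M \<le> M'"
  proof -
    have "(1 + e) * M * (1 - \<eta>) \<le> (1 + e) * M * 1" using M0 e \<eta> by (intro mult_left_mono) auto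
    thus ?thesis using \<eta> by (simp add: M'_def field_simps)
  qed
  have "Z * V \<le> (X - real j * Y) * V" using X[of j] V by (intro mult_right_mono) (auto simp: Z_def E_def D_def)
  also have "\<dots> \<le> (1 + e) * M / 2 + sqrt (2 * V * M * Y * B * (1 + e))" using main by (simp only: M_def B_def)
  also have "2 * V * M * Y * B * (1 + e) = 2 * A * (Z * V) * M'"
    using E0 \<eta> by (simp add: A_def Z_def M'_def field_simps)
  also have "\<dots> = 2 * A * t * M'\<^sup>2" by (simp add: ZV power2_eq_square)
  also have "sqrt \<dots> = M' * sqrt (2 * A * t)" using M'0 by (simp add: real_sqrt_mult)
  finally have "t * M' \<le> M' / 2 + M' * sqrt (2 * A * t)" using ZV M'M by linarith
  also have "\<dots> = (1 / 2 + sqrt (2 * A * t)) * M'" by (simp add: algebra_simps)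
  finally have "t \<le> 1 / 2 + sqrt (2 * A * t)" using M'0 by simp
  hence "t \<le> gam A" using t0 A0 by (intro le_gam) auto
  also have "gam A \<le> D / E * gam (B / D)"
  proof -
    have "gam (D / E * (B / D)) \<le> D / E * gam (B / D)"
      using B0 D0 E0 by (intro gam_scale) (auto simp: E_def)
    moreover have "D / E * (B / D) = A" using D0 by (simp add: A_def)
    ultimately show ?thesis by simp
  qed
  finally have t: "t * E \<le> D * gam (B / D)" using E0 by (simp add: field_simps)
  let ?P = "\<Prod>i<j. D - real i"
  have Di: "D - real i > 0" if "i \<le> j" for i using that E0 by (simp add: E_def)
  have P0: "?P > 0" using Di by (intro prod_pos) auto
  have "Y ^ j * ?P * (1 - \<eta>) ^ j = (\<Prod>i<j. Y * (D - real i) * (1 - \<eta>))"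
    by (simp add: prod.distrib)
  also have "\<dots> \<le> (\<Prod>i<j. X - real i * Y)"
    using X Y \<eta> Di by (intro prod_mono) (auto simp: D_def less_imp_le)
  finally have "N * (Y ^ j * ?P * (1 - \<eta>) ^ j) \<le> V" using NV N by (meson mult_left_mono order.trans)
  hence "N * (Y ^ j * ?P * (1 - \<eta>) ^ j) * Z \<le> t * M'" using Z0 ZV by (metis mult.commute mult_left_mono less_imp_le)
  hence "N * (Y ^ j * ?P * (1 - \<eta>) ^ j) * Z * (1 - \<eta>) \<le> t * ((1 + e) * M)"
    using \<eta> by (simp add: M'_def field_simps)
  also have "N * (Y ^ j * ?P * (1 - \<eta>) ^ j) * Z * (1 - \<eta>) = N * (1 - \<eta>) ^ (j + 2) * (?P * E) * Y ^ Suc j"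
    by (simp add: Z_def algebra_simps)
  also have "t * ((1 + e) * M) = (1 + e) * x * g ^ Suc j * t * Y ^ Suc j" by (simp add: M_def power_mult_distrib)
  finally have "N * (1 - \<eta>) ^ (j + 2) * (?P * E) \<le> (1 + e) * x * g ^ Suc j * t"
    using Y by (subst (asm) mult_le_cancel_right) auto
  hence "N * (1 - \<eta>) ^ (j + 2) * (?P * E) * E \<le> (1 + e) * x * g ^ Suc j * t * E" using E0 by (intro mult_right_mono) auto
  also have "\<dots> = (1 + e) * x * g ^ Suc j * (t * E)" by simp
  also have "\<dots> \<le> (1 + e) * x * g ^ Suc j * (D * gam (B / D))" using t e x g by (intro mult_left_mono) auto
  finally have 1: "N * (1 - \<eta>) ^ (j + 2) * (?P * E * E) \<le> (1 + e) * x * g ^ Suc j * gam (B / D) * D"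
    by (simp add: mult_ac)
  define G where "G = d * (d - 1) ^ j * u ^ Suc j"
  have G0: "G > 0" using d u0 by (simp add: G_def)
  have "G * D \<le> ?P * E * E"
    using falling_product_lower[OF d u] by (simp add: G_def D_def E_def)
  hence "N * (1 - \<eta>) ^ (j + 2) * (G * D) \<le> N * (1 - \<eta>) ^ (j + 2) * (?P * E * E)"
    using N \<eta> by (intro mult_left_mono) auto
  also note 1
  finally have "N * (1 - \<eta>) ^ (j + 2) * G * D \<le> (1 + e) * x * g ^ Suc j * gam (B / D) * D" by (simp add: mult_ac)
  hence "N * (1 - \<eta>) ^ (j + 2) * G \<le> (1 + e) * x * g ^ Suc j * gam (B / D)" using D0 by (subst (asm) mult_le_cancel_right) auto
  hence "N * (1 - \<eta>) ^ (j + 2) \<le> (1 + e) * x * g ^ Suc j * gam (B / D) / G" using G0 by (simp add: pos_le_divide_eq)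
  also have "\<dots> = (1 + e) * x * (gam (B / D) * (g ^ Suc j / G))" by simp
  also have "B / D = (2 * g + 1) / (16 * d * u)" by (simp add: B_def D_def)
  finally show ?thesis by (simp only: G_def)
qed

context smooth_sieve
begin

lemma lam_al_S1: "(\<Sum>q\<in>S. lam q * pp_al h q) = S1 h S"
  by (simp add: S1_def lam_def pp_al_def case_prod_beta)

lemma lam_al_Sq: "(\<Sum>q\<in>S. (2 * real (snd q) - 1) * (lam q)\<^sup>2 * pp_al h q) = Sq h S"
  by (simp add: Sq_def lam_def pp_al_def case_prod_beta)

lemma sum_lam_be_le:
  assumes C: "C \<ge> 0" "\<And>p j. prime p \<Longrightarrow> j \<ge> 1 \<Longrightarrow> real (rho h (p ^ j)) \<le> C" and z: "z \<ge> 1"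
  shows "(\<Sum>q\<in>PP z. lam q * pp_be h q) \<le> 6 * C * z"
proof -
  have "(\<Sum>q\<in>PP z. lam q * pp_be h q) \<le> (\<Sum>q\<in>PP z. lam q * C)"
    using C(2) lam_nonneg by (intro sum_mono mult_left_mono) (auto simp: pp_be_def PP_def)
  also have "\<dots> = C * (\<Sum>(p, j)\<in>PP z. ln (real p))" by (simp add: sum_distrib_left lam_def case_prod_beta mult.commute)
  also have "\<dots> \<le> C * (6 * z)" using PP_theta_le[OF z] C(1) by (intro mult_left_mono)
  finally show ?thesis by simp
qed

text \<open>One factor \<open>lam\<close> combines with the weight to at most
  \<open>ln y \<le> 2 * sqrt y\<close>; the other is summed by \<open>PP_theta_le\<close>.\<close>

lemma sum_lam_sq_be_le:
  assumes C: "C \<ge> 0" "\<And>p j. prime p \<Longrightarrow> j \<ge> 1 \<Longrightarrow> real (rho h (p ^ j)) \<le> C"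
  shows "(\<Sum>q\<in>PP (sqrt y). (2 * real (snd q) - 1) * (lam q)\<^sup>2 * pp_be h q) \<le> 12 * C * y"
proof -
  have s1: "sqrt y \<ge> 1" using y by simp
  have lny: "ln y \<le> 2 * sqrt y"
  proof -
    have "ln y = 2 * ln (sqrt y)" using y by (simp add: ln_sqrt)
    also have "\<dots> \<le> 2 * (sqrt y - 1)" using s1 by (intro mult_left_mono ln_le_minus_one) auto
    finally show ?thesis by simp
  qed
  have "(\<Sum>q\<in>PP (sqrt y). (2 * real (snd q) - 1) * (lam q)\<^sup>2 * pp_be h q) \<le> (\<Sum>q\<in>PP (sqrt y). (2 * sqrt y * C) * lam q)"
  proof (rule sum_mono)
    fix q assume q: "q \<in> PP (sqrt y)"
    obtain p i where pi: "q = (p, i)" by (cases q)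
    note D = PP_D[OF q[unfolded pi]]
    have p: "real p > 0" using D(1) by (simp add: prime_gt_0_nat)
    have "ln (real p ^ i) \<le> ln (sqrt y)" using D(3) p s1 by (intro ln_mono) auto
    hence "2 * real i * lam q \<le> ln y" using p y by (simp add: ln_realpow ln_sqrt lam_def pi)
    hence a: "(2 * real i - 1) * lam q \<le> 2 * sqrt y" using lny lam_nonneg[OF q] by (simp add: algebra_simps)
    have "pp_be h q \<le> C" using C(2) D by (simp add: pp_be_def pi)
    hence "((2 * real i - 1) * lam q) * pp_be h q \<le> (2 * sqrt y) * C"
      by (rule mult_mono[OF a]) (use s1 pp_be_nonneg in auto)
    hence "((2 * real i - 1) * lam q * pp_be h q) * lam q \<le> ((2 * sqrt y) * C) * lam q"
      using lam_nonneg[OF q] by (intro mult_right_mono)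
    thus "(2 * real (snd q) - 1) * (lam q)\<^sup>2 * pp_be h q \<le> (2 * sqrt y * C) * lam q"
      by (simp add: pi power2_eq_square mult_ac)
  qed
  also have "\<dots> = (2 * sqrt y * C) * (\<Sum>(p, j)\<in>PP (sqrt y). ln (real p))"
    by (simp add: sum_distrib_left lam_def case_prod_beta)
  also have "\<dots> \<le> (2 * sqrt y * C) * (6 * sqrt y)"
    using PP_theta_le[OF s1] C(1) s1 by (intro mult_left_mono) auto
  also have "\<dots> = 12 * C * (sqrt y * sqrt y)" by simp
  finally show ?thesis using y by simp
qed

text \<open>The \<open>j\<close> prime powers of a tuple together with one more, or with two below
  \<open>sqrt y\<close>, have product at most \<open>y ^ (j + 1)\<close>; so the rounding errors of
  both moments are of the same order.\<close>

lemma sieve_bounds: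
  assumes C: "C \<ge> 1" "\<And>p j. prime p \<Longrightarrow> j \<ge> 1 \<Longrightarrow> real (rho h (p ^ j)) \<le> C"
    and X: "\<And>i. i < j \<Longrightarrow> X - real i * ln y \<ge> 0"
  shows "\<exists>V\<ge>0. real (card Ns) * (\<Prod>i<j. X - real i * ln y) \<le> V \<and>
    (X - real j * ln y) * V \<le> x * S1 h (PP y - PP (sqrt y)) * S1 h (PP y) ^ j + (6 * C * y) ^ Suc j
     + sqrt (V * (x * ((S1 h (PP (sqrt y)))\<^sup>2 + Sq h (PP (sqrt y))) * S1 h (PP y) ^ j + 48 * C\<^sup>2 * y * (6 * C * y) ^ j))"
proof (intro exI conjI)
  define V where "V = (\<Sum>n\<in>Ns. W j n)"
  have C0: "C \<ge> 0" using C(1) by simp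
  have s1: "sqrt y \<ge> 1" using y by simp
  show V0: "V \<ge> 0" unfolding V_def by (rule sieve_inequality(2))
  have "real (card Ns) * (\<Prod>i<j. X - real i * ln y) = (\<Sum>n\<in>Ns. \<Prod>i<j. X - real i * ln y)" by simp
  also have "\<dots> \<le> V" unfolding V_def by (intro sum_mono W_lower X)
  finally show "real (card Ns) * (\<Prod>i<j. X - real i * ln y) \<le> V" .
  note be = sum_lam_be_le[OF C0 C(2)]
  have MA: "MA = S1 h (PP y)" by (simp add: MA_def lam_al_S1)
  have MB0: "MB \<ge> 0" unfolding MB_def using lam_nonneg pp_be_nonneg by (intro sum_nonneg mult_nonneg_nonneg) auto
  have MB: "MB \<le> 6 * C * y" unfolding MB_def by (rule be[OF _ _ y])
  have MBj: "MB ^ j \<le> (6 * C * y) ^ j" by (rule power_mono[OF MB MB0])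
  have "(\<Sum>q\<in>PP y - PP (sqrt y). lam q * pp_be h q) \<le> (\<Sum>q\<in>PP y. lam q * pp_be h q)"
    using lam_nonneg pp_be_nonneg by (intro sum_mono2 mult_nonneg_nonneg) auto
  also have "\<dots> \<le> 6 * C * y" by (rule be[OF _ _ y])
  finally have b1: "(\<Sum>q\<in>PP y - PP (sqrt y). lam q * pp_be h q) * MB ^ j \<le> (6 * C * y) ^ Suc j"
    using MBj MB0 C0 y unfolding power_Suc by (intro mult_mono) auto
  have n1: "(\<Sum>q\<in>PP (sqrt y). lam q * pp_be h q) \<ge> 0" using lam_nonneg pp_be_nonneg by (intro sum_nonneg mult_nonneg_nonneg) auto
  have "(\<Sum>q\<in>PP (sqrt y). lam q * pp_be h q)\<^sup>2 \<le> (6 * C * sqrt y)\<^sup>2"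
    by (rule power_mono[OF be[OF _ _ s1] n1])
  also have "\<dots> = 36 * C\<^sup>2 * y" using y by (simp add: power_mult_distrib)
  finally have "(\<Sum>q\<in>PP (sqrt y). lam q * pp_be h q)\<^sup>2 + (\<Sum>q\<in>PP (sqrt y). (2 * real (snd q) - 1) * (lam q)\<^sup>2 * pp_be h q) \<le> 36 * C\<^sup>2 * y + 12 * C * y"
    using sum_lam_sq_be_le[OF C0 C(2)] by simp
  also have "\<dots> \<le> 48 * C\<^sup>2 * y"
  proof -
    have "C * y \<le> C\<^sup>2 * y" using C(1) y by (simp add: power2_eq_square)
    thus ?thesis by (simp add: mult_ac)
  qed
  finally have b2: "((\<Sum>q\<in>PP (sqrt y). lam q * pp_be h q)\<^sup>2 + (\<Sum>q\<in>PP (sqrt y). (2 * real (snd q) - 1) * (lam q)\<^sup>2 * pp_be h q)) * MB ^ j \<le> 48 * C\<^sup>2 * y * (6 * C * y) ^ j"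
    using MBj MB0 C0 y by (intro mult_mono) auto
  have "(X - real j * ln y) * V \<le> x * S1 h (PP y - PP (sqrt y)) * S1 h (PP y) ^ j + (\<Sum>q\<in>PP y - PP (sqrt y). lam q * pp_be h q) * MB ^ j
    + sqrt (V * (x * ((S1 h (PP (sqrt y)))\<^sup>2 + Sq h (PP (sqrt y))) * S1 h (PP y) ^ j
        + ((\<Sum>q\<in>PP (sqrt y). lam q * pp_be h q)\<^sup>2 + (\<Sum>q\<in>PP (sqrt y). (2 * real (snd q) - 1) * (lam q)\<^sup>2 * pp_be h q)) * MB ^ j))"
    using sieve_inequality(1)[of j] unfolding V_def lam_al_S1 lam_al_Sq MA .
  also have "\<dots> \<le> x * S1 h (PP y - PP (sqrt y)) * S1 h (PP y) ^ j + (6 * C * y) ^ Suc j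
     + sqrt (V * (x * ((S1 h (PP (sqrt y)))\<^sup>2 + Sq h (PP (sqrt y))) * S1 h (PP y) ^ j + 48 * C\<^sup>2 * y * (6 * C * y) ^ j))"
    by (intro add_mono add_left_mono b1 b2 real_sqrt_le_mono mult_left_mono V0)
  finally show "(X - real j * ln y) * V \<le> \<dots>" .
qed

end

section \<open>Exceptional integers and the size of the error terms\<close>

lemma poly_growth_lower:
  fixes h :: "int poly"
  assumes "h \<noteq> 0"
  shows "\<exists>n0. \<forall>n\<ge>n0. n > 0 \<longrightarrow> poly h n \<noteq> 0 \<and> ln (real_of_int \<bar>poly h n\<bar>) \<ge> real (degree h) * ln (real_of_int n) - ln 2"
proof -
  define s where "s = sgn (lead_coeff h)"
  \<comment> \<open>The leading coefficient of \<open>h\<close> has absolute value at least 1, so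
    \<open>2 * \<bar>poly h n\<bar>\<close> eventually exceeds \<open>n ^ degree h\<close>; this
    explains \<open>ln 2\<close>.\<close>
  define P where "P = Polynomial.smult (2 * s) h - monom 1 (degree h)"
  have lc: "lead_coeff h \<noteq> 0" using assms by simp
  have "s * lead_coeff h = \<bar>lead_coeff h\<bar>" unfolding s_def by (simp add: abs_sgn mult.commute)
  hence s: "s * lead_coeff h \<ge> 1" using lc by linarith
  have s2: "\<bar>s\<bar> = 1" using lc by (simp add: s_def)
  have c: "coeff P (degree h) = 2 * (s * lead_coeff h) - 1" by (simp add: P_def)
  have "degree P \<le> degree h" unfolding P_def by (intro degree_diff_le) (auto simp: degree_monom_le)
  moreover have "degree P \<ge> degree h" using c s by (intro le_degree) auto
  ultimately have "lead_coeff P > 0" using c s by simp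
  then obtain n0 where n0: "\<And>n. n \<ge> n0 \<Longrightarrow> poly P n > 0" using int_poly_eventually_pos by blast
  show ?thesis
  proof (intro exI allI impI)
    fix n assume n: "n \<ge> n0" "n > 0"
    have "n ^ degree h < 2 * (s * poly h n)" using n0[OF n(1)] by (simp add: P_def poly_monom)
    also have "\<dots> \<le> 2 * \<bar>poly h n\<bar>" using s2 by (metis abs_ge_self abs_mult mult_1 mult_left_mono zero_le_numeral)
    finally have l: "n ^ degree h < 2 * \<bar>poly h n\<bar>" .
    have p: "n ^ degree h > 0" using n(2) by simp
    have nz: "poly h n \<noteq> 0" using l p by auto
    have "real (degree h) * ln (real_of_int n) = ln (real_of_int (n ^ degree h))" using n(2) by (simp add: ln_realpow)
    also have "\<dots> \<le> ln (real_of_int (2 * \<bar>poly h n\<bar>))" using l p by (intro ln_mono) (auto simp del: of_int_power)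
    also have "\<dots> = ln 2 + ln (real_of_int \<bar>poly h n\<bar>)" using nz by (simp add: ln_mult)
    finally show "poly h n \<noteq> 0 \<and> ln (real_of_int \<bar>poly h n\<bar>) \<ge> real (degree h) * ln (real_of_int n) - ln 2" using nz by simp
  qed
qed

lemma card_primes_upto_le_self: assumes "z \<ge> 0" shows "real (card (primes_upto z)) \<le> z"
proof -
  have "primes_upto z \<subseteq> {1..nat \<lfloor>z\<rfloor>}"
    using assms by (auto simp: in_primes_upto le_nat_floor Suc_le_eq prime_gt_0_nat)
  hence "card (primes_upto z) \<le> nat \<lfloor>z\<rfloor>" using card_mono[of "{1..nat \<lfloor>z\<rfloor>}"] by fastforce
  thus ?thesis using assms by linarith
qed

text \<open>Primes above \<open>sqrt y\<close> have logarithm at least \<open>ln y / 2\<close>, so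
  the bound for \<open>theta\<close> limits their number.\<close>

lemma card_primes_upto_le:
  assumes "y > 1"
  shows "real (card (primes_upto y)) \<le> sqrt y + 8 * y / ln y"
proof -
  let ?B = "primes_upto y - primes_upto (sqrt y)"
  have ly: "ln y > 0" using assms by simp
  have "(ln y / 2) * real (card ?B) = (\<Sum>p\<in>?B. ln y / 2)" by simp
  also have "\<dots> \<le> (\<Sum>p\<in>?B. ln (real p))"
  proof (rule sum_mono)
    fix p assume "p \<in> ?B"
    hence "sqrt y < real p" by (auto simp: in_primes_upto)
    hence "ln (sqrt y) \<le> ln (real p)" using assms by (intro ln_mono) auto
    thus "ln y / 2 \<le> ln (real p)" using assms by (simp add: ln_sqrt)
  qed
  also have "\<dots> \<le> theta y" unfolding theta_def by (intro sum_mono2) (auto simp: in_primes_upto)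
  also have "\<dots> \<le> 4 * y" using assms by (intro theta_le) auto
  finally have b: "real (card ?B) \<le> 8 * y / ln y" using ly by (simp add: field_simps)
  have "card (primes_upto y) \<le> card (primes_upto (sqrt y) \<union> ?B)" by (intro card_mono) auto
  also have "\<dots> \<le> card (primes_upto (sqrt y)) + card ?B" by (rule card_Un_le)
  finally have "real (card (primes_upto y)) \<le> real (card (primes_upto (sqrt y))) + real (card ?B)" by linarith
  also have "real (card (primes_upto (sqrt y))) \<le> sqrt y" using assms by (intro card_primes_upto_le_self) auto
  finally show ?thesis using b by linarith
qed

text \<open>It suffices to consider the least power of \<open>p\<close> above \<open>y\<close>,
  whose exponent is at least 2. For \<open>p\<close> up to \<open>sqrt y\<close> its reciprocal is
  below \<open>1 / y\<close>, and there are at most \<open>sqrt y\<close> such primes; for larger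
  \<open>p\<close> it is at most \<open>1 / p\<^sup>2\<close>. The two parts give
  \<open>1 + 2\<close> in the constant 3.\<close>

lemma large_prime_power_exceptions:
  assumes C: "C \<ge> 0" "\<And>p j. prime p \<Longrightarrow> j \<ge> 1 \<Longrightarrow> real (rho h (p ^ j)) \<le> C" and x: "x \<ge> 0" and y: "y \<ge> 1"
  defines "E \<equiv> {n. 1 \<le> n \<and> real_of_int n \<le> x \<and>
     (\<exists>p j. prime p \<and> real p \<le> y \<and> int (p ^ j) dvd poly h n \<and> real p ^ j > y)}"
  shows "real (card E) \<le> 3 * C * x / sqrt y + C * real (card (primes_upto y))"
proof -
  define J where "J p = (LEAST j. real p ^ j > y)" for p :: nat
  define N where "N = {n :: int. 1 \<le> n \<and> real_of_int n \<le> x}"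
  define A where "A p = {n\<in>N. \<forall>q\<in>set [(p, J p)]. pp_dvd h n q}" for p
  have finN: "finite N"
    by (rule finite_subset[of _ "{1..\<lfloor>x\<rfloor>}"]) (auto simp: N_def le_floor_iff)
  have J: "real p ^ J p > y" if "prime p" for p
  proof -
    have "real p > 1" using prime_gt_1_nat[OF that] by simp
    then obtain n where "y < real p ^ n" using real_arch_pow by blast
    thus ?thesis unfolding J_def by (rule LeastI)
  qed
  have J2: "J p \<ge> 2" if "p \<in> primes_upto y" for p
  proof (rule ccontr)
    assume "\<not> J p \<ge> 2"
    hence "J p = 0 \<or> J p = 1" by linarith
    thus False using J[of p] that y by (auto simp: in_primes_upto)
  qed
  have sub: "E \<subseteq> (\<Union>p\<in>primes_upto y. A p)"
  proof
    fix n assume "n \<in> E"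
    then obtain p j where n: "n \<in> N" and p: "prime p" "real p \<le> y" "int (p ^ j) dvd poly h n" "real p ^ j > y"
      by (auto simp: E_def N_def)
    have "J p \<le> j" unfolding J_def using p(4) by (rule Least_le)
    hence "p ^ J p dvd p ^ j" by (rule le_imp_power_dvd)
    hence "int (p ^ J p) dvd int (p ^ j)" by (simp only: int_dvd_int_iff)
    hence "int (p ^ J p) dvd poly h n" using p(3) by (rule dvd_trans)
    hence "n \<in> A p" using n by (simp add: A_def pp_dvd_def)
    thus "n \<in> (\<Union>p\<in>primes_upto y. A p)" using p by (auto simp: in_primes_upto)
  qed
  have Ap: "real (card (A p)) \<le> C * x * (1 / real p ^ J p) + C" if "p \<in> primes_upto y" for p
  proof -
    have p: "prime p" using that by (simp add: in_primes_upto)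
    have "real (card (A p)) \<le> x * prod_list (map (pp_al h) [(p, J p)]) + prod_list (map (pp_be h) [(p, J p)])"
      unfolding A_def by (rule count_list_bound) (use p x in \<open>auto simp: N_def\<close>)
    also have "\<dots> = x * (real (rho h (p ^ J p)) * (1 / real p ^ J p)) + real (rho h (p ^ J p))" by (simp add: pp_al_def pp_be_def)
    also have "\<dots> \<le> x * (C * (1 / real p ^ J p)) + C"
      using C(2)[OF p, of "J p"] J2[OF that] x by (intro add_mono mult_left_mono mult_right_mono) auto
    finally show ?thesis by (simp add: mult_ac)
  qed
  define w where "w = nat \<lfloor>sqrt y\<rfloor>"
  have s1: "sqrt y \<ge> 1" using y by simp
  have w1: "real w \<ge> 1" "real w \<le> sqrt y" "real w \<ge> sqrt y - 1" "w > 0"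
    using s1 floor_correct[of "sqrt y"] by (auto simp: w_def le_nat_iff le_floor_iff simp del: floor_correct)
  have wh: "real w \<ge> sqrt y / 2" using w1 by linarith
  let ?S = "primes_upto y \<inter> {..w}" and ?T = "primes_upto y - {..w}"
  have "(\<Sum>p\<in>?S. 1 / real p ^ J p) \<le> (\<Sum>p\<in>?S. 1 / y)"
    using J y by (intro sum_mono divide_left_mono) (auto simp: in_primes_upto less_imp_le prime_gt_0_nat)
  also have "\<dots> = real (card ?S) / y" by simp
  also have "\<dots> \<le> sqrt y / y"
  proof (rule divide_right_mono)
    have "?S \<subseteq> {1..w}" by (auto simp: in_primes_upto Suc_le_eq prime_gt_0_nat)
    hence "card ?S \<le> w" using card_mono[of "{1..w}" ?S] by simp
    thus "real (card ?S) \<le> sqrt y" using w1 by linarith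
  qed (use y in simp)
  also have "\<dots> = sqrt y / (sqrt y * sqrt y)" using y by simp
  also have "\<dots> = 1 / sqrt y" using s1 by (simp only: nonzero_divide_mult_cancel_left)
  finally have sm: "(\<Sum>p\<in>?S. 1 / real p ^ J p) \<le> 1 / sqrt y" .
  have "(\<Sum>p\<in>?T. 1 / real p ^ J p) \<le> (\<Sum>p\<in>?T. 1 / (real p)\<^sup>2)"
  proof (intro sum_mono divide_left_mono)
    fix p assume p: "p \<in> ?T"
    hence "prime p" by (simp add: in_primes_upto)
    hence p1: "real p \<ge> 1" using prime_ge_1_nat by simp
    show "(real p)\<^sup>2 \<le> real p ^ J p" using p1 J2 p by (intro power_increasing) auto
    show "0 < real p ^ J p * (real p)\<^sup>2" using p1 by simp
  qed simp
  also have "\<dots> \<le> 1 / real w" using w1(4) by (intro sum_inverse_squares_tail) auto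
  also have "\<dots> \<le> 1 / (sqrt y / 2)" using wh s1 w1 by (intro divide_left_mono) auto
  finally have lg: "(\<Sum>p\<in>?T. 1 / real p ^ J p) \<le> 2 / sqrt y" by simp
  have "(\<Sum>p\<in>primes_upto y. 1 / real p ^ J p) = (\<Sum>p\<in>?S. 1 / real p ^ J p) + (\<Sum>p\<in>?T. 1 / real p ^ J p)"
    by (rule sum.Int_Diff) simp
  hence sum: "(\<Sum>p\<in>primes_upto y. 1 / real p ^ J p) \<le> 3 / sqrt y" using sm lg by (simp add: add_divide_distrib[symmetric])
  have "card E \<le> card (\<Union>p\<in>primes_upto y. A p)" using sub finN by (intro card_mono) (auto simp: A_def)
  also have "\<dots> \<le> (\<Sum>p\<in>primes_upto y. card (A p))" by (rule card_UN_le) simp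
  finally have "real (card E) \<le> (\<Sum>p\<in>primes_upto y. real (card (A p)))" by (simp flip: of_nat_sum)
  also have "\<dots> \<le> (\<Sum>p\<in>primes_upto y. C * x * (1 / real p ^ J p) + C)" by (rule sum_mono[OF Ap])
  also have "\<dots> = C * x * (\<Sum>p\<in>primes_upto y. 1 / real p ^ J p) + C * real (card (primes_upto y))"
    by (simp only: sum.distrib sum_distrib_left sum_constant mult.commute)
  also have "\<dots> \<le> C * x * (3 / sqrt y) + C * real (card (primes_upto y))"
    using sum C(1) x by (intro add_right_mono mult_left_mono) auto
  finally show ?thesis by (simp add: mult_ac)
qed

text \<open>Here \<open>l\<close> and \<open>s\<close> stand for \<open>ln (ln x)\<close> and
  \<open>sqrt (ln x)\<close>, and every secondary term is shown to be at most a multiple of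
  \<open>1 / l\<close> of the main one. The factors 128 and 9 are generous: three factors
  \<open>1 + \<delta>\<close> and one summand \<open>\<delta>\<close> have to fit below
  \<open>1 + 9 * \<delta>\<close>.\<close>

lemma error_terms:
  fixes g C x y Y s l b1 b2 b3 b4 :: real
  assumes C: "C \<ge> 1" and g: "g \<ge> 1" and x: "x > 0" and y: "y \<ge> 0" "y ^ Suc j \<le> x"
    and l: "l \<ge> 128 * C\<^sup>2" and sl: "s \<ge> l" and j: "real j \<le> s / l" and Y: "Y \<ge> s * l"
    and lnY: "l / 2 \<le> ln Y" "ln Y \<le> l"
    and b0: "b1 \<ge> 0" "b2 \<ge> 0" "b3 \<ge> 0" "b4 \<ge> 0"
    and b1: "b1 \<le> g * Y + C * ln Y" and b2: "b2 \<le> g * (Y / 2) + C * ln Y"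
    and b3: "b3 \<le> g * (Y / 2) + C * (Y / ln Y)" and b4: "b4 \<le> g * (Y\<^sup>2 / 8) + C * (Y\<^sup>2 / ln Y)"
  defines "M \<equiv> x * (g * Y) ^ Suc j" and "\<delta> \<equiv> 128 * C\<^sup>2 / l"
  shows "x * b3 * b1 ^ j + (6 * C * y) ^ Suc j \<le> (1 + 9 * \<delta>) * M / 2"
    "x * (b2\<^sup>2 + b4) * b1 ^ j + 48 * C\<^sup>2 * y * (6 * C * y) ^ j \<le> 2 * M * Y * ((2 * g + 1) / 16) * (1 + 9 * \<delta>)"
proof -
  have C2: "C \<le> C\<^sup>2" "C\<^sup>2 \<ge> 1" using C by (auto simp: power2_eq_square intro: order.trans[OF C])
  have l1: "l \<ge> 128" using l C2 by linarith
  have l0: "l > 0" using l1 by simp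
  have lC: "l \<ge> 128 * C" using l C2 by linarith
  have s0: "s > 0" using sl l0 by simp
  have "l * l \<le> s * l" using sl l0 by (intro mult_right_mono) auto
  hence Yll: "Y \<ge> l * l" using Y by simp
  moreover have "l * 1 \<le> l * l" using l1 by (intro mult_left_mono) auto
  ultimately have Yl: "Y \<ge> l" by simp
  have Y0: "Y > 0" using Yl l0 by simp
  have gY: "g * Y \<ge> Y" using g Y0 by simp
  have gY0: "g * Y > 0" using gY Y0 by simp
  have lY0: "ln Y > 0" using lnY(1) l0 by linarith
  have d0: "\<delta> \<ge> 0" using l0 by (simp add: \<delta>_def)
  have d1: "\<delta> \<le> 1" using l l0 by (simp add: \<delta>_def field_simps)
  have dl: "\<delta> * l = 128 * C\<^sup>2" using l0 by (simp add: \<delta>_def)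
  have dY: "\<delta> * Y \<ge> 128 * C\<^sup>2 * l"
  proof -
    have "\<delta> * (l * l) \<le> \<delta> * Y" using Yll d0 by (intro mult_left_mono)
    thus ?thesis using dl by (simp add: mult.assoc[symmetric])
  qed
  have dgY: "\<delta> * (g * Y) \<ge> 128 * C\<^sup>2 * l" using dY mult_left_mono[OF gY d0] by linarith
  have YlnY: "Y / ln Y \<le> 2 * Y / l"
  proof -
    have "Y / ln Y \<le> Y / (l / 2)" using lnY lY0 l0 Y0 by (intro divide_left_mono) auto
    thus ?thesis by (simp add: mult.commute)
  qed
  have CYl: "C * (Y / l) \<le> \<delta> * (g * Y) / 128"
  proof -
    have "C * (Y / l) \<le> C\<^sup>2 * (g * Y / l)" using C2 gY Y0 l0 C by (intro mult_mono divide_right_mono) auto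
    thus ?thesis by (simp add: \<delta>_def)
  qed
  have CYlnY: "C * (Y / ln Y) \<le> \<delta> * (g * Y) / 64"
  proof -
    have "C * (Y / ln Y) \<le> C * (2 * Y / l)" using YlnY C by (intro mult_left_mono) auto
    also have "\<dots> = 2 * (C * (Y / l))" by simp
    finally show ?thesis using CYl by linarith
  qed
  have "C * ln Y \<le> C\<^sup>2 * l" using C2 lnY lY0 by (intro mult_mono) auto
  hence ClnY: "C * ln Y \<le> \<delta> * (g * Y) / 128" using dgY by linarith
  have a3: "b3 \<le> (g * Y / 2) * (1 + \<delta>)" and a2: "b2 \<le> (g * Y / 2) * (1 + \<delta>)"
  proof -
    have "(g * Y / 2) * (1 + \<delta>) = g * (Y / 2) + \<delta> * (g * Y) / 2" by (simp add: algebra_simps)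
    moreover have "\<delta> * (g * Y) \<ge> 0" using d0 gY0 by simp
    ultimately show "b3 \<le> (g * Y / 2) * (1 + \<delta>)" "b2 \<le> (g * Y / 2) * (1 + \<delta>)"
      using b3 b2 CYlnY ClnY by linarith+
  qed
  have "C * (Y\<^sup>2 / ln Y) = (C * (Y / ln Y)) * Y" by (simp add: power2_eq_square)
  also have "\<dots> \<le> (\<delta> * (g * Y) / 64) * Y" using CYlnY Y0 by (intro mult_right_mono) auto
  also have "\<dots> \<le> (\<delta> * (g * Y) / 8) * Y" using d0 gY0 Y0 by (intro mult_right_mono divide_left_mono) auto
  finally have "C * (Y\<^sup>2 / ln Y) \<le> (\<delta> * (g * Y) / 8) * Y" .
  moreover have "(g * Y\<^sup>2 / 8) * (1 + \<delta>) = g * (Y\<^sup>2 / 8) + (\<delta> * (g * Y) / 8) * Y"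
    by (simp add: algebra_simps power2_eq_square)
  ultimately have "b4 \<le> (g * Y\<^sup>2 / 8) * (1 + \<delta>)" using b4 by linarith
  also have "\<dots> \<le> (g * Y\<^sup>2 / 8) * (1 + \<delta>)\<^sup>2"
    using d0 g self_le_power[of "1 + \<delta>" 2] by (intro mult_left_mono) auto
  finally have a4: "b4 \<le> (g * Y\<^sup>2 / 8) * (1 + \<delta>)\<^sup>2" .
  \<comment> \<open>Here the range of \<open>u\<close> is used: the relative error of
    \<open>b1\<close> is at most \<open>C / s\<close>, and raising to a power
    \<open>j \<le> s / l\<close> keeps it of order \<open>C / l\<close>.\<close>
  have a1: "b1 ^ j \<le> (g * Y) ^ j * (1 + \<delta>)"
  proof -
    have "C * ln Y \<le> C * l" using lnY C by (intro mult_left_mono) auto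
    also have "\<dots> \<le> C * (Y / s)" using Y s0 C by (intro mult_left_mono) (auto simp: field_simps)
    also have "\<dots> \<le> C * (g * Y / s)" using gY s0 C by (intro mult_left_mono divide_right_mono) auto
    finally have "b1 \<le> (g * Y) * (1 + C / s)" using b1 by (simp add: algebra_simps)
    also have "\<dots> \<le> (g * Y) * exp (C / s)" using gY0 by (intro mult_left_mono exp_ge_add_one_self) auto
    finally have "b1 ^ j \<le> ((g * Y) * exp (C / s)) ^ j" using b0 by (intro power_mono) auto
    also have "\<dots> = (g * Y) ^ j * exp (real j * (C / s))" by (simp only: power_mult_distrib exp_of_nat_mult)
    also have "\<dots> \<le> (g * Y) ^ j * (1 + \<delta>)"
    proof (rule mult_left_mono)
      have "real j * (C / s) \<le> (s / l) * (C / s)" using j C s0 by (intro mult_right_mono) auto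
      also have "\<dots> = C / l" using s0 by simp
      finally have "exp (real j * (C / s)) \<le> exp (C / l)" by simp
      also have "\<dots> \<le> 1 + C / l + (C / l)\<^sup>2" using C lC l0 by (intro exp_bound) auto
      also have "(C / l)\<^sup>2 \<le> C / l * 1" unfolding power2_eq_square using C lC l0 by (intro mult_left_mono) auto
      also have "1 + C / l + C / l * 1 \<le> 1 + \<delta>"
      proof -
        have "C / l + C / l = (2 * C) / l" by simp
        also have "\<dots> \<le> \<delta>" unfolding \<delta>_def using C C2 l0 by (intro divide_right_mono) auto
        finally show ?thesis by simp
      qed
      finally show "exp (real j * (C / s)) \<le> 1 + \<delta>" by simp
    qed (use gY0 in simp)
    finally show ?thesis .
  qed
  have M0: "M > 0" using x gY0 by (simp add: M_def)
  have C6: "6 * C \<le> g * Y" using lC Yl gY l1 C by linarith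
  \<comment> \<open>The assumption \<open>y ^ Suc j \<le> x\<close> keeps the rounding errors below
    the main term, with a factor \<open>g * Y\<close> to spare.\<close>
  have yk: "(6 * C * y) ^ Suc j \<le> 6 * C * (x * (g * Y) ^ j)"
  proof -
    have "(6 * C * y) ^ Suc j = 6 * C * ((6 * C) ^ j * y ^ Suc j)" by (simp add: power_mult_distrib)
    also have "\<dots> \<le> 6 * C * ((g * Y) ^ j * x)"
      using C C6 y gY0 power_mono[of "6 * C" "g * Y" j] by (intro mult_left_mono mult_mono[of "(6 * C) ^ j"]) auto
    finally show ?thesis by (simp add: mult_ac)
  qed
  define Q where "Q = x * (g * Y) ^ j"
  have Q0: "Q > 0" using x gY0 by (simp add: Q_def)
  have MQ: "M = Q * (g * Y)" by (simp add: M_def Q_def)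
  have dM: "\<delta> * M \<ge> 128 * (C\<^sup>2 * Q)"
  proof -
    have "128 * C\<^sup>2 * 1 \<le> 128 * C\<^sup>2 * l" using l1 by (intro mult_left_mono) auto
    hence "Q * (128 * C\<^sup>2) \<le> Q * (\<delta> * (g * Y))" using dgY Q0 by (intro mult_left_mono) auto
    thus ?thesis by (simp add: MQ mult_ac)
  qed
  have CQ0: "0 \<le> C\<^sup>2 * Q" using Q0 by simp
  have CQ: "C * Q \<le> C\<^sup>2 * Q" using C2 Q0 by (intro mult_right_mono) auto
  have a5: "(6 * C * y) ^ Suc j \<le> \<delta> * M / 2"
  proof -
    have "6 * C * (x * (g * Y) ^ j) = 6 * (C * Q)" by (simp add: Q_def)
    thus ?thesis using yk dM CQ CQ0 by linarith
  qed
  have "x * b3 * b1 ^ j \<le> x * ((g * Y / 2) * (1 + \<delta>)) * ((g * Y) ^ j * (1 + \<delta>))"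
    using x a3 a1 b0 d0 gY0 by (intro mult_mono mult_left_mono) auto
  also have "\<dots> = M / 2 * (1 + \<delta>)\<^sup>2" by (simp add: M_def power2_eq_square)
  finally have "x * b3 * b1 ^ j + (6 * C * y) ^ Suc j \<le> M / 2 * ((1 + \<delta>)\<^sup>2 + \<delta>)"
    using a5 by (simp add: algebra_simps)
  also have "\<dots> \<le> M / 2 * (1 + 9 * \<delta>)"
  proof (rule mult_left_mono)
    have "\<delta> * \<delta> \<le> \<delta> * 1" using d0 d1 by (intro mult_left_mono)
    thus "(1 + \<delta>)\<^sup>2 + \<delta> \<le> 1 + 9 * \<delta>" using d0 by (simp add: power2_eq_square algebra_simps)
  qed (use M0 in simp)
  finally show "x * b3 * b1 ^ j + (6 * C * y) ^ Suc j \<le> (1 + 9 * \<delta>) * M / 2" by (simp add: mult_ac)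
  define R where "R = M * Y * ((2 * g + 1) / 8)"
  have R0: "R > 0" using M0 Y0 g by (simp add: R_def)
  have MR: "3 * M \<le> R"
  proof -
    have "M * 8 * (3 / 8) \<le> M * Y * ((2 * g + 1) / 8)" using M0 Y0 Yl l1 g by (intro mult_mono) auto
    thus ?thesis by (simp add: R_def)
  qed
  have a6: "48 * C\<^sup>2 * y * (6 * C * y) ^ j \<le> \<delta> * R"
  proof -
    have "48 * C\<^sup>2 * y * (6 * C * y) ^ j = 8 * C * (6 * C * y) ^ Suc j" by (simp add: power2_eq_square)
    also have "\<dots> \<le> 8 * C * (6 * C * Q)" using yk C by (intro mult_left_mono) (auto simp: Q_def)
    also have "\<dots> = 48 * (C\<^sup>2 * Q)" by (simp add: power2_eq_square)
    also have "\<dots> \<le> \<delta> * M" using dM CQ0 by linarith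
    also have "\<dots> \<le> \<delta> * R" using MR M0 d0 by (intro mult_left_mono) auto
    finally show ?thesis .
  qed
  have "b2\<^sup>2 \<le> ((g * Y / 2) * (1 + \<delta>))\<^sup>2" using a2 b0 by (intro power_mono) auto
  \<comment> \<open>The two parts of the second moment, from different and from equal primes, add up
    to the factor \<open>2 * g + 1\<close>.\<close>
  hence "b2\<^sup>2 + b4 \<le> (g * Y\<^sup>2 * (2 * g + 1) / 8) * (1 + \<delta>)\<^sup>2"
    using a4 by (simp add: power2_eq_square field_simps)
  hence "x * (b2\<^sup>2 + b4) * b1 ^ j \<le> x * ((g * Y\<^sup>2 * (2 * g + 1) / 8) * (1 + \<delta>)\<^sup>2) * ((g * Y) ^ j * (1 + \<delta>))"
    using x a1 b0 d0 g Y0 by (intro mult_mono mult_left_mono) auto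
  also have "\<dots> = R * (1 + \<delta>) ^ 3" by (simp add: R_def M_def power2_eq_square power3_eq_cube)
  finally have "x * (b2\<^sup>2 + b4) * b1 ^ j + 48 * C\<^sup>2 * y * (6 * C * y) ^ j \<le> R * ((1 + \<delta>) ^ 3 + \<delta>)"
    using a6 by (simp add: distrib_left mult.commute)
  also have "\<dots> \<le> R * (1 + 9 * \<delta>)"
  proof (rule mult_left_mono)
    have "\<delta> * \<delta> \<le> \<delta> * 1" using d0 d1 by (intro mult_left_mono)
    moreover have "\<delta> * \<delta> * \<delta> \<le> \<delta> * \<delta> * 1" using d0 d1 by (intro mult_left_mono) auto
    ultimately show "(1 + \<delta>) ^ 3 + \<delta> \<le> 1 + 9 * \<delta>" using d0 by (simp add: power3_eq_cube algebra_simps)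
  qed (use R0 in simp)
  finally show "x * (b2\<^sup>2 + b4) * b1 ^ j + 48 * C\<^sup>2 * y * (6 * C * y) ^ j \<le> 2 * M * Y * ((2 * g + 1) / 16) * (1 + 9 * \<delta>)"
    by (simp add: R_def)
qed

section \<open>Degenerate cases and the scale of the parameters\<close>

lemma P_plus_le_D:
  assumes "P_plus m \<le> ereal y"
  shows "m \<noteq> 0" "prime (p :: nat) \<Longrightarrow> int p dvd m \<Longrightarrow> real p \<le> y"
proof -
  show m: "m \<noteq> 0" using assms by (auto simp: P_plus_def)
  assume p: "prime p" "int p dvd m"
  have m1: "\<bar>m\<bar> \<noteq> 1"
  proof
    assume "\<bar>m\<bar> = 1"
    hence "int p dvd 1" using p(2) by (metis dvd_abs_iff)
    thus False using p(1) by (auto simp: prime_nat_iff)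
  qed
  have "int p \<in> prime_factors m" using p m by (simp add: in_prime_factors_iff)
  hence "int p \<le> Max (prime_factors m)" by (intro Max_ge) auto
  moreover have "real_of_int (Max (prime_factors m)) \<le> y" using assms m m1 by (simp add: P_plus_def)
  ultimately show "real p \<le> y" by linarith
qed

lemma S1_nonneg: "S \<subseteq> PP y \<Longrightarrow> S1 h S \<ge> 0"
  unfolding S1_def by (intro sum_nonneg) (auto simp: PP_def)

lemma Sq_nonneg: "S \<subseteq> PP y \<Longrightarrow> Sq h S \<ge> 0"
  unfolding Sq_def by (intro sum_nonneg) (auto simp: PP_def)

lemma irreducible_monic_linear_int: "irreducible [:a, 1 :: int:]"
proof (rule irreducibleI)
  show "[:a, 1:] \<noteq> 0" by simp
  show "\<not> is_unit [:a, 1 :: int:]" by (auto simp: is_unit_poly_iff)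
  fix p q assume e: "[:a, 1 :: int:] = p * q"
  have const: "is_unit r" if "degree r = 0" "[:a, 1 :: int:] = r * t" for r t
  proof -
    from that(1) obtain c where r: "r = [:c:]" by (rule degree_eq_zeroE)
    have "coeff [:a, 1 :: int:] 1 = c * coeff t 1" unfolding that(2) r by simp
    hence "c * coeff t 1 = 1" by simp
    hence "c dvd 1" by (metis dvd_triv_left)
    thus ?thesis unfolding r by (auto simp: is_unit_poly_iff)
  qed
  have "p \<noteq> 0" "q \<noteq> 0" using e by auto
  hence "degree p + degree q = 1" using e degree_mult_eq[of p q] by (metis degree_pCons_eq_if one_pCons degree_1 one_neq_zero add.commute plus_1_eq_Suc add_0)
  hence "degree p = 0 \<or> degree q = 0" by linarith
  thus "is_unit p \<or> is_unit q" using const[OF _ e] const[of q p] e by (auto simp: mult.commute)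
qed

text \<open>Every \<open>t + a\<close> divides 0, so the index set is infinite and the sum over it
  is 0 by convention.\<close>

lemma total_degree_zero: "total_degree 0 = 0"
proof -
  have n: "normalize [:a, 1 :: int:] = [:a, 1:]" for a by (simp add: normalize_poly_def one_pCons[symmetric])
  have "range (\<lambda>a. [:a, 1 :: int:]) \<subseteq> irred_factors 0"
    using irreducible_monic_linear_int n by (auto simp: irred_factors_def)
  moreover have "infinite (range (\<lambda>a. [:a, 1 :: int:]))"
    using finite_image_iff[of "\<lambda>a. [:a, 1 :: int:]" UNIV] by (simp add: inj_on_def infinite_UNIV_int)
  ultimately have "infinite (irred_factors 0)" using finite_subset by blast
  thus ?thesis by (simp add: total_degree_def)
qed

text \<open>The bound on \<open>u\<close> says \<open>u * l \<le> s\<close>, so that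
  \<open>Y = ln y\<close> never falls below \<open>s * l\<close> and its logarithm is comparable to
  \<open>l\<close>.\<close>

lemma scale_facts:
  fixes x K u :: real
  assumes K: "K \<ge> 9" and x: "x \<ge> exp (exp K)" and u: "1 \<le> u" "u \<le> sqrt (ln x) / ln (ln x)"
  defines "L \<equiv> ln x" and "l \<equiv> ln (ln x)" and "s \<equiv> sqrt (ln x)" and "Y \<equiv> ln x / u"
  shows "x > 0" "l \<ge> K" "s \<ge> l" "L = s * s" "ln s = l / 2" "u * l \<le> s" "Y \<ge> s * l" "Y \<le> L"
    "l / 2 \<le> ln Y" "ln Y \<le> l" "u * Y = L" "x = exp L"
proof -
  show x0: "x > 0" using less_le_trans[OF exp_gt_zero x] .
  show xL: "x = exp L" using x0 by (simp add: L_def)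
  have "ln (exp (exp K)) \<le> ln x" using x by (intro ln_mono) auto
  hence LK: "L \<ge> exp K" by (simp add: L_def)
  have L0: "L > 0" using less_le_trans[OF exp_gt_zero LK] .
  have "ln (exp K) \<le> ln L" using LK by (intro ln_mono) auto
  thus lK: "l \<ge> K" by (simp add: l_def L_def)
  have l0: "l > 0" using lK K by linarith
  show Ls: "L = s * s" using L0 by (simp add: s_def L_def)
  have s0: "s > 0" using L0 by (simp add: s_def L_def)
  show lns: "ln s = l / 2" using L0 by (simp add: s_def l_def L_def ln_sqrt)
  show sl: "s \<ge> l"
  proof -
    have "ln (s / 2) \<le> s / 2 - 1" using s0 by (intro ln_le_minus_one) auto
    moreover have "ln (s / 2) = ln s - ln 2" using s0 by (simp add: ln_div)
    moreover have "ln (2 :: real) \<le> 2 - 1" by (rule ln_le_minus_one) simp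
    ultimately show ?thesis using lns by linarith
  qed
  have "u \<le> s / l" using u(2) by (simp only: s_def l_def)
  thus ul: "u * l \<le> s" using l0 by (simp add: pos_le_divide_eq)
  have Yu: "Y = L / u" by (simp add: Y_def L_def)
  show uY: "u * Y = L" using u by (simp add: Yu)
  show YL: "Y \<le> L" using u L0 by (simp add: Yu divide_le_eq)
  have "u * l * s \<le> s * s" using ul s0 by (intro mult_right_mono) auto
  hence "s * l * u \<le> L" by (simp add: Ls mult_ac)
  thus Ysl: "Y \<ge> s * l" using u unfolding Yu by (simp add: pos_le_divide_eq)
  have "s * 1 \<le> s * l" using s0 lK K by (intro mult_left_mono) auto
  hence Ys: "Y \<ge> s" using Ysl by simp
  have "ln s \<le> ln Y" using Ys s0 by (intro ln_mono) auto
  thus "l / 2 \<le> ln Y" using lns by simp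
  have "ln Y \<le> ln L" using YL Ys s0 by (intro ln_mono) auto
  thus "ln Y \<le> l" by (simp add: l_def L_def)
qed

text \<open>The factor in front of \<open>x\<close> can be nearly as small as
  \<open>exp (- s)\<close>. This fixes how rare the discarded integers have to be, and thereby the
  cut-off \<open>x * exp (- 2 * s)\<close> of the final proof.\<close>

lemma main_term_lower:
  fixes d g u l s c :: real
  assumes d: "d \<ge> 2" and g: "g \<ge> 1" and u: "real (Suc j) \<le> u" "u \<le> s" and c: "c \<ge> 1 / 2"
    and l: "l \<ge> 2 * ln d" "ln s = l / 2" "real (Suc j) * l \<le> s"
  shows "exp (- s) / 2 \<le> c * (g ^ Suc j / (d * (d - 1) ^ j * u ^ Suc j))"
proof -
  have u1: "u \<ge> 1" using u(1) by simp
  have du: "d * u > 0" using d u1 by simp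
  have G: "d * (d - 1) ^ j * u ^ Suc j > 0" using d u1 by simp
  have "d * (d - 1) ^ j * u ^ Suc j \<le> d * d ^ j * u ^ Suc j"
    using d u1 by (intro mult_right_mono mult_left_mono power_mono) auto
  also have "\<dots> = (d * u) ^ Suc j" by (simp add: power_mult_distrib)
  also have "\<dots> = exp (ln (d * u)) ^ Suc j" using du by (simp only: exp_ln)
  also have "\<dots> = exp (real (Suc j) * ln (d * u))" by (simp only: exp_of_nat_mult)
  also have "\<dots> \<le> exp s"
  proof -
    have "ln u \<le> l / 2" unfolding l(2)[symmetric] using u u1 by (intro ln_mono) auto
    hence "ln (d * u) \<le> l" using d u1 l(1) by (simp add: ln_mult)
    hence "real (Suc j) * ln (d * u) \<le> real (Suc j) * l" by (intro mult_left_mono) auto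
    hence "real (Suc j) * ln (d * u) \<le> s" using l(3) by (rule order.trans)
    thus ?thesis by (simp only: exp_le_cancel_iff)
  qed
  finally have "1 / exp s \<le> 1 / (d * (d - 1) ^ j * u ^ Suc j)" using G by (intro divide_left_mono) auto
  also have "\<dots> \<le> g ^ Suc j / (d * (d - 1) ^ j * u ^ Suc j)" by (intro divide_right_mono less_imp_le[OF G] one_le_power[OF g])
  finally have "1 / 2 * (1 / exp s) \<le> c * (g ^ Suc j / (d * (d - 1) ^ j * u ^ Suc j))"
    using c by (intro mult_mono) auto
  thus ?thesis by (simp add: exp_minus field_simps)
qed

theorem theorem1p1:
  fixes f :: "int poly" and g d :: nat
  assumes "g = num_factors f"
    and "d = total_degree f"
    and "d \<ge> 2"
  shows "\<exists>C > (0::real). \<exists>x\<^sub>0 > exp (1::real).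
    \<forall>x \<ge> x\<^sub>0. \<forall>u::real. 1 \<le> u \<and> u \<le> sqrt (ln x) / ln (ln x) \<longrightarrow>
      real (Psi f x (x powr (1 / u)))
        < gamma_f f u
          * (real g ^ nat \<lfloor>u\<rfloor>
             / (real d * (real d - 1) ^ (nat \<lfloor>u\<rfloor> - 1) * u ^ nat \<lfloor>u\<rfloor>))
          * (x + C * (x / ln (ln x)))"
proof -
  define h where "h = rad f"
  have f0: "f \<noteq> 0" using assms(2,3) total_degree_zero by auto
  have dh: "degree h = d" by (simp add: h_def degree_rad assms(2))
  have h0: "h \<noteq> 0" using dh assms(3) by auto
  have hf: "h dvd f" unfolding h_def by (rule rad_dvd[OF f0])
  have d2: "real d \<ge> 2" using assms(3) by simp
  have "irred_factors f \<noteq> {}" using assms(2,3) by (auto simp: total_degree_def)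
  hence "g > 0" using finite_irred_factors[OF f0] by (simp add: assms(1) num_factors_def card_gt_0_iff)
  hence g1: "real g \<ge> 1" by simp
  obtain C where C1: "C \<ge> 1" and C2: "\<And>p j. prime p \<Longrightarrow> j \<ge> 1 \<Longrightarrow> real (rho h (p ^ j)) \<le> C"
    and S: "\<And>y. y \<ge> exp (exp 2) \<Longrightarrow> S1 h (PP y) \<le> real g * ln y + C * ln (ln y) \<and>
       S1 h (PP (sqrt y)) \<le> real g * (ln y / 2) + C * ln (ln y) \<and>
       S1 h (PP y - PP (sqrt y)) \<le> real g * (ln y / 2) + C * (ln y / ln (ln y)) \<and>
       Sq h (PP (sqrt y)) \<le> real g * ((ln y)\<^sup>2 / 8) + C * ((ln y)\<^sup>2 / ln (ln y))"
    using rad_prime_power_sums[OF f0] unfolding h_def[symmetric] assms(1)[symmetric] by blast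
  obtain n0 where n0: "\<And>n. n \<ge> n0 \<Longrightarrow> n > 0 \<Longrightarrow> poly h n \<noteq> 0 \<and> ln (real_of_int \<bar>poly h n\<bar>) \<ge> real d * ln (real_of_int n) - ln 2"
    using poly_growth_lower[OF h0] unfolding dh by blast
  \<comment> \<open>\<open>K\<close> bounds \<open>ln (ln x)\<close> from below. Its summands ensure
    \<open>e \<le> 1\<close>, \<open>\<eta> < 1\<close>, \<open>\<kappa> \<le> 1 / 2\<close> and
    that the integers kept in \<open>Ns\<close> exceed \<open>n0\<close>.\<close>
  define K where "K = 1152 * C\<^sup>2 + 8 * (2 * real d + 1) + real_of_int \<bar>n0\<bar> + 9"
  \<comment> \<open>The summands are the errors of the final estimate in units of
    \<open>1 / l\<close>: \<open>e\<close>, \<open>4 * \<kappa>\<close>, the integers up to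
    \<open>t\<close>, the two terms for large prime powers, and 1 for strictness.\<close>
  define CC where "CC = 1152 * C\<^sup>2 + 8 * (2 * real d + 1) + 2 + 6 * C + C * (2 + 64 * real d) + 1"
  have CC0: "CC > 0" using C1 d2 by (simp add: CC_def add_nonneg_pos)
  have Kb: "K \<ge> 1152 * C\<^sup>2" "K \<ge> 16 * real d + 8" "K \<ge> real_of_int \<bar>n0\<bar>" "K \<ge> 9"
    using d2 by (auto simp: K_def)
  have "exp (exp K) > exp 1" using Kb(4) by simp
  moreover have "real (Psi f x (x powr (1 / u)))
        < gamma_f f u * (real g ^ nat \<lfloor>u\<rfloor> / (real d * (real d - 1) ^ (nat \<lfloor>u\<rfloor> - 1) * u ^ nat \<lfloor>u\<rfloor>))
          * (x + CC * (x / ln (ln x)))"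
    if x: "x \<ge> exp (exp K)" and u: "1 \<le> u" "u \<le> sqrt (ln x) / ln (ln x)" for x u :: real
  proof -
    define L where "L = ln x"
    define l where "l = ln (ln x)"
    define s where "s = sqrt (ln x)"
    define Y where "Y = ln x / u"
    note sf = scale_facts[OF Kb(4) x u, folded L_def l_def s_def Y_def, folded L_def]
    have l9: "l \<ge> 9" and s9: "s \<ge> 9" and l0: "l > 0" and s0: "s > 0" using sf(2,3) Kb(4) by linarith+
    have sl: "s * 4 \<le> s * l" using s0 l9 by (intro mult_left_mono) auto
    have Y4: "Y \<ge> 4 * s" using sl sf(7) by linarith
    have Y0: "Y > 0" using Y4 s0 by linarith
    define y where "y = x powr (1 / u)"
    have ye: "y = exp Y" using sf(1) by (simp add: y_def powr_def Y_def)
    have lny: "ln y = Y" by (simp add: ye)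
    have y1: "y \<ge> 1" using Y0 by (simp add: ye)
    have sqy: "sqrt y = exp (Y / 2)" unfolding ye by (rule real_sqrt_unique) (simp_all add: power2_eq_square flip: exp_add)
    have "exp (2 :: real) = exp 1 * exp 1" by (simp flip: exp_add)
    also have "\<dots> \<le> 3 * 3" by (intro mult_mono exp_le) auto
    finally have "exp 2 \<le> Y" using Y4 s9 by linarith
    hence yy: "y \<ge> exp (exp 2)" by (simp add: ye)
    \<comment> \<open>\<open>u \<ge> 1\<close> makes the truncated subtraction exact, so that
      \<open>Suc j\<close> is the integer part of \<open>u\<close>.\<close>
    define j where "j = nat \<lfloor>u\<rfloor> - 1"
    have jk: "nat \<lfloor>u\<rfloor> = Suc j" using u(1) by (simp add: j_def le_nat_iff le_floor_iff Suc_diff_Suc)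
    have ju: "real (Suc j) \<le> u" unfolding jk[symmetric] using u(1) by (simp add: of_nat_nat)
    have yk: "y ^ Suc j \<le> x"
    proof -
      have "y ^ Suc j = exp (real (Suc j) * Y)" unfolding ye by (simp only: exp_of_nat_mult)
      also have "\<dots> \<le> exp (u * Y)" using ju Y0 by (simp only: exp_le_cancel_iff) (intro mult_right_mono, auto)
      finally show ?thesis using sf(11,12) by simp
    qed
    \<comment> \<open>Integers below this cut-off are few enough to be discarded; above it
      \<open>ln n\<close> falls short of \<open>ln x\<close> by at most \<open>2 * s\<close>, which
      \<open>X\<close> takes into account.\<close>
    define t where "t = x * exp (- 2 * s)"
    define X where "X = real d * L - 2 * real d * s - ln 2"
    define Q where "Q = {n :: int. 1 \<le> n \<and> real_of_int n \<le> x \<and> P_plus (poly f n) \<le> ereal y}"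
    define Ns where "Ns = {n\<in>Q. t \<le> real_of_int n \<and> (\<forall>p j. prime p \<longrightarrow> j \<ge> 1 \<longrightarrow> int (p ^ j) dvd poly h n \<longrightarrow> real p ^ j \<le> y)}"
    have tL: "t = exp (L - 2 * s)" unfolding t_def sf(12) by (simp flip: exp_add)
    have Lt: "L - 2 * s \<ge> s"
    proof -
      have "s * 3 \<le> s * s" using s9 by (intro mult_left_mono) auto
      thus ?thesis using sf(4) by simp
    qed
    have tn0: "t \<ge> real_of_int n0"
    proof -
      have "real_of_int n0 \<le> s" using Kb(3) sf(2,3) by linarith
      also have "\<dots> \<le> L - 2 * s" by (rule Lt)
      also have "\<dots> \<le> t" unfolding tL using exp_ge_add_one_self[of "L - 2 * s"] by linarith
      finally show ?thesis .
    qed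
    have big: "X \<le> ln (real_of_int \<bar>poly h n\<bar>)" and nz: "poly h n \<noteq> 0" if "n \<in> Ns" for n
    proof -
      have n: "1 \<le> n" "t \<le> real_of_int n" using that by (auto simp: Ns_def Q_def)
      have n': "n \<ge> n0" "n > 0" using n tn0 by linarith+
      show "poly h n \<noteq> 0" using n0[OF n'] by simp
      have "ln t \<le> ln (real_of_int n)" using n(2) by (intro ln_mono) (auto simp: tL)
      hence "L - 2 * s \<le> ln (real_of_int n)" by (simp add: tL)
      hence "real d * (L - 2 * s) \<le> real d * ln (real_of_int n)" by (intro mult_left_mono) auto
      thus "X \<le> ln (real_of_int \<bar>poly h n\<bar>)" using n0[OF n'] by (simp add: X_def algebra_simps)
    qed
    interpret smooth_sieve h x y X Ns
    proof unfold_locales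
      show "x \<ge> 0" using sf(1) by simp
      show "y \<ge> 1" by (rule y1)
    qed (use big nz in \<open>auto simp: Ns_def Q_def\<close>)
    \<comment> \<open>The relative loss in \<open>X\<close>: at most
      \<open>2 * d * s + ln 2\<close>, compared with a main term that is at least
      \<open>ln x = s * s\<close>.\<close>
    define \<eta> where "\<eta> = (2 * real d + 1) / s"
    have \<eta>0: "\<eta> \<ge> 0" using d2 s0 by (simp add: \<eta>_def)
    have \<eta>1: "\<eta> < 1"
    proof -
      have "2 * real d + 1 < s" using sf(2,3) Kb(2) d2 by linarith
      thus ?thesis using s0 by (simp add: \<eta>_def)
    qed
    have XB: "X - real i * Y \<ge> Y * (real d * u - real i) * (1 - \<eta>)" if "i \<le> j" for i
    proof -
      have "real i * Y \<le> u * Y" using that ju Y0 by (intro mult_right_mono) auto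
      hence iY: "real i * Y \<le> L" using sf(11) by simp
      have "2 * L \<le> real d * L" using d2 sf(4) by (intro mult_right_mono) auto
      hence "\<eta> * L \<le> \<eta> * (real d * L - real i * Y)" using iY \<eta>0 by (intro mult_left_mono) auto
      moreover have "\<eta> * L = (2 * real d + 1) * s" using s0 by (simp add: \<eta>_def sf(4))
      moreover have "ln (2 :: real) \<le> 2 - 1" by (rule ln_le_minus_one) simp
      ultimately have "2 * real d * s + ln 2 \<le> \<eta> * (real d * L - real i * Y)" using s9 by (simp add: algebra_simps)
      moreover have "Y * (real d * u - real i) * (1 - \<eta>) = (real d * L - real i * Y) - \<eta> * (real d * L - real i * Y)"
        unfolding sf(11)[symmetric] by (simp add: algebra_simps)
      ultimately show ?thesis by (simp add: X_def)
    qed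
    have XB0: "X - real i * Y \<ge> 0" if "i < j" for i
    proof -
      have "2 * u \<le> real d * u" using d2 u by (intro mult_right_mono) auto
      moreover have "real i < real (Suc j)" using that by simp
      ultimately have "real i \<le> real d * u" using ju u(1) by linarith
      hence "0 \<le> Y * (real d * u - real i) * (1 - \<eta>)" using Y0 \<eta>1 by (intro mult_nonneg_nonneg) auto
      thus ?thesis using XB[of i] that by simp
    qed
    obtain V where V0: "V \<ge> 0" and NV: "real (card Ns) * (\<Prod>i<j. X - real i * Y) \<le> V"
      and VV: "(X - real j * Y) * V \<le> x * S1 h (PP y - PP (sqrt y)) * S1 h (PP y) ^ j + (6 * C * y) ^ Suc j
     + sqrt (V * (x * ((S1 h (PP (sqrt y)))\<^sup>2 + Sq h (PP (sqrt y))) * S1 h (PP y) ^ j + 48 * C\<^sup>2 * y * (6 * C * y) ^ j))"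
      using sieve_bounds[of C j, OF C1 C2] XB0 unfolding lny by blast
    define e where "e = 9 * (128 * C\<^sup>2 / l)"
    have e0: "e \<ge> 0" using l0 by (simp add: e_def)
    have e1: "e \<le> 1" using l0 sf(2) Kb(1) by (simp add: e_def)
    define M where "M = x * (real g * Y) ^ Suc j"
    have jsl: "real (Suc j) * l \<le> s"
    proof -
      have "real (Suc j) * l \<le> u * l" using ju l0 by (intro mult_right_mono) auto
      thus ?thesis using sf(6) by simp
    qed
    have et: "x * S1 h (PP y - PP (sqrt y)) * S1 h (PP y) ^ j + (6 * C * y) ^ Suc j \<le> (1 + e) * M / 2"
      "x * ((S1 h (PP (sqrt y)))\<^sup>2 + Sq h (PP (sqrt y))) * S1 h (PP y) ^ j + 48 * C\<^sup>2 * y * (6 * C * y) ^ j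
        \<le> 2 * M * Y * ((2 * real g + 1) / 16) * (1 + e)"
    proof -
      have jl: "real j \<le> s / l" using jsl l0 by (simp add: pos_le_divide_eq algebra_simps)
      have l128: "l \<ge> 128 * C\<^sup>2" using sf(2) Kb(1) zero_le_power2[of C] by linarith
      note Sy = S[OF yy, unfolded lny]
      have y0: "y \<ge> 0" using y1 by simp
      note E = error_terms[of C "real g" x y j l s Y "S1 h (PP y)" "S1 h (PP (sqrt y))" "S1 h (PP y - PP (sqrt y))" "Sq h (PP (sqrt y))",
        OF C1 g1 sf(1) y0 yk l128 sf(3) jl sf(7) sf(9) sf(10)
          S1_nonneg[OF subset_refl] S1_nonneg[OF subset_refl] S1_nonneg[OF Diff_subset] Sq_nonneg[OF subset_refl]]
      show "x * S1 h (PP y - PP (sqrt y)) * S1 h (PP y) ^ j + (6 * C * y) ^ Suc j \<le> (1 + e) * M / 2"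
        using E(1) Sy unfolding e_def M_def by blast
      show "x * ((S1 h (PP (sqrt y)))\<^sup>2 + Sq h (PP (sqrt y))) * S1 h (PP y) ^ j + 48 * C\<^sup>2 * y * (6 * C * y) ^ j
        \<le> 2 * M * Y * ((2 * real g + 1) / 16) * (1 + e)"
        using E(2) Sy unfolding e_def M_def by blast
    qed
    have "(X - real j * Y) * V \<le> (1 + e) * M / 2 + sqrt (V * (2 * M * Y * ((2 * real g + 1) / 16) * (1 + e)))"
      by (rule order.trans[OF VV add_mono[OF et(1) real_sqrt_le_mono[OF mult_left_mono[OF et(2) V0]]]])
    also have "V * (2 * M * Y * ((2 * real g + 1) / 16) * (1 + e)) = 2 * V * M * Y * ((2 * real g + 1) / 16) * (1 + e)"
      by (simp only: mult_ac)
    finally have main: "(X - real j * Y) * V \<le> (1 + e) * M / 2 + sqrt (2 * V * M * Y * ((2 * real g + 1) / 16) * (1 + e))" .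
    define G where "G = gamma_f f u * (real g ^ Suc j / (real d * (real d - 1) ^ j * u ^ Suc j))"
    have gg: "gamma_f f u = gam ((2 * real g + 1) / (16 * real d * u))"
      by (simp add: gamma_f_def gam_def Let_def assms(1,2))
    have gh: "gamma_f f u \<ge> 1 / 2" unfolding gg using u by (intro gam_ge_half) auto
    have g0: "real g > 0" using g1 by linarith
    have Nb: "real (card Ns) * (1 - \<eta>) ^ (j + 2) \<le> (1 + e) * x * G"
      unfolding G_def gg
      by (rule sieve_conclude[OF d2 g0 ju Y0 sf(1) e0 \<eta>0 \<eta>1 V0 _ NV XB main[unfolded M_def]]) auto
    have us: "u \<le> s"
    proof -
      have "u * 1 \<le> u * l" using l9 u by (intro mult_left_mono) auto
      thus ?thesis using sf(6) by simp
    qed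
    have Glow: "exp (- s) / 2 \<le> G" unfolding G_def
    proof (rule main_term_lower[OF d2 g1 ju us gh _ sf(5) jsl])
      have "ln (real d) \<le> real d - 1" using d2 by (intro ln_le_minus_one) auto
      thus "2 * ln (real d) \<le> l" using sf(2) Kb(2) by linarith
    qed
    have G0: "G > 0" using Glow less_le_trans[of 0 "exp (- s) / 2" G] by simp
    \<comment> \<open>By Bernoulli's inequality the \<open>j + 2\<close> factors
      \<open>1 - \<eta>\<close> lose at most \<open>(j + 2) * \<eta>\<close>, and
      \<open>j + 2 \<le> 2 * s / l\<close>.\<close>
    define \<kappa> where "\<kappa> = 2 * (2 * real d + 1) / l"
    have \<kappa>0: "\<kappa> \<ge> 0" using l0 by (simp add: \<kappa>_def)
    have \<kappa>1: "\<kappa> \<le> 1 / 2" using l0 sf(2) Kb(2) by (simp add: \<kappa>_def field_simps)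
    have "1 - \<kappa> \<le> 1 + real (j + 2) * (- \<eta>)"
    proof -
      have "real (j + 2) * l \<le> 2 * (real (Suc j) * l)" using l0 by (simp add: algebra_simps)
      also have "\<dots> \<le> 2 * s" using jsl by simp
      finally have "real (j + 2) \<le> 2 * s / l" using l0 by (simp add: pos_le_divide_eq)
      hence "real (j + 2) * \<eta> \<le> 2 * s / l * \<eta>" using \<eta>0 by (intro mult_right_mono)
      also have "\<dots> = \<kappa>" using s0 by (simp add: \<eta>_def \<kappa>_def)
      finally show ?thesis by simp
    qed
    also have "\<dots> \<le> (1 + (- \<eta>)) ^ (j + 2)" using \<eta>1 by (intro Bernoulli_inequality) auto
    finally have "real (card Ns) * (1 - \<kappa>) \<le> real (card Ns) * (1 - \<eta>) ^ (j + 2)" by (intro mult_left_mono) auto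
    also note Nb
    finally have Nk: "real (card Ns) * (1 - \<kappa>) \<le> (1 + e) * x * G" .
    have GX: "G * x > 0" using G0 sf(1) by simp
    have Nfin: "real (card Ns) \<le> G * x * (1 + e + 4 * \<kappa>)"
    proof -
      have "1 \<le> (1 - \<kappa>) * (1 + 2 * \<kappa>)" using \<kappa>0 \<kappa>1 mult_left_mono[OF \<kappa>1 \<kappa>0] by (simp add: algebra_simps)
      hence "real (card Ns) * 1 \<le> real (card Ns) * ((1 - \<kappa>) * (1 + 2 * \<kappa>))" by (intro mult_left_mono) auto
      also have "\<dots> = real (card Ns) * (1 - \<kappa>) * (1 + 2 * \<kappa>)" by simp
      also have "\<dots> \<le> (1 + e) * x * G * (1 + 2 * \<kappa>)" using Nk \<kappa>0 by (intro mult_right_mono) auto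
      also have "\<dots> = G * x * ((1 + e) * (1 + 2 * \<kappa>))" by (simp only: mult_ac)
      also have "\<dots> \<le> G * x * (1 + e + 4 * \<kappa>)"
        using GX e0 \<kappa>0 mult_right_mono[OF e1 \<kappa>0] by (intro mult_left_mono) (auto simp: algebra_simps)
      finally show ?thesis by simp
    qed
    define E2 where "E2 = {n. 1 \<le> n \<and> real_of_int n \<le> x \<and>
     (\<exists>p j. prime p \<and> real p \<le> y \<and> int (p ^ j) dvd poly h n \<and> real p ^ j > y)}"
    have finx: "finite {n :: int. 1 \<le> n \<and> real_of_int n \<le> z}" for z :: real
      by (rule finite_subset[of _ "{1..\<lfloor>z\<rfloor>}"]) (auto simp: le_floor_iff)
    let ?E1 = "{1..\<lfloor>t\<rfloor>}"
    have "Q \<subseteq> Ns \<union> ?E1 \<union> E2"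
    proof
      fix n assume n: "n \<in> Q"
      have pn: "P_plus (poly f n) \<le> ereal y" using n by (simp add: Q_def)
      show "n \<in> Ns \<union> ?E1 \<union> E2"
      proof (rule ccontr)
        assume a: "n \<notin> Ns \<union> ?E1 \<union> E2"
        have "t \<le> real_of_int n" using a n by (auto simp: Q_def le_floor_iff)
        then obtain p i where p: "prime p" "i \<ge> 1" "int (p ^ i) dvd poly h n" "\<not> real p ^ i \<le> y"
          using a n by (auto simp: Ns_def)
        have "p dvd p ^ i" using p(2) by (cases i) auto
        hence "int p dvd int (p ^ i)" by (simp only: int_dvd_int_iff)
        also note p(3)
        also have "poly h n dvd poly f n" using hf by (metis dvdE dvd_triv_left poly_mult)
        finally have "real p \<le> y" using P_plus_le_D(2)[OF pn p(1)] by blast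
        hence "n \<in> E2" using n p by (auto simp: E2_def Q_def not_le)
        thus False using a by simp
      qed
    qed
    hence "card Q \<le> card (Ns \<union> ?E1 \<union> E2)"
      using finite_Ns finx[of x] by (intro card_mono) (auto simp: E2_def intro: finite_subset[OF _ finx[of x]])
    also have "\<dots> \<le> card Ns + card ?E1 + card E2"
      using card_Un_le[of "Ns \<union> ?E1" E2] card_Un_le[of Ns ?E1] by linarith
    finally have Q3: "real (card Q) \<le> real (card Ns) + real (card ?E1) + real (card E2)" by linarith
    have t0: "t > 0" by (simp add: tL)
    have E1: "real (card ?E1) \<le> t" using t0 by simp
    have E2: "real (card E2) \<le> 3 * C * x / sqrt y + C * real (card (primes_upto y))"
      unfolding E2_def using C1 sf(1) y1 by (intro large_prime_power_exceptions C2) auto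
    have exs: "exp (- s) \<le> 1 / l"
    proof -
      have "l \<le> exp s" using sf(3) exp_ge_add_one_self[of s] by linarith
      hence "1 / exp s \<le> 1 / l" using l0 by (intro divide_left_mono) auto
      thus ?thesis by (simp add: exp_minus field_simps)
    qed
    have tG: "t \<le> 2 * (G * x / l)"
    proof -
      have "t = x * (exp (- s) * exp (- s))" by (simp add: t_def flip: exp_add)
      also have "\<dots> \<le> x * ((2 * G) * (1 / l))" using sf(1) Glow exs G0 by (intro mult_left_mono mult_mono) auto
      finally show ?thesis by (simp add: mult_ac)
    qed
    have "x / sqrt y \<le> t"
    proof -
      have "x / sqrt y = x * exp (- (Y / 2))" by (simp add: sqy exp_minus field_simps)
      also have "\<dots> \<le> x * exp (- 2 * s)" using Y4 sf(1) by (intro mult_left_mono) auto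
      finally show ?thesis by (simp add: t_def)
    qed
    hence "3 * C * (x / sqrt y) \<le> 3 * C * (2 * (G * x / l))" using tG C1 by (intro mult_left_mono) auto
    hence sq: "3 * C * x / sqrt y \<le> 6 * C * (G * x / l)" by simp
    have hL: "exp (L / 2) \<le> t"
    proof -
      have "s * 4 \<le> s * s" using s9 by (intro mult_left_mono) auto
      thus ?thesis using sf(4) by (simp add: tL)
    qed
    \<comment> \<open>If \<open>u \<ge> 2\<close>, then \<open>y \<le> sqrt x\<close> and the
      trivial bound suffices. For \<open>u < 2\<close> the number \<open>y\<close> may be as large
      as \<open>x\<close>, so the logarithm saved by Chebyshev's bound is needed, while
      \<open>G\<close> is bounded below by a constant.\<close>
    have pi: "real (card (primes_upto y)) \<le> (2 + 64 * real d) * (G * x / l)"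
    proof (cases "u \<ge> 2")
      case True
      have "Y * 2 \<le> Y * u" using True Y0 by (intro mult_left_mono) auto
      hence "Y \<le> L / 2" using sf(11) by (simp add: mult.commute)
      hence "exp Y \<le> exp (L / 2)" by simp
      hence "y \<le> t" using hL unfolding ye by linarith
      hence "real (card (primes_upto y)) \<le> 2 * (G * x / l)"
        using card_primes_upto_le_self[of y] y1 tG by linarith
      also have "\<dots> \<le> (2 + 64 * real d) * (G * x / l)" using GX l0 by (intro mult_right_mono) auto
      finally show ?thesis .
    next
      case False
      have "\<lfloor>u\<rfloor> = 1" using u(1) False by (intro floor_unique) auto
      hence j0: "j = 0" by (simp add: j_def)
      have "1 / 2 * (1 / (real d * 2)) \<le> gamma_f f u * (real g / (real d * u))"
        using False gh g1 u d2 by (intro mult_mono frac_le) auto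
      hence G4: "1 \<le> 4 * real d * G" using d2 by (simp add: G_def j0 field_simps)
      have Lu: "Y \<ge> L / 2" using sf(11) False Y0 mult_left_mono[of u 2 Y] by (simp add: mult.commute)
      have yx: "y \<le> x" using sf(8,12) by (simp add: ye)
      have L0: "L > 0" using s0 by (simp add: sf(4))
      have "s * 1 \<le> s * s" using s9 by (intro mult_left_mono) auto
      hence lL: "l \<le> L" using sf(3,4) by linarith
      have "real (card (primes_upto y)) \<le> sqrt y + 8 * y / Y"
        using card_primes_upto_le[of y] Y0 by (simp add: lny) (simp add: ye)
      also have "sqrt y \<le> t"
      proof -
        have "exp (Y / 2) \<le> exp (L / 2)" using sf(8) by simp
        thus ?thesis using hL unfolding sqy by linarith
      qed
      also have "8 * y / Y \<le> 8 * x / (L / 2)" using yx Lu L0 y1 sf(1) by (intro frac_le) auto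
      also have "\<dots> = 16 * (x / L)" by simp
      also have "x / L \<le> x / l" using lL l0 sf(1) by (intro divide_left_mono) auto
      also have "x / l \<le> (4 * real d * G) * (x / l)" using G4 sf(1) l0 mult_right_mono[OF G4, of "x / l"] by simp
      finally show ?thesis using tG by (simp add: algebra_simps)
    qed
    have "C * real (card (primes_upto y)) \<le> C * ((2 + 64 * real d) * (G * x / l))" using pi C1 by (intro mult_left_mono) auto
    hence "real (card Q) \<le> G * x * (1 + e + 4 * \<kappa>) + 2 * (G * x / l) + 6 * C * (G * x / l) + C * (2 + 64 * real d) * (G * x / l)"
      using Q3 E1 E2 sq Nfin tG by (simp add: mult.assoc)
    also have "\<dots> = G * x * (1 + (CC - 1) / l)"
      by (simp add: e_def \<kappa>_def CC_def algebra_simps add_divide_distrib)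
    also have "\<dots> < G * x * (1 + CC / l)" using GX l0 by (intro mult_strict_left_mono) (auto simp: divide_strict_right_mono)
    also have "\<dots> = G * (x + CC * (x / l))" by (simp add: algebra_simps)
    finally have "real (card Q) < G * (x + CC * (x / l))" .
    moreover have "Psi f x (x powr (1 / u)) = card Q" by (simp add: Psi_def Q_def y_def)
    ultimately show ?thesis unfolding G_def jk l_def by simp
  qed
  ultimately show ?thesis using CC0 by blast
qed

end
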